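(* Let $(X,g)$ be a closed Riemannian manifold of dimension $m\ge2$, and let $\mu$ be a nonzero finite measure on $X$ such that, for some $N<\infty$, $$\int_X|\widetilde u|^2\,d\mu\le N\|u\|_{H^1(X)}^2,\qquad u\in H^1(X).$$ There are $C,r_0>0$ such that, for all $x\in X$ and $0<\rho\le r_0/4$, $$\mu(B(x,\rho))\le CN\begin{cases}\rho^{m-2},&m\ge3,\\ \bigl(1+\log(r_0/\rho)\bigr)^{-1},&m=2.\end{cases}$$ Every Borel set carrying $\mu$ is nonpolar. If $m\ge3$, every such set has Hausdorff dimension at least $m-2$. In dimension $2$, $\mu$ has no atoms, and the lower bound $\dim_{\mathrm H}S\ge0$ for a Borel set $S$ carrying $\mu$ is sharp: on $X$ there are a nonzero finite measure $\mu'$ and a constant $N'<\infty$ such that $\int_X|\widetilde u|^2\,d\mu'\le N'\|u\|_{H^1(X)}^2$ for every $u\in H^1(X)$, and $\mu'$ is carried by a Borel set of Hausdorff dimension $0$.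
   Context: $\widetilde u$ is the quasi-continuous representative of $u\in H^1(X)$. A set $S$ carries $\mu$ if $\mu(X\setminus S)=0$. A Borel set is polar if it has zero $H^1(X)$-capacity (equivalently, it is not hit by Brownian motion from quasi-every starting point). *)

theory Defs
  imports "HOL-Analysis.Analysis"
begin

section \<open>Closed Riemannian manifolds\<close>

text \<open>The manifold is a whole type, with its topology given by the type class. A chart is a pair of
  an open domain and a coordinate map; values of the coordinate map outside the domain are
  irrelevant. The dimension is the cardinality of the index type of \<^typ>\<open>real ^ 'm\<close>.\<close>

type_synonym ('a, 'm) chart = "'a set \<times> ('a \<Rightarrow> real ^ 'm)"

abbreviation dom :: "('a, 'm) chart \<Rightarrow> 'a set" where "dom \<equiv> fst"
abbreviation coord :: "('a, 'm) chart \<Rightarrow> 'a \<Rightarrow> real ^ 'm" where "coord \<equiv> snd"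

abbreviation param :: "('a, 'm) chart \<Rightarrow> real ^ 'm \<Rightarrow> 'a" where
  "param c \<equiv> inv_into (dom c) (coord c)"

text \<open>\<open>C\<^sup>k\<close> and \<open>C\<^sup>\<infinity>\<close> on an open set \<open>S\<close>, by iterated directional derivatives.\<close>

primrec k_smooth_on ::
    "nat \<Rightarrow> 'e::real_normed_vector set \<Rightarrow> ('e \<Rightarrow> 'f::real_normed_vector) \<Rightarrow> bool" where
  "k_smooth_on 0 S f \<longleftrightarrow> continuous_on S f"
| "k_smooth_on (Suc k) S f \<longleftrightarrow> (\<forall>x\<in>S. f differentiable (at x)) \<and>
     (\<forall>v. k_smooth_on k S (\<lambda>x. frechet_derivative f (at x) v))"

definition smooth_on :: "'e::real_normed_vector set \<Rightarrow> ('e \<Rightarrow> 'f::real_normed_vector) \<Rightarrow> bool" where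
  "smooth_on S f \<longleftrightarrow> (\<forall>k. k_smooth_on k S f)"

definition smooth_atlas ::
    "('a::{t2_space,second_countable_topology}, 'm::finite) chart set \<Rightarrow> bool" where
  "smooth_atlas A \<longleftrightarrow>
     (\<Union>c\<in>A. dom c) = UNIV \<and>
     (\<forall>c\<in>A. open (dom c) \<and> open (coord c ` dom c) \<and>
        homeomorphism (dom c) (coord c ` dom c) (coord c) (param c)) \<and>
     (\<forall>c\<in>A. \<forall>c'\<in>A. smooth_on (coord c ` (dom c \<inter> dom c')) (coord c' \<circ> param c))"

text \<open>Jacobian matrix at \<open>p\<close> of the coordinate change from \<open>c\<close> to \<open>c'\<close>.\<close>

definition jac :: "('a, 'm::finite) chart \<Rightarrow> ('a, 'm) chart \<Rightarrow> 'a \<Rightarrow> real ^ 'm ^ 'm" where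
  "jac c c' p = matrix (frechet_derivative (coord c' \<circ> param c) (at (coord c p)))"

text \<open>A Riemannian metric is given by its coefficient matrices: \<open>g c p\<close> is the matrix \<open>(g\<^sub>i\<^sub>j)\<close> at
  the point \<open>p\<close> in the coordinates of the chart \<open>c\<close>. The last condition is the transformation law
  of a covariant 2-tensor.\<close>

type_synonym ('a, 'm) metric_coeffs = "('a, 'm) chart \<Rightarrow> 'a \<Rightarrow> real ^ 'm ^ 'm"

definition riemannian_metric ::
    "('a, 'm::finite) chart set \<Rightarrow> ('a, 'm) metric_coeffs \<Rightarrow> bool" where
  "riemannian_metric A g \<longleftrightarrow>
     (\<forall>c\<in>A. smooth_on (coord c ` dom c) (g c \<circ> param c)) \<and>
     (\<forall>c\<in>A. \<forall>p\<in>dom c. transpose (g c p) = g c p \<and> (\<forall>v. v \<noteq> 0 \<longrightarrow> v \<bullet> (g c p *v v) > 0)) \<and>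
     (\<forall>c\<in>A. \<forall>c'\<in>A. \<forall>p\<in>dom c \<inter> dom c'.
        g c p = transpose (jac c c' p) ** g c' p ** jac c c' p)"

text \<open>Connectedness is not required.\<close>

definition closed_riemannian_manifold ::
    "('a::{t2_space,second_countable_topology}, 'm::finite) chart set \<Rightarrow>
     ('a, 'm) metric_coeffs \<Rightarrow> bool" where
  "closed_riemannian_manifold A g \<longleftrightarrow>
     compact (UNIV :: 'a set) \<and> smooth_atlas A \<and> riemannian_metric A g"

text \<open>An arbitrary chart around \<open>p\<close>, used to evaluate expressions that do not depend on the chart.\<close>

definition chart_at :: "('a, 'm) chart set \<Rightarrow> 'a \<Rightarrow> ('a, 'm) chart" where
  "chart_at A p = (SOME c. c \<in> A \<and> p \<in> dom c)"


section \<open>Riemannian distance and volume\<close>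

definition pw_C1_curve ::
    "('a::topological_space, 'm::finite) chart set \<Rightarrow> (real \<Rightarrow> 'a) \<Rightarrow> bool" where
  "pw_C1_curve A \<gamma> \<longleftrightarrow> continuous_on {0..1} \<gamma> \<and>
     (\<forall>c\<in>A. \<forall>a b. 0 \<le> a \<and> a \<le> b \<and> b \<le> 1 \<and> \<gamma> ` {a..b} \<subseteq> dom c \<longrightarrow>
        (coord c \<circ> \<gamma>) piecewise_C1_differentiable_on {a..b})"

definition speed ::
    "('a, 'm::finite) chart set \<Rightarrow> ('a, 'm) metric_coeffs \<Rightarrow> (real \<Rightarrow> 'a) \<Rightarrow> real \<Rightarrow> real" where
  "speed A g \<gamma> t =
     (let c = chart_at A (\<gamma> t); v = vector_derivative (coord c \<circ> \<gamma>) (at t)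
      in sqrt (v \<bullet> (g c (\<gamma> t) *v v)))"

definition curve_length ::
    "('a, 'm::finite) chart set \<Rightarrow> ('a, 'm) metric_coeffs \<Rightarrow> (real \<Rightarrow> 'a) \<Rightarrow> ennreal" where
  "curve_length A g \<gamma> = (\<integral>\<^sup>+ t\<in>{0..1}. ennreal (speed A g \<gamma> t) \<partial>lborel)"

text \<open>The distance between different components is \<open>\<infinity>\<close>.\<close>

definition riem_dist ::
    "('a::topological_space, 'm::finite) chart set \<Rightarrow> ('a, 'm) metric_coeffs \<Rightarrow>
     'a \<Rightarrow> 'a \<Rightarrow> ennreal" where
  "riem_dist A g x y =
     (INF \<gamma>\<in>{\<gamma>. pw_C1_curve A \<gamma> \<and> \<gamma> 0 = x \<and> \<gamma> 1 = y}. curve_length A g \<gamma>)"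

definition riem_ball ::
    "('a::topological_space, 'm::finite) chart set \<Rightarrow> ('a, 'm) metric_coeffs \<Rightarrow>
     'a \<Rightarrow> real \<Rightarrow> 'a set" where
  "riem_ball A g x \<rho> = {y. riem_dist A g x y < ennreal \<rho>}"

text \<open>The unique Borel measure that equals \<open>sqrt (det (g\<^sub>i\<^sub>j)) dx\<close> in every chart.\<close>

definition riem_volume ::
    "('a::topological_space, 'm::finite) chart set \<Rightarrow> ('a, 'm) metric_coeffs \<Rightarrow> 'a measure" where
  "riem_volume A g = (THE M. sets M = sets borel \<and>
     (\<forall>c\<in>A. \<forall>S\<in>sets borel. S \<subseteq> dom c \<longrightarrow>
        emeasure M S =
          (\<integral>\<^sup>+ x\<in>coord c ` S. ennreal (sqrt (det (g c (param c x)))) \<partial>lborel)))"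


section \<open>The Sobolev space \<open>H\<^sup>1\<close>\<close>

definition smooth_fun :: "('a, 'm::finite) chart set \<Rightarrow> ('a \<Rightarrow> real) \<Rightarrow> bool" where
  "smooth_fun A f \<longleftrightarrow> (\<forall>c\<in>A. smooth_on (coord c ` dom c) (f \<circ> param c))"

text \<open>\<open>|\<nabla>f|\<^sup>2 = g\<^sup>i\<^sup>j \<partial>\<^sub>i f \<partial>\<^sub>j f\<close> for smooth \<open>f\<close>.\<close>

definition grad_sq ::
    "('a, 'm::finite) chart set \<Rightarrow> ('a, 'm) metric_coeffs \<Rightarrow> ('a \<Rightarrow> real) \<Rightarrow> 'a \<Rightarrow> real" where
  "grad_sq A g f p =
     (let c = chart_at A p;
          df = (\<chi> i. frechet_derivative (f \<circ> param c) (at (coord c p)) (axis i 1))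
      in df \<bullet> (matrix_inv (g c p) *v df))"

definition smooth_h1_norm ::
    "('a::topological_space, 'm::finite) chart set \<Rightarrow> ('a, 'm) metric_coeffs \<Rightarrow>
     ('a \<Rightarrow> real) \<Rightarrow> real" where
  "smooth_h1_norm A g f = sqrt (LINT p|riem_volume A g. (f p)\<^sup>2 + grad_sq A g f p)"

text \<open>\<open>H\<^sup>1\<close> is the completion of the smooth functions in the \<open>H\<^sup>1\<close> norm, realised inside \<open>L\<^sup>2\<close>: its
  elements are the \<open>L\<^sup>2\<close> limits of \<open>H\<^sup>1\<close>-Cauchy sequences of smooth functions. Functions that agree
  almost everywhere are not identified.\<close>

definition h1_approx ::
    "('a::topological_space, 'm::finite) chart set \<Rightarrow> ('a, 'm) metric_coeffs \<Rightarrow>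
     (nat \<Rightarrow> 'a \<Rightarrow> real) \<Rightarrow> ('a \<Rightarrow> real) \<Rightarrow> bool" where
  "h1_approx A g f u \<longleftrightarrow>
     (\<forall>n. smooth_fun A (f n)) \<and>
     (\<forall>e>0. \<exists>K. \<forall>i\<ge>K. \<forall>j\<ge>K. smooth_h1_norm A g (\<lambda>p. f i p - f j p) < e) \<and>
     (\<lambda>n. \<integral>\<^sup>+ p. ennreal ((f n p - u p)\<^sup>2) \<partial>riem_volume A g) \<longlonglongrightarrow> 0"

definition H1 ::
    "('a::topological_space, 'm::finite) chart set \<Rightarrow> ('a, 'm) metric_coeffs \<Rightarrow>
     ('a \<Rightarrow> real) set" where
  "H1 A g = {u \<in> borel_measurable borel. \<exists>f. h1_approx A g f u}"

text \<open>The Dirichlet form on smooth functions is closable, so all approximating sequences of \<open>u\<close> have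
  the same limit of norms, and for \<open>u \<in> H\<^sup>1\<close> the infimum is over a singleton.\<close>

definition h1_norm ::
    "('a::topological_space, 'm::finite) chart set \<Rightarrow> ('a, 'm) metric_coeffs \<Rightarrow>
     ('a \<Rightarrow> real) \<Rightarrow> real" where
  "h1_norm A g u =
     Inf {l. \<exists>f. h1_approx A g f u \<and> (\<lambda>n. smooth_h1_norm A g (f n)) \<longlonglongrightarrow> l}"


section \<open>Capacity and quasi-continuity\<close>

definition h1_capacity ::
    "('a::topological_space, 'm::finite) chart set \<Rightarrow> ('a, 'm) metric_coeffs \<Rightarrow>
     'a set \<Rightarrow> real" where
  "h1_capacity A g E = Inf {(h1_norm A g u)\<^sup>2 | u. u \<in> H1 A g \<and>
     (\<exists>W. open W \<and> E \<subseteq> W \<and> (AE p in riem_volume A g. p \<in> W \<longrightarrow> 1 \<le> u p))}"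

definition polar ::
    "('a::topological_space, 'm::finite) chart set \<Rightarrow> ('a, 'm) metric_coeffs \<Rightarrow>
     'a set \<Rightarrow> bool" where
  "polar A g E \<longleftrightarrow> E \<in> sets borel \<and> h1_capacity A g E = 0"

definition quasi_continuous ::
    "('a::topological_space, 'm::finite) chart set \<Rightarrow> ('a, 'm) metric_coeffs \<Rightarrow>
     ('a \<Rightarrow> real) \<Rightarrow> bool" where
  "quasi_continuous A g v \<longleftrightarrow>
     (\<forall>e>0. \<exists>W. open W \<and> h1_capacity A g W < e \<and> continuous_on (- W) v)"

text \<open>Quasi-continuous representatives are unique only up to polar sets.\<close>

definition qc_representative ::
    "('a::topological_space, 'm::finite) chart set \<Rightarrow> ('a, 'm) metric_coeffs \<Rightarrow>
     ('a \<Rightarrow> real) \<Rightarrow> ('a \<Rightarrow> real) \<Rightarrow> bool" where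
  "qc_representative A g u v \<longleftrightarrow>
     v \<in> borel_measurable borel \<and> quasi_continuous A g v \<and> (AE p in riem_volume A g. v p = u p)"

definition finite_borel_measure :: "'a::topological_space measure \<Rightarrow> bool" where
  "finite_borel_measure \<mu> \<longleftrightarrow> sets \<mu> = sets borel \<and> finite_measure \<mu>"

text \<open>The inequality \<open>\<integral>|v|\<^sup>2 d\<mu> \<le> N \<parallel>u\<parallel>\<^sup>2\<close> is required for every choice \<open>v\<close> of the quasi-continuous
  representative of \<open>u\<close>.\<close>

definition trace_bound ::
    "('a::topological_space, 'm::finite) chart set \<Rightarrow> ('a, 'm) metric_coeffs \<Rightarrow>
     'a measure \<Rightarrow> real \<Rightarrow> bool" where
  "trace_bound A g \<mu> N \<longleftrightarrow> 0 \<le> N \<and>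
     (\<forall>u\<in>H1 A g. \<forall>v. qc_representative A g u v \<longrightarrow>
        (\<integral>\<^sup>+ p. ennreal ((v p)\<^sup>2) \<partial>\<mu>) \<le> ennreal (N * (h1_norm A g u)\<^sup>2))"

definition carries :: "'a set \<Rightarrow> 'a measure \<Rightarrow> bool" where
  "carries S \<mu> \<longleftrightarrow> emeasure \<mu> (space \<mu> - S) = 0"


section \<open>Hausdorff dimension\<close>

text \<open>For a \<open>[0,\<infinity>]\<close>-valued distance \<open>d\<close>. Only exponents \<open>s > 0\<close> are used (the infimum defining the
  dimension is the same as over \<open>s \<ge> 0\<close>), since \<^term>\<open>0 powr 0 = (0::real)\<close> is the wrong
  convention for the diameter of a point.\<close>

definition diam :: "('a \<Rightarrow> 'a \<Rightarrow> ennreal) \<Rightarrow> 'a set \<Rightarrow> ennreal" where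
  "diam d E = (SUP x\<in>E. SUP y\<in>E. d x y)"

definition hausdorff_premeasure ::
    "('a \<Rightarrow> 'a \<Rightarrow> ennreal) \<Rightarrow> real \<Rightarrow> real \<Rightarrow> 'a set \<Rightarrow> ennreal" where
  "hausdorff_premeasure d s \<delta> S =
     (INF E\<in>{E :: nat \<Rightarrow> 'a set. S \<subseteq> (\<Union>n. E n) \<and> (\<forall>n. diam d (E n) \<le> ennreal \<delta>)}.
        \<Sum>n. ennreal (enn2real (diam d (E n)) powr s))"

definition hausdorff_measure ::
    "('a \<Rightarrow> 'a \<Rightarrow> ennreal) \<Rightarrow> real \<Rightarrow> 'a set \<Rightarrow> ennreal" where
  "hausdorff_measure d s S = (SUP \<delta>\<in>{0<..}. hausdorff_premeasure d s \<delta> S)"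

definition hausdorff_dim :: "('a \<Rightarrow> 'a \<Rightarrow> ennreal) \<Rightarrow> 'a set \<Rightarrow> ereal" where
  "hausdorff_dim d S = (INF s\<in>{s. 0 < s \<and> hausdorff_measure d s S = 0}. ereal s)"

end

theory Submission
  imports Defs
begin

text \<open>
  Everything rests on one inequality, \<open>\<integral> f\<^sup>2 d\<mu> \<le> N \<parallel>f\<parallel>\<^sup>2\<close> for smooth \<open>f\<close>, called \<open>smooth_trace\<close>. It is
  a special case of the hypothesis on \<open>\<mu>\<close>, because a smooth function is its own quasi-continuous
  representative, and by \<open>smooth_trace_imp_trace_bound\<close> it is equivalent to it.

  The growth bound comes from testing with functions that equal \<open>1\<close> on a ball of radius \<open>\<rho>\<close>. For
  \<open>m \<ge> 3\<close> a single bump of width \<open>\<rho>\<close> has squared norm of order \<open>\<rho>\<^sup>m\<^sup>-\<^sup>2\<close>. In the plane the energy of a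
  bump does not depend on its width. Averaging \<open>J \<sim> log (r / \<rho>)\<close> bumps at dyadic scales gains the
  factor \<open>1 / J\<close>, since their gradients live on disjoint annuli (\<open>dyadic_bump_energy\<close>). Riemannian
  balls lie in coordinate balls of comparable radius (\<open>riem_ball_subset\<close>). The power of \<open>\<rho>\<close> gives the
  lower bound on the Hausdorff dimension by the mass distribution principle (\<open>hausdorff_dim_ge\<close>), and
  the logarithm excludes atoms (\<open>smooth_trace_no_atoms\<close>).

  Polar sets are null, and quasi-continuous representatives inherit the inequality, for a common
  reason, \<open>truncation_trace_vanishes\<close>. Let \<open>f n\<close> and \<open>\<zeta> n\<close> be smooth \<open>H\<^sup>1\<close>-Cauchy sequences with limits
  \<open>u\<close> and \<open>z\<close>, and let \<open>\<Psi>\<close> and \<open>\<Phi>\<close> be smooth truncations with \<open>\<Psi> u \<sqdot> \<Phi> z = 0\<close> near a point. Then a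
  cutoff times \<open>\<Psi> (f n) \<sqdot> \<Phi> (\<zeta> n)\<close> is again \<open>H\<^sup>1\<close>-Cauchy and tends to \<open>0\<close> in \<open>L\<^sup>2\<close>. The Dirichlet form
  is closable, so the \<open>H\<^sup>1\<close> norms tend to \<open>0\<close>, and the trace inequality carries this over to \<open>L\<^sup>2(\<mu>)\<close>.
  If \<open>z \<ge> 1\<close> on an open set \<open>W\<close>, this shows that \<open>\<zeta> n\<close> is at least \<open>1 / 2\<close> on most of \<open>W\<close> with respect
  to \<open>\<mu>\<close>, so that \<open>\<mu> W \<le> 4 N \<parallel>z\<parallel>\<^sup>2\<close> (\<open>measure_le_capacity_potential\<close>); in particular polar sets are
  null. With \<open>\<Psi>\<close> vanishing near a value of a quasi-continuous representative \<open>v\<close>, it shows that \<open>f n\<close>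
  tends to \<open>v\<close> in \<open>\<mu>\<close>-measure (\<open>approx_converges_in_measure\<close>), and Fatou's lemma finishes.

  For the sharpness in dimension two, push Lebesgue measure on \<open>[0, 1)\<close> to a coordinate segment by
  \<open>\<omega> \<mapsto> \<Sum>k. 2\<^sup>-\<^sup>k\<^sup>(\<^sup>k\<^sup>+\<^sup>1\<^sup>) \<lfloor>2\<^sup>k \<omega>\<rfloor>\<close>. The image is covered by \<open>2\<^sup>k\<close> intervals of length \<open>2\<^sup>-\<^sup>k\<^sup>*\<^sup>k\<close> for every
  \<open>k\<close>, so its dimension is \<open>0\<close>. Points at distance \<open>2\<^sup>-\<^sup>k\<close> are moved at least \<open>2\<^sup>-\<^sup>k\<^sup>(\<^sup>k\<^sup>+\<^sup>1\<^sup>)\<close> apart, so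
  an interval of length \<open>2\<^sup>-\<^sup>n\<close> has mass about \<open>2\<close> to the power \<open>- sqrt n\<close>. This decay is enough for a trace
  inequality: the averages of a function over dyadic squares at a point form a telescoping series whose
  increments are bounded by the energy on the squares, uniformly in the scale (\<open>planar_trace\<close>).
\<close>

section \<open>Calculus of smooth functions\<close>

lemma k_smooth_onD:
  assumes "k_smooth_on (Suc k) S f" "x \<in> S"
  shows "(f has_derivative frechet_derivative f (at x)) (at x)"
  using assms by (simp add: frechet_derivative_works[symmetric])

lemma has_derivative_transform_open:
  assumes "open S" "x \<in> S" "\<And>y. y \<in> S \<Longrightarrow> f y = h y" "(f has_derivative D) (at x)"
  shows "(h has_derivative D) (at x)"
  using has_derivative_transform_within_open[OF assms(4,1,2,3)] .

lemma k_smooth_on_cong: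
  assumes "open S" "\<And>x. x \<in> S \<Longrightarrow> f x = h x" "k_smooth_on k S f"
  shows "k_smooth_on k S h"
  using assms
proof (induction k arbitrary: f h)
  case 0
  then show ?case by (metis continuous_on_cong k_smooth_on.simps(1))
next
  case (Suc k)
  have D: "(h has_derivative frechet_derivative f (at x)) (at x)" if "x \<in> S" for x
    using has_derivative_transform_open[OF Suc.prems(1) that Suc.prems(2) k_smooth_onD[OF Suc.prems(3) that]] .
  have e: "frechet_derivative f (at x) = frechet_derivative h (at x)" if "x \<in> S" for x
    using D[OF that] by (rule frechet_derivative_at)
  have "k_smooth_on k S (\<lambda>x. frechet_derivative h (at x) v)" for v
    by (rule Suc.IH[of "\<lambda>x. frechet_derivative f (at x) v"]) (use Suc.prems e in auto)
  moreover have "h differentiable at x" if "x \<in> S" for x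
    using D[OF that] by (auto simp: differentiable_def)
  ultimately show ?case by simp
qed

text \<open>Iterated smoothness is checked by exhibiting a derivative whose values are smooth of lower order.
  The inductive closure proofs below all exhibit a derivative in this way.\<close>

lemma k_smooth_on_SucI:
  assumes "open S" "\<And>x. x \<in> S \<Longrightarrow> (f has_derivative f' x) (at x)"
    "\<And>v. k_smooth_on k S (\<lambda>x. f' x v)"
  shows "k_smooth_on (Suc k) S f"
proof -
  have "frechet_derivative f (at x) = f' x" if "x \<in> S" for x
    using frechet_derivative_at[OF assms(2)[OF that]] by simp
  then have "k_smooth_on k S (\<lambda>x. frechet_derivative f (at x) v)" for v
    by (intro k_smooth_on_cong[OF assms(1) _ assms(3)[of v]]) simp
  with assms(2) show ?thesis by (auto simp: differentiable_def)
qed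

lemma k_smooth_on_Suc_imp: "k_smooth_on (Suc k) S f \<Longrightarrow> k_smooth_on k S f"
proof (induction k arbitrary: f)
  case 0
  then show ?case
    by (auto simp: differentiable_on_def differentiable_at_withinI intro: differentiable_imp_continuous_on)
next
  case (Suc k)
  then show ?case by auto
qed

lemma k_smooth_on_local:
  assumes "\<And>x. x \<in> S \<Longrightarrow> \<exists>U. open U \<and> x \<in> U \<and> k_smooth_on k U f"
  shows "k_smooth_on k S f"
  using assms
proof (induction k arbitrary: f)
  case 0
  have "\<exists>U. open U \<and> x \<in> U \<and> continuous_on U f" if "x \<in> S" for x using 0[OF that] by simp
  then have "isCont f x" if "x \<in> S" for x using that by (metis continuous_on_eq_continuous_at)
  then show ?case by (simp add: continuous_at_imp_continuous_on)
next
  case (Suc k)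
  have "k_smooth_on k S (\<lambda>x. frechet_derivative f (at x) v)" for v
  proof (rule Suc.IH)
    fix x assume "x \<in> S"
    from Suc.prems[OF this] show "\<exists>U. open U \<and> x \<in> U \<and> k_smooth_on k U (\<lambda>x. frechet_derivative f (at x) v)"
      by auto
  qed
  moreover have "f differentiable at x" if "x \<in> S" for x using Suc.prems[OF that] by auto
  ultimately show ?case by simp
qed

lemma k_smooth_on_const: "open S \<Longrightarrow> k_smooth_on k S (\<lambda>x. c)"
proof (induction k arbitrary: c)
  case (Suc k)
  show ?case by (rule k_smooth_on_SucI[where f' = "\<lambda>x v. 0"]) (use Suc in auto)
qed simp

lemma k_smooth_on_add:
  "open S \<Longrightarrow> k_smooth_on k S f \<Longrightarrow> k_smooth_on k S h \<Longrightarrow> k_smooth_on k S (\<lambda>x. f x + h x)"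
proof (induction k arbitrary: f h)
  case 0 then show ?case by (auto intro: continuous_intros)
next
  case (Suc k)
  show ?case
  proof (rule k_smooth_on_SucI[where f' = "\<lambda>x v. frechet_derivative f (at x) v + frechet_derivative h (at x) v"])
    fix x assume "x \<in> S"
    show "((\<lambda>x. f x + h x) has_derivative (\<lambda>v. frechet_derivative f (at x) v + frechet_derivative h (at x) v)) (at x)"
      using has_derivative_add[OF k_smooth_onD[OF Suc.prems(2) \<open>x \<in> S\<close>] k_smooth_onD[OF Suc.prems(3) \<open>x \<in> S\<close>]] .
  qed (use Suc in auto)
qed

lemma k_smooth_on_sum:
  assumes "open S" "\<And>i. i \<in> I \<Longrightarrow> k_smooth_on k S (f i)"
  shows "k_smooth_on k S (\<lambda>x. \<Sum>i\<in>I. f i x)"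
  using assms(2)
  by (induction I rule: infinite_finite_induct)
     (use k_smooth_on_add[OF assms(1)] k_smooth_on_const[OF assms(1)] in auto)

lemma k_smooth_on_scaleR:
  fixes f :: "'e::real_normed_vector \<Rightarrow> real" and h :: "'e \<Rightarrow> 'f::real_normed_vector"
  shows "open S \<Longrightarrow> k_smooth_on k S f \<Longrightarrow> k_smooth_on k S h \<Longrightarrow> k_smooth_on k S (\<lambda>x. f x *\<^sub>R h x)"
proof (induction k arbitrary: f h)
  case 0 then show ?case by (auto intro: continuous_intros)
next
  case (Suc k)
  note ds = k_smooth_on_Suc_imp[OF Suc.prems(2)] k_smooth_on_Suc_imp[OF Suc.prems(3)]
  show ?case
  proof (rule k_smooth_on_SucI[where f' = "\<lambda>x v. f x *\<^sub>R frechet_derivative h (at x) v + frechet_derivative f (at x) v *\<^sub>R h x"])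
    fix x assume "x \<in> S"
    show "((\<lambda>x. f x *\<^sub>R h x) has_derivative (\<lambda>v. f x *\<^sub>R frechet_derivative h (at x) v + frechet_derivative f (at x) v *\<^sub>R h x)) (at x)"
      using has_derivative_scaleR[OF k_smooth_onD[OF Suc.prems(2) \<open>x \<in> S\<close>] k_smooth_onD[OF Suc.prems(3) \<open>x \<in> S\<close>]] .
  next
    fix v
    show "k_smooth_on k S (\<lambda>x. f x *\<^sub>R frechet_derivative h (at x) v + frechet_derivative f (at x) v *\<^sub>R h x)"
      using Suc.prems by (intro k_smooth_on_add Suc.IH ds) auto
  qed fact
qed

lemma k_smooth_on_mult:
  fixes f h :: "'e::real_normed_vector \<Rightarrow> real"
  shows "open S \<Longrightarrow> k_smooth_on k S f \<Longrightarrow> k_smooth_on k S h \<Longrightarrow> k_smooth_on k S (\<lambda>x. f x * h x)"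
  using k_smooth_on_scaleR[of S k f h] by simp

lemma k_smooth_on_bounded_linear:
  assumes "open S" "bounded_linear L"
  shows "k_smooth_on k S L"
proof (cases k)
  case 0 with assms(2) show ?thesis by (simp add: linear_continuous_on)
next
  case (Suc n)
  show ?thesis unfolding Suc
    by (rule k_smooth_on_SucI[OF assms(1), where f' = "\<lambda>x. L"])
       (use assms in \<open>auto simp: bounded_linear_imp_has_derivative k_smooth_on_const\<close>)
qed

lemma k_smooth_on_bounded_linear_compose:
  assumes "open S" "bounded_linear L"
  shows "k_smooth_on k S f \<Longrightarrow> k_smooth_on k S (\<lambda>x. L (f x))"
proof (induction k arbitrary: f)
  case 0 then show ?case using assms(2) by (auto intro: linear_continuous_on_compose bounded_linear.continuous_on)
next
  case (Suc k)
  show ?case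
    by (rule k_smooth_on_SucI[OF assms(1), where f' = "\<lambda>x v. L (frechet_derivative f (at x) v)"])
      (use Suc bounded_linear.has_derivative[OF assms(2) k_smooth_onD[OF Suc.prems]] in auto)
qed

text \<open>In the induction step the derivative of the inner map is expanded in a basis. The chain rule then
  becomes a finite sum of products of scalar functions and compositions of lower order.\<close>

lemma k_smooth_on_compose:
  fixes f :: "'d::euclidean_space \<Rightarrow> 'f::real_normed_vector" and h :: "'e::real_normed_vector \<Rightarrow> 'd"
  assumes "open S" "open T" "h ` S \<subseteq> T"
  shows "k_smooth_on k T f \<Longrightarrow> k_smooth_on k S h \<Longrightarrow> k_smooth_on k S (\<lambda>x. f (h x))"
proof (induction k arbitrary: f)
  case 0 then show ?case using assms(3) by (auto intro: continuous_on_compose2)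
next
  case (Suc k)
  let ?f = "\<lambda>x. frechet_derivative f (at x)" and ?h = "\<lambda>x. frechet_derivative h (at x)"
  show ?case
  proof (rule k_smooth_on_SucI[OF assms(1), where f' = "\<lambda>x v. \<Sum>b\<in>Basis. (?h x v \<bullet> b) *\<^sub>R ?f (h x) b"])
    fix x assume x: "x \<in> S"
    then have hx: "h x \<in> T" using assms(3) by auto
    note D = k_smooth_onD[OF Suc.prems(1) hx]
    have lin: "?f (h x) w = (\<Sum>b\<in>Basis. (w \<bullet> b) *\<^sub>R ?f (h x) b)" for w
    proof -
      have "?f (h x) w = ?f (h x) (\<Sum>b\<in>Basis. (w \<bullet> b) *\<^sub>R b)" by (simp add: euclidean_representation)
      also have "\<dots> = (\<Sum>b\<in>Basis. (w \<bullet> b) *\<^sub>R ?f (h x) b)"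
        using has_derivative_linear[OF D] by (simp add: linear_sum linear_cmul)
      finally show ?thesis .
    qed
    have "((\<lambda>x. f (h x)) has_derivative (\<lambda>v. ?f (h x) (?h x v))) (at x)"
      using has_derivative_compose[OF k_smooth_onD[OF Suc.prems(2) x] D] .
    then show "((\<lambda>x. f (h x)) has_derivative (\<lambda>v. \<Sum>b\<in>Basis. (?h x v \<bullet> b) *\<^sub>R ?f (h x) b)) (at x)"
      by (subst (asm) lin)
  next
    fix v
    have "k_smooth_on k S (\<lambda>x. ?h x v \<bullet> b)" for b
      using Suc.prems(2) by (intro k_smooth_on_bounded_linear_compose[OF assms(1) bounded_linear_inner_left]) auto
    moreover have "k_smooth_on k S (\<lambda>x. ?f (h x) b)" for b
      using Suc.prems k_smooth_on_Suc_imp by (intro Suc.IH) auto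
    ultimately show "k_smooth_on k S (\<lambda>x. \<Sum>b\<in>Basis. (?h x v \<bullet> b) *\<^sub>R ?f (h x) b)"
      using assms(1) by (intro k_smooth_on_sum k_smooth_on_scaleR)
  qed
qed

lemma k_smooth_on_inverse: "k_smooth_on k {x. x \<noteq> 0} (inverse :: real \<Rightarrow> real)"
proof (induction k)
  case 0
  show ?case by (auto intro!: continuous_intros)
next
  case (Suc k)
  have o: "open {x::real. x \<noteq> 0}" by (rule open_Collect_neq) (auto intro: continuous_intros)
  show ?case
  proof (rule k_smooth_on_SucI[OF o, where f' = "\<lambda>x v. (- v) * (inverse x * inverse x)"])
    show "k_smooth_on k {x. x \<noteq> 0} (\<lambda>x::real. (- v) * (inverse x * inverse x))" for v
      by (intro k_smooth_on_mult k_smooth_on_const o Suc)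
    fix x :: real assume "x \<in> {x. x \<noteq> 0}"
    then have "(inverse has_real_derivative - (inverse x ^ 2)) (at x)"
      using DERIV_inverse[of x UNIV] by (simp add: numeral_2_eq_2)
    moreover have "(*) (- (inverse x ^ 2)) = (\<lambda>v. (- v) * (inverse x * inverse x))"
      by (auto simp: fun_eq_iff power2_eq_square)
    ultimately show "(inverse has_derivative (\<lambda>v. (- v) * (inverse x * inverse x))) (at x)"
      unfolding has_field_derivative_def by metis
  qed
qed

lemma smooth_on_cong: "open S \<Longrightarrow> (\<And>x. x \<in> S \<Longrightarrow> f x = h x) \<Longrightarrow> smooth_on S f \<Longrightarrow> smooth_on S h"
  unfolding smooth_on_def by (intro allI, rule k_smooth_on_cong[of S f h]) simp_all
lemma smooth_on_local: "(\<And>x. x \<in> S \<Longrightarrow> \<exists>U. open U \<and> x \<in> U \<and> smooth_on U f) \<Longrightarrow> smooth_on S f"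
  unfolding smooth_on_def by (intro allI k_smooth_on_local) metis
lemma smooth_on_const: "open S \<Longrightarrow> smooth_on S (\<lambda>x. c)"
  unfolding smooth_on_def by (simp add: k_smooth_on_const)
lemma smooth_on_add: "open S \<Longrightarrow> smooth_on S f \<Longrightarrow> smooth_on S h \<Longrightarrow> smooth_on S (\<lambda>x. f x + h x)"
  unfolding smooth_on_def by (simp add: k_smooth_on_add)
lemma smooth_on_mult:
  "open S \<Longrightarrow> smooth_on S f \<Longrightarrow> smooth_on S h \<Longrightarrow> smooth_on S (\<lambda>x. f x * h x :: real)"
  unfolding smooth_on_def by (simp add: k_smooth_on_mult)
lemma smooth_on_sum:
  "open S \<Longrightarrow> (\<And>i. i \<in> I \<Longrightarrow> smooth_on S (f i)) \<Longrightarrow> smooth_on S (\<lambda>x. \<Sum>i\<in>I. f i x)"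
  unfolding smooth_on_def by (simp add: k_smooth_on_sum)
lemma smooth_on_bounded_linear: "open S \<Longrightarrow> bounded_linear L \<Longrightarrow> smooth_on S L"
  unfolding smooth_on_def by (simp add: k_smooth_on_bounded_linear)
lemma smooth_on_compose:
  fixes f :: "'d::euclidean_space \<Rightarrow> 'f::real_normed_vector" and h :: "'e::real_normed_vector \<Rightarrow> 'd"
  shows "open S \<Longrightarrow> open T \<Longrightarrow> h ` S \<subseteq> T \<Longrightarrow> smooth_on T f \<Longrightarrow> smooth_on S h \<Longrightarrow>
    smooth_on S (\<lambda>x. f (h x))"
  unfolding smooth_on_def by (intro allI, rule k_smooth_on_compose[of S T h]) simp_all

lemma smooth_on_continuous: "smooth_on S f \<Longrightarrow> continuous_on S f"
  unfolding smooth_on_def using k_smooth_on.simps(1) by blast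
lemma smooth_onD:
  "smooth_on S f \<Longrightarrow> x \<in> S \<Longrightarrow> (f has_derivative frechet_derivative f (at x)) (at x)"
  unfolding smooth_on_def using k_smooth_onD by blast
lemma smooth_on_frechet: "smooth_on S f \<Longrightarrow> smooth_on S (\<lambda>x. frechet_derivative f (at x) v)"
  unfolding smooth_on_def using k_smooth_on.simps(2) by blast
lemma smooth_on_frechet_continuous:
  "smooth_on S f \<Longrightarrow> continuous_on S (\<lambda>x. frechet_derivative f (at x) v)"
  using smooth_on_frechet smooth_on_continuous by blast

section \<open>Smooth cutoff functions\<close>

text \<open>The family \<open>p (1 / x) e\<^sup>-\<^sup>1\<^sup>/\<^sup>x\<close> for \<open>x > 0\<close>, extended by zero, is closed under
  differentiation. Carrying the polynomial along makes smoothness at \<open>0\<close> a plain induction.\<close>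

definition flat_exp :: "real poly \<Rightarrow> real \<Rightarrow> real" where
  "flat_exp p x = (if x > 0 then poly p (inverse x) * exp (- inverse x) else 0)"

lemma poly_exp_tendsto_0: "((\<lambda>s. poly p s * exp (- s)) \<longlongrightarrow> 0) at_top" for p :: "real poly"
proof -
  have "((\<lambda>s. \<Sum>i\<le>degree p. coeff p i * (s ^ i / exp s)) \<longlongrightarrow> (\<Sum>i\<le>degree p. coeff p i * 0)) at_top"
    by (intro tendsto_sum tendsto_mult tendsto_const tendsto_power_div_exp_0)
  moreover have "poly p s * exp (- s) = (\<Sum>i\<le>degree p. coeff p i * (s ^ i / exp s))" for s
    by (simp add: poly_altdef sum_distrib_right exp_minus divide_inverse mult.assoc)
  ultimately show ?thesis by simp
qed

lemma flat_exp_has_derivative: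
  "(flat_exp p has_field_derivative flat_exp ([:0,0,1:] * (p - pderiv p)) x) (at x)"
proof -
  let ?q = "[:0,0,1:] * (p - pderiv p)"
  consider "x > 0" | "x < 0" | "x = 0" by linarith
  then show ?thesis
  proof cases
    case 1
    have "((\<lambda>x. poly p (inverse x) * exp (- inverse x)) has_field_derivative flat_exp ?q x) (at x)"
      using 1 by (auto intro!: derivative_eq_intros simp: flat_exp_def power2_eq_square field_simps)
    then show ?thesis
      by (rule has_field_derivative_transform_within_open[where S="{0<..}"]) (use 1 in \<open>auto simp: flat_exp_def\<close>)
  next
    case 2
    have "((\<lambda>x. 0) has_field_derivative flat_exp ?q x) (at x)"
      using 2 by (auto simp: flat_exp_def)
    then show ?thesis
      by (rule has_field_derivative_transform_within_open[where S="{..<0}"]) (use 2 in \<open>auto simp: flat_exp_def\<close>)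
  next
    case 3
    have "((\<lambda>h. poly ([:0,1:] * p) (inverse h) * exp (- inverse h)) \<longlongrightarrow> 0) (at_right 0)"
      using filterlim_compose[OF poly_exp_tendsto_0 filterlim_inverse_at_top_right] .
    then have r: "((\<lambda>h. (flat_exp p (0 + h) - flat_exp p 0) / h) \<longlongrightarrow> 0) (at_right 0)"
      by (rule Lim_transform_eventually)
         (auto simp: eventually_at_right_less flat_exp_def field_simps intro!: eventually_at_rightI[of 0 1])
    have l: "((\<lambda>h. (flat_exp p (0 + h) - flat_exp p 0) / h) \<longlongrightarrow> 0) (at_left 0)"
      by (rule Lim_transform_eventually[OF tendsto_const])
         (auto simp: flat_exp_def intro!: eventually_at_leftI[of "-1" 0])
    have "(flat_exp p has_field_derivative 0) (at 0)"
      unfolding DERIV_def using l r filterlim_split_at by blast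
    with 3 show ?thesis by (simp add: flat_exp_def)
  qed
qed

lemma smooth_flat_exp: "smooth_on UNIV (flat_exp p)"
  unfolding smooth_on_def
proof
  fix k show "k_smooth_on k UNIV (flat_exp p)"
  proof (induction k arbitrary: p)
    case 0
    show ?case
      using flat_exp_has_derivative[of p] by (auto intro!: continuous_at_imp_continuous_on DERIV_isCont)
  next
    case (Suc k)
    show ?case
    proof (rule k_smooth_on_SucI[where f' = "\<lambda>x v. v * flat_exp ([:0,0,1:] * (p - pderiv p)) x"])
      show "(flat_exp p has_derivative (\<lambda>v. v * flat_exp ([:0, 0, 1:] * (p - pderiv p)) x)) (at x)" for x
        using flat_exp_has_derivative[of p x] by (simp add: has_field_derivative_def mult_commute_abs)
      show "k_smooth_on k UNIV (\<lambda>x. v * flat_exp ([:0,0,1:] * (p - pderiv p)) x)" for v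
        by (intro k_smooth_on_mult k_smooth_on_const Suc) auto
    qed auto
  qed
qed

text \<open>The quotient of flat exponentials that descends from \<open>1\<close> to \<open>0\<close> on the interval \<open>[1, 2]\<close>.\<close>

definition smooth_step :: "real \<Rightarrow> real" where
  "smooth_step t = flat_exp 1 (2 - t) / (flat_exp 1 (2 - t) + flat_exp 1 (t - 1))"

lemma flat_exp_1: "flat_exp 1 x \<ge> 0" "flat_exp 1 x = 0 \<longleftrightarrow> x \<le> 0" "x > 0 \<Longrightarrow> flat_exp 1 x > 0"
  by (auto simp: flat_exp_def)

lemma smooth_step_denom: "flat_exp 1 (2 - t) + flat_exp 1 (t - 1) > 0"
  using flat_exp_1(3)[of "2 - t"] flat_exp_1(3)[of "t - 1"] flat_exp_1(1)[of "2 - t"] flat_exp_1(1)[of "t - 1"]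
  by (cases "t < 2") (auto intro: add_pos_nonneg add_nonneg_pos)

lemma smooth_step_bounds: "0 \<le> smooth_step t" "smooth_step t \<le> 1"
  and smooth_step_eq_1: "t \<le> 1 \<Longrightarrow> smooth_step t = 1"
  and smooth_step_eq_0: "t \<ge> 2 \<Longrightarrow> smooth_step t = 0"
  using smooth_step_denom[of t] flat_exp_1(1)[of "2 - t"] flat_exp_1(1)[of "t - 1"]
    flat_exp_1(2)[of "2 - t"] flat_exp_1(2)[of "t - 1"]
  by (auto simp: smooth_step_def)

lemma smooth_smooth_step: "smooth_on UNIV smooth_step"
proof -
  have lin: "smooth_on UNIV (\<lambda>t::real. 2 - t)" "smooth_on UNIV (\<lambda>t::real. t - 1)"
  proof -
    have "smooth_on UNIV (\<lambda>t::real. 2 + (-t))"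
      by (intro smooth_on_add smooth_on_const smooth_on_bounded_linear) (auto intro: bounded_linear_minus bounded_linear_ident)
    then show "smooth_on UNIV (\<lambda>t::real. 2 - t)" by simp
    have "smooth_on UNIV (\<lambda>t::real. t + (-1))"
      by (intro smooth_on_add smooth_on_const smooth_on_bounded_linear) (auto intro: bounded_linear_minus bounded_linear_ident)
    then show "smooth_on UNIV (\<lambda>t::real. t - 1)" by simp
  qed
  have s: "smooth_on UNIV (\<lambda>t. flat_exp 1 (2 - t))" "smooth_on UNIV (\<lambda>t. flat_exp 1 (t - 1))"
    by (rule smooth_on_compose[OF _ _ _ smooth_flat_exp lin(1)] smooth_on_compose[OF _ _ _ smooth_flat_exp lin(2)]; simp)+
  have o: "open {x::real. x \<noteq> 0}" by (rule open_Collect_neq) (auto intro: continuous_intros)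
  have si: "smooth_on {x. x \<noteq> 0} (inverse :: real \<Rightarrow> real)"
    using k_smooth_on_inverse by (simp add: smooth_on_def)
  have "smooth_on UNIV (\<lambda>t. inverse (flat_exp 1 (2 - t) + flat_exp 1 (t - 1)))"
  proof (rule smooth_on_compose[OF _ o _ si])
    show "range (\<lambda>t. flat_exp 1 (2 - t) + flat_exp 1 (t - 1)) \<subseteq> {x. x \<noteq> 0}"
      using smooth_step_denom by (metis (mono_tags, lifting) image_subsetI less_irrefl mem_Collect_eq)
  qed (intro smooth_on_add s open_UNIV)+
  then have "smooth_on UNIV (\<lambda>t. flat_exp 1 (2 - t) * inverse (flat_exp 1 (2 - t) + flat_exp 1 (t - 1)))"
    by (intro smooth_on_mult s) auto
  then show ?thesis by (simp add: smooth_step_def[abs_def] divide_inverse)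
qed


section \<open>Change of variables for arbitrary finite index types\<close>

text \<open>The change of variables theorem is stated for wellordered index types, while the index type of
  the coordinates is only finite. A copy of the index type carries an arbitrary wellorder, and
  everything is transported along the relabelling of coordinates.\<close>

datatype 'm ordered_copy = Copy (original: 'm)

lemma UNIV_ordered_copy: "UNIV = range Copy"
  by (metis ordered_copy.exhaust surj_def)

instance ordered_copy :: (finite) finite
  by standard (simp add: UNIV_ordered_copy)

definition rank_in_copy :: "'m::finite ordered_copy \<Rightarrow> nat" where
  "rank_in_copy x = to_nat_on UNIV (original x)"

lemma inj_rank_in_copy: "rank_in_copy x = rank_in_copy y \<longleftrightarrow> x = y"
  using to_nat_on_inj[of UNIV "original x" "original y"]
  by (auto simp: rank_in_copy_def countable_finite intro: ordered_copy.expand)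

instantiation ordered_copy :: (finite) wellorder
begin

definition less_eq_ordered_copy :: "'a ordered_copy \<Rightarrow> 'a ordered_copy \<Rightarrow> bool" where
  "less_eq_ordered_copy x y \<longleftrightarrow> rank_in_copy x \<le> rank_in_copy y"

definition less_ordered_copy :: "'a ordered_copy \<Rightarrow> 'a ordered_copy \<Rightarrow> bool" where
  "less_ordered_copy x y \<longleftrightarrow> rank_in_copy x < rank_in_copy y"

instance
proof
  fix P :: "'a ordered_copy \<Rightarrow> bool" and a
  assume *: "\<And>x. (\<And>y. y < x \<Longrightarrow> P y) \<Longrightarrow> P x"
  show "P a"
  proof (induction a rule: measure_induct_rule[of rank_in_copy])
    case (less x)
    show ?case by (rule *) (rule less, simp add: less_ordered_copy_def)
  qed
qed (auto simp: less_eq_ordered_copy_def less_ordered_copy_def inj_rank_in_copy[symmetric])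

end

definition to_copy :: "real ^ 'm \<Rightarrow> real ^ 'm::finite ordered_copy" where
  "to_copy x = (\<chi> i. x $ original i)"
definition from_copy :: "real ^ 'm::finite ordered_copy \<Rightarrow> real ^ 'm" where
  "from_copy y = (\<chi> i. y $ Copy i)"

lemma to_from_copy [simp]: "to_copy (from_copy y) = y" "from_copy (to_copy x) = x"
  by (simp_all add: to_copy_def from_copy_def vec_eq_iff)

lemma linear_to_copy: "linear to_copy" and linear_from_copy: "linear from_copy"
  by (auto intro!: linearI simp: to_copy_def from_copy_def vec_eq_iff)

lemma bounded_linear_copy: "bounded_linear to_copy" "bounded_linear from_copy"
  using linear_to_copy linear_from_copy linear_linear by blast+

lemma measurable_copy [measurable]:
  "to_copy \<in> borel_measurable borel" "from_copy \<in> borel_measurable borel"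
  by (simp_all add: borel_measurable_continuous_onI linear_continuous_on bounded_linear_copy)

lemma image_copy: "from_copy ` S = to_copy -` S" "to_copy ` T = from_copy -` T"
  by (auto simp: image_iff) (metis to_from_copy)+

lemma prod_copy: "(\<Prod>i\<in>UNIV. F i) = (\<Prod>i\<in>UNIV. F (Copy i))" for F :: "'m::finite ordered_copy \<Rightarrow> 'b::comm_monoid_mult"
  unfolding UNIV_ordered_copy by (subst prod.reindex) (auto simp: inj_on_def)

lemma prod_Basis_cart: "(\<Prod>b\<in>Basis. f b) = (\<Prod>i\<in>UNIV. f (axis i 1))"
  for f :: "real ^ 'n \<Rightarrow> 'b::comm_monoid_mult"
proof -
  have "Basis = range (\<lambda>i::'n. axis i (1::real))" by (auto simp: Basis_vec_def)
  moreover have "inj (\<lambda>i::'n. axis i (1::real))" by (auto simp: inj_on_def axis_eq_axis)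
  ultimately show ?thesis by (metis prod.reindex_cong)
qed

lemma lborel_from_copy: "distr lborel borel from_copy = (lborel :: (real ^ 'm::finite) measure)"
proof (rule lborel_eqI[symmetric])
  fix l u :: "real ^ 'm"
  assume le: "\<And>b. b \<in> Basis \<Longrightarrow> l \<bullet> b \<le> u \<bullet> b"
  then have le': "l $ i \<le> u $ i" for i using le[of "axis i 1"] by (simp add: inner_axis)
  have "from_copy -` box l u = box (to_copy l) (to_copy u)"
    by (auto simp: mem_box_cart to_copy_def from_copy_def)
       (metis ordered_copy.exhaust_sel ordered_copy.sel)+
  then have "emeasure (distr lborel borel from_copy) (box l u) = emeasure lborel (box (to_copy l) (to_copy u))"
    by (subst emeasure_distr) auto
  also have "\<dots> = (\<Prod>b\<in>Basis. (to_copy u - to_copy l) \<bullet> b)"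
    by (rule emeasure_lborel_box) (use le' in \<open>auto simp: Basis_vec_def inner_axis to_copy_def\<close>)
  also have "\<dots> = (\<Prod>b\<in>Basis. (u - l) \<bullet> b)"
    by (simp add: prod_Basis_cart prod_copy inner_axis to_copy_def)
  finally show "emeasure (distr lborel borel from_copy) (box l u) = (\<Prod>b\<in>Basis. (u - l) \<bullet> b)" .
qed simp

text \<open>The Leibniz sum is invariant under relabelling, because relabelling preserves signs.\<close>

lemma det_copy:
  fixes M :: "real ^ 'm ^ 'm::finite"
  shows "det (\<chi> i j. M $ original i $ original j) = det M"
proof -
  let ?M = "(\<chi> i j. M $ original i $ original j)"
  have bij: "bij_betw (map_permutation UNIV Copy) {p. p permutes (UNIV :: 'm set)} {p. p permutes UNIV}"
  proof (rule bij_betw_byWitness[where f' = "map_permutation UNIV original"])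
    have c: "bij_betw Copy UNIV UNIV" by (rule bij_betw_byWitness[where f' = original]) auto
    have c': "bij_betw original UNIV UNIV" by (rule bij_betw_byWitness[where f' = Copy]) auto
    show "\<forall>p\<in>{p. p permutes UNIV}. map_permutation UNIV original (map_permutation UNIV Copy p) = p"
      "\<forall>p\<in>{p. p permutes UNIV}. map_permutation UNIV Copy (map_permutation UNIV original p) = p"
      by (auto intro!: map_permutation_compose_inv[OF c] map_permutation_compose_inv[OF c'])
    show "map_permutation UNIV Copy ` {p. p permutes UNIV} \<subseteq> {p. p permutes UNIV}"
      "map_permutation UNIV original ` {p. p permutes UNIV} \<subseteq> {p. p permutes UNIV}"
      using map_permutation_permutes[OF c] map_permutation_permutes[OF c'] by auto
  qed
  have "det ?M = (\<Sum>p | p permutes (UNIV :: 'm set). of_int (sign (map_permutation UNIV Copy p)) *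
      (\<Prod>i\<in>UNIV. ?M $ i $ map_permutation UNIV Copy p i))"
    unfolding det_def by (rule sum.reindex_bij_betw[OF bij, symmetric])
  also have "\<dots> = (\<Sum>p | p permutes (UNIV :: 'm set). of_int (sign p) * (\<Prod>i\<in>UNIV. M $ i $ p i))"
    by (intro sum.cong refl arg_cong2[of _ _ _ _ "(*)"])
       (auto simp: sign_map_permutation inj_on_def prod_copy map_permutation_apply)
  finally show ?thesis by (simp add: det_def)
qed

text \<open>The version for gauge integrals is an equivalence of integrability and measurability of the image
  with finite measure, so that both sides are infinite together.\<close>

lemma emeasure_image_wellorder:
  fixes T :: "real ^ 'n::{finite,wellorder} \<Rightarrow> real ^ 'n::_"
  assumes S: "S \<in> sets borel" and TS: "T ` S \<in> sets borel"
    and D: "\<And>x. x \<in> S \<Longrightarrow> (T has_derivative T' x) (at x)" and inj: "inj_on T S"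
    and meas: "(\<lambda>x. indicator S x * \<bar>det (matrix (T' x))\<bar>) \<in> borel_measurable borel"
  shows "emeasure lborel (T ` S) = (\<integral>\<^sup>+ x. ennreal (indicator S x * \<bar>det (matrix (T' x))\<bar>) \<partial>lborel)"
proof -
  let ?d = "\<lambda>x. \<bar>det (matrix (T' x))\<bar>"
  have SL: "S \<in> sets lebesgue" using S by auto
  have D': "(T has_derivative T' x) (at x within S)" if "x \<in> S" for x
    using D[OF that] by (rule has_derivative_at_withinI)
  note iff = measurable_differentiable_image_eq[OF SL D' inj]
  have restr: "(?d has_integral I) S \<longleftrightarrow> ((\<lambda>x. indicator S x * ?d x) has_integral I) UNIV" for I
  proof -
    have "(\<lambda>x. indicator S x * ?d x) = (\<lambda>x. if x \<in> S then ?d x else 0)" by auto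
    then show ?thesis by (simp only: has_integral_restrict_UNIV)
  qed
  show ?thesis
  proof (cases "?d integrable_on S")
    case True
    then have i: "(?d has_integral integral S ?d) S" by (rule integrable_integral)
    have "emeasure lborel (T ` S) = emeasure lebesgue (T ` S)" using TS by simp
    also have "\<dots> = ennreal (measure lebesgue (T ` S))"
      using iff True by (intro emeasure_eq_ennreal_measure) (auto simp: fmeasurable_def)
    also have "measure lebesgue (T ` S) = integral S ?d"
      by (rule measure_differentiable_image_eq[OF SL D' inj True])
    also have "ennreal (integral S ?d) = (\<integral>\<^sup>+ x. ennreal (indicator S x * ?d x) \<partial>lborel)"
      using i[unfolded restr] meas by (subst nn_integral_has_integral_lborel) auto
    finally show ?thesis .
  next
    case False
    have "emeasure lborel (T ` S) = \<infinity>"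
    proof (rule ccontr)
      assume "emeasure lborel (T ` S) \<noteq> \<infinity>"
      then have "T ` S \<in> lmeasurable" using TS by (auto simp: fmeasurable_def less_top)
      with False iff show False by simp
    qed
    moreover have "(\<integral>\<^sup>+ x. ennreal (indicator S x * ?d x) \<partial>lborel) = \<infinity>"
    proof (rule ccontr)
      assume "(\<integral>\<^sup>+ x. ennreal (indicator S x * ?d x) \<partial>lborel) \<noteq> \<infinity>"
      then obtain r where "(\<integral>\<^sup>+ x. ennreal (indicator S x * ?d x) \<partial>lborel) = ennreal r" "0 \<le> r"
        by (cases rule: ennreal_cases) auto
      then have "((\<lambda>x. indicator S x * ?d x) has_integral r) UNIV"
        by (intro nn_integral_has_integral[OF meas]) auto
      with False show False unfolding restr[symmetric] by blast
    qed
    ultimately show ?thesis by simp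
  qed
qed

text \<open>Relabel the coordinates, apply the wellordered case, and relabel back.\<close>

lemma emeasure_image:
  fixes T :: "real ^ 'm::finite \<Rightarrow> real ^ 'm"
  assumes S: "S \<in> sets borel" and TS: "T ` S \<in> sets borel"
    and D: "\<And>x. x \<in> S \<Longrightarrow> (T has_derivative T' x) (at x)" and inj: "inj_on T S"
    and meas: "(\<lambda>x. indicator S x * \<bar>det (matrix (T' x))\<bar>) \<in> borel_measurable borel"
  shows "emeasure lborel (T ` S) = (\<integral>\<^sup>+ x. ennreal (indicator S x * \<bar>det (matrix (T' x))\<bar>) \<partial>lborel)"
proof -
  define S2 where "S2 = to_copy ` S"
  define T2 where "T2 = to_copy \<circ> T \<circ> from_copy"
  define T2' where "T2' = (\<lambda>y. to_copy \<circ> T' (from_copy y) \<circ> from_copy)"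
  have S2: "S2 \<in> sets borel" unfolding S2_def image_copy
    using measurable_sets[OF measurable_copy(2) S] by simp
  have T2S: "T2 ` S2 = to_copy ` (T ` S)" by (force simp: T2_def S2_def image_iff)
  have T2S2: "T2 ` S2 \<in> sets borel" unfolding T2S image_copy
    using measurable_sets[OF measurable_copy(2) TS] by simp
  have D2: "(T2 has_derivative T2' y) (at y)" if "y \<in> S2" for y
  proof -
    have "from_copy y \<in> S" using that by (auto simp: S2_def)
    then show ?thesis unfolding T2_def T2'_def comp_assoc
      by (intro diff_chain_at bounded_linear_imp_has_derivative bounded_linear_copy)
         (use D[of "from_copy y"] in \<open>auto simp: comp_def\<close>)
  qed
  have inj2: "inj_on T2 S2"
    using inj by (auto simp: inj_on_def T2_def S2_def) (metis to_from_copy(2))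
  have det2: "det (matrix (T2' y)) = det (matrix (T' (from_copy y)))" for y
  proof -
    have "from_copy (axis j 1) = axis (original j) 1" for j :: "'m ordered_copy"
      by (auto simp: from_copy_def axis_def vec_eq_iff) 
    note fc = this
    have "matrix (T2' y) = (\<chi> i j. matrix (T' (from_copy y)) $ original i $ original j)"
      by (simp add: matrix_def T2'_def to_copy_def fc)
    then show ?thesis by (simp add: det_copy)
  qed
  have ind: "indicator S2 y = (indicator S (from_copy y) :: real)" for y
    by (auto simp: S2_def image_copy indicator_def)
  have "emeasure lborel (T ` S) = emeasure (distr lborel borel from_copy) (T ` S)"
    by (simp add: lborel_from_copy)
  also have "\<dots> = emeasure lborel (T2 ` S2)"
    using TS by (subst emeasure_distr) (auto simp: T2S image_copy)
  also have "\<dots> = (\<integral>\<^sup>+ y. ennreal (indicator S2 y * \<bar>det (matrix (T2' y))\<bar>) \<partial>lborel)"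
    using measurable_compose[OF measurable_copy(2) meas]
    by (intro emeasure_image_wellorder[OF S2 T2S2 D2 inj2]) (simp_all add: det2 ind)
  also have "\<dots> = (\<integral>\<^sup>+ y. ennreal (indicator S (from_copy y) * \<bar>det (matrix (T' (from_copy y)))\<bar>) \<partial>lborel)"
    by (simp add: det2 ind)
  also have "\<dots> = (\<integral>\<^sup>+ x. ennreal (indicator S x * \<bar>det (matrix (T' x))\<bar>) \<partial>distr lborel borel from_copy)"
    by (subst nn_integral_distr) (use meas in simp_all)
  finally show ?thesis by (simp add: lborel_from_copy)
qed

text \<open>The area formula on the Borel subsets of \<open>S\<close> says that two measures agree; integrate against them.\<close>

lemma nn_integral_image:
  fixes T :: "real ^ 'm::finite \<Rightarrow> real ^ 'm"
  assumes S: "S \<in> sets borel" and TS: "\<And>B. B \<in> sets borel \<Longrightarrow> B \<subseteq> S \<Longrightarrow> T ` B \<in> sets borel"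
    and D: "\<And>x. x \<in> S \<Longrightarrow> (T has_derivative T' x) (at x)" and inj: "inj_on T S"
    and meas: "(\<lambda>x. indicator S x * \<bar>det (matrix (T' x))\<bar>) \<in> borel_measurable borel"
    and h: "h \<in> borel_measurable borel"
  shows "(\<integral>\<^sup>+ y. h y * indicator (T ` S) y \<partial>lborel) =
    (\<integral>\<^sup>+ x. h (T x) * ennreal \<bar>det (matrix (T' x))\<bar> * indicator S x \<partial>lborel)"
proof -
  let ?d = "\<lambda>x. \<bar>det (matrix (T' x))\<bar>"
  have [measurable]: "S \<in> sets borel" "T ` S \<in> sets borel" by (auto intro: S TS)
  have [measurable]: "(\<lambda>x. ennreal (indicator S x * ?d x)) \<in> borel_measurable borel"
    by (rule measurable_compose[OF meas measurable_ennreal])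
  define T0 where "T0 = (\<lambda>x. if x \<in> S then T x else 0)"
  have T0 [measurable]: "T0 \<in> borel_measurable borel"
    unfolding T0_def
  proof (rule borel_measurable_continuous_on_if[OF S])
    show "continuous_on S T" using D by (auto intro!: continuous_at_imp_continuous_on has_derivative_continuous)
  qed simp
  have eq: "density lborel (indicator (T ` S)) = distr (density lborel (\<lambda>x. ennreal (indicator S x * ?d x))) borel T0"
    (is "?L = ?R")
  proof (rule measure_eqI)
    fix B assume "B \<in> sets ?L"
    then have B [measurable]: "B \<in> sets borel" by simp
    let ?S = "S \<inter> T0 -` B"
    have "T0 -` B \<in> sets borel" using measurable_sets[OF T0 B] by simp
    then have S': "?S \<in> sets borel" using S by auto
    have im: "T ` ?S = T ` S \<inter> B" by (auto simp: T0_def)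
    have "(\<lambda>x. indicator ?S x * (indicator S x * ?d x)) \<in> borel_measurable borel"
      by (rule borel_measurable_times[OF borel_measurable_indicator[OF S'] meas])
    also have "(\<lambda>x. indicator ?S x * (indicator S x * ?d x)) = (\<lambda>x. indicator ?S x * ?d x)"
      by (auto simp: indicator_def)
    finally have "emeasure lborel (T ` ?S) = (\<integral>\<^sup>+ x. ennreal (indicator ?S x * ?d x) \<partial>lborel)"
      using D inj TS[OF S'] by (intro emeasure_image S') (auto intro: inj_on_subset)
    also have "\<dots> = (\<integral>\<^sup>+ x. ennreal (indicator S x * ?d x) * indicator (T0 -` B) x \<partial>lborel)"
      by (intro nn_integral_cong) (auto simp: indicator_def)
    also have "\<dots> = emeasure ?R B"
      by (subst emeasure_distr, simp, simp, subst emeasure_density) (use \<open>T0 -` B \<in> sets borel\<close> meas in auto)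
    finally have R: "emeasure lborel (T ` S \<inter> B) = emeasure ?R B" unfolding im .
    have "emeasure ?L B = (\<integral>\<^sup>+ y. indicator (T ` S) y * indicator B y \<partial>lborel)"
      by (rule emeasure_density) auto
    also have "\<dots> = (\<integral>\<^sup>+ y. indicator (T ` S \<inter> B) y \<partial>lborel)"
      by (intro nn_integral_cong) (auto simp: indicator_def)
    also have "\<dots> = emeasure lborel (T ` S \<inter> B)" by simp
    finally show "emeasure ?L B = emeasure ?R B" using R by simp
  qed simp
  have "(\<integral>\<^sup>+ y. h y * indicator (T ` S) y \<partial>lborel) = (\<integral>\<^sup>+ y. h y \<partial>?L)"
    using h by (subst nn_integral_density) (auto simp: mult.commute)
  also have "\<dots> = (\<integral>\<^sup>+ x. ennreal (indicator S x * ?d x) * h (T0 x) \<partial>lborel)"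
    unfolding eq using h meas by (subst nn_integral_distr, simp, simp, subst nn_integral_density) auto
  also have "\<dots> = (\<integral>\<^sup>+ x. h (T x) * ennreal (?d x) * indicator S x \<partial>lborel)"
    by (intro nn_integral_cong) (auto simp: indicator_def T0_def mult.commute)
  finally show ?thesis .
qed


section \<open>Positive definite matrices\<close>

definition pos_def :: "real ^ 'n ^ 'n \<Rightarrow> bool" where
  "pos_def G \<longleftrightarrow> transpose G = G \<and> (\<forall>v. v \<noteq> 0 \<longrightarrow> v \<bullet> (G *v v) > 0)"

lemma pos_def_det_neq_0: "pos_def G \<Longrightarrow> det G \<noteq> 0" for G :: "real ^ 'n::finite ^ 'n"
proof -
  assume G: "pos_def G"
  have "inj ((*v) G)"
  proof (rule linear_injective_0[THEN iffD2])
    show "\<forall>x. G *v x = 0 \<longrightarrow> x = 0"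
      using G unfolding pos_def_def by (metis inner_zero_right less_irrefl)
  qed (rule matrix_vector_mul_linear)
  then show ?thesis
    using det_nz_iff_inj[of "(*v) G"] by (simp add: matrix_vector_mul_linear)
qed

lemma continuous_on_det:
  fixes F :: "'a::topological_space \<Rightarrow> real ^ 'n::finite ^ 'n"
  shows "continuous_on S F \<Longrightarrow> continuous_on S (\<lambda>x. det (F x))"
  unfolding det_def by (intro continuous_intros continuous_on_component) auto

text \<open>The determinant does not vanish on the segment of positive definite matrices from the identity
  to \<open>G\<close>.\<close>

lemma pos_def_det_pos: "pos_def G \<Longrightarrow> det G > 0" for G :: "real ^ 'n::finite ^ 'n"
proof (rule ccontr)
  assume G: "pos_def G" and "\<not> det G > 0"
  \<comment> \<open>The segment from the identity to \<open>G\<close> stays positive definite.\<close>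
  define P where "P t = (1 - t) *\<^sub>R mat 1 + t *\<^sub>R G" for t :: real
  have "continuous_on {0..1} (\<lambda>t. det (P t))"
    unfolding P_def by (intro continuous_on_det continuous_intros)
  moreover have "det (P 1) \<le> 0" "0 \<le> det (P 0)"
    using \<open>\<not> det G > 0\<close> by (auto simp: P_def)
  ultimately obtain t where t: "0 \<le> t" "t \<le> 1" "det (P t) = 0"
    using IVT2'[of "\<lambda>t. det (P t)" 1 0 0] by auto
  have "pos_def (P t)"
    unfolding pos_def_def
  proof (intro conjI allI impI)
    show "transpose (P t) = P t"
      using G by (simp add: pos_def_def P_def transpose_def vec_eq_iff mat_def)
    fix v :: "real ^ 'n" assume v: "v \<noteq> 0"
    have "v \<bullet> (P t *v v) = (1 - t) * (v \<bullet> v) + t * (v \<bullet> (G *v v))"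
      by (simp add: P_def matrix_vector_mult_add_rdistrib scaleR_matrix_vector_assoc[symmetric] inner_add_right)
    moreover have "v \<bullet> (G *v v) > 0" "v \<bullet> v > 0" using G v by (auto simp: pos_def_def)
    ultimately show "v \<bullet> (P t *v v) > 0"
      using t by (cases "t = 0") (auto intro!: add_nonneg_pos)
  qed
  then show False using pos_def_det_neq_0 t by blast
qed

lemma invertible_matrix_inv:
  "invertible M \<Longrightarrow> M ** matrix_inv M = mat 1 \<and> matrix_inv M ** M = mat 1"
  unfolding matrix_inv_def invertible_def by (rule someI_ex)

lemma pos_def_matrix_inv:
  fixes G :: "real ^ 'n::finite ^ 'n"
  assumes "pos_def G"
  shows "G ** matrix_inv G = mat 1" "matrix_inv G ** G = mat 1"
proof -
  have "invertible G" using pos_def_det_neq_0[OF assms] by (simp add: invertible_det_nz)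
  then show "G ** matrix_inv G = mat 1" "matrix_inv G ** G = mat 1"
    using invertible_matrix_inv by blast+
qed

lemma pos_def_sym: "pos_def G \<Longrightarrow> v \<bullet> (G *v w) = w \<bullet> (G *v v)" for G :: "real ^ 'n::finite ^ 'n"
  by (metis dot_lmul_matrix inner_commute pos_def_def transpose_matrix_vector)

lemma pos_def_inv_vec:
  fixes G :: "real ^ 'n::finite ^ 'n"
  assumes "pos_def G"
  shows "G *v (matrix_inv G *v w) = w" "matrix_inv G *v (G *v w) = w"
  by (simp_all add: matrix_vector_mul_assoc pos_def_matrix_inv[OF assms])

lemma pos_def_inv: "pos_def G \<Longrightarrow> pos_def (matrix_inv G)" for G :: "real ^ 'n::finite ^ 'n"
proof -
  assume G: "pos_def G"
  note inv = pos_def_inv_vec[OF G]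
  have pos: "v \<bullet> (matrix_inv G *v v) > 0" if "v \<noteq> 0" for v
  proof -
    have "matrix_inv G *v v \<noteq> 0" using inv(1)[of v] that by auto
    then have "(matrix_inv G *v v) \<bullet> (G *v (matrix_inv G *v v)) > 0" using G by (simp add: pos_def_def)
    then show ?thesis by (simp add: inv inner_commute)
  qed
  have "v \<bullet> (matrix_inv G *v w) = (transpose (matrix_inv G) *v v) \<bullet> w" for v w
    by (simp add: dot_lmul_matrix transpose_matrix_vector)
  moreover have "v \<bullet> (matrix_inv G *v w) = (matrix_inv G *v v) \<bullet> w" for v w
    using pos_def_sym[OF G, of "matrix_inv G *v v" "matrix_inv G *v w"] by (simp add: inv inner_commute)
  ultimately have "transpose (matrix_inv G) *v v = matrix_inv G *v v" for v
    by (metis vector_eq_rdot)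
  then have "transpose (matrix_inv G) = matrix_inv G" by (simp add: matrix_eq)
  with pos show ?thesis by (simp add: pos_def_def)
qed

text \<open>The upper bound is the Cauchy--Schwarz inequality for \<open>w \<bullet> v\<close> with \<open>v = matrix_inv G *v w\<close>,
  whose norm is at most \<open>K\<close> times that of \<open>w\<close>. The lower bound expands the form of \<open>G\<close>
  at \<open>w - K v\<close>, which is nonnegative.\<close>

lemma pos_def_inv_bounds:
  fixes G :: "real ^ 'n::finite ^ 'n"
  assumes G: "pos_def G" and K: "K > 0"
    and b: "\<And>v. (norm v)\<^sup>2 / K \<le> v \<bullet> (G *v v)" "\<And>v. v \<bullet> (G *v v) \<le> K * (norm v)\<^sup>2"
  shows "(norm w)\<^sup>2 / K \<le> w \<bullet> (matrix_inv G *v w)" "w \<bullet> (matrix_inv G *v w) \<le> K * (norm w)\<^sup>2"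
proof -
  define v where "v = matrix_inv G *v w"
  have w: "w = G *v v" by (simp add: v_def pos_def_inv_vec[OF G])
  have vv: "v \<bullet> (G *v v) = w \<bullet> v" by (simp add: w[symmetric] inner_commute)
  have "(norm v)\<^sup>2 / K \<le> norm w * norm v"
    using b(1)[of v] vv norm_cauchy_schwarz[of w v] by linarith
  then have "norm v * norm v \<le> (K * norm w) * norm v" using K by (simp add: field_simps power2_eq_square)
  then have nv: "norm v \<le> K * norm w"
    using K by (cases "norm v = 0") (auto simp only: mult_le_cancel_right, auto)
  have "w \<bullet> v \<le> norm w * norm v" by (rule norm_cauchy_schwarz)
  also have "\<dots> \<le> norm w * (K * norm w)" using nv by (intro mult_left_mono) auto
  finally show "w \<bullet> (matrix_inv G *v w) \<le> K * (norm w)\<^sup>2" by (simp add: v_def power2_eq_square mult_ac)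
  have "0 \<le> (w - K *\<^sub>R v) \<bullet> (G *v (w - K *\<^sub>R v))"
    using G by (cases "w - K *\<^sub>R v = 0") (auto simp: pos_def_def intro: less_imp_le)
  also have "\<dots> = w \<bullet> (G *v w) - 2 * K * (norm w)\<^sup>2 + K\<^sup>2 * (w \<bullet> v)"
    using pos_def_sym[OF G, of w v] vv
    by (simp add: matrix_vector_mult_diff_distrib matrix_vector_mult_scaleR inner_diff_left inner_diff_right
        w[symmetric] power2_norm_eq_inner algebra_simps power2_eq_square[of K])
  also have "\<dots> \<le> K\<^sup>2 * (w \<bullet> v) - K * (norm w)\<^sup>2" using b(2)[of w] by (simp add: algebra_simps)
  finally have "K * (norm w)\<^sup>2 \<le> K * (K * (w \<bullet> v))" by (simp add: power2_eq_square mult_ac)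
  then show "(norm w)\<^sup>2 / K \<le> w \<bullet> (matrix_inv G *v w)" using K by (simp add: v_def field_simps)
qed

lemma continuous_on_quadratic_form:
  fixes F :: "'a::topological_space \<Rightarrow> real ^ 'n::finite ^ 'n"
  assumes "continuous_on S F" "continuous_on S h" "continuous_on S k"
  shows "continuous_on S (\<lambda>x. h x \<bullet> (F x *v k x))"
  unfolding matrix_vector_mult_def inner_vec_def
  by (simp, intro continuous_intros continuous_on_component assms)

text \<open>The constant is extracted from the extreme values of the quadratic form on the product with the
  unit sphere and from those of the determinant.\<close>

lemma compact_elliptic:
  fixes F :: "'a::topological_space \<Rightarrow> real ^ 'n::finite ^ 'n"
  assumes F: "continuous_on Z F" and Z: "compact Z" and pd: "\<And>z. z \<in> Z \<Longrightarrow> pos_def (F z)"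
  obtains K where "K \<ge> 1" and
    "\<And>z v. z \<in> Z \<Longrightarrow> (norm v)\<^sup>2 / K \<le> v \<bullet> (F z *v v)"
    "\<And>z v. z \<in> Z \<Longrightarrow> v \<bullet> (F z *v v) \<le> K * (norm v)\<^sup>2"
    "\<And>z. z \<in> Z \<Longrightarrow> 1 / K \<le> sqrt (det (F z))"
    "\<And>z. z \<in> Z \<Longrightarrow> sqrt (det (F z)) \<le> K"
proof (cases "Z = {}")
  case True
  then show ?thesis using that[of 1] by auto
next
  case False
  let ?q = "\<lambda>x. snd x \<bullet> (F (fst x) *v snd x)" and ?s = "Z \<times> sphere (0 :: real ^ 'n) 1" and ?d = "\<lambda>z. sqrt (det (F z))"
  have F': "continuous_on ?s (\<lambda>x. F (fst x))"
    by (rule continuous_on_compose2[OF F continuous_on_fst[OF continuous_on_id]]) auto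
  have cq: "continuous_on ?s ?q"
    by (rule continuous_on_quadratic_form[OF F' continuous_on_snd continuous_on_snd]) (rule continuous_on_id)+
  have cd: "continuous_on Z ?d" by (intro continuous_intros continuous_on_det F)
  obtain e1 :: "real ^ 'n" where "norm e1 = 1" using vector_choose_size[of 1] by auto
  moreover obtain z1 where "z1 \<in> Z" using False by auto
  ultimately have "(z1, e1) \<in> ?s" by simp
  then have ne: "?s \<noteq> {}" by (metis empty_iff)
  have cs: "compact ?s" using Z by (intro compact_Times) auto
  obtain a where a: "a \<in> ?s" "\<And>x. x \<in> ?s \<Longrightarrow> ?q a \<le> ?q x" using continuous_attains_inf[OF cs ne cq] by blast
  obtain b where b: "b \<in> ?s" "\<And>x. x \<in> ?s \<Longrightarrow> ?q x \<le> ?q b" using continuous_attains_sup[OF cs ne cq] by blast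
  obtain u where u: "u \<in> Z" "\<And>x. x \<in> Z \<Longrightarrow> ?d u \<le> ?d x" using continuous_attains_inf[OF Z False cd] by blast
  obtain w where w: "w \<in> Z" "\<And>x. x \<in> Z \<Longrightarrow> ?d x \<le> ?d w" using continuous_attains_sup[OF Z False cd] by blast
  have "fst a \<in> Z" "snd a \<noteq> 0" using a(1) by (auto simp: mem_Times_iff)
  then have pa: "?q a > 0" using pd[of "fst a"] by (simp add: pos_def_def)
  have pu: "?d u > 0" using pos_def_det_pos[OF pd[OF u(1)]] by simp
  define K where "K = Max {1, 1 / ?q a, ?q b, 1 / ?d u, ?d w}"
  have K: "K \<ge> 1" "K \<ge> 1 / ?q a" "K \<ge> ?q b" "K \<ge> 1 / ?d u" "K \<ge> ?d w"
    unfolding K_def by auto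
  have iK: "1 / K \<le> ?q a" "1 / K \<le> ?d u"
    using K pa pu by (auto simp: field_simps)
  have sc: "v \<bullet> (F z *v v) = (norm v)\<^sup>2 * ?q (z, v /\<^sub>R norm v)" for z v
    by (cases "v = 0") (auto simp: matrix_vector_mult_scaleR power2_eq_square field_simps)
  have in_s: "(z, v /\<^sub>R norm v) \<in> ?s" if "z \<in> Z" "v \<noteq> 0" for z v using that by simp
  show ?thesis
  proof (rule that[OF K(1)])
    fix z v assume z: "z \<in> Z"
    show "(norm v)\<^sup>2 / K \<le> v \<bullet> (F z *v v)"
    proof (cases "v = 0")
      case False
      have "(norm v)\<^sup>2 * (1 / K) \<le> (norm v)\<^sup>2 * ?q (z, v /\<^sub>R norm v)"
        using a(2)[OF in_s[OF z False]] iK by (intro mult_left_mono) auto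
      then show ?thesis by (simp add: sc[of v])
    qed simp
    show "v \<bullet> (F z *v v) \<le> K * (norm v)\<^sup>2"
    proof (cases "v = 0")
      case False
      have "(norm v)\<^sup>2 * ?q (z, v /\<^sub>R norm v) \<le> (norm v)\<^sup>2 * K"
        using b(2)[OF in_s[OF z False]] K by (intro mult_left_mono) auto
      then show ?thesis by (simp add: sc[of v] mult.commute)
    qed simp
  next
    fix z assume z: "z \<in> Z"
    show "1 / K \<le> ?d z" "?d z \<le> K" using u(2)[OF z] w(2)[OF z] iK K by linarith+
  qed
qed

section \<open>Charts of a closed Riemannian manifold\<close>

locale closed_riemannian =
  fixes A :: "('a::{t2_space,second_countable_topology}, 'm::finite) chart set"
    and g :: "('a, 'm) metric_coeffs"
  assumes X: "closed_riemannian_manifold A g"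
begin

abbreviation im :: "('a, 'm) chart \<Rightarrow> (real ^ 'm) set" where "im c \<equiv> coord c ` dom c"

lemma compact_X: "compact (UNIV :: 'a set)"
  and atlas: "smooth_atlas A"
  and metric: "riemannian_metric A g"
  using X by (auto simp: closed_riemannian_manifold_def)

lemma open_dom: "c \<in> A \<Longrightarrow> open (dom c)"
  and open_im: "c \<in> A \<Longrightarrow> open (im c)"
  and homeo: "c \<in> A \<Longrightarrow> homeomorphism (dom c) (im c) (coord c) (param c)"
  and transition_smooth:
    "c \<in> A \<Longrightarrow> c' \<in> A \<Longrightarrow> smooth_on (coord c ` (dom c \<inter> dom c')) (coord c' \<circ> param c)"
  using atlas unfolding smooth_atlas_def by blast+

lemma ex_chart: "\<exists>c\<in>A. p \<in> dom c"
  using atlas unfolding smooth_atlas_def by (metis UNIV_I UN_iff)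

lemma chart_at: "chart_at A p \<in> A" "p \<in> dom (chart_at A p)"
  using someI_ex[of "\<lambda>c. c \<in> A \<and> p \<in> dom c"] ex_chart unfolding chart_at_def by blast+

lemma param_coord: "c \<in> A \<Longrightarrow> p \<in> dom c \<Longrightarrow> param c (coord c p) = p"
  and coord_param: "c \<in> A \<Longrightarrow> z \<in> im c \<Longrightarrow> coord c (param c z) = z"
  and param_in: "c \<in> A \<Longrightarrow> z \<in> im c \<Longrightarrow> param c z \<in> dom c"
  and continuous_coord: "c \<in> A \<Longrightarrow> continuous_on (dom c) (coord c)"
  and continuous_param: "c \<in> A \<Longrightarrow> continuous_on (im c) (param c)"
  using homeo[of c] unfolding homeomorphism_def by auto

lemma pd: "c \<in> A \<Longrightarrow> p \<in> dom c \<Longrightarrow> pos_def (g c p)"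
  using metric unfolding riemannian_metric_def pos_def_def by blast

lemma metric_law:
  "c \<in> A \<Longrightarrow> c' \<in> A \<Longrightarrow> p \<in> dom c \<Longrightarrow> p \<in> dom c' \<Longrightarrow>
    g c p = transpose (jac c c' p) ** g c' p ** jac c c' p"
  using metric unfolding riemannian_metric_def by blast

lemma continuous_metric: "c \<in> A \<Longrightarrow> continuous_on (im c) (\<lambda>z. g c (param c z))"
  using metric smooth_on_continuous unfolding riemannian_metric_def comp_def by blast

lemma open_coord_image: "c \<in> A \<Longrightarrow> open S \<Longrightarrow> S \<subseteq> dom c \<Longrightarrow> open (coord c ` S)"
  by (metis homeo homeomorphism_imp_open_map open_im open_dom openin_open_eq open_subset openin_subtopology)

lemma coord_image_eq: "c \<in> A \<Longrightarrow> S \<subseteq> dom c \<Longrightarrow> coord c ` S = {z \<in> im c. param c z \<in> S}"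
  by (auto simp: param_coord coord_param subset_iff)

lemma open_param_image: "c \<in> A \<Longrightarrow> open S \<Longrightarrow> S \<subseteq> im c \<Longrightarrow> open (param c ` S)"
proof -
  assume c: "c \<in> A" and S: "open S" "S \<subseteq> im c"
  have "param c ` S = {p \<in> dom c. coord c p \<in> S}"
    using S(2) c by (auto simp: coord_param param_in subset_iff) (metis param_coord imageI)
  also have "\<dots> = coord c -` S \<inter> dom c" by auto
  finally show ?thesis
    using continuous_open_preimage[OF continuous_coord[OF c] open_dom[OF c] S(1)] by (simp add: Int_commute)
qed

lemma compact_param_image: "c \<in> A \<Longrightarrow> compact Z \<Longrightarrow> Z \<subseteq> im c \<Longrightarrow> compact (param c ` Z)"
  by (meson compact_continuous_image continuous_on_subset continuous_param)

lemma transition_has_derivative: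
  assumes "c \<in> A" "c' \<in> A" "p \<in> dom c" "p \<in> dom c'"
  shows "((coord c' \<circ> param c) has_derivative (*v) (jac c c' p)) (at (coord c p))"
proof -
  have D: "((coord c' \<circ> param c) has_derivative frechet_derivative (coord c' \<circ> param c) (at (coord c p))) (at (coord c p))"
    by (rule smooth_onD[OF transition_smooth]) (use assms in auto)
  have "(*v) (jac c c' p) = frechet_derivative (coord c' \<circ> param c) (at (coord c p))"
    unfolding jac_def using matrix_vector_mul(2)[OF has_derivative_linear[OF D]] by simp
  with D show ?thesis by simp
qed

lemma metric_law_vec:
  assumes "c \<in> A" "c' \<in> A" "p \<in> dom c" "p \<in> dom c'"
  shows "v \<bullet> (g c p *v w) = (jac c c' p *v v) \<bullet> (g c' p *v (jac c c' p *v w))"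
  unfolding metric_law[OF assms]
  by (metis dot_lmul_matrix inner_commute matrix_vector_mul_assoc transpose_matrix_vector)

lemma det_metric_law:
  assumes "c \<in> A" "c' \<in> A" "p \<in> dom c" "p \<in> dom c'"
  shows "sqrt (det (g c p)) = \<bar>det (jac c c' p)\<bar> * sqrt (det (g c' p))" "det (jac c c' p) \<noteq> 0"
proof -
  have *: "det (g c p) = (det (jac c c' p))\<^sup>2 * det (g c' p)"
    unfolding metric_law[OF assms] by (simp add: det_mul power2_eq_square)
  then show "sqrt (det (g c p)) = \<bar>det (jac c c' p)\<bar> * sqrt (det (g c' p))"
    by (simp add: real_sqrt_mult)
  show "det (jac c c' p) \<noteq> 0" using * pos_def_det_pos[OF pd[OF assms(1,3)]] by auto
qed

lemma matrix_inv_law: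
  assumes "c \<in> A" "c' \<in> A" "p \<in> dom c" "p \<in> dom c'"
  shows "(transpose (jac c c' p) *v v) \<bullet> (matrix_inv (g c p) *v (transpose (jac c c' p) *v w)) =
    v \<bullet> (matrix_inv (g c' p) *v w)"
proof -
  let ?J = "jac c c' p" and ?G = "g c p" and ?H = "g c' p"
  have "invertible ?J" using det_metric_law(2)[OF assms] by (simp add: invertible_det_nz)
  then obtain y where y: "?J *v y = matrix_inv ?H *v w"
    by (metis invertible_matrix_inv matrix_vector_mul_assoc matrix_vector_mul_lid)
  have "?G *v y = transpose ?J *v (?H *v (?J *v y))"
    unfolding metric_law[OF assms] by (simp add: matrix_vector_mul_assoc matrix_mul_assoc)
  also have "\<dots> = transpose ?J *v w" by (simp add: y pos_def_inv_vec pd assms)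
  finally have "matrix_inv ?G *v (transpose ?J *v w) = y"
    by (metis pos_def_inv_vec(2) pd assms(1,3))
  then have "(transpose ?J *v v) \<bullet> (matrix_inv ?G *v (transpose ?J *v w)) = (transpose ?J *v v) \<bullet> y" by simp
  also have "\<dots> = v \<bullet> (?J *v y)"
    by (metis dot_lmul_matrix transpose_matrix_vector)
  finally show ?thesis by (simp add: y)
qed

text \<open>A coordinate ball on which the metric, its inverse and its density are comparable to the Euclidean
  ones. The factor \<open>3\<close> leaves room for cutoffs that equal \<open>1\<close> on radius \<open>R\<close> and vanish beyond \<open>2 R\<close>.\<close>

definition good :: "real \<Rightarrow> ('a, 'm) chart \<Rightarrow> real ^ 'm \<Rightarrow> real \<Rightarrow> bool" where
  "good K c y R \<longleftrightarrow> c \<in> A \<and> 0 < R \<and> 1 \<le> K \<and> cball y (3 * R) \<subseteq> im c \<and>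
    (\<forall>z\<in>cball y (3 * R).
      (\<forall>v. (norm v)\<^sup>2 / K \<le> v \<bullet> (g c (param c z) *v v) \<and> v \<bullet> (g c (param c z) *v v) \<le> K * (norm v)\<^sup>2) \<and>
      (\<forall>v. (norm v)\<^sup>2 / K \<le> v \<bullet> (matrix_inv (g c (param c z)) *v v) \<and>
         v \<bullet> (matrix_inv (g c (param c z)) *v v) \<le> K * (norm v)\<^sup>2) \<and>
      1 / K \<le> sqrt (det (g c (param c z))) \<and> sqrt (det (g c (param c z))) \<le> K)"

lemma good_mono: "good K c y R \<Longrightarrow> K \<le> K' \<Longrightarrow> good K' c y R"
proof -
  assume G: "good K c y R" and K: "K \<le> K'"
  then have "1 \<le> K" by (simp add: good_def)
  have 1: "t / K' \<le> t / K" "K * t \<le> K' * t" if "0 \<le> t" for t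
    using that K \<open>1 \<le> K\<close> by (auto intro: divide_left_mono mult_right_mono)
  have 2: "1 / K' \<le> 1 / K" using 1(1)[of 1] by simp
  show ?thesis
    using G K unfolding good_def
    by (meson 1 2 order_trans zero_le_power2)
qed

lemma good_exists: "c \<in> A \<Longrightarrow> p \<in> dom c \<Longrightarrow> \<exists>K R. good K c (coord c p) R"
proof -
  assume c: "c \<in> A" "p \<in> dom c"
  then obtain e where e: "e > 0" "cball (coord c p) e \<subseteq> im c"
    using open_im[OF c(1)] by (meson imageI open_contains_cball)
  let ?Z = "cball (coord c p) e"
  have pdZ: "pos_def (g c (param c z))" if "z \<in> ?Z" for z using that e c by (auto intro!: pd param_in)
  obtain K where K: "K \<ge> 1"
    "\<And>z v. z \<in> ?Z \<Longrightarrow> (norm v)\<^sup>2 / K \<le> v \<bullet> (g c (param c z) *v v)"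
    "\<And>z v. z \<in> ?Z \<Longrightarrow> v \<bullet> (g c (param c z) *v v) \<le> K * (norm v)\<^sup>2"
    "\<And>z. z \<in> ?Z \<Longrightarrow> 1 / K \<le> sqrt (det (g c (param c z)))"
    "\<And>z. z \<in> ?Z \<Longrightarrow> sqrt (det (g c (param c z))) \<le> K"
    using compact_elliptic[OF continuous_on_subset[OF continuous_metric[OF c(1)] e(2)] compact_cball pdZ] by blast
  have inv: "(norm v)\<^sup>2 / K \<le> v \<bullet> (matrix_inv (g c (param c z)) *v v)"
    "v \<bullet> (matrix_inv (g c (param c z)) *v v) \<le> K * (norm v)\<^sup>2" if "z \<in> ?Z" for z v
    using pos_def_inv_bounds[OF pdZ[OF that], of K v] K that by auto
  have "good K c (coord c p) (e / 3)"
    unfolding good_def using c e K inv by auto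
  then show ?thesis by blast
qed

lemma good_cover:
  obtains I K where "finite I" "\<And>i. i \<in> I \<Longrightarrow> (case i of (c, y, R) \<Rightarrow> good K c y R)"
    "\<And>p. \<exists>(c, y, R)\<in>I. p \<in> dom c \<and> coord c p \<in> ball y R"
proof -
  have "\<exists>i. case i of (c, y, R, K) \<Rightarrow> good K c y R \<and> p \<in> dom c \<and> coord c p \<in> ball y R" for p
  proof -
    obtain K R where "good K (chart_at A p) (coord (chart_at A p) p) R" using good_exists chart_at by blast
    then show ?thesis
      using chart_at[of p] by (intro exI[of _ "(chart_at A p, coord (chart_at A p) p, R, K)"]) (simp add: good_def)
  qed
  from choice[OF allI[OF this]]
  obtain F where "\<forall>p. case F p of (c, y, R, K) \<Rightarrow> good K c y R \<and> p \<in> dom c \<and> coord c p \<in> ball y R" ..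
  then have F: "case F p of (c, y, R, K) \<Rightarrow> good K c y R \<and> p \<in> dom c \<and> coord c p \<in> ball y R" for p ..
  define V where "V = (\<lambda>p. case F p of (c, y, R, K) \<Rightarrow> param c ` ball y R)"
  have "open (V p) \<and> p \<in> V p" for p
  proof -
    obtain c y R k where Fp: "F p = (c, y, R, k)" by (metis prod.exhaust)
    with F[of p] have gd: "good k c y R" and p: "p \<in> dom c" "coord c p \<in> ball y R" by simp_all
    then have "c \<in> A" "0 < R" "cball y (3 * R) \<subseteq> im c" by (auto simp: good_def)
    moreover have "ball y R \<subseteq> cball y (3 * R)" using \<open>0 < R\<close> by auto
    ultimately have "open (V p)" by (simp add: V_def Fp open_param_image order_trans)
    moreover have "p \<in> V p" using p param_coord[OF \<open>c \<in> A\<close> p(1)] by (simp add: V_def Fp) (metis image_eqI mem_ball)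
    ultimately show ?thesis ..
  qed
  then obtain P where P: "finite P" "UNIV \<subseteq> (\<Union>p\<in>P. V p)"
    using compactE_image[OF compact_X, of UNIV V] by (metis UNIV_I UN_I subsetI)
  define K where "K = Max (insert 1 ((\<lambda>p. snd (snd (snd (F p)))) ` P))"
  define I where "I = (\<lambda>p. case F p of (c, y, R, K) \<Rightarrow> (c, y, R)) ` P"
  show ?thesis
  proof (rule that[of I K])
    show "finite I" using P by (simp add: I_def)
    fix i assume "i \<in> I"
    then obtain p where p: "p \<in> P" "i = (case F p of (c, y, R, K) \<Rightarrow> (c, y, R))" by (auto simp: I_def)
    have "snd (snd (snd (F p))) \<le> K" unfolding K_def using P p by (intro Max_ge) auto
    with p F[of p] show "case i of (c, y, R) \<Rightarrow> good K c y R" by (auto split: prod.splits intro: good_mono)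
  next
    fix q
    obtain p where p: "p \<in> P" "q \<in> V p" using P by auto
    obtain c y R k where Fp: "F p = (c, y, R, k)" by (metis prod.exhaust)
    have gd: "good k c y R" using F[of p] Fp by simp
    obtain z where z: "z \<in> ball y R" "q = param c z" using p Fp by (auto simp: V_def)
    have "z \<in> im c" using z gd by (force simp: good_def)
    then have "q \<in> dom c \<and> coord c q \<in> ball y R"
      using z gd coord_param[of c z] param_in[of c z] by (auto simp: good_def)
    moreover have "(c, y, R) \<in> I" using p Fp by (force simp: I_def)
    ultimately show "\<exists>(c, y, R)\<in>I. q \<in> dom c \<and> coord c q \<in> ball y R" by blast
  qed
qed

end


section \<open>The Riemannian volume measure\<close>

lemma sum_of_measures:
  fixes M :: "nat \<Rightarrow> 'a::topological_space measure"
  assumes "\<And>i. sets (M i) = sets borel"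
  obtains N where "sets N = sets borel" "\<And>S. S \<in> sets borel \<Longrightarrow> emeasure N S = (\<Sum>i<n. emeasure (M i) S)"
proof
  let ?N = "measure_of UNIV (sets borel) (\<lambda>S. \<Sum>i<n. emeasure (M i) S)"
  show sets: "sets ?N = sets borel" using sets.sigma_sets_eq[of borel] by simp
  fix S :: "'a set" assume S: "S \<in> sets borel"
  show "emeasure ?N S = (\<Sum>i<n. emeasure (M i) S)"
  proof (rule emeasure_measure_of)
    show "countably_additive (sets ?N) (\<lambda>S. \<Sum>i<n. emeasure (M i) S)"
      unfolding sets
    proof (rule countably_additiveI)
      fix B :: "nat \<Rightarrow> 'a set" assume B: "range B \<subseteq> sets borel" "disjoint_family B"
      have "(\<Sum>j. \<Sum>i<n. emeasure (M i) (B j)) = (\<Sum>i<n. \<Sum>j. emeasure (M i) (B j))"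
        by (intro suminf_sum summableI)
      also have "\<dots> = (\<Sum>i<n. emeasure (M i) (\<Union>j. B j))"
        using B assms by (intro sum.cong refl suminf_emeasure) auto
      finally show "(\<Sum>j. \<Sum>i<n. emeasure (M i) (B j)) = (\<Sum>i<n. emeasure (M i) (\<Union>j. B j))" .
    qed
  qed (use S sets in \<open>auto simp: positive_def\<close>)
qed

context closed_riemannian
begin

lemma in_param_image: "c \<in> A \<Longrightarrow> p \<in> dom c \<Longrightarrow> coord c p \<in> S \<Longrightarrow> p \<in> param c ` S"
  using param_coord[of c p] by (metis imageI)

definition density_in :: "('a, 'm) chart \<Rightarrow> real ^ 'm \<Rightarrow> real" where
  "density_in c z = sqrt (det (g c (param c z)))"

text \<open>Outside the image of the chart the value is constant, so that the map is Borel on the whole space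
  and measures can be pushed forward along it.\<close>

definition param_ext :: "('a, 'm) chart \<Rightarrow> real ^ 'm \<Rightarrow> 'a" where
  "param_ext c z = (if z \<in> im c then param c z else undefined)"

lemma continuous_density_in: "c \<in> A \<Longrightarrow> continuous_on (im c) (density_in c)"
  unfolding density_in_def by (intro continuous_intros continuous_on_det continuous_metric)

lemma density_in_pos: "c \<in> A \<Longrightarrow> z \<in> im c \<Longrightarrow> density_in c z > 0"
  unfolding density_in_def using pos_def_det_pos[OF pd[OF _ param_in]] by simp

lemma borel_im [measurable]: "c \<in> A \<Longrightarrow> im c \<in> sets borel"
  and borel_dom [measurable]: "c \<in> A \<Longrightarrow> dom c \<in> sets borel"
  using open_im open_dom by auto

lemma param_ext_measurable [measurable]: "c \<in> A \<Longrightarrow> param_ext c \<in> borel_measurable borel"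
  unfolding param_ext_def
  by (rule borel_measurable_continuous_on_if) (auto simp: continuous_param)

lemma density_in_measurable [measurable]:
  "c \<in> A \<Longrightarrow> (\<lambda>z. density_in c z * indicator (im c) z) \<in> borel_measurable borel"
  using borel_measurable_continuous_on_indicator[of "im c" "density_in c"]
  by (simp add: continuous_density_in mult.commute)

lemma coord_image_borel: "c \<in> A \<Longrightarrow> S \<in> sets borel \<Longrightarrow> S \<subseteq> dom c \<Longrightarrow> coord c ` S \<in> sets borel"
proof -
  assume c: "c \<in> A" and S: "S \<in> sets borel" "S \<subseteq> dom c"
  have "coord c ` S = param_ext c -` S \<inter> im c"
    using coord_image_eq[OF c S(2)] by (auto simp: param_ext_def)
  moreover have "param_ext c -` S \<in> sets borel"
    using measurable_sets[OF param_ext_measurable[OF c] S(1)] by simp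
  ultimately show ?thesis using c by auto
qed

lemma param_image_borel: "c \<in> A \<Longrightarrow> S \<in> sets borel \<Longrightarrow> S \<subseteq> im c \<Longrightarrow> param c ` S \<in> sets borel"
proof -
  assume c: "c \<in> A" and S: "S \<in> sets borel" "S \<subseteq> im c"
  define q where "q p = (if p \<in> dom c then coord c p else undefined)" for p
  have q: "q \<in> borel_measurable borel"
    unfolding q_def by (rule borel_measurable_continuous_on_if) (use c in \<open>auto simp: continuous_coord\<close>)
  have "param c ` S = {p \<in> dom c. coord c p \<in> S}"
    using S(2) c by (auto simp: coord_param param_in subset_iff) (metis param_coord imageI)
  also have "\<dots> = q -` S \<inter> dom c" by (auto simp: q_def)
  finally show ?thesis using measurable_sets[OF q S(1)] c by auto
qed

definition chart_measure :: "('a, 'm) chart \<Rightarrow> 'a measure" where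
  "chart_measure c =
    distr (density lborel (\<lambda>z. ennreal (density_in c z * indicator (im c) z))) borel (param_ext c)"

lemma sets_chart_measure [simp]: "sets (chart_measure c) = sets borel"
  by (simp add: chart_measure_def)

lemma measurable_chart_measure [simp]: "measurable (chart_measure c) M = measurable borel M"
  by (rule measurable_cong_sets) simp_all

lemma emeasure_chart_measure:
  assumes "c \<in> A" "S \<in> sets borel"
  shows "emeasure (chart_measure c) S =
    (\<integral>\<^sup>+ z. ennreal (density_in c z) * indicator (coord c ` (S \<inter> dom c)) z \<partial>lborel)"
proof -
  have pre: "param_ext c -` S \<in> sets borel"
    using measurable_sets[OF param_ext_measurable[OF assms(1)] assms(2)] by simp
  have "coord c ` (S \<inter> dom c) = param_ext c -` S \<inter> im c"
    using coord_image_eq[OF assms(1), of "S \<inter> dom c"] param_in[OF assms(1)] by (auto simp: param_ext_def)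
  then have ind: "ennreal (density_in c z) * indicator (coord c ` (S \<inter> dom c)) z =
      ennreal (density_in c z * indicator (im c) z) * indicator (param_ext c -` S) z" for z
    by (simp add: indicator_def)
  show ?thesis
    unfolding chart_measure_def ind using assms pre
    by (subst emeasure_distr, simp, simp, subst emeasure_density) auto
qed

lemma nn_integral_chart_measure:
  assumes "c \<in> A" and [measurable]: "h \<in> borel_measurable borel"
  shows "(\<integral>\<^sup>+ p. h p \<partial>chart_measure c) =
    (\<integral>\<^sup>+ z. h (param c z) * ennreal (density_in c z) * indicator (im c) z \<partial>lborel)"
proof -
  have "(\<integral>\<^sup>+ p. h p \<partial>chart_measure c) =
      (\<integral>\<^sup>+ z. ennreal (density_in c z * indicator (im c) z) * h (param_ext c z) \<partial>lborel)"
    unfolding chart_measure_def using assms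
    by (subst nn_integral_distr, simp, simp, subst nn_integral_density) simp_all
  also have "\<dots> = (\<integral>\<^sup>+ z. h (param c z) * ennreal (density_in c z) * indicator (im c) z \<partial>lborel)"
    by (intro nn_integral_cong) (auto simp: indicator_def param_ext_def mult.commute)
  finally show ?thesis .
qed

text \<open>By the change of variables formula and the transformation law of the metric, the measures of
  two charts agree on the overlap.\<close>

lemma chart_measure_agree:
  assumes c: "c \<in> A" and c': "c' \<in> A" and S: "S \<in> sets borel" "S \<subseteq> dom c \<inter> dom c'"
  shows "emeasure (chart_measure c) S = emeasure (chart_measure c') S"
proof -
  let ?U = "coord c ` S" and ?T = "coord c' \<circ> param c"
  have TU: "?T ` B = coord c' ` (param c ` B)" for B by (simp add: image_comp)
  have pU: "param c ` coord c ` S = S"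
  proof -
    have "param c (coord c p) = p" if "p \<in> S" for p by (rule param_coord[OF c]) (use that S in blast)
    then show ?thesis by (simp add: image_image)
  qed
  have U: "?U \<in> sets borel" by (rule coord_image_borel[OF c S(1)]) (use S in auto)
  have pz: "param c z \<in> S" "z \<in> im c" "param c z \<in> dom c" "param c z \<in> dom c'" if "z \<in> ?U" for z
  proof -
    show "param c z \<in> S" using that pU by blast
    then show "param c z \<in> dom c" "param c z \<in> dom c'" using S by blast+
    show "z \<in> im c" using that S by blast
  qed
  have cz: "coord c (param c z) = z" if "z \<in> ?U" for z by (rule coord_param[OF c pz(2)[OF that]])
  have T'z: "param c' (?T z) = param c z" if "z \<in> ?U" for z
    using param_coord[OF c' pz(4)[OF that]] by simp
  have J: "(?T has_derivative (*v) (jac c c' (param c z))) (at z)" if "z \<in> ?U" for z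
  proof -
    have "(?T has_derivative (*v) (jac c c' (param c z))) (at (coord c (param c z)))"
      by (rule transition_has_derivative[OF c c']) (rule pz(3)[OF that], rule pz(4)[OF that])
    then show ?thesis unfolding cz[OF that] .
  qed
  have inj: "inj_on ?T ?U"
  proof (rule inj_onI)
    fix z w assume zw: "z \<in> ?U" "w \<in> ?U" and eq: "?T z = ?T w"
    have "param c z = param c w" by (rule T'z[OF zw(1), unfolded eq T'z[OF zw(2)], symmetric])
    then have "coord c (param c z) = coord c (param c w)" by (rule arg_cong)
    then show "z = w" unfolding cz[OF zw(1)] cz[OF zw(2)] .
  qed
  have dz: "density_in c z = \<bar>det (jac c c' (param c z))\<bar> * density_in c' (?T z)" if "z \<in> ?U" for z
  proof -
    have "sqrt (det (g c (param c z))) = \<bar>det (jac c c' (param c z))\<bar> * sqrt (det (g c' (param c z)))"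
      by (rule det_metric_law(1)[OF c c']) (rule pz(3)[OF that], rule pz(4)[OF that])
    then show ?thesis unfolding density_in_def T'z[OF that] .
  qed
  have contJ: "continuous_on ?U (\<lambda>z. \<bar>det (matrix ((*v) (jac c c' (param c z))))\<bar>)"
  proof -
    have "continuous_on ?U (density_in c)"
      by (rule continuous_on_subset[OF continuous_density_in[OF c]]) (use pz in blast)
    moreover have "continuous_on ?U (\<lambda>z. density_in c' (?T z))"
    proof (rule continuous_on_compose2[OF continuous_density_in[OF c']])
      show "continuous_on ?U ?T"
        by (intro continuous_at_imp_continuous_on ballI) (rule has_derivative_continuous[OF J])
      show "?T ` ?U \<subseteq> im c'" unfolding TU pU using S by auto
    qed
    moreover have d'0: "density_in c' (?T z) > 0" if "z \<in> ?U" for z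
      by (rule density_in_pos[OF c']) (use pz(4)[OF that] in simp)
    ultimately have "continuous_on ?U (\<lambda>z. density_in c z / density_in c' (?T z))"
      by (intro continuous_on_divide) (auto simp: less_le)
    moreover have "\<bar>det (matrix ((*v) (jac c c' (param c z))))\<bar> = density_in c z / density_in c' (?T z)" if "z \<in> ?U" for z
      using dz[OF that] d'0[OF that] by (simp add: field_simps)
    ultimately show ?thesis by (simp cong: continuous_on_cong)
  qed
  have "emeasure (chart_measure c') S = (\<integral>\<^sup>+ y. ennreal (density_in c' y * indicator (im c') y) * indicator (?T ` ?U) y \<partial>lborel)"
    unfolding emeasure_chart_measure[OF c' S(1)] TU pU
    by (intro nn_integral_cong) (use S in \<open>auto simp: indicator_def Int_absorb2\<close>)
  also have "\<dots> = (\<integral>\<^sup>+ z. ennreal (density_in c' (?T z) * indicator (im c') (?T z)) *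
      ennreal \<bar>det (matrix ((*v) (jac c c' (param c z))))\<bar> * indicator ?U z \<partial>lborel)"
  proof (rule nn_integral_image[OF U _ J inj])
    fix B assume "B \<in> sets borel" "B \<subseteq> ?U"
    then show "?T ` B \<in> sets borel"
      unfolding TU using pU pz(2) S by (intro coord_image_borel[OF c'] param_image_borel[OF c]) (blast+)
  next
    show "(\<lambda>z. indicator ?U z * \<bar>det (matrix ((*v) (jac c c' (param c z))))\<bar>) \<in> borel_measurable borel"
      using borel_measurable_continuous_on_indicator[OF U contJ] by simp
    show "(\<lambda>y. ennreal (density_in c' y * indicator (im c') y)) \<in> borel_measurable borel"
      using density_in_measurable[OF c'] by simp
  qed
  also have "\<dots> = (\<integral>\<^sup>+ z. ennreal (density_in c z) * indicator (coord c ` (S \<inter> dom c)) z \<partial>lborel)"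
  proof (rule nn_integral_cong)
    fix z
    have "S \<inter> dom c = S" using S by auto
    moreover have "?T z \<in> im c'" "density_in c' (?T z) > 0" if "z \<in> ?U"
      using pz(4)[OF that] density_in_pos[OF c', of "?T z"] by simp_all
    ultimately show "ennreal (density_in c' (?T z) * indicator (im c') (?T z)) *
        ennreal \<bar>det (matrix ((*v) (jac c c' (param c z))))\<bar> * indicator ?U z =
        ennreal (density_in c z) * indicator (coord c ` (S \<inter> dom c)) z"
      using dz[of z] by (auto simp: indicator_def ennreal_mult'[symmetric] mult.commute)
  qed
  finally show ?thesis by (simp add: emeasure_chart_measure[OF c S(1)])
qed

abbreviation vol :: "'a measure" where "vol \<equiv> riem_volume A g"

lemma finite_chart_cover: "\<exists>C :: nat \<Rightarrow> ('a, 'm) chart. \<exists>n. (\<forall>i<n. C i \<in> A) \<and> (\<Union>i<n. dom (C i)) = UNIV"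
proof -
  obtain F where F: "finite F" "F \<subseteq> A" "UNIV \<subseteq> (\<Union>c\<in>F. dom c)"
    using compactE_image[OF compact_X, of A dom] open_dom ex_chart by (metis UN_I subsetI)
  then obtain C and n :: nat where "F = C ` {i. i < n}" using finite_imp_nat_seg_image_inj_on by metis
  with F show ?thesis by (intro exI[of _ C] exI[of _ n]) auto
qed

text \<open>The definite description in the definition of the volume is meaningful. The manifold is cut into
  finitely many disjoint Borel pieces, each inside one chart. The sum of the chart measures on the
  pieces has the required values by \<open>chart_measure_agree\<close>, and the pieces determine the measure.\<close>

lemma riem_volume: "sets vol = sets borel"
  "c \<in> A \<Longrightarrow> S \<in> sets borel \<Longrightarrow> S \<subseteq> dom c \<Longrightarrow> emeasure vol S = emeasure (chart_measure c) S"
proof -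
  let ?P = "\<lambda>M. sets M = sets borel \<and> (\<forall>c\<in>A. \<forall>S\<in>sets borel. S \<subseteq> dom c \<longrightarrow>
      emeasure M S = (\<integral>\<^sup>+ x\<in>coord c ` S. ennreal (sqrt (det (g c (param c x)))) \<partial>lborel))"
  have P: "?P M \<longleftrightarrow> sets M = sets borel \<and> (\<forall>c\<in>A. \<forall>S\<in>sets borel. S \<subseteq> dom c \<longrightarrow> emeasure M S = emeasure (chart_measure c) S)" for M
    by (intro conj_cong ball_cong imp_cong refl)
       (auto simp: emeasure_chart_measure density_in_def Int_absorb2)
  obtain C and n :: nat where C: "\<And>i. i < n \<Longrightarrow> C i \<in> A" and cov: "(\<Union>i<n. dom (C i)) = UNIV"
    using finite_chart_cover by blast
  \<comment> \<open>First-come-first-served cells of the finite chart cover.\<close>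
  define D where "D i = dom (C i) - (\<Union>j<i. dom (C j))" for i
  have D: "D i \<in> sets borel" if "i < n" for i
    unfolding D_def using that C by (intro sets.Diff sets.finite_UN) auto
  have dis: "disjoint_family_on (\<lambda>i. S \<inter> D i) {..<n}" for S :: "'a set"
    unfolding disjoint_family_on_def D_def by (auto simp: neq_iff)
  have un: "S = (\<Union>i<n. S \<inter> D i)" for S
  proof -
    have "\<exists>i<n. p \<in> D i" for p
    proof -
      obtain k where k: "k < n" "p \<in> dom (C k)" using cov by blast
      obtain i where i: "p \<in> dom (C i)" "\<And>j. j < i \<Longrightarrow> p \<notin> dom (C j)"
        using exists_least_iff[of "\<lambda>i. p \<in> dom (C i)"] k(2) by blast
      have "i \<le> k" using i(2) k(2) not_le by blast
      moreover have "p \<in> D i" unfolding D_def using i by blast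
      ultimately show ?thesis using k(1) by (meson le_less_trans)
    qed
    then show ?thesis by auto
  qed
  have split: "emeasure M S = (\<Sum>i<n. emeasure M (S \<inter> D i))" if "sets M = sets borel" "S \<in> sets borel" for M S
    by (subst un[of S], subst sum_emeasure[symmetric]) (use that D dis in auto)
  obtain N where N: "sets N = sets borel"
    "\<And>S. S \<in> sets borel \<Longrightarrow> emeasure N S = (\<Sum>i<n. emeasure (density (chart_measure (C i)) (indicator (D i))) S)"
    using sum_of_measures[of "\<lambda>i. density (chart_measure (C i)) (indicator (D i))" n] by auto
  have "?P N"
    unfolding P
  proof (intro conjI ballI impI)
    fix c S assume c: "c \<in> A" and S: "S \<in> sets borel" "S \<subseteq> dom c"
    have "emeasure N S = (\<Sum>i<n. emeasure (density (chart_measure (C i)) (indicator (D i))) S)" by (rule N(2)[OF S(1)])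
    also have "\<dots> = (\<Sum>i<n. emeasure (chart_measure c) (S \<inter> D i))"
    proof (rule sum.cong[OF refl])
      fix i assume "i \<in> {..<n}"
      then have i: "i < n" by simp
      have "emeasure (density (chart_measure (C i)) (indicator (D i))) S
          = (\<integral>\<^sup>+ x. indicator (D i) x * indicator S x \<partial>chart_measure (C i))"
        using D[OF i] S by (intro emeasure_density) auto
      also have "\<dots> = (\<integral>\<^sup>+ x. indicator (S \<inter> D i) x \<partial>chart_measure (C i))"
        by (intro nn_integral_cong) (auto simp: indicator_def)
      also have "\<dots> = emeasure (chart_measure (C i)) (S \<inter> D i)" using D[OF i] S by auto
      also have "\<dots> = emeasure (chart_measure c) (S \<inter> D i)"
        by (rule chart_measure_agree) (use D[OF i] S C[OF i] c in \<open>auto simp: D_def\<close>)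
      finally show "emeasure (density (chart_measure (C i)) (indicator (D i))) S = emeasure (chart_measure c) (S \<inter> D i)" .
    qed
    also have "\<dots> = emeasure (chart_measure c) S" using split[of "chart_measure c" S] S by simp
    finally show "emeasure N S = emeasure (chart_measure c) S" .
  qed (rule N)
  moreover have "M = N" if M: "?P M" for M
  proof (rule measure_eqI)
    show "sets M = sets N" using M N by simp
    fix S assume "S \<in> sets M"
    then have S: "S \<in> sets borel" using M by simp
    have "emeasure M S = (\<Sum>i<n. emeasure M (S \<inter> D i))" using split M S by blast
    also have "\<dots> = (\<Sum>i<n. emeasure N (S \<inter> D i))"
    proof (rule sum.cong[OF refl])
      fix i assume "i \<in> {..<n}"
      then have i: "i < n" by simp
      have "S \<inter> D i \<in> sets borel" "S \<inter> D i \<subseteq> dom (C i)" using S D[OF i] by (auto simp: D_def)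
      then show "emeasure M (S \<inter> D i) = emeasure N (S \<inter> D i)"
        using M \<open>?P N\<close> C[OF i] unfolding P by metis
    qed
    also have "\<dots> = emeasure N S" using split N S by simp
    finally show "emeasure M S = emeasure N S" .
  qed
  ultimately have "?P (THE M. ?P M)" by (rule theI)
  then have V: "?P vol" unfolding riem_volume_def .
  show "sets vol = sets borel" using V by simp
  show "emeasure vol S = emeasure (chart_measure c) S" if "c \<in> A" "S \<in> sets borel" "S \<subseteq> dom c"
    using V that unfolding P by blast
qed

lemma space_vol [simp]: "space vol = UNIV" 
  using sets_eq_imp_space_eq[OF riem_volume(1)] by simp
lemma sets_vol [measurable_cong, simp]: "sets vol = sets borel" by (rule riem_volume)
lemma measurable_vol [simp]: "measurable vol M = measurable borel M"
  by (rule measurable_cong_sets) simp_all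

lemma nn_integral_vol_chart:
  assumes c: "c \<in> A" and [measurable]: "h \<in> borel_measurable borel" and S: "S \<in> sets borel" "S \<subseteq> im c"
  shows "(\<integral>\<^sup>+ p. h p * indicator (param c ` S) p \<partial>vol) =
    (\<integral>\<^sup>+ z. h (param c z) * ennreal (density_in c z) * indicator S z \<partial>lborel)"
proof -
  have pS [measurable]: "param c ` S \<in> sets borel" by (rule param_image_borel[OF c S])
  have sub: "param c ` S \<subseteq> dom c" using S param_in[OF c] by blast
  have [measurable]: "dom c \<in> sets borel" using c by auto
  have eq: "density vol (indicator (param c ` S)) = density (chart_measure c) (indicator (param c ` S))"
  proof (rule measure_eqI)
    fix B assume "B \<in> sets (density vol (indicator (param c ` S)))"
    then have B: "B \<in> sets borel" by simp
    have *: "emeasure (density M (indicator (param c ` S))) B = emeasure M (param c ` S \<inter> B)" if M: "sets M = sets borel" for M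
    proof -
      have "emeasure (density M (indicator (param c ` S))) B = (\<integral>\<^sup>+ x. indicator (param c ` S) x * indicator B x \<partial>M)"
        using B M pS by (intro emeasure_density) (auto cong: measurable_cong_sets)
      also have "\<dots> = (\<integral>\<^sup>+ x. indicator (param c ` S \<inter> B) x \<partial>M)"
        by (intro nn_integral_cong) (auto simp: indicator_def)
      also have "\<dots> = emeasure M (param c ` S \<inter> B)" using M B pS by (intro nn_integral_indicator) auto
      finally show ?thesis .
    qed
    show "emeasure (density vol (indicator (param c ` S))) B = emeasure (density (chart_measure c) (indicator (param c ` S))) B"
      using sub B pS by (subst (1 2) *) (auto intro!: riem_volume(2)[OF c])
  qed simp
  have "(\<integral>\<^sup>+ p. h p * indicator (param c ` S) p \<partial>vol) = (\<integral>\<^sup>+ p. h p \<partial>density vol (indicator (param c ` S)))"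
    by (subst nn_integral_density) (auto simp: mult.commute)
  also have "\<dots> = (\<integral>\<^sup>+ p. indicator (param c ` S) p * h p \<partial>chart_measure c)"
    unfolding eq by (subst nn_integral_density) auto
  also have "\<dots> = (\<integral>\<^sup>+ z. indicator (param c ` S) (param c z) * h (param c z) * ennreal (density_in c z) * indicator (im c) z \<partial>lborel)"
    by (rule nn_integral_chart_measure[OF c, where h = "\<lambda>p. indicator (param c ` S) p * h p"]) measurable
  also have "\<dots> = (\<integral>\<^sup>+ z. h (param c z) * ennreal (density_in c z) * indicator S z \<partial>lborel)"
  proof (intro nn_integral_cong)
    fix z
    have "param c z \<in> param c ` S \<longleftrightarrow> z \<in> S" if z: "z \<in> im c"
    proof
      assume "param c z \<in> param c ` S"
      then obtain w where w: "w \<in> S" "param c z = param c w" by blast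
      have cz: "coord c (param c z) = z" by (rule coord_param[OF c z])
      have cw: "coord c (param c w) = w" by (rule coord_param[OF c]) (use w S in blast)
      have "z = w" using cz cw unfolding w(2) by (rule trans[OF sym])
      then show "z \<in> S" using w(1) by blast
    qed (rule imageI)
    then show "indicator (param c ` S) (param c z) * h (param c z) * ennreal (density_in c z) * indicator (im c) z
        = h (param c z) * ennreal (density_in c z) * indicator S z"
      using S by (auto simp: indicator_def)
  qed
  finally show ?thesis .
qed

text \<open>The density of the volume lies between \<open>1 / K\<close> and \<open>K\<close> on a good ball.\<close>

lemma good_integral_le:
  assumes gd: "good K c y R" and [measurable]: "h \<in> borel_measurable borel"
    and S: "S \<in> sets borel" "S \<subseteq> cball y (3 * R)"
  shows "(\<integral>\<^sup>+ p. h p * indicator (param c ` S) p \<partial>vol) \<le> ennreal K * (\<integral>\<^sup>+ z. h (param c z) * indicator S z \<partial>lborel)"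
    and "(\<integral>\<^sup>+ z. h (param c z) * indicator S z \<partial>lborel) \<le> ennreal K * (\<integral>\<^sup>+ p. h p * indicator (param c ` S) p \<partial>vol)"
proof -
  have c: "c \<in> A" and K: "K \<ge> 1" and sub: "S \<subseteq> im c" using gd S by (auto simp: good_def)
  have b: "density_in c z \<le> K" "1 \<le> K * density_in c z" if "z \<in> S" for z
    using gd that S K by (auto simp: good_def density_in_def field_simps)
  have m: "(\<lambda>z. h (param c z) * indicator S z) \<in> borel_measurable borel"
  proof -
    have "(\<lambda>z. h (param c z) * indicator S z) = (\<lambda>z. h (param_ext c z) * indicator S z)"
      using sub by (auto simp: fun_eq_iff param_ext_def indicator_def)
    then show ?thesis using c S by simp
  qed
  note eq = nn_integral_vol_chart[OF c assms(2) S(1) sub]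
  show "(\<integral>\<^sup>+ p. h p * indicator (param c ` S) p \<partial>vol) \<le> ennreal K * (\<integral>\<^sup>+ z. h (param c z) * indicator S z \<partial>lborel)"
    unfolding eq
  proof (subst nn_integral_cmult[symmetric])
    show "(\<integral>\<^sup>+ z. h (param c z) * ennreal (density_in c z) * indicator S z \<partial>lborel) \<le>
        (\<integral>\<^sup>+ z. ennreal K * (h (param c z) * indicator S z) \<partial>lborel)"
    proof (rule nn_integral_mono)
      fix z
      show "h (param c z) * ennreal (density_in c z) * indicator S z \<le> ennreal K * (h (param c z) * indicator S z)"
      proof (cases "z \<in> S")
        case True
        have "h (param c z) * ennreal (density_in c z) \<le> h (param c z) * ennreal K"
          using b(1)[OF True] by (intro mult_left_mono ennreal_leI) auto
        then show ?thesis using True by (simp add: mult.commute)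
      qed simp
    qed
  qed (use m in simp)
  have m2: "(\<lambda>z. h (param c z) * ennreal (density_in c z) * indicator S z) \<in> borel_measurable borel"
  proof -
    have "(\<lambda>z. h (param c z) * ennreal (density_in c z) * indicator S z) =
        (\<lambda>z. (h (param c z) * indicator S z) * ennreal (density_in c z * indicator (im c) z))"
      using sub by (auto simp: fun_eq_iff indicator_def)
    then show ?thesis using m density_in_measurable[OF c] by simp
  qed
  show "(\<integral>\<^sup>+ z. h (param c z) * indicator S z \<partial>lborel) \<le> ennreal K * (\<integral>\<^sup>+ p. h p * indicator (param c ` S) p \<partial>vol)"
    unfolding eq
  proof (subst nn_integral_cmult[symmetric], use m2 in simp, rule nn_integral_mono)
    fix z
    show "h (param c z) * indicator S z \<le> ennreal K * (h (param c z) * ennreal (density_in c z) * indicator S z)"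
    proof (cases "z \<in> S")
      case True
      have "h (param c z) * 1 \<le> h (param c z) * ennreal (K * density_in c z)"
        using b(2)[OF True] by (intro mult_left_mono) auto
      then show ?thesis using True K b(2)[OF True]
        by (simp add: ennreal_mult'' ennreal_mult' mult_ac)
    qed simp
  qed
qed

lemma finite_measure_vol: "finite_measure vol"
proof
  obtain I K where I: "finite I" "\<And>i. i \<in> I \<Longrightarrow> (case i of (c, y, R) \<Rightarrow> good K c y R)"
    "\<And>p. \<exists>(c, y, R)\<in>I. p \<in> dom c \<and> coord c p \<in> ball y R" using good_cover by blast
  define B where "B = (\<lambda>(c :: ('a, 'm) chart, y :: real ^ 'm, R). param c ` ball y R)"
  have fin: "B i \<in> sets vol \<and> emeasure vol (B i) < \<infinity>" if i: "i \<in> I" for i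
  proof -
    obtain c y R where i': "i = (c, y, R)" by (metis prod.exhaust)
    have gd: "good K c y R" using I(2)[OF i] i' by simp
    then have sub: "ball y R \<subseteq> cball y (3 * R)" and c: "c \<in> A" by (auto simp: good_def)
    then have bor: "B i \<in> sets borel" using gd unfolding B_def i' by (auto simp: good_def intro!: param_image_borel)
    have "emeasure vol (B i) = (\<integral>\<^sup>+ p. 1 * indicator (param c ` ball y R) p \<partial>vol)"
      using bor by (simp add: B_def i')
    also have "\<dots> \<le> ennreal K * (\<integral>\<^sup>+ z. 1 * indicator (ball y R) z \<partial>lborel)"
      by (rule good_integral_le(1)[OF gd]) (use sub in auto)
    also have "\<dots> < \<infinity>" using emeasure_lborel_ball_finite[of y R] by (simp add: ennreal_mult_less_top)
    finally show ?thesis using bor by simp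
  qed
  have un: "UNIV = (\<Union>i\<in>I. B i)"
  proof -
    have "p \<in> (\<Union>i\<in>I. B i)" for p
    proof -
      obtain c y R where i: "(c, y, R) \<in> I" "p \<in> dom c" "coord c p \<in> ball y R" using I(3)[of p] by blast
      then have "c \<in> A" using I(2)[of "(c, y, R)"] by (auto simp: good_def)
      then have "p \<in> B (c, y, R)" unfolding B_def prod.case by (rule in_param_image) (use i in blast)+
      then show ?thesis using i by blast
    qed
    then show ?thesis by auto
  qed
  have "B ` I \<subseteq> sets vol" using fin by blast
  then have "emeasure vol (space vol) \<le> (\<Sum>i\<in>I. emeasure vol (B i))"
    using emeasure_subadditive_finite[OF I(1), of B vol] by (simp add: un[symmetric])
  also have "\<dots> < \<infinity>" using fin by (simp add: I(1))
  finally show "emeasure vol (space vol) \<noteq> \<infinity>" by simp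
qed

end


section \<open>Smooth functions and their gradients\<close>

text \<open>The Cauchy--Schwarz inequality of a nonnegative quadratic form, in terms of its values along a line:
  this covers the dual metric at a point and the \<open>H\<^sup>1\<close> inner product alike.\<close>

lemma quadratic_nonneg_imp_discriminant:
  fixes a b c :: real
  assumes q: "\<And>t. 0 \<le> a + 2 * t * b + t\<^sup>2 * c" and c: "0 \<le> c"
  shows "b\<^sup>2 \<le> a * c"
proof (cases "c = 0")
  case True
  have "b = 0"
  proof (rule ccontr)
    assume "b \<noteq> 0"
    have "0 \<le> a + 2 * (- (a + 1) / (2 * b)) * b" using q[of "- (a + 1) / (2 * b)"] True by simp
    also have "\<dots> = -1" using \<open>b \<noteq> 0\<close> by (simp add: field_simps)
    finally show False by simp
  qed
  then show ?thesis using True by simp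
next
  case False
  with c have "c > 0" by simp
  have "0 \<le> a + 2 * (- b / c) * b + (- b / c)\<^sup>2 * c" by (rule q)
  also have "\<dots> = a - b\<^sup>2 / c" using \<open>c > 0\<close> by (simp add: field_simps power2_eq_square)
  finally show ?thesis using \<open>c > 0\<close> by (simp add: field_simps)
qed

lemma sqrt_form_triangle:
  fixes a b c :: real
  assumes q: "\<And>t. 0 \<le> a + 2 * t * b + t\<^sup>2 * c" and c: "0 \<le> c"
  shows "sqrt (a + 2 * b + c) \<le> sqrt a + sqrt c"
proof -
  have a: "0 \<le> a" using q[of 0] by simp
  have "b \<le> sqrt (a * c)"
    using quadratic_nonneg_imp_discriminant[OF assms] by (rule real_le_rsqrt)
  then have "a + 2 * b + c \<le> (sqrt a + sqrt c)\<^sup>2"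
    using a c by (simp add: power2_sum real_sqrt_mult)
  then show ?thesis by (rule real_le_lsqrt[rotated]) (simp add: a c)
qed

lemma pos_def_form_nonneg: "pos_def G \<Longrightarrow> 0 \<le> v \<bullet> (G *v v)"
  by (cases "v = 0") (auto simp: pos_def_def less_imp_le)

lemma pos_def_triangle:
  fixes G :: "real ^ 'n::finite ^ 'n"
  assumes G: "pos_def G"
  shows "sqrt ((v + w) \<bullet> (G *v (v + w))) \<le> sqrt (v \<bullet> (G *v v)) + sqrt (w \<bullet> (G *v w))"
proof -
  have *: "(v + t *\<^sub>R w) \<bullet> (G *v (v + t *\<^sub>R w)) = v \<bullet> (G *v v) + 2 * t * (v \<bullet> (G *v w)) + t\<^sup>2 * (w \<bullet> (G *v w))" for t
    using pos_def_sym[OF G, of w v]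
    by (simp add: matrix_vector_right_distrib matrix_vector_mult_scaleR inner_add_left inner_add_right algebra_simps power2_eq_square)
  have "0 \<le> v \<bullet> (G *v v) + 2 * t * (v \<bullet> (G *v w)) + t\<^sup>2 * (w \<bullet> (G *v w))" for t
    unfolding *[symmetric] by (rule pos_def_form_nonneg[OF G])
  from sqrt_form_triangle[OF this pos_def_form_nonneg[OF G]]
  show ?thesis using *[of 1] by simp
qed

lemma continuous_on_matrix_inv_form:
  fixes F :: "'a::topological_space \<Rightarrow> real ^ 'n::finite ^ 'n"
  assumes "continuous_on S F" "continuous_on S h" "continuous_on S k" "\<And>x. x \<in> S \<Longrightarrow> pos_def (F x)"
  shows "continuous_on S (\<lambda>x. h x \<bullet> (matrix_inv (F x) *v k x))"
proof -
  have d0: "det (F x) \<noteq> 0" if "x \<in> S" for x using pos_def_det_neq_0 assms(4)[OF that] by blast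
  have "matrix_inv (F x) *v k x = (\<chi> l. det (\<chi> i j. if j = l then k x $ i else F x $ i $ j) / det (F x))" if "x \<in> S" for x
    using cramer[OF d0[OF that], of "matrix_inv (F x) *v k x" "k x"] pos_def_inv_vec(1)[OF assms(4)[OF that]] by simp
  moreover have "continuous_on S (\<lambda>x. h x \<bullet> (\<chi> l. det (\<chi> i j. if j = l then k x $ i else F x $ i $ j) / det (F x)))"
  proof (intro continuous_on_inner assms(2) continuous_on_vec_lambda continuous_on_divide continuous_on_det assms(1) ballI d0)
    fix l i j
    show "continuous_on S (\<lambda>x. if j = l then k x $ i else F x $ i $ j)"
      by (cases "j = l") (auto intro!: continuous_on_component assms)
  qed
  ultimately show ?thesis by (simp cong: continuous_on_cong)
qed

context closed_riemannian
begin

lemma smooth_funD: "smooth_fun A f \<Longrightarrow> c \<in> A \<Longrightarrow> smooth_on (im c) (f \<circ> param c)"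
  by (simp add: smooth_fun_def)

lemma smooth_fun_const: "smooth_fun A (\<lambda>p. k)"
  unfolding smooth_fun_def comp_def by (intro ballI smooth_on_const open_im)

lemma smooth_fun_add: "smooth_fun A f \<Longrightarrow> smooth_fun A h \<Longrightarrow> smooth_fun A (\<lambda>p. f p + h p)"
  unfolding smooth_fun_def comp_def by (intro ballI smooth_on_add open_im) blast+

lemma smooth_fun_mult: "smooth_fun A f \<Longrightarrow> smooth_fun A h \<Longrightarrow> smooth_fun A (\<lambda>p. f p * h p)"
  unfolding smooth_fun_def comp_def by (intro ballI smooth_on_mult open_im) blast+

lemma smooth_fun_cmult: "smooth_fun A f \<Longrightarrow> smooth_fun A (\<lambda>p. k * f p)"
  by (rule smooth_fun_mult[OF smooth_fun_const])

lemma smooth_fun_diff: "smooth_fun A f \<Longrightarrow> smooth_fun A h \<Longrightarrow> smooth_fun A (\<lambda>p. f p - h p)"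
  using smooth_fun_add[OF _ smooth_fun_cmult[of h "-1"], of f] by simp

lemma smooth_fun_compose: "smooth_on UNIV \<Phi> \<Longrightarrow> smooth_fun A f \<Longrightarrow> smooth_fun A (\<lambda>p. \<Phi> (f p))"
  for \<Phi> :: "real \<Rightarrow> real"
  unfolding smooth_fun_def comp_def by (intro ballI, rule smooth_on_compose[of _ UNIV _ \<Phi>]) (simp_all add: open_im)

lemma continuous_smooth_fun: "smooth_fun A f \<Longrightarrow> continuous_on UNIV f"
proof -
  assume f: "smooth_fun A f"
  have "continuous_on (dom c) f" if c: "c \<in> A" for c
  proof -
    have "continuous_on (dom c) (\<lambda>p. (f \<circ> param c) (coord c p))"
      by (rule continuous_on_compose2[OF smooth_on_continuous[OF smooth_funD[OF f c]] continuous_coord[OF c]]) simp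
    then show ?thesis by (rule continuous_on_cong[THEN iffD1, rotated 2]) (simp_all add: param_coord[OF c])
  qed
  then have "continuous_on (\<Union>c\<in>A. dom c) f" using open_dom by (intro continuous_on_open_UN) auto
  moreover have "(\<Union>c\<in>A. dom c) = UNIV" using ex_chart by blast
  ultimately show ?thesis by simp
qed

text \<open>Transplants a function of the coordinates to the manifold by zero extension.\<close>

definition in_chart :: "('a, 'm) chart \<Rightarrow> (real ^ 'm \<Rightarrow> real) \<Rightarrow> 'a \<Rightarrow> real" where
  "in_chart c \<phi> p = (if p \<in> dom c then \<phi> (coord c p) else 0)"

text \<open>Smoothness is local: a point either lies in the chart, where the function is a composition with a
  coordinate change, or outside a compact set beyond which the function vanishes.\<close>

lemma smooth_fun_in_chart:
  assumes c: "c \<in> A" and \<phi>: "smooth_on UNIV \<phi>" and Z: "compact Z" "Z \<subseteq> im c" "\<And>z. z \<notin> Z \<Longrightarrow> \<phi> z = 0"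
  shows "smooth_fun A (in_chart c \<phi>)"
  unfolding smooth_fun_def
proof (intro ballI smooth_on_local)
  fix c' z assume c': "c' \<in> A" and z: "z \<in> im c'"
  let ?p = "param c' z"
  have zp: "coord c' ?p = z" by (rule coord_param[OF c' z])
  have pd': "?p \<in> dom c'" by (rule param_in[OF c' z])
  show "\<exists>U. open U \<and> z \<in> U \<and> smooth_on U (in_chart c \<phi> \<circ> param c')"
  proof (cases "?p \<in> dom c")
    case True
    let ?U = "coord c' ` (dom c' \<inter> dom c)"
    have U: "open ?U" by (rule open_coord_image[OF c']) (intro open_Int open_dom c c' Int_lower1)+
    moreover have "z \<in> ?U" by (rule image_eqI[where x = ?p], rule zp[symmetric]) (use True pd' in blast)
    moreover have "smooth_on ?U (in_chart c \<phi> \<circ> param c')"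
    proof (rule smooth_on_cong[OF U])
      show "smooth_on ?U (\<lambda>z. \<phi> ((coord c \<circ> param c') z))"
        by (rule smooth_on_compose[OF U open_UNIV _ \<phi> transition_smooth[OF c' c]]) simp
      fix w assume "w \<in> ?U"
      then obtain q where q: "q \<in> dom c'" "q \<in> dom c" "w = coord c' q" by blast
      have "param c' w = q" unfolding q(3) by (rule param_coord[OF c' q(1)])
      then show "\<phi> ((coord c \<circ> param c') w) = (in_chart c \<phi> \<circ> param c') w"
        using q(2) by (simp add: in_chart_def)
    qed
    ultimately show ?thesis by blast
  next
    case False
    let ?U = "coord c' ` (dom c' - param c ` Z)"
    have "closed (param c ` Z)" by (intro compact_imp_closed compact_param_image c Z)
    then have U: "open ?U" by (intro open_coord_image[OF c']) (use open_dom[OF c'] in auto)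
    moreover have "param c ` Z \<subseteq> dom c" using param_in[OF c] Z(2) by blast
    then have "?p \<in> dom c' - param c ` Z" using False pd' by blast
    then have "z \<in> ?U" by (rule image_eqI[where x = ?p, rotated]) (rule zp[symmetric])
    moreover have "smooth_on ?U (in_chart c \<phi> \<circ> param c')"
    proof (rule smooth_on_cong[OF U])
      show "smooth_on ?U (\<lambda>z. 0 :: real)" by (rule smooth_on_const[OF U])
      fix w assume "w \<in> ?U"
      then obtain q where q: "q \<in> dom c'" "q \<notin> param c ` Z" "w = coord c' q" by blast
      have "param c' w = q" unfolding q(3) by (rule param_coord[OF c' q(1)])
      moreover have "in_chart c \<phi> q = 0"
        using q(2) in_param_image[OF c, of q Z] Z(3) by (auto simp: in_chart_def)
      ultimately show "0 = (in_chart c \<phi> \<circ> param c') w" by simp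
    qed
    ultimately show ?thesis by blast
  qed
qed

definition differential :: "('a, 'm) chart \<Rightarrow> ('a \<Rightarrow> real) \<Rightarrow> 'a \<Rightarrow> real ^ 'm" where
  "differential c f p = (\<chi> i. frechet_derivative (f \<circ> param c) (at (coord c p)) (axis i 1))"

lemma differential_has_derivative:
  assumes c: "c \<in> A" and f: "smooth_fun A f" and p: "p \<in> dom c"
  shows "((f \<circ> param c) has_derivative (\<lambda>v. differential c f p \<bullet> v)) (at (coord c p))"
proof -
  let ?D = "frechet_derivative (f \<circ> param c) (at (coord c p))"
  have D: "((f \<circ> param c) has_derivative ?D) (at (coord c p))"
    by (rule smooth_onD[OF smooth_funD[OF f c]]) (use p in blast)
  have "?D v = differential c f p \<bullet> v" for v
  proof -
    have "?D v = ?D (\<Sum>i\<in>UNIV. (v $ i) *\<^sub>R axis i 1)"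
      using basis_expansion[of v] by (simp add: scalar_mult_eq_scaleR)
    also have "\<dots> = (\<Sum>i\<in>UNIV. (v $ i) *\<^sub>R ?D (axis i 1))"
      using has_derivative_linear[OF D] by (simp add: linear_sum linear_cmul)
    finally show ?thesis by (simp add: differential_def inner_vec_def mult.commute)
  qed
  then have "?D = (\<lambda>v. differential c f p \<bullet> v)" by auto
  with D show ?thesis by metis
qed

lemma differentialI:
  assumes "((f \<circ> param c) has_derivative (\<lambda>v. w \<bullet> v)) (at (coord c p))"
  shows "differential c f p = w"
  unfolding differential_def frechet_derivative_at[OF assms, symmetric]
  by (simp add: vec_eq_iff inner_axis)

lemma differential_const: "differential c (\<lambda>p. k) p = 0"
  by (rule differentialI) (simp add: comp_def)

lemma differential_add:
  assumes "c \<in> A" "p \<in> dom c" "smooth_fun A f" "smooth_fun A h"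
  shows "differential c (\<lambda>p. f p + h p) p = differential c f p + differential c h p"
proof (rule differentialI)
  show "((\<lambda>p. f p + h p) \<circ> param c has_derivative (\<bullet>) (differential c f p + differential c h p)) (at (coord c p))"
    using has_derivative_add[OF differential_has_derivative[OF assms(1,3,2)] differential_has_derivative[OF assms(1,4,2)]]
    by (simp add: comp_def inner_add_left[abs_def])
qed

lemma differential_mult:
  assumes "c \<in> A" "p \<in> dom c" "smooth_fun A f" "smooth_fun A h"
  shows "differential c (\<lambda>p. f p * h p) p = f p *\<^sub>R differential c h p + h p *\<^sub>R differential c f p"
proof (rule differentialI)
  have "((\<lambda>z. (f \<circ> param c) z * (h \<circ> param c) z) has_derivative
      (\<lambda>v. (f \<circ> param c) (coord c p) * (differential c h p \<bullet> v) + (differential c f p \<bullet> v) * (h \<circ> param c) (coord c p))) (at (coord c p))"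
    by (rule has_derivative_mult[OF differential_has_derivative[OF assms(1,3,2)] differential_has_derivative[OF assms(1,4,2)]])
  moreover have "(\<lambda>v. (f \<circ> param c) (coord c p) * (differential c h p \<bullet> v) + (differential c f p \<bullet> v) * (h \<circ> param c) (coord c p))
    = (\<bullet>) (f p *\<^sub>R differential c h p + h p *\<^sub>R differential c f p)"
    unfolding comp_def param_coord[OF assms(1,2)] by (simp add: fun_eq_iff inner_add_left mult.commute)
  ultimately show "((\<lambda>p. f p * h p) \<circ> param c has_derivative (\<bullet>) (f p *\<^sub>R differential c h p + h p *\<^sub>R differential c f p)) (at (coord c p))"
    by (simp add: comp_def)
qed

lemma differential_cmult:
  "c \<in> A \<Longrightarrow> p \<in> dom c \<Longrightarrow> smooth_fun A f \<Longrightarrow> differential c (\<lambda>p. k * f p) p = k *\<^sub>R differential c f p"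
  using differential_mult[OF _ _ smooth_fun_const, of c p f k] by (simp add: differential_const)

lemma differential_diff:
  "c \<in> A \<Longrightarrow> p \<in> dom c \<Longrightarrow> smooth_fun A f \<Longrightarrow> smooth_fun A h \<Longrightarrow>
    differential c (\<lambda>p. f p - h p) p = differential c f p - differential c h p"
  using differential_add[of c p f "\<lambda>p. -1 * h p"] smooth_fun_cmult[of h "-1"] differential_cmult[of c p h "-1"] by simp

lemma differential_compose:
  assumes "c \<in> A" "p \<in> dom c" "smooth_fun A f" "(\<Phi> has_real_derivative d) (at (f p))"
  shows "differential c (\<lambda>p. \<Phi> (f p)) p = d *\<^sub>R differential c f p"
proof (rule differentialI)
  have "(\<Phi> has_derivative (*) d) (at ((f \<circ> param c) (coord c p)))"
    using assms(4) unfolding has_field_derivative_def comp_def param_coord[OF assms(1,2)] .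
  from has_derivative_compose[OF differential_has_derivative[OF assms(1,3,2)] this]
  show "((\<lambda>p. \<Phi> (f p)) \<circ> param c has_derivative (\<bullet>) (d *\<^sub>R differential c f p)) (at (coord c p))"
    by (simp add: comp_def inner_scaleR_left[abs_def])
qed

text \<open>The chain rule for the coordinate change.\<close>

lemma differential_change:
  assumes c: "c \<in> A" and c': "c' \<in> A" and p: "p \<in> dom c" "p \<in> dom c'" and f: "smooth_fun A f"
  shows "differential c f p = transpose (jac c c' p) *v differential c' f p"
proof (rule differentialI)
  let ?T = "coord c' \<circ> param c" and ?U = "coord c ` (dom c \<inter> dom c')"
  have Tp: "?T (coord c p) = coord c' p" unfolding comp_def param_coord[OF c p(1)] ..
  have "((\<lambda>z. (f \<circ> param c') (?T z)) has_derivative (\<lambda>v. differential c' f p \<bullet> (jac c c' p *v v))) (at (coord c p))"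
    by (rule has_derivative_compose[OF transition_has_derivative[OF c c' p]])
       (unfold Tp, rule differential_has_derivative[OF c' f p(2)])
  moreover have "(\<lambda>v. differential c' f p \<bullet> (jac c c' p *v v)) = (\<bullet>) (transpose (jac c c' p) *v differential c' f p)"
    by (simp add: fun_eq_iff dot_lmul_matrix)
  ultimately have *: "((\<lambda>z. (f \<circ> param c') (?T z)) has_derivative (\<bullet>) (transpose (jac c c' p) *v differential c' f p)) (at (coord c p))"
    by simp
  show "(f \<circ> param c has_derivative (\<bullet>) (transpose (jac c c' p) *v differential c' f p)) (at (coord c p))"
  proof (rule has_derivative_transform_open[OF _ _ _ *])
    show "open ?U" by (rule open_coord_image[OF c]) (intro open_Int open_dom c c' Int_lower1)+
    show "coord c p \<in> ?U" using p by blast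
    fix y assume "y \<in> ?U"
    then obtain q where q: "q \<in> dom c" "q \<in> dom c'" "y = coord c q" by blast
    have "param c y = q" unfolding q(3) by (rule param_coord[OF c q(1)])
    then show "(f \<circ> param c') (?T y) = (f \<circ> param c) y"
      using param_coord[OF c' q(2)] by simp
  qed
qed

definition grad_inner :: "('a \<Rightarrow> real) \<Rightarrow> ('a \<Rightarrow> real) \<Rightarrow> 'a \<Rightarrow> real" where
  "grad_inner f h p = differential (chart_at A p) f p \<bullet>
     (matrix_inv (g (chart_at A p) p) *v differential (chart_at A p) h p)"

lemma grad_sq_eq: "grad_sq A g f p = grad_inner f f p"
  by (simp add: grad_sq_def grad_inner_def differential_def Let_def)

text \<open>The transformation laws of the differential and of the inverse metric cancel, so every chart
  computes the same value.\<close>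

lemma grad_inner_chart:
  assumes c: "c \<in> A" and p: "p \<in> dom c" and f: "smooth_fun A f" and h: "smooth_fun A h"
  shows "grad_inner f h p = differential c f p \<bullet> (matrix_inv (g c p) *v differential c h p)"
  unfolding grad_inner_def
    differential_change[OF c chart_at(1) p chart_at(2) f] differential_change[OF c chart_at(1) p chart_at(2) h]
  by (rule matrix_inv_law[OF c chart_at(1) p chart_at(2), symmetric])

lemma continuous_grad_inner:
  assumes f: "smooth_fun A f" and h: "smooth_fun A h"
  shows "continuous_on UNIV (grad_inner f h)"
proof -
  have "continuous_on (dom c) (grad_inner f h)" if c: "c \<in> A" for c
  proof -
    let ?d = "\<lambda>f z. \<chi> i. frechet_derivative (f \<circ> param c) (at z) (axis i 1)"
    have cd: "continuous_on (im c) (?d f)" if "smooth_fun A f" for f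
      by (intro continuous_on_vec_lambda smooth_on_frechet_continuous smooth_funD that c)
    have "continuous_on (im c) (\<lambda>z. ?d f z \<bullet> (matrix_inv (g c (param c z)) *v ?d h z))"
      by (intro continuous_on_matrix_inv_form continuous_metric[OF c] cd f h pd[OF c] param_in[OF c])
    from continuous_on_compose2[OF this continuous_coord[OF c] order_refl]
    have "continuous_on (dom c) (\<lambda>p. differential c f p \<bullet> (matrix_inv (g c (param c (coord c p))) *v differential c h p))"
      by (simp only: differential_def)
    then show ?thesis
      by (rule continuous_on_cong[THEN iffD1, rotated 2]) (simp_all add: param_coord[OF c] grad_inner_chart[OF c _ f h])
  qed
  then have "continuous_on (\<Union>c\<in>A. dom c) (grad_inner f h)" using open_dom by (intro continuous_on_open_UN) auto
  moreover have "(\<Union>c\<in>A. dom c) = UNIV" using ex_chart by blast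
  ultimately show ?thesis by simp
qed

text \<open>The dual norm of a covector at \<open>p\<close>, in the coordinates of \<^term>\<open>chart_at A p\<close>.\<close>

definition conorm :: "'a \<Rightarrow> real ^ 'm \<Rightarrow> real" where
  "conorm p v = sqrt (v \<bullet> (matrix_inv (g (chart_at A p) p) *v v))"

abbreviation diff_at :: "('a \<Rightarrow> real) \<Rightarrow> 'a \<Rightarrow> real ^ 'm" where
  "diff_at f p \<equiv> differential (chart_at A p) f p"

lemma pd_inv: "pos_def (matrix_inv (g (chart_at A p) p))"
  by (intro pos_def_inv pd chart_at)

lemma conorm_nonneg: "0 \<le> conorm p v"
  unfolding conorm_def using pos_def_form_nonneg[OF pd_inv] by simp

lemma conorm_triangle: "conorm p (v + w) \<le> conorm p v + conorm p w"
  unfolding conorm_def by (rule pos_def_triangle[OF pd_inv])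

lemma conorm_scaleR: "conorm p (r *\<^sub>R v) = \<bar>r\<bar> * conorm p v"
  unfolding conorm_def by (simp add: matrix_vector_mult_scaleR real_sqrt_mult flip: mult.assoc)

lemma grad_sq_conorm: "grad_sq A g f p = (conorm p (diff_at f p))\<^sup>2"
  unfolding grad_sq_eq grad_inner_def conorm_def using pos_def_form_nonneg[OF pd_inv] by simp

lemma grad_sq_nonneg: "0 \<le> grad_sq A g f p"
  by (simp add: grad_sq_conorm)

lemma continuous_grad_sq: "smooth_fun A f \<Longrightarrow> continuous_on UNIV (grad_sq A g f)"
  using continuous_grad_inner[of f f] by (simp add: grad_sq_eq[abs_def])

section \<open>The Sobolev norm of smooth functions\<close>

lemma continuous_imp_borel: "continuous_on UNIV f \<Longrightarrow> f \<in> borel_measurable borel"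
  for f :: "'a \<Rightarrow> real"
  by (rule borel_measurable_continuous_onI)

lemma integrable_continuous:
  fixes f :: "'a \<Rightarrow> real"
  assumes f: "continuous_on UNIV f" and M: "finite_measure M" "sets M = sets borel"
  shows "integrable M f"
proof -
  obtain B where "\<And>x. \<bar>f x\<bar> \<le> B"
    using compact_imp_bounded[OF compact_continuous_image[OF f compact_X]] by (auto simp: bounded_iff)
  moreover have "f \<in> borel_measurable M"
    using continuous_imp_borel[OF f] measurable_cong_sets[OF M(2) refl] by blast
  ultimately show ?thesis by (intro finite_measure.integrable_const_bound[OF M(1), of f B]) simp_all
qed

lemmas integrable_vol = integrable_continuous[OF _ finite_measure_vol sets_vol]

abbreviation h1n :: "('a \<Rightarrow> real) \<Rightarrow> real" where "h1n \<equiv> smooth_h1_norm A g"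

definition h1_inner :: "('a \<Rightarrow> real) \<Rightarrow> ('a \<Rightarrow> real) \<Rightarrow> real" where
  "h1_inner f h = (LINT p|vol. f p * h p + grad_inner f h p)"

lemma h1_density_continuous:
  assumes "smooth_fun A f" "smooth_fun A h"
  shows "continuous_on UNIV (\<lambda>p. f p * h p + grad_inner f h p)"
  by (intro continuous_intros continuous_smooth_fun continuous_grad_inner assms)

lemma h1n_eq: "h1n f = sqrt (h1_inner f f)"
  by (simp add: smooth_h1_norm_def h1_inner_def grad_sq_eq power2_eq_square)

lemma h1_inner_nonneg: "0 \<le> h1_inner f f"
  unfolding h1_inner_def grad_sq_eq[symmetric] by (intro integral_nonneg_AE) (auto simp: grad_sq_nonneg)

lemma h1n_nonneg: "0 \<le> h1n f" by (simp add: h1n_eq h1_inner_nonneg)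
lemma h1n_sq: "(h1n f)\<^sup>2 = h1_inner f f" by (simp add: h1n_eq h1_inner_nonneg)

lemma nn_integral_h1:
  assumes f: "smooth_fun A f"
  shows "(\<integral>\<^sup>+ p. ennreal ((f p)\<^sup>2 + grad_sq A g f p) \<partial>vol) = ennreal ((h1n f)\<^sup>2)"
proof -
  have "(\<integral>\<^sup>+ p. ennreal ((f p)\<^sup>2 + grad_sq A g f p) \<partial>vol) = ennreal (LINT p|vol. (f p)\<^sup>2 + grad_sq A g f p)"
    by (intro nn_integral_eq_integral integrable_vol continuous_intros continuous_smooth_fun continuous_grad_sq f)
       (simp add: grad_sq_nonneg)
  also have "(LINT p|vol. (f p)\<^sup>2 + grad_sq A g f p) = (h1n f)\<^sup>2"
    unfolding h1n_sq h1_inner_def grad_sq_eq by (simp add: power2_eq_square)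
  finally show ?thesis .
qed

lemma h1_inner_expand:
  assumes f: "smooth_fun A f" and h: "smooth_fun A h"
  shows "h1_inner (\<lambda>p. f p + t * h p) (\<lambda>p. f p + t * h p) = h1_inner f f + 2 * t * h1_inner f h + t\<^sup>2 * h1_inner h h"
proof -
  have gi: "grad_inner (\<lambda>p. f p + t * h p) (\<lambda>p. f p + t * h p) p =
      grad_inner f f p + 2 * t * grad_inner f h p + t\<^sup>2 * grad_inner h h p" for p
  proof -
    have d: "diff_at (\<lambda>p. f p + t * h p) p = diff_at f p + t *\<^sub>R diff_at h p"
      by (simp add: differential_add[OF chart_at] differential_cmult[OF chart_at] f h smooth_fun_cmult)
    show ?thesis
      unfolding grad_inner_def d using pos_def_sym[OF pd_inv, of "diff_at f p" p "diff_at h p"]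
      by (simp add: matrix_vector_right_distrib matrix_vector_mult_scaleR inner_add_left inner_add_right algebra_simps power2_eq_square)
  qed
  have "h1_inner (\<lambda>p. f p + t * h p) (\<lambda>p. f p + t * h p) =
      (LINT p|vol. (f p * f p + grad_inner f f p) + ((2 * t) * (f p * h p + grad_inner f h p) + t\<^sup>2 * (h p * h p + grad_inner h h p)))"
    unfolding h1_inner_def gi by (intro Bochner_Integration.integral_cong refl) (simp add: algebra_simps power2_eq_square)
  also have "\<dots> = h1_inner f f + ((2 * t) * h1_inner f h + t\<^sup>2 * h1_inner h h)"
  proof -
    have i: "integrable vol (\<lambda>p. f p * f p + grad_inner f f p)" "integrable vol (\<lambda>p. f p * h p + grad_inner f h p)"
      "integrable vol (\<lambda>p. h p * h p + grad_inner h h p)"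
      by (intro integrable_vol h1_density_continuous f h)+
    then show ?thesis unfolding h1_inner_def by simp
  qed
  finally show ?thesis by simp
qed

text \<open>Minkowski's inequality for the form \<open>h1_inner\<close>.\<close>

lemma h1n_triangle:
  assumes "smooth_fun A f" "smooth_fun A h"
  shows "h1n (\<lambda>p. f p + h p) \<le> h1n f + h1n h"
proof -
  have "0 \<le> h1_inner f f + 2 * t * h1_inner f h + t\<^sup>2 * h1_inner h h" for t
    unfolding h1_inner_expand[OF assms, symmetric] by (rule h1_inner_nonneg)
  from sqrt_form_triangle[OF this h1_inner_nonneg]
  show ?thesis using h1_inner_expand[OF assms, of 1] by (simp add: h1n_eq)
qed

lemma h1n_minus_commute:
  assumes "smooth_fun A f" "smooth_fun A h"
  shows "h1n (\<lambda>p. f p - h p) = h1n (\<lambda>p. h p - f p)"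
proof -
  have "diff_at (\<lambda>p. f p - h p) p = - diff_at (\<lambda>p. h p - f p) p" for p
    by (simp add: differential_diff[OF chart_at] assms)
  then have "grad_inner (\<lambda>p. f p - h p) (\<lambda>p. f p - h p) = grad_inner (\<lambda>p. h p - f p) (\<lambda>p. h p - f p)"
    by (simp add: grad_inner_def fun_eq_iff vec.linear_neg[OF matrix_vector_mul_linear_gen])
  then show ?thesis unfolding h1n_eq h1_inner_def by (simp add: algebra_simps)
qed

lemma h1n_diff_bound:
  assumes f: "smooth_fun A f" and h: "smooth_fun A h"
  shows "\<bar>h1n f - h1n h\<bar> \<le> h1n (\<lambda>p. f p - h p)"
  using h1n_triangle[OF smooth_fun_diff[OF f h] h] h1n_triangle[OF smooth_fun_diff[OF h f] f]
    h1n_minus_commute[OF f h] by simp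

end


section \<open>Local comparison with the Euclidean Sobolev norm\<close>

definition egrad :: "(real ^ 'm \<Rightarrow> real) \<Rightarrow> real ^ 'm \<Rightarrow> real ^ 'm::finite" where
  "egrad \<phi> z = (\<chi> i. frechet_derivative \<phi> (at z) (axis i 1))"

lemma egradI: "(\<phi> has_derivative (\<lambda>v. w \<bullet> v)) (at z) \<Longrightarrow> egrad \<phi> z = w"
proof -
  assume "(\<phi> has_derivative (\<lambda>v. w \<bullet> v)) (at z)"
  from frechet_derivative_at[OF this, symmetric] show ?thesis
    unfolding egrad_def by (simp add: vec_eq_iff inner_axis)
qed

context closed_riemannian
begin

lemma good_subset:
  assumes "good K c y R" "cball x (3 * r) \<subseteq> cball y (3 * R)" "0 < r"
  shows "good K c x r"
  using assms unfolding good_def by blast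

text \<open>Recentre the balls of a finite cover and halve the smallest radius.\<close>

lemma uniform_good:
  obtains K r where "1 \<le> K" "0 < r" "\<And>p. \<exists>c\<in>A. p \<in> dom c \<and> good K c (coord c p) r"
proof -
  obtain I K where I: "finite I" "\<And>i. i \<in> I \<Longrightarrow> (case i of (c, y, R) \<Rightarrow> good K c y R)"
    "\<And>p. \<exists>(c, y, R)\<in>I. p \<in> dom c \<and> coord c p \<in> ball y R" using good_cover by blast
  define r where "r = Min (insert 1 ((\<lambda>(c, y, R). R / 2) ` I))"
  have r: "r \<le> R / 2" if "(c, y, R) \<in> I" for c y R
    unfolding r_def using I(1) that by (intro Min_le) force+
  have "0 < r" unfolding r_def using I(1,2) by (subst Min_gr_iff) (auto simp: good_def)
  have *: "\<exists>c\<in>A. p \<in> dom c \<and> good K c (coord c p) r" for p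
  proof -
    obtain c y R where i: "(c, y, R) \<in> I" "p \<in> dom c" "coord c p \<in> ball y R" using I(3)[of p] by blast
    have gd: "good K c y R" using I(2)[OF i(1)] by simp
    have "cball (coord c p) (3 * r) \<subseteq> cball y (3 * R)"
    proof
      fix z assume "z \<in> cball (coord c p) (3 * r)"
      then have "dist (coord c p) z \<le> 3 * r" "dist y (coord c p) < R" using i(3) by simp_all
      then have "dist y z \<le> 3 * R"
        using r[OF i(1)] dist_triangle[of y z "coord c p"] zero_le_dist[of y "coord c p"] by linarith
      then show "z \<in> cball y (3 * R)" by simp
    qed
    then have "good K c (coord c p) r" by (rule good_subset[OF gd]) fact
    moreover have "c \<in> A" using gd by (simp add: good_def)
    ultimately show ?thesis using i(2) by blast
  qed
  obtain c where "good K c (coord c undefined) r" using *[of undefined] by blast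
  then have "1 \<le> K" by (simp add: good_def)
  with * \<open>0 < r\<close> show ?thesis using that by blast
qed

lemma differential_egrad: "c \<in> A \<Longrightarrow> z \<in> im c \<Longrightarrow> differential c f (param c z) = egrad (f \<circ> param c) z"
  unfolding differential_def egrad_def using coord_param[of c z] by simp

text \<open>On a good ball the inverse metric lies between \<open>1 / K\<close> and \<open>K\<close> times the Euclidean one.\<close>

lemma good_grad_sq:
  assumes gd: "good K c y R" and z: "z \<in> cball y (3 * R)" and f: "smooth_fun A f"
  shows "(f (param c z))\<^sup>2 + grad_sq A g f (param c z) \<le> K * ((f (param c z))\<^sup>2 + (norm (egrad (f \<circ> param c) z))\<^sup>2)"
    and "(f (param c z))\<^sup>2 + (norm (egrad (f \<circ> param c) z))\<^sup>2 \<le> K * ((f (param c z))\<^sup>2 + grad_sq A g f (param c z))"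
proof -
  have c: "c \<in> A" and zi: "z \<in> im c" and K: "1 \<le> K" using gd z by (auto simp: good_def)
  let ?w = "egrad (f \<circ> param c) z"
  have eq: "grad_sq A g f (param c z) = ?w \<bullet> (matrix_inv (g c (param c z)) *v ?w)"
    unfolding grad_sq_eq grad_inner_chart[OF c param_in[OF c zi] f f] differential_egrad[OF c zi] ..
  have b: "(norm ?w)\<^sup>2 / K \<le> ?w \<bullet> (matrix_inv (g c (param c z)) *v ?w)"
    "?w \<bullet> (matrix_inv (g c (param c z)) *v ?w) \<le> K * (norm ?w)\<^sup>2"
    using gd z unfolding good_def by blast+
  have f2: "(f (param c z))\<^sup>2 \<le> K * (f (param c z))\<^sup>2" using mult_right_mono[OF K, of "(f (param c z))\<^sup>2"] by simp
  show "(f (param c z))\<^sup>2 + grad_sq A g f (param c z) \<le> K * ((f (param c z))\<^sup>2 + (norm ?w)\<^sup>2)"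
    unfolding eq distrib_left using b(2) f2 by linarith
  have "(norm ?w)\<^sup>2 \<le> K * (?w \<bullet> (matrix_inv (g c (param c z)) *v ?w))"
    using b(1) K by (simp add: field_simps)
  then show "(f (param c z))\<^sup>2 + (norm ?w)\<^sup>2 \<le> K * ((f (param c z))\<^sup>2 + grad_sq A g f (param c z))"
    unfolding eq distrib_left using f2 by linarith
qed

definition energy_density :: "('a \<Rightarrow> real) \<Rightarrow> 'a \<Rightarrow> ennreal" where
  "energy_density f p = ennreal ((f p)\<^sup>2 + grad_sq A g f p)"

lemma energy_density_measurable [measurable]: "smooth_fun A f \<Longrightarrow> energy_density f \<in> borel_measurable borel"
  unfolding energy_density_def
  by (intro measurable_compose[OF _ measurable_ennreal] continuous_imp_borel continuous_intros
      continuous_smooth_fun continuous_grad_sq)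

lemma smooth_chart_energy_measurable:
  assumes c: "c \<in> A" and f: "smooth_fun A f" and S: "S \<in> sets borel" "S \<subseteq> im c"
  shows "(\<lambda>z. ennreal ((f (param c z))\<^sup>2 + (norm (egrad (f \<circ> param c) z))\<^sup>2) * indicator S z) \<in> borel_measurable borel"
proof -
  let ?h = "\<lambda>z. (f (param c z))\<^sup>2 + (norm (egrad (f \<circ> param c) z))\<^sup>2"
  have "continuous_on (im c) ?h"
    unfolding egrad_def
    by (intro continuous_intros continuous_on_vec_lambda smooth_on_frechet_continuous smooth_funD[OF f c]
      smooth_on_continuous[OF smooth_funD[OF f c], unfolded comp_def])
  then have "(\<lambda>z. indicator S z *\<^sub>R ?h z) \<in> borel_measurable borel"
    using S by (intro borel_measurable_continuous_on_indicator) (auto intro: continuous_on_subset)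
  then have "(\<lambda>z. ennreal (indicator S z *\<^sub>R ?h z)) \<in> borel_measurable borel" by simp
  moreover have "(\<lambda>z. ennreal (indicator S z *\<^sub>R ?h z)) = (\<lambda>z. ennreal (?h z) * indicator S z)"
    by (auto simp: fun_eq_iff indicator_def)
  ultimately show ?thesis by metis
qed

lemma good_energy:
  assumes gd: "good K c y R" and f: "smooth_fun A f" and S: "S \<in> sets borel" "S \<subseteq> cball y (3 * R)"
  shows "(\<integral>\<^sup>+ p. energy_density f p * indicator (param c ` S) p \<partial>vol) \<le>
      ennreal (K\<^sup>2) * (\<integral>\<^sup>+ z. ennreal ((f (param c z))\<^sup>2 + (norm (egrad (f \<circ> param c) z))\<^sup>2) * indicator S z \<partial>lborel)"
    and "(\<integral>\<^sup>+ z. ennreal ((f (param c z))\<^sup>2 + (norm (egrad (f \<circ> param c) z))\<^sup>2) * indicator S z \<partial>lborel) \<le>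
      ennreal (K\<^sup>2 * (h1n f)\<^sup>2)"
proof -
  have c: "c \<in> A" and K: "1 \<le> K" and sub: "S \<subseteq> im c" using gd S by (auto simp: good_def)
  have pS: "param c ` S \<in> sets borel" by (rule param_image_borel[OF c S(1) sub])
  let ?h = "\<lambda>z. (f (param c z))\<^sup>2 + (norm (egrad (f \<circ> param c) z))\<^sup>2"
  note m = smooth_chart_energy_measurable[OF c f S(1) sub]
  have K2: "ennreal (K\<^sup>2) = ennreal K * ennreal K" using K by (simp add: ennreal_mult' power2_eq_square)
  have "(\<integral>\<^sup>+ p. energy_density f p * indicator (param c ` S) p \<partial>vol) \<le>
      ennreal K * (\<integral>\<^sup>+ z. energy_density f (param c z) * indicator S z \<partial>lborel)"
    by (rule good_integral_le(1)[OF gd energy_density_measurable[OF f] S])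
  also have "\<dots> \<le> ennreal K * (\<integral>\<^sup>+ z. ennreal K * (ennreal (?h z) * indicator S z) \<partial>lborel)"
    using good_grad_sq(1)[OF gd _ f] K S(2)
    by (intro mult_left_mono nn_integral_mono)
       (auto simp: indicator_def energy_density_def ennreal_mult'[symmetric] intro!: ennreal_leI simp del: ennreal_plus)
  also have "\<dots> = ennreal (K\<^sup>2) * (\<integral>\<^sup>+ z. ennreal (?h z) * indicator S z \<partial>lborel)"
    using m by (simp add: nn_integral_cmult K2 mult.assoc)
  finally show "(\<integral>\<^sup>+ p. energy_density f p * indicator (param c ` S) p \<partial>vol) \<le>
      ennreal (K\<^sup>2) * (\<integral>\<^sup>+ z. ennreal (?h z) * indicator S z \<partial>lborel)" .
  have me: "(\<lambda>p. energy_density f p * indicator (param c ` S) p) \<in> borel_measurable borel"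
    using energy_density_measurable[OF f] pS by simp
  have "(\<integral>\<^sup>+ z. ennreal (?h z) * indicator S z \<partial>lborel) \<le>
      (\<integral>\<^sup>+ z. (ennreal K * energy_density f (param c z)) * indicator S z \<partial>lborel)"
    using good_grad_sq(2)[OF gd _ f] K S(2)
    by (intro nn_integral_mono)
       (auto simp: indicator_def energy_density_def ennreal_mult'[symmetric] intro!: ennreal_leI simp del: ennreal_plus)
  also have "\<dots> \<le> ennreal K * (\<integral>\<^sup>+ p. (ennreal K * energy_density f p) * indicator (param c ` S) p \<partial>vol)"
    by (rule good_integral_le(2)[OF gd _ S]) (use energy_density_measurable[OF f] in simp)
  also have "\<dots> = ennreal (K\<^sup>2) * (\<integral>\<^sup>+ p. energy_density f p * indicator (param c ` S) p \<partial>vol)"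
    using me by (simp add: nn_integral_cmult K2 mult.assoc)
  also have "\<dots> \<le> ennreal (K\<^sup>2) * (\<integral>\<^sup>+ p. energy_density f p \<partial>vol)"
    by (intro mult_left_mono nn_integral_mono) (auto simp: indicator_def)
  also have "\<dots> = ennreal (K\<^sup>2 * (h1n f)\<^sup>2)"
    unfolding energy_density_def nn_integral_h1[OF f] by (simp add: ennreal_mult')
  finally show "(\<integral>\<^sup>+ z. ennreal (?h z) * indicator S z \<partial>lborel) \<le> ennreal (K\<^sup>2 * (h1n f)\<^sup>2)" .
qed

lemma differential_locally_const:
  assumes "c \<in> A" "p \<in> dom c" "open U" "p \<in> U" "\<And>q. q \<in> U \<Longrightarrow> f q = k"
  shows "differential c f p = 0"
proof (rule differentialI)
  have "((\<lambda>z. k) has_derivative (\<bullet>) 0) (at (coord c p))" 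
    using has_derivative_const[of k "at (coord c p)"] by (simp add: inner_zero_left[abs_def])
  then show "(f \<circ> param c has_derivative (\<bullet>) 0) (at (coord c p))"
  proof (rule has_derivative_transform_open[rotated 3])
    show "open (coord c ` (dom c \<inter> U))"
      by (intro open_coord_image assms open_Int open_dom Int_lower1)
    show "coord c p \<in> coord c ` (dom c \<inter> U)" using assms by blast
    fix z assume "z \<in> coord c ` (dom c \<inter> U)"
    then obtain q where q: "q \<in> dom c" "q \<in> U" "z = coord c q" by blast
    have "param c z = q" unfolding q(3) by (rule param_coord[OF assms(1) q(1)])
    then show "k = (f \<circ> param c) z" using assms(5)[OF q(2)] by simp
  qed
qed

lemma energy_density_zero:
  assumes "open U" "p \<in> U" "\<And>q. q \<in> U \<Longrightarrow> f q = 0"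
  shows "energy_density f p = 0"
  using differential_locally_const[OF chart_at assms(1,2,3)] assms(3)[OF assms(2)]
  by (simp add: energy_density_def grad_sq_eq grad_inner_def)

text \<open>The transplanted function and its gradient vanish off the ball of radius \<open>2 R\<close>, so the comparison on
  the good ball accounts for the whole norm.\<close>

lemma in_chart_energy:
  assumes gd: "good K c y R" and \<phi>: "smooth_on UNIV \<phi>" and Z: "\<And>z. z \<notin> cball y (2 * R) \<Longrightarrow> \<phi> z = 0"
  shows "ennreal ((h1n (in_chart c \<phi>))\<^sup>2) \<le>
      ennreal (K\<^sup>2) * (\<integral>\<^sup>+ z. ennreal ((\<phi> z)\<^sup>2 + (norm (egrad \<phi> z))\<^sup>2) * indicator (cball y (2 * R)) z \<partial>lborel)"
    and "smooth_fun A (in_chart c \<phi>)"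
proof -
  have c: "c \<in> A" and R: "R > 0" and sub3: "cball y (3 * R) \<subseteq> im c" using gd by (auto simp: good_def)
  have s23: "cball y (2 * R) \<subseteq> cball y (3 * R)" using R by auto
  then have sub: "cball y (2 * R) \<subseteq> im c" using sub3 by blast
  let ?f = "in_chart c \<phi>" and ?B = "cball y (2 * R)"
  show f: "smooth_fun A ?f" by (rule smooth_fun_in_chart[OF c \<phi> compact_cball sub Z])
  have cl: "closed (param c ` ?B)" by (intro compact_imp_closed compact_param_image c compact_cball sub)
  have out: "?f q = 0" if "q \<notin> param c ` ?B" for q
    using that in_param_image[OF c, of q ?B] Z by (auto simp: in_chart_def)
  have e0: "energy_density ?f p = energy_density ?f p * indicator (param c ` ?B) p" for p
    using energy_density_zero[of "- (param c ` ?B)" p ?f] cl out by (auto simp: indicator_def)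
  have fz: "(?f \<circ> param c) z = \<phi> z" if "z \<in> im c" for z
    using param_in[OF c that] coord_param[OF c that] by (simp add: in_chart_def)
  have ez: "egrad (?f \<circ> param c) z = egrad \<phi> z" if "z \<in> im c" for z
  proof -
    have "frechet_derivative (?f \<circ> param c) (at z) = frechet_derivative \<phi> (at z)"
    proof (rule sym, rule frechet_derivative_at)
      show "(?f \<circ> param c has_derivative frechet_derivative \<phi> (at z)) (at z)"
        by (rule has_derivative_transform_open[OF open_im[OF c] that fz[symmetric] smooth_onD[OF \<phi>]]) auto
    qed
    then show ?thesis by (simp add: egrad_def)
  qed
  have "ennreal ((h1n ?f)\<^sup>2) = (\<integral>\<^sup>+ p. energy_density ?f p \<partial>vol)"
    unfolding energy_density_def nn_integral_h1[OF f] ..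
  also have "\<dots> = (\<integral>\<^sup>+ p. energy_density ?f p * indicator (param c ` ?B) p \<partial>vol)"
    by (subst e0) simp
  also have "\<dots> \<le> ennreal (K\<^sup>2) * (\<integral>\<^sup>+ z. ennreal ((?f (param c z))\<^sup>2 + (norm (egrad (?f \<circ> param c) z))\<^sup>2) * indicator ?B z \<partial>lborel)"
    by (rule good_energy(1)[OF gd f _ s23]) simp
  also have "(\<integral>\<^sup>+ z. ennreal ((?f (param c z))\<^sup>2 + (norm (egrad (?f \<circ> param c) z))\<^sup>2) * indicator ?B z \<partial>lborel) =
      (\<integral>\<^sup>+ z. ennreal ((\<phi> z)\<^sup>2 + (norm (egrad \<phi> z))\<^sup>2) * indicator ?B z \<partial>lborel)"
  proof (rule nn_integral_cong)
    fix z
    show "ennreal ((?f (param c z))\<^sup>2 + (norm (egrad (?f \<circ> param c) z))\<^sup>2) * indicator ?B z =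
      ennreal ((\<phi> z)\<^sup>2 + (norm (egrad \<phi> z))\<^sup>2) * indicator ?B z"
    proof (cases "z \<in> ?B")
      case True
      then have "z \<in> im c" using sub by blast
      then show ?thesis using fz[of z] ez[of z] by simp
    qed simp
  qed
  finally show "ennreal ((h1n ?f)\<^sup>2) \<le>
      ennreal (K\<^sup>2) * (\<integral>\<^sup>+ z. ennreal ((\<phi> z)\<^sup>2 + (norm (egrad \<phi> z))\<^sup>2) * indicator ?B z \<partial>lborel)" .
qed

section \<open>The trace inequality for smooth functions\<close>

lemma h1n_zero: "h1n (\<lambda>p. 0) = 0"
  by (simp add: h1n_eq h1_inner_def grad_inner_def differential_const)

lemma h1_approx_const: "smooth_fun A f \<Longrightarrow> h1_approx A g (\<lambda>n. f) f"
  by (simp add: h1_approx_def h1n_zero)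

lemma smooth_fun_H1: "smooth_fun A f \<Longrightarrow> f \<in> H1 A g"
  unfolding H1_def using h1_approx_const continuous_imp_borel continuous_smooth_fun by blast

lemma h1_approx_convergent:
  assumes "h1_approx A g f u"
  shows "\<exists>l. (\<lambda>n. h1n (f n)) \<longlonglongrightarrow> l"
proof -
  have "Cauchy (\<lambda>n. h1n (f n))"
  proof (rule metric_CauchyI)
    fix e :: real assume "e > 0"
    then obtain M where M: "\<And>i j. i \<ge> M \<Longrightarrow> j \<ge> M \<Longrightarrow> h1n (\<lambda>p. f i p - f j p) < e"
      using assms unfolding h1_approx_def by blast
    have "dist (h1n (f i)) (h1n (f j)) < e" if "i \<ge> M" "j \<ge> M" for i j
      using h1n_diff_bound[of "f i" "f j"] M[OF that] assms by (simp add: h1_approx_def dist_real_def)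
    then show "\<exists>M. \<forall>m\<ge>M. \<forall>n\<ge>M. dist (h1n (f m)) (h1n (f n)) < e" by blast
  qed
  then show ?thesis using Cauchy_convergent convergent_def by blast
qed

lemma h1_norm_le: "h1_approx A g f u \<Longrightarrow> (\<lambda>n. h1n (f n)) \<longlonglongrightarrow> l \<Longrightarrow> h1_norm A g u \<le> l"
  and h1_norm_nonneg: "u \<in> H1 A g \<Longrightarrow> 0 \<le> h1_norm A g u"
  and h1_norm_less: "u \<in> H1 A g \<Longrightarrow> h1_norm A g u < b \<Longrightarrow>
    \<exists>f l. h1_approx A g f u \<and> (\<lambda>n. h1n (f n)) \<longlonglongrightarrow> l \<and> 0 \<le> l \<and> l < b"
proof -
  let ?S = "{l. \<exists>f. h1_approx A g f u \<and> (\<lambda>n. h1n (f n)) \<longlonglongrightarrow> l}"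
  have nn: "0 \<le> l" if "l \<in> ?S" for l using that h1n_nonneg by (auto intro: LIMSEQ_le_const)
  then have bdd: "bdd_below ?S" by (rule bdd_belowI)
  show "h1_approx A g f u \<Longrightarrow> (\<lambda>n. h1n (f n)) \<longlonglongrightarrow> l \<Longrightarrow> h1_norm A g u \<le> l"
    unfolding h1_norm_def by (rule cInf_lower[OF _ bdd]) blast
  have ne: "?S \<noteq> {}" if u: "u \<in> H1 A g"
    using u h1_approx_convergent unfolding H1_def by blast
  show "0 \<le> h1_norm A g u" if u: "u \<in> H1 A g"
    unfolding h1_norm_def using ne[OF u] nn by (rule cInf_greatest)
  show "\<exists>f l. h1_approx A g f u \<and> (\<lambda>n. h1n (f n)) \<longlonglongrightarrow> l \<and> 0 \<le> l \<and> l < b"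
    if u: "u \<in> H1 A g" "h1_norm A g u < b"
    using cInf_lessD[OF ne[OF u(1)] u(2)[unfolded h1_norm_def]] nn by blast
qed

lemma h1_norm_smooth_le: "smooth_fun A f \<Longrightarrow> h1_norm A g f \<le> h1n f"
  by (rule h1_norm_le[OF h1_approx_const]) auto

lemma h1_capacity_le:
  assumes "u \<in> H1 A g" "open W" "E \<subseteq> W" "AE p in vol. p \<in> W \<longrightarrow> 1 \<le> u p"
  shows "h1_capacity A g E \<le> (h1_norm A g u)\<^sup>2"
  unfolding h1_capacity_def
  by (rule cInf_lower) (use assms in \<open>blast, auto intro!: bdd_belowI[of _ 0]\<close>)

lemma h1_capacity_empty: "h1_capacity A g {} \<le> 0"
proof -
  have s: "smooth_fun A (\<lambda>p. 0)" by (rule smooth_fun_const)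
  have "h1_norm A g (\<lambda>p. 0) = 0"
    using h1_norm_smooth_le[OF s] h1_norm_nonneg[OF smooth_fun_H1[OF s]] by (simp add: h1n_zero)
  then show ?thesis using h1_capacity_le[OF smooth_fun_H1[OF s], of "{}" "{}"] by simp
qed

lemma qc_representative_smooth:
  assumes f: "smooth_fun A f"
  shows "qc_representative A g f f"
proof -
  have "quasi_continuous A g f"
    unfolding quasi_continuous_def
  proof (intro allI impI exI conjI)
    fix e :: real assume "e > 0"
    then show "h1_capacity A g {} < e" using h1_capacity_empty by linarith
  qed (use continuous_smooth_fun[OF f] in auto)
  then show ?thesis
    using continuous_imp_borel[OF continuous_smooth_fun[OF f]] by (simp add: qc_representative_def)
qed

text \<open>The only form in which a trace inequality enters the estimates. Testing with smooth functions
  avoids quasi-continuity and the completion.\<close>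

definition smooth_trace :: "'a measure \<Rightarrow> real \<Rightarrow> bool" where
  "smooth_trace \<mu> N \<longleftrightarrow> finite_borel_measure \<mu> \<and> 0 \<le> N \<and>
    (\<forall>f. smooth_fun A f \<longrightarrow> (\<integral>\<^sup>+ p. ennreal ((f p)\<^sup>2) \<partial>\<mu>) \<le> ennreal (N * (h1n f)\<^sup>2))"

text \<open>A smooth function is its own quasi-continuous representative, since the empty set has capacity
  zero, and the constant sequence bounds its norm.\<close>

lemma trace_bound_imp_smooth_trace:
  assumes "finite_borel_measure \<mu>" "trace_bound A g \<mu> N"
  shows "smooth_trace \<mu> N"
  unfolding smooth_trace_def
proof (intro conjI allI impI)
  fix f assume f: "smooth_fun A f"
  have "(\<integral>\<^sup>+ p. ennreal ((f p)\<^sup>2) \<partial>\<mu>) \<le> ennreal (N * (h1_norm A g f)\<^sup>2)"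
    using assms(2) smooth_fun_H1[OF f] qc_representative_smooth[OF f] by (auto simp: trace_bound_def)
  also have "\<dots> \<le> ennreal (N * (h1n f)\<^sup>2)"
    using assms(2) h1_norm_smooth_le[OF f] h1_norm_nonneg[OF smooth_fun_H1[OF f]]
    by (intro ennreal_leI mult_left_mono power_mono) (auto simp: trace_bound_def)
  finally show "(\<integral>\<^sup>+ p. ennreal ((f p)\<^sup>2) \<partial>\<mu>) \<le> ennreal (N * (h1n f)\<^sup>2)" .
qed (use assms in \<open>auto simp: trace_bound_def\<close>)

end


section \<open>Growth of measures with a trace inequality\<close>

lemma smooth_step_derivative:
  obtains s' L where "\<And>t. (smooth_step has_real_derivative s' t) (at t)" "\<And>t. \<bar>s' t\<bar> \<le> L"
    "\<And>t. s' t \<noteq> 0 \<Longrightarrow> 1 \<le> t \<and> t \<le> 2" "0 < (L :: real)"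
proof -
  define s' where "s' t = frechet_derivative smooth_step (at t) 1" for t :: real
  have d: "(smooth_step has_real_derivative s' t) (at t)" for t
  proof -
    have D: "(smooth_step has_derivative frechet_derivative smooth_step (at t)) (at t)"
      by (rule smooth_onD[OF smooth_smooth_step]) simp
    have "frechet_derivative smooth_step (at t) = (\<lambda>h. s' t * h)"
    proof
      fix h show "frechet_derivative smooth_step (at t) h = s' t * h"
        unfolding s'_def using linear_cmul[OF has_derivative_linear[OF D], of h 1] by simp
    qed
    with D show ?thesis by (simp add: has_field_derivative_def)
  qed
  have z1: "s' t = 0" if "t < 1" for t
  proof -
    have "((\<lambda>t. 1) has_real_derivative s' t) (at t)"
      by (rule has_field_derivative_transform_within_open[OF d, of "{..<1}"]) (use that smooth_step_eq_1 in auto)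
    then show ?thesis using DERIV_unique[OF _ DERIV_const] by blast
  qed
  have z2: "s' t = 0" if "t > 2" for t
  proof -
    have "((\<lambda>t. 0) has_real_derivative s' t) (at t)"
      by (rule has_field_derivative_transform_within_open[OF d, of "{2<..}"]) (use that smooth_step_eq_0 in auto)
    then show ?thesis using DERIV_unique[OF _ DERIV_const] by blast
  qed
  have "continuous_on {1..2} s'"
    unfolding s'_def using smooth_on_frechet_continuous[OF smooth_smooth_step] by (rule continuous_on_subset) simp
  then have "bounded (s' ` {1..2})" by (intro compact_imp_bounded compact_continuous_image) auto
  then obtain B where B: "\<And>t. 1 \<le> t \<Longrightarrow> t \<le> 2 \<Longrightarrow> \<bar>s' t\<bar> \<le> B"
    unfolding bounded_iff by (metis atLeastAtMost_iff imageI real_norm_def)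
  show ?thesis
  proof (rule that[of s' "\<bar>B\<bar> + 1"])
    show "\<bar>s' t\<bar> \<le> \<bar>B\<bar> + 1" for t
      using B[of t] z1[of t] z2[of t] by (cases "t < 1"; cases "t > 2") auto
    show "1 \<le> t \<and> t \<le> 2" if "s' t \<noteq> 0" for t using z1[of t] z2[of t] that by force
  qed (use d in auto)
qed

lemma smooth_norm_sq: "smooth_on UNIV (\<lambda>z :: 'e::euclidean_space. (norm (z - y))\<^sup>2)"
proof -
  have *: "smooth_on UNIV (\<lambda>z. z \<bullet> b + (- (y \<bullet> b)))" for b
    by (intro smooth_on_add smooth_on_const smooth_on_bounded_linear bounded_linear_inner_left) auto
  have "smooth_on UNIV (\<lambda>z. \<Sum>b\<in>Basis. (z \<bullet> b + (- (y \<bullet> b))) * (z \<bullet> b + (- (y \<bullet> b))))"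
    by (intro smooth_on_sum smooth_on_mult *) auto
  moreover have "(norm (z - y))\<^sup>2 = (\<Sum>b\<in>Basis. (z \<bullet> b + (- (y \<bullet> b))) * (z \<bullet> b + (- (y \<bullet> b))))" for z
    unfolding power2_norm_eq_inner euclidean_inner[of "z - y" "z - y"] by (simp add: inner_diff_left)
  ultimately show ?thesis by simp
qed

definition bump :: "'e::euclidean_space \<Rightarrow> real \<Rightarrow> 'e \<Rightarrow> real" where
  "bump y s z = smooth_step ((norm (z - y))\<^sup>2 / s\<^sup>2)"

lemma smooth_bump: "smooth_on UNIV (bump y s)"
proof -
  have "smooth_on UNIV (\<lambda>z. (norm (z - y))\<^sup>2 * inverse (s\<^sup>2))"
    by (intro smooth_on_mult smooth_norm_sq smooth_on_const) auto
  then show ?thesis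
    unfolding bump_def by (intro smooth_on_compose[OF _ _ _ smooth_smooth_step]) (auto simp: divide_inverse)
qed

lemma bump_bounds: "0 \<le> bump y s z" "bump y s z \<le> 1"
  by (simp_all add: bump_def smooth_step_bounds)

lemma bump_eq_1: "0 < s \<Longrightarrow> norm (z - y) \<le> s \<Longrightarrow> bump y s z = 1"
  unfolding bump_def by (rule smooth_step_eq_1) (simp add: power_mono)

lemma bump_eq_0: "0 < s \<Longrightarrow> 2 * s \<le> norm (z - y) \<Longrightarrow> bump y s z = 0"
proof -
  assume s: "0 < s" "2 * s \<le> norm (z - y)"
  then have "(2 * s)\<^sup>2 \<le> (norm (z - y))\<^sup>2" by (intro power_mono) auto
  moreover have "(2 * s)\<^sup>2 = 4 * s\<^sup>2" by (simp add: power2_eq_square)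
  ultimately have "2 * s\<^sup>2 \<le> (norm (z - y))\<^sup>2" using zero_le_power2[of s] by linarith
  then have "2 \<le> (norm (z - y))\<^sup>2 / s\<^sup>2" using s by (simp add: pos_le_divide_eq)
  then show ?thesis unfolding bump_def by (rule smooth_step_eq_0)
qed

lemma bump_has_derivative:
  assumes "\<And>t. (smooth_step has_real_derivative s' t) (at t)"
  shows "(bump y s has_derivative (\<lambda>v. ((2 * s' ((norm (z - y))\<^sup>2 / s\<^sup>2) / s\<^sup>2) *\<^sub>R (z - y)) \<bullet> v)) (at z)"
proof -
  let ?q = "\<lambda>z. (norm (z - y))\<^sup>2 / s\<^sup>2"
  have "(?q has_derivative (\<lambda>v. (2 * ((z - y) \<bullet> v)) / s\<^sup>2)) (at z)"
    unfolding power2_norm_eq_inner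
    by (auto intro!: derivative_eq_intros simp: inner_commute fun_eq_iff divide_inverse)
  from has_derivative_compose[OF this assms[unfolded has_field_derivative_def, of "?q z"]]
  show ?thesis unfolding bump_def[abs_def] by (simp add: mult_ac)
qed

text \<open>The average of bumps at dyadic scales. In the plane it has energy of order \<open>1 / J\<close>: the
  gradients of the summands live on disjoint annuli and have comparable energies.\<close>

definition dyadic_bump :: "nat \<Rightarrow> 'e::euclidean_space \<Rightarrow> real \<Rightarrow> 'e \<Rightarrow> real" where
  "dyadic_bump J y \<rho> z = (\<Sum>j<J. bump y (2 ^ j * \<rho>) z) * inverse (real J)"

lemma smooth_dyadic_bump: "smooth_on UNIV (dyadic_bump J y \<rho>)"
  unfolding dyadic_bump_def by (intro smooth_on_mult smooth_on_sum smooth_bump smooth_on_const) auto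

lemma dyadic_bump_eq_1: "0 < J \<Longrightarrow> 0 < \<rho> \<Longrightarrow> norm (z - y) \<le> \<rho> \<Longrightarrow> dyadic_bump J y \<rho> z = 1"
proof -
  assume *: "0 < J" "0 < \<rho>" "norm (z - y) \<le> \<rho>"
  have "bump y (2 ^ j * \<rho>) z = 1" for j
  proof (rule bump_eq_1)
    have "1 * \<rho> \<le> 2 ^ j * \<rho>" using * by (intro mult_right_mono) auto
    then show "norm (z - y) \<le> 2 ^ j * \<rho>" using * by linarith
  qed (use * in simp)
  then show ?thesis using * by (simp add: dyadic_bump_def)
qed

lemma dyadic_bump_eq_0: "0 < \<rho> \<Longrightarrow> 2 ^ J * \<rho> \<le> norm (z - y) \<Longrightarrow> dyadic_bump J y \<rho> z = 0"
proof -
  assume *: "0 < \<rho>" "2 ^ J * \<rho> \<le> norm (z - y)"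
  have "bump y (2 ^ j * \<rho>) z = 0" if "j < J" for j
  proof (rule bump_eq_0)
    have "(2::real) ^ Suc j \<le> 2 ^ J" using that by (intro power_increasing) auto
    then have "2 ^ Suc j * \<rho> \<le> 2 ^ J * \<rho>" using * by (intro mult_right_mono) auto
    then show "2 * (2 ^ j * \<rho>) \<le> norm (z - y)" using * unfolding power_Suc by linarith
  qed (use * in simp)
  then show ?thesis by (simp add: dyadic_bump_def)
qed

lemma norm_sum_at_most_one_nonzero:
  fixes v :: "'i \<Rightarrow> 'e::real_normed_vector"
  assumes "finite I" "\<And>i j. i \<in> I \<Longrightarrow> j \<in> I \<Longrightarrow> v i \<noteq> 0 \<Longrightarrow> v j \<noteq> 0 \<Longrightarrow> i = j"
  shows "(norm (\<Sum>i\<in>I. v i))\<^sup>2 = (\<Sum>i\<in>I. (norm (v i))\<^sup>2)"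
proof (cases "\<exists>k\<in>I. v k \<noteq> 0")
  case True
  then obtain k where k: "k \<in> I" "v k \<noteq> 0" by blast
  have z: "v i = 0" if "i \<in> I - {k}" for i using assms(2)[OF k(1), of i] k that by auto
  have "(\<Sum>i\<in>I. v i) = v k" "(\<Sum>i\<in>I. (norm (v i))\<^sup>2) = (norm (v k))\<^sup>2"
    using sum.remove[OF assms(1) k(1), of v] sum.remove[OF assms(1) k(1), of "\<lambda>i. (norm (v i))\<^sup>2"] z by auto
  then show ?thesis by simp
qed simp

text \<open>The derivative of the bump of width \<open>s\<close> is supported where \<open>s\<^sup>2 \<le> d\<^sup>2 \<le> 2 s\<^sup>2\<close> in terms of the distance
  \<open>d\<close> to the centre. These annuli are disjoint for distinct powers of two, so the square of the norm of
  the sum of gradients is the sum of the squares.\<close>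

lemma dyadic_bump_energy:
  fixes y :: "real ^ 'm::finite"
  assumes s': "\<And>t. (smooth_step has_real_derivative s' t) (at t)" "\<And>t. \<bar>s' t\<bar> \<le> L"
    "\<And>t. s' t \<noteq> 0 \<Longrightarrow> 1 \<le> t \<and> t \<le> 2"
    and \<rho>: "0 < \<rho>" and J: "0 < J"
  shows "(dyadic_bump J y \<rho> z)\<^sup>2 + (norm (egrad (dyadic_bump J y \<rho>) z))\<^sup>2 \<le>
    (\<Sum>j<J. (1 / real J + 8 * L\<^sup>2 / ((real J)\<^sup>2 * (2 ^ j * \<rho>)\<^sup>2)) * indicator (cball y (2 * (2 ^ j * \<rho>))) z)"
proof -
  let ?s = "\<lambda>j. 2 ^ j * \<rho>"
  define d where "d = norm (z - y)"
  define v where "v j = (2 * s' (d\<^sup>2 / (?s j)\<^sup>2) / (?s j)\<^sup>2) *\<^sub>R (z - y)" for j :: nat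
  have sp: "?s j > 0" for j :: nat using \<rho> by simp
  have e: "egrad (dyadic_bump J y \<rho>) z = inverse (real J) *\<^sub>R (\<Sum>j<J. v j)"
  proof (rule egradI)
    have "((\<lambda>z. (\<Sum>j<J. bump y (?s j) z) * inverse (real J)) has_derivative
        (\<lambda>w. (\<Sum>j<J. v j \<bullet> w) * inverse (real J))) (at z)"
      unfolding v_def d_def by (intro has_derivative_mult_left has_derivative_sum bump_has_derivative s')
    moreover have "(\<lambda>w. (\<Sum>j<J. v j \<bullet> w) * inverse (real J)) = (\<bullet>) (inverse (real J) *\<^sub>R (\<Sum>j<J. v j))"
      by (simp add: fun_eq_iff inner_sum_left mult.commute)
    ultimately have "((\<lambda>z. (\<Sum>j<J. bump y (?s j) z) * inverse (real J)) has_derivative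
        (\<bullet>) (inverse (real J) *\<^sub>R (\<Sum>j<J. v j))) (at z)" by simp
    then show "(dyadic_bump J y \<rho> has_derivative (\<bullet>) (inverse (real J) *\<^sub>R (\<Sum>j<J. v j))) (at z)"
      unfolding dyadic_bump_def[abs_def] .
  qed
  have nz: "(?s j)\<^sup>2 \<le> d\<^sup>2 \<and> d\<^sup>2 \<le> 2 * (?s j)\<^sup>2" if "v j \<noteq> 0" for j
    using s'(3)[of "d\<^sup>2 / (?s j)\<^sup>2"] that sp[of j] by (auto simp: v_def field_simps)
  \<comment> \<open>At most one annulus contains \<open>z\<close>.\<close>
  have one: "i = j" if "v i \<noteq> 0" "v j \<noteq> 0" for i j
  proof -
    have False if ij: "i < j" "v i \<noteq> 0" "v j \<noteq> 0" for i j
    proof -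
      have "(2::real) ^ Suc i \<le> 2 ^ j" using ij by (intro power_increasing) auto
      then have "2 * ?s i \<le> ?s j" using \<rho> by simp
      then have "(2 * ?s i)\<^sup>2 \<le> (?s j)\<^sup>2" using sp[of i] by (intro power_mono) auto
      moreover have "(2 * ?s i)\<^sup>2 = 4 * (?s i)\<^sup>2" by (simp add: power2_eq_square)
      moreover have "0 < (?s i)\<^sup>2" using sp[of i] by (rule zero_less_power)
      ultimately show False using nz[OF ij(2)] nz[OF ij(3)] by linarith
    qed
    with that show ?thesis by (metis nat_neq_iff)
  qed
  have vb: "(norm (v j))\<^sup>2 \<le> 8 * L\<^sup>2 / (?s j)\<^sup>2 * indicator (cball y (2 * ?s j)) z" for j
  proof (cases "v j = 0")
    case True
    then show ?thesis by simp
  next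
    case False
    note n = nz[OF False]
    have "(2 * ?s j)\<^sup>2 = 4 * (?s j)\<^sup>2" by (simp add: power2_eq_square)
    then have "d\<^sup>2 \<le> (2 * ?s j)\<^sup>2" using n zero_le_power2[of "?s j"] by linarith
    then have "d \<le> 2 * ?s j" by (rule power2_le_imp_le) (use sp[of j] in simp)
    then have ind: "indicator (cball y (2 * ?s j)) z = (1::real)" by (simp add: d_def dist_norm norm_minus_commute)
    have "(norm (v j))\<^sup>2 = 4 * (s' (d\<^sup>2 / (?s j)\<^sup>2))\<^sup>2 * d\<^sup>2 / ((?s j)\<^sup>2)\<^sup>2"
      by (simp add: v_def d_def[symmetric] power_mult_distrib power_divide)
    also have "\<dots> \<le> 4 * L\<^sup>2 * (2 * (?s j)\<^sup>2) / ((?s j)\<^sup>2)\<^sup>2"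
      using n s'(2)[of "d\<^sup>2 / (?s j)\<^sup>2"]
      by (intro divide_right_mono mult_mono) (auto simp: abs_le_square_iff[symmetric] intro: order_trans[OF _ abs_ge_self])
    also have "\<dots> = 8 * L\<^sup>2 / (?s j)\<^sup>2" using sp[of j] by (simp add: power2_eq_square)
    finally show ?thesis using ind by simp
  qed
  have b1: "dyadic_bump J y \<rho> z \<le> 1" "0 \<le> dyadic_bump J y \<rho> z"
  proof -
    have "(\<Sum>j<J. bump y (?s j) z) \<le> (\<Sum>j<J. 1)" by (intro sum_mono bump_bounds)
    then have "(\<Sum>j<J. bump y (?s j) z) * inverse (real J) \<le> real J * inverse (real J)"
      by (intro mult_right_mono) auto
    then show "dyadic_bump J y \<rho> z \<le> 1" using J by (simp add: dyadic_bump_def)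
    show "0 \<le> dyadic_bump J y \<rho> z" unfolding dyadic_bump_def by (intro mult_nonneg_nonneg sum_nonneg bump_bounds) auto
  qed
  have bb: "bump y (?s j) z \<le> indicator (cball y (2 * ?s j)) z" for j
    using bump_bounds(2)[of y "?s j" z] bump_eq_0[OF sp[of j], of z y]
    by (auto simp: indicator_def dist_norm norm_minus_commute)
  have "(dyadic_bump J y \<rho> z)\<^sup>2 \<le> dyadic_bump J y \<rho> z"
    using mult_left_mono[OF b1] by (simp add: power2_eq_square)
  also have "\<dots> \<le> (\<Sum>j<J. 1 / real J * indicator (cball y (2 * ?s j)) z)"
    unfolding dyadic_bump_def sum_distrib_right using J
    by (intro sum_mono) (use bb in \<open>auto simp: divide_inverse mult.commute intro!: mult_right_mono\<close>)
  finally have 1: "(dyadic_bump J y \<rho> z)\<^sup>2 \<le> (\<Sum>j<J. 1 / real J * indicator (cball y (2 * ?s j)) z)" .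
  have "(norm (egrad (dyadic_bump J y \<rho>) z))\<^sup>2 = (inverse (real J))\<^sup>2 * (\<Sum>j<J. (norm (v j))\<^sup>2)"
    unfolding e using norm_sum_at_most_one_nonzero[of "{..<J}" v] one by (simp add: power_mult_distrib)
  also have "\<dots> \<le> (inverse (real J))\<^sup>2 * (\<Sum>j<J. 8 * L\<^sup>2 / (?s j)\<^sup>2 * indicator (cball y (2 * ?s j)) z)"
    by (intro mult_left_mono sum_mono vb) auto
  finally have 2: "(norm (egrad (dyadic_bump J y \<rho>) z))\<^sup>2 \<le>
      (\<Sum>j<J. 8 * L\<^sup>2 / ((real J)\<^sup>2 * (?s j)\<^sup>2) * indicator (cball y (2 * ?s j)) z)"
    unfolding sum_distrib_left by (simp add: divide_inverse mult_ac power_inverse)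
  show ?thesis using add_mono[OF 1 2] by (simp add: sum.distrib distrib_right)
qed

lemma nn_integral_sum_indicator:
  fixes a :: "'i \<Rightarrow> ennreal"
  assumes "\<And>j. B j \<in> sets M"
  shows "(\<integral>\<^sup>+ z. (\<Sum>j\<in>J. a j * indicator (B j) z) \<partial>M) = (\<Sum>j\<in>J. a j * emeasure M (B j))"
  using assms by (subst nn_integral_sum) (auto simp: nn_integral_cmult_indicator)

context closed_riemannian
begin

text \<open>Test the trace inequality with the averaged bump, which is \<open>1\<close> on the ball, and integrate the
  pointwise energy bound.\<close>

lemma ball_measure_le_dyadic:
  assumes s': "\<And>t. (smooth_step has_real_derivative s' t) (at t)" "\<And>t. \<bar>s' t\<bar> \<le> L"
    "\<And>t. s' t \<noteq> 0 \<Longrightarrow> 1 \<le> t \<and> t \<le> 2"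
    and gd: "good K c y R" and \<mu>: "smooth_trace \<mu> N"
    and \<rho>: "0 < \<rho>" and J: "0 < J" and JR: "2 ^ J * \<rho> \<le> 2 * R"
  shows "measure \<mu> (param c ` cball y \<rho>) \<le> N * (K\<^sup>2 * (\<Sum>j<J. (1 / real J + 8 * L\<^sup>2 / ((real J)\<^sup>2 * (2 ^ j * \<rho>)\<^sup>2)) *
      (unit_ball_vol (real CARD('m)) * (2 * (2 ^ j * \<rho>)) ^ CARD('m))))"
proof -
  let ?\<phi> = "dyadic_bump J y \<rho>" and ?a = "\<lambda>j. 1 / real J + 8 * L\<^sup>2 / ((real J)\<^sup>2 * (2 ^ j * \<rho>)\<^sup>2)"
    and ?B = "\<lambda>j. cball y (2 * (2 ^ j * \<rho>))"
  let ?f = "in_chart c ?\<phi>"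
  let ?T = "\<Sum>j<J. ?a j * (unit_ball_vol (real CARD('m)) * (2 * (2 ^ j * \<rho>)) ^ CARD('m))"
  have c: "c \<in> A" and R: "R > 0" and K: "1 \<le> K" and sub3: "cball y (3 * R) \<subseteq> im c" using gd by (auto simp: good_def)
  have Bm: "?B j \<in> sets borel" for j by (rule borel_closed) (rule closed_cball)
  have a0: "0 \<le> ?a j" for j by simp
  have T0: "0 \<le> ?T" using a0 \<rho> by (intro sum_nonneg mult_nonneg_nonneg) auto
  have supp: "?\<phi> z = 0" if "z \<notin> cball y (2 * R)" for z
    using that JR by (intro dyadic_bump_eq_0 \<rho>) (auto simp: dist_norm norm_minus_commute)
  note en = in_chart_energy[OF gd smooth_dyadic_bump supp]
  have "\<rho> \<le> 2 ^ J * \<rho>" using \<rho> mult_right_mono[of 1 "2 ^ J" \<rho>] by simp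
  then have "\<rho> \<le> 2 * R" using JR by simp
  then have sub: "cball y \<rho> \<subseteq> im c" using sub3 R by (intro order_trans[OF subset_cball sub3]) auto
  have pB: "param c ` cball y \<rho> \<in> sets borel" by (rule param_image_borel[OF c _ sub]) auto
  have f1: "?f p = 1" if p: "p \<in> param c ` cball y \<rho>" for p
  proof -
    obtain z where z: "z \<in> cball y \<rho>" "p = param c z" using p by blast
    have zi: "z \<in> im c" using z sub by blast
    have "?f (param c z) = ?\<phi> z" using param_in[OF c zi] coord_param[OF c zi] by (simp add: in_chart_def)
    also have "\<dots> = 1" using z \<rho> J by (intro dyadic_bump_eq_1) (auto simp: dist_norm norm_minus_commute)
    finally show ?thesis using z by simp
  qed
  have sets: "sets \<mu> = sets borel" and fin: "finite_measure \<mu>" and N: "0 \<le> N" and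
    tr: "(\<integral>\<^sup>+ p. ennreal ((?f p)\<^sup>2) \<partial>\<mu>) \<le> ennreal (N * (h1n ?f)\<^sup>2)"
    using \<mu> en(2) by (auto simp: smooth_trace_def finite_borel_measure_def)
  have "ennreal ((h1n ?f)\<^sup>2) \<le>
      ennreal (K\<^sup>2) * (\<integral>\<^sup>+ z. ennreal ((?\<phi> z)\<^sup>2 + (norm (egrad ?\<phi> z))\<^sup>2) * indicator (cball y (2 * R)) z \<partial>lborel)"
    by (rule en(1))
  also have "\<dots> \<le> ennreal (K\<^sup>2) * (\<integral>\<^sup>+ z. (\<Sum>j<J. ennreal (?a j) * indicator (?B j) z) \<partial>lborel)"
  proof (intro mult_left_mono nn_integral_mono)
    fix z
    have "ennreal ((?\<phi> z)\<^sup>2 + (norm (egrad ?\<phi> z))\<^sup>2) * indicator (cball y (2 * R)) z \<le> ennreal ((?\<phi> z)\<^sup>2 + (norm (egrad ?\<phi> z))\<^sup>2)"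
      by (auto simp: indicator_def)
    also have "\<dots> \<le> ennreal (\<Sum>j<J. ?a j * indicator (?B j) z)"
      by (rule ennreal_leI, rule dyadic_bump_energy[OF s' \<rho> J])
    also have "\<dots> = (\<Sum>j<J. ennreal (?a j * indicator (?B j) z))"
      by (rule sum_ennreal[symmetric]) (intro mult_nonneg_nonneg a0, simp)
    also have "\<dots> = (\<Sum>j<J. ennreal (?a j) * indicator (?B j) z)"
      by (intro sum.cong refl) (auto simp: indicator_def)
    finally show "ennreal ((?\<phi> z)\<^sup>2 + (norm (egrad ?\<phi> z))\<^sup>2) * indicator (cball y (2 * R)) z \<le>
      (\<Sum>j<J. ennreal (?a j) * indicator (?B j) z)" .
  qed simp
  also have "(\<integral>\<^sup>+ z. (\<Sum>j<J. ennreal (?a j) * indicator (?B j) z) \<partial>lborel) = (\<Sum>j<J. ennreal (?a j) * emeasure lborel (?B j))"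
    by (rule nn_integral_sum_indicator) (unfold sets_lborel, rule Bm)
  also have "\<dots> = (\<Sum>j<J. ennreal (?a j * (unit_ball_vol (real CARD('m)) * (2 * (2 ^ j * \<rho>)) ^ CARD('m))))"
    using \<rho> by (intro sum.cong refl) (simp add: emeasure_cball ennreal_mult' a0 del: ennreal_plus)
  also have "\<dots> = ennreal ?T"
    using a0 \<rho> by (intro sum_ennreal mult_nonneg_nonneg) auto
  also have "ennreal (K\<^sup>2) * ennreal ?T = ennreal (K\<^sup>2 * ?T)" by (simp add: ennreal_mult')
  finally have h: "(h1n ?f)\<^sup>2 \<le> K\<^sup>2 * ?T" using T0 by (subst (asm) ennreal_le_iff) auto
  have "ennreal (measure \<mu> (param c ` cball y \<rho>)) = emeasure \<mu> (param c ` cball y \<rho>)"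
    using finite_measure.emeasure_eq_measure[OF fin] by simp
  also have "\<dots> = (\<integral>\<^sup>+ p. indicator (param c ` cball y \<rho>) p \<partial>\<mu>)"
    using pB sets by (intro nn_integral_indicator[symmetric]) simp
  also have "\<dots> \<le> (\<integral>\<^sup>+ p. ennreal ((?f p)\<^sup>2) \<partial>\<mu>)"
    using f1 by (intro nn_integral_mono) (auto simp: indicator_def)
  also have "\<dots> \<le> ennreal (N * (h1n ?f)\<^sup>2)" by (rule tr)
  also have "\<dots> \<le> ennreal (N * (K\<^sup>2 * ?T))" by (intro ennreal_leI mult_left_mono h N)
  finally show ?thesis using N T0 by (subst (asm) ennreal_le_iff) auto
qed

definition growth_gauge :: "real \<Rightarrow> real \<Rightarrow> real" where
  "growth_gauge r \<rho> = (if CARD('m) \<ge> 3 then \<rho> ^ (CARD('m) - 2) else inverse (1 + ln (r / \<rho>)))"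

text \<open>For \<open>m \<ge> 3\<close> one bump suffices. In the plane take the largest \<open>J\<close> with \<open>2\<^sup>J \<rho> \<le> r\<close>.
  It is at least a third of \<open>1 + log (r / \<rho>)\<close>, the gradients contribute \<open>1 / J\<close> altogether,
  and the squares of the functions contribute a geometric sum divided by \<open>J\<close>.\<close>

lemma ball_growth:
  assumes m: "CARD('m) \<ge> 2" and K: "1 \<le> K" and r: "0 < r"
  obtains C where "0 < C"
    "\<And>c y \<mu> N \<rho>. good K c y r \<Longrightarrow> smooth_trace \<mu> N \<Longrightarrow> 0 < \<rho> \<Longrightarrow> \<rho> \<le> r / 4 \<Longrightarrow>
      measure \<mu> (param c ` cball y \<rho>) \<le> C * N * growth_gauge r \<rho>"
proof -
  obtain s' L where s': "\<And>t. (smooth_step has_real_derivative s' t) (at t)" "\<And>t. \<bar>s' t\<bar> \<le> L"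
    "\<And>t. s' t \<noteq> 0 \<Longrightarrow> 1 \<le> t \<and> t \<le> 2" "0 < L" using smooth_step_derivative by blast
  let ?\<omega> = "unit_ball_vol (real CARD('m))"
  have w: "0 < ?\<omega>" by simp
  define C where "C = 12 * 2 ^ CARD('m) * ?\<omega> * K\<^sup>2 * (r\<^sup>2 + 8 * L\<^sup>2)"
  have C: "0 < C" unfolding C_def using w K r s'(4) by (intro mult_pos_pos add_pos_pos) auto
  have "measure \<mu> (param c ` cball y \<rho>) \<le> C * N * growth_gauge r \<rho>"
    if gd: "good K c y r" and \<mu>: "smooth_trace \<mu> N" and \<rho>: "0 < \<rho>" "\<rho> \<le> r / 4" for c y \<mu> N \<rho>
  proof -
    have N: "0 \<le> N" using \<mu> by (simp add: smooth_trace_def)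
    show ?thesis
    proof (cases "CARD('m) \<ge> 3")
      case True
      define k where "k = CARD('m) - 2"
      have cm: "CARD('m) = k + 2" using m by (simp add: k_def)
      have "measure \<mu> (param c ` cball y \<rho>) \<le> N * (K\<^sup>2 * ((1 + 8 * L\<^sup>2 / \<rho>\<^sup>2) * (?\<omega> * (2 * \<rho>) ^ CARD('m))))"
        using ball_measure_le_dyadic[OF s'(1-3) gd \<mu> \<rho>(1), of 1] \<rho> r by simp
      also have "(1 + 8 * L\<^sup>2 / \<rho>\<^sup>2) * (?\<omega> * (2 * \<rho>) ^ CARD('m)) = ?\<omega> * 2 ^ CARD('m) * (\<rho>\<^sup>2 + 8 * L\<^sup>2) * \<rho> ^ k"
        using \<rho> unfolding cm by (simp add: power_mult_distrib power_add field_simps power2_eq_square)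
      also have "N * (K\<^sup>2 * (?\<omega> * 2 ^ CARD('m) * (\<rho>\<^sup>2 + 8 * L\<^sup>2) * \<rho> ^ k)) \<le>
          N * (K\<^sup>2 * (?\<omega> * 2 ^ CARD('m) * (12 * (r\<^sup>2 + 8 * L\<^sup>2)) * \<rho> ^ k))"
      proof -
        have "\<rho>\<^sup>2 \<le> r\<^sup>2" using \<rho> r by (intro power_mono) auto
        then have "\<rho>\<^sup>2 + 8 * L\<^sup>2 \<le> 12 * (r\<^sup>2 + 8 * L\<^sup>2)" by (simp add: algebra_simps) (use zero_le_power2[of L] zero_le_power2[of r] in linarith)
        then show ?thesis using N w \<rho> by (intro mult_left_mono mult_right_mono) auto
      qed
      also have "\<dots> = C * N * growth_gauge r \<rho>" using True by (simp add: C_def growth_gauge_def k_def)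
      finally show ?thesis .
    next
      case False
      then have cm: "CARD('m) = 2" using m by simp
      have "\<exists>n::nat. r < 2 ^ n * \<rho>"
        using real_arch_pow[of 2 "r / \<rho>"] \<rho> by (auto simp: field_simps)
      then obtain n where n: "r < 2 ^ n * \<rho>" "\<And>j. j < n \<Longrightarrow> 2 ^ j * \<rho> \<le> r"
        using exists_least_iff[of "\<lambda>n. r < 2 ^ n * \<rho>"] not_less by metis
      have "n \<ge> 2"
      proof (rule ccontr)
        assume "\<not> n \<ge> 2"
        then have "n = 0 \<or> n = 1" by auto
        then show False using n(1) \<rho> by auto
      qed
      define J where "J = n - 1"
      have nJ: "n = Suc J" using \<open>n \<ge> 2\<close> by (simp add: J_def)
      have J: "0 < J" "2 ^ J * \<rho> \<le> r" "r < 2 * 2 ^ J * \<rho>"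
        using \<open>n \<ge> 2\<close> n(1) n(2)[of J] unfolding nJ by simp_all
      have p4: "(2 ^ j * \<rho>)\<^sup>2 = 4 ^ j * \<rho>\<^sup>2" for j :: nat
        by (simp add: power_mult_distrib) (simp add: power2_eq_square flip: power_mult_distrib)
      have geo: "(\<Sum>j<J. (4::real) ^ j) \<le> 4 ^ J"
      proof (induction J)
        case (Suc J)
        have "(0::real) \<le> 4 ^ J" by simp
        then show ?case using Suc unfolding sum.lessThan_Suc power_Suc by linarith
      qed simp
      have sq: "(\<Sum>j<J. (2 ^ j * \<rho>)\<^sup>2) \<le> r\<^sup>2"
      proof -
        have "(\<Sum>j<J. (2 ^ j * \<rho>)\<^sup>2) = (\<Sum>j<J. 4 ^ j) * \<rho>\<^sup>2"
          unfolding p4 by (simp add: sum_distrib_right)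
        also have "\<dots> \<le> 4 ^ J * \<rho>\<^sup>2" by (intro mult_right_mono geo) auto
        also have "\<dots> = (2 ^ J * \<rho>)\<^sup>2" unfolding p4 ..
        also have "\<dots> \<le> r\<^sup>2" using J \<rho> by (intro power_mono) auto
        finally show ?thesis .
      qed
      have "(\<Sum>j<J. (1 / real J + 8 * L\<^sup>2 / ((real J)\<^sup>2 * (2 ^ j * \<rho>)\<^sup>2)) * (?\<omega> * (2 * (2 ^ j * \<rho>)) ^ CARD('m)))
        = (\<Sum>j<J. 4 * ?\<omega> / real J * (2 ^ j * \<rho>)\<^sup>2 + 4 * ?\<omega> * 8 * L\<^sup>2 / (real J)\<^sup>2)"
        unfolding cm using \<rho> J by (intro sum.cong refl) (simp add: field_simps power2_eq_square)
      also have "\<dots> = 4 * ?\<omega> / real J * (\<Sum>j<J. (2 ^ j * \<rho>)\<^sup>2) + 4 * ?\<omega> * 8 * L\<^sup>2 / real J"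
        using J by (simp add: sum.distrib sum_distrib_left power2_eq_square)
      also have "\<dots> \<le> 4 * ?\<omega> / real J * r\<^sup>2 + 4 * ?\<omega> * 8 * L\<^sup>2 / real J"
        using sq w by (intro add_right_mono mult_left_mono) auto
      also have "\<dots> = 4 * ?\<omega> * (r\<^sup>2 + 8 * L\<^sup>2) * (1 / real J)"
        by (simp add: divide_inverse algebra_simps)
      finally have T: "(\<Sum>j<J. (1 / real J + 8 * L\<^sup>2 / ((real J)\<^sup>2 * (2 ^ j * \<rho>)\<^sup>2)) * (?\<omega> * (2 * (2 ^ j * \<rho>)) ^ CARD('m)))
        \<le> 4 * ?\<omega> * (r\<^sup>2 + 8 * L\<^sup>2) * (1 / real J)" .
      have rr: "r / \<rho> \<ge> 4" using \<rho> by (simp add: field_simps)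
      have "ln (r / \<rho>) \<le> ln (2 ^ Suc J)"
        using J \<rho> r by (subst ln_le_cancel_iff) (auto simp: field_simps)
      also have "\<dots> = real (Suc J) * ln 2" by (rule ln_realpow)
      also have "\<dots> \<le> real (Suc J) * 1" using ln_2_less_1 by (intro mult_left_mono) auto
      finally have l: "1 + ln (r / \<rho>) \<le> 3 * real J" using J by simp
      moreover have lp: "0 < 1 + ln (r / \<rho>)" using rr by (intro add_pos_nonneg) auto
      ultimately have "1 / real J \<le> 3 * inverse (1 + ln (r / \<rho>))" using J by (simp add: field_simps)
      then have "4 * ?\<omega> * (r\<^sup>2 + 8 * L\<^sup>2) * (1 / real J) \<le> 4 * ?\<omega> * (r\<^sup>2 + 8 * L\<^sup>2) * (3 * inverse (1 + ln (r / \<rho>)))"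
        using w by (intro mult_left_mono mult_nonneg_nonneg) auto
      then have "(\<Sum>j<J. (1 / real J + 8 * L\<^sup>2 / ((real J)\<^sup>2 * (2 ^ j * \<rho>)\<^sup>2)) * (?\<omega> * (2 * (2 ^ j * \<rho>)) ^ CARD('m)))
        \<le> 4 * 4 * ?\<omega> * (r\<^sup>2 + 8 * L\<^sup>2) * (3 * inverse (1 + ln (r / \<rho>)))"
      proof -
        have "0 \<le> 4 * ?\<omega> * (r\<^sup>2 + 8 * L\<^sup>2) * (3 * inverse (1 + ln (r / \<rho>)))"
          using w lp by (intro mult_nonneg_nonneg) auto
        then show ?thesis using T \<open>4 * ?\<omega> * (r\<^sup>2 + 8 * L\<^sup>2) * (1 / real J) \<le> _\<close> by linarith
      qed
      then have "N * (K\<^sup>2 * (\<Sum>j<J. (1 / real J + 8 * L\<^sup>2 / ((real J)\<^sup>2 * (2 ^ j * \<rho>)\<^sup>2)) * (?\<omega> * (2 * (2 ^ j * \<rho>)) ^ CARD('m))))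
        \<le> N * (K\<^sup>2 * (4 * 4 * ?\<omega> * (r\<^sup>2 + 8 * L\<^sup>2) * (3 * inverse (1 + ln (r / \<rho>)))))"
        using N by (intro mult_left_mono) auto
      also have "\<dots> = C * N * growth_gauge r \<rho>" unfolding C_def growth_gauge_def cm by simp
      finally show ?thesis
        using ball_measure_le_dyadic[OF s'(1-3) gd \<mu> \<rho>(1) J(1)] J(2) r by simp
    qed
  qed
  with C show ?thesis using that by blast
qed

end


section \<open>Riemannian distance and coordinate distance\<close>

context closed_riemannian
begin

text \<open>The chart used to define the speed is arbitrary; the transformation law of the metric allows any
  other chart around the point.\<close>

lemma speed_chart:
  assumes c: "c \<in> A" and U: "open U" "t \<in> U" "\<gamma> ` U \<subseteq> dom c"
    and cont: "continuous (at t) \<gamma>"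
    and D: "((coord c \<circ> \<gamma>) has_vector_derivative v) (at t)"
  shows "speed A g \<gamma> t = sqrt (v \<bullet> (g c (\<gamma> t) *v v))"
proof -
  let ?c' = "chart_at A (\<gamma> t)"
  have c': "?c' \<in> A" "\<gamma> t \<in> dom ?c'" by (rule chart_at)+
  have gt: "\<gamma> t \<in> dom c" using U by blast
  let ?J = "jac c ?c' (\<gamma> t)"
  have T: "((coord ?c' \<circ> param c) has_derivative (*v) ?J) (at ((coord c \<circ> \<gamma>) t))"
    unfolding comp_def[of "coord c"] by (rule transition_has_derivative[OF c c'(1) gt c'(2)])
  have "((\<lambda>s. (coord ?c' \<circ> param c) ((coord c \<circ> \<gamma>) s)) has_derivative (\<lambda>h. ?J *v (h *\<^sub>R v))) (at t)"
    by (rule has_derivative_compose[OF D[unfolded has_vector_derivative_def] T])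
  then have "((\<lambda>s. (coord ?c' \<circ> param c) ((coord c \<circ> \<gamma>) s)) has_vector_derivative ?J *v v) (at t)"
    by (simp add: has_vector_derivative_def matrix_vector_mult_scaleR)
  then have "((coord ?c' \<circ> \<gamma>) has_vector_derivative ?J *v v) (at t)"
  proof (rule has_vector_derivative_transform_within_open[OF _ U(1,2)])
    fix s assume "s \<in> U"
    then have "param c (coord c (\<gamma> s)) = \<gamma> s" using U by (intro param_coord[OF c]) blast
    then show "(coord ?c' \<circ> param c) ((coord c \<circ> \<gamma>) s) = (coord ?c' \<circ> \<gamma>) s" by simp
  qed
  then have "vector_derivative (coord ?c' \<circ> \<gamma>) (at t) = ?J *v v"
    by (rule vector_derivative_at)
  then show ?thesis
    unfolding speed_def Let_def metric_law_vec[OF c c'(1) gt c'(2)] by simp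
qed

text \<open>Integrate the velocity in coordinates, whose norm is at most \<open>sqrt K\<close> times the speed because the
  curve stays in a good ball.\<close>

lemma coord_displacement_le:
  assumes gd: "good K c y R" and \<gamma>: "pw_C1_curve A \<gamma>" and t: "0 \<le> t" "t \<le> 1"
    and stay: "\<And>u. u \<in> {0..t} \<Longrightarrow> \<gamma> u \<in> param c ` cball y (3 * R)"
  shows "ennreal (norm (coord c (\<gamma> t) - coord c (\<gamma> 0)) / sqrt K) \<le> curve_length A g \<gamma>"
proof -
  let ?h = "coord c \<circ> \<gamma>"
  have c: "c \<in> A" and K: "1 \<le> K" and sub: "cball y (3 * R) \<subseteq> im c" using gd by (auto simp: good_def)
  have "param c ` cball y (3 * R) \<subseteq> dom c" using param_in[OF c] sub by blast
  then have in_dom: "\<gamma> ` {0..t} \<subseteq> dom c" using stay by blast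
  have contg: "continuous_on {0..1} \<gamma>" using \<gamma> by (simp add: pw_C1_curve_def)
  have "?h piecewise_C1_differentiable_on {0..t}"
    using \<gamma> c t in_dom unfolding pw_C1_curve_def by auto
  then obtain S where S: "finite S" "?h C1_differentiable_on ({0..t} - S)" and conth: "continuous_on {0..t} ?h"
    unfolding piecewise_C1_differentiable_on_def by blast
  then obtain D where D: "\<And>u. u \<in> {0..t} - S \<Longrightarrow> (?h has_vector_derivative D u) (at u)"
    and contD: "continuous_on ({0..t} - S) D" unfolding C1_differentiable_on_def by blast
  let ?U = "{0<..<t} - S"
  have oU: "open ?U" using S(1) by (intro open_Diff finite_imp_closed) auto
  define F where "F u = indicator ?U u *\<^sub>R D u" for u
  have Fm: "F \<in> borel_measurable borel"
    unfolding F_def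
  proof (rule borel_measurable_continuous_on_indicator)
    show "?U \<in> sets borel" using oU by (rule borel_open)
    show "continuous_on ?U D" by (rule continuous_on_subset[OF contD]) auto
  qed
  have bound: "ennreal (norm (F u) / sqrt K) \<le> ennreal (speed A g \<gamma> u) * indicator {0..1} u" for u
  proof (cases "u \<in> ?U")
    case True
    then have u: "u \<in> {0..t} - S" "u \<in> {0..1}" using t by auto
    obtain z where z: "z \<in> cball y (3 * R)" "\<gamma> u = param c z" using stay[of u] u by blast
    have "continuous (at u) \<gamma>"
      using contg True t by (intro continuous_on_interior[OF contg]) auto
    then have sp: "speed A g \<gamma> u = sqrt (D u \<bullet> (g c (\<gamma> u) *v D u))"
      using speed_chart[OF c oU True _ _ D[OF u(1)]] in_dom by fastforce
    have "(norm (D u))\<^sup>2 / K \<le> D u \<bullet> (g c (\<gamma> u) *v D u)"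
      unfolding z(2) using gd z(1) unfolding good_def by blast
    then have "sqrt ((norm (D u))\<^sup>2 / K) \<le> speed A g \<gamma> u" unfolding sp by (rule real_sqrt_le_mono)
    then have "norm (D u) / sqrt K \<le> speed A g \<gamma> u" by (simp add: real_sqrt_divide)
    then show ?thesis using True u by (simp add: F_def ennreal_leI)
  qed (simp add: F_def)
  have le: "(\<integral>\<^sup>+ u. ennreal (norm (F u) / sqrt K) \<partial>lborel) \<le> curve_length A g \<gamma>"
    unfolding curve_length_def by (intro nn_integral_mono bound)
  have eq: "(\<integral>\<^sup>+ u. ennreal (norm (F u) / sqrt K) \<partial>lborel) = ennreal (1 / sqrt K) * (\<integral>\<^sup>+ u. ennreal (norm (F u)) \<partial>lborel)"
    using K Fm by (subst nn_integral_cmult[symmetric]) (auto simp: ennreal_mult'[symmetric] intro!: nn_integral_cong)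
  show ?thesis
  proof (cases "(\<integral>\<^sup>+ u. ennreal (norm (F u)) \<partial>lborel) = \<infinity>")
    case True
    then have "curve_length A g \<gamma> = \<infinity>" using le K unfolding eq by (simp add: ennreal_mult_top top_unique)
    then show ?thesis by simp
  next
    case False
    then have int: "integrable lborel F" using Fm by (intro integrableI_bounded) (auto simp: less_top)
    have "(F has_integral ?h t - ?h 0) {0..t}"
    proof (rule fundamental_theorem_of_calculus_interior_strong[OF S(1) t(1) _ conth])
      show "(?h has_vector_derivative F u) (at u)" if "u \<in> {0<..<t} - S" for u
        using D[of u] that by (simp add: F_def)
    qed
    then have "(F has_integral ?h t - ?h 0) UNIV"
      by (rule has_integral_on_superset) (auto simp: F_def)
    then have "?h t - ?h 0 = integral\<^sup>L lborel F"
      using has_integral_integral_lborel[OF int] has_integral_unique by blast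
    then have n: "ennreal (norm (?h t - ?h 0)) \<le> (\<integral>\<^sup>+ u. ennreal (norm (F u)) \<partial>lborel)"
      using integral_norm_bound_ennreal[OF int] by simp
    have "ennreal (norm (?h t - ?h 0) / sqrt K) = ennreal (1 / sqrt K) * ennreal (norm (?h t - ?h 0))"
      using K by (simp add: ennreal_mult'[symmetric])
    also have "\<dots> \<le> ennreal (1 / sqrt K) * (\<integral>\<^sup>+ u. ennreal (norm (F u)) \<partial>lborel)"
      by (intro mult_left_mono n) simp
    also have "\<dots> \<le> curve_length A g \<gamma>" using le unfolding eq .
    finally show ?thesis by simp
  qed
qed

text \<open>A continuity argument: a curve from the centre that is shorter than \<open>\<rho>\<close> cannot leave the
  coordinate ball of radius \<open>sqrt K * \<rho>\<close>, since up to the first exit time its displacement is bounded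
  by its length.\<close>

lemma riem_ball_subset:
  assumes gd: "good K c y R" and \<rho>: "0 < \<rho>" "sqrt K * \<rho> \<le> 3 * R" 
  shows "riem_ball A g (param c y) \<rho> \<subseteq> param c ` ball y (sqrt K * \<rho>)"
proof
  fix q assume "q \<in> riem_ball A g (param c y) \<rho>"
  then have "riem_dist A g (param c y) q < ennreal \<rho>" by (simp add: riem_ball_def)
  then obtain \<gamma> where \<gamma>: "pw_C1_curve A \<gamma>" "\<gamma> 0 = param c y" "\<gamma> 1 = q" "curve_length A g \<gamma> < ennreal \<rho>"
    unfolding riem_dist_def INF_less_iff by blast
  have c: "c \<in> A" and K: "1 \<le> K" and R: "0 < R" and sub: "cball y (3 * R) \<subseteq> im c" using gd by (auto simp: good_def)
  obtain l where l: "0 \<le> l" "curve_length A g \<gamma> = ennreal l" using \<gamma>(4) by (cases "curve_length A g \<gamma>") auto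
  then have l\<rho>: "l < \<rho>" using \<gamma>(4) by (simp add: ennreal_less_iff)
  let ?r = "sqrt K * \<rho>" and ?s = "sqrt K * l"
  have sr: "?s < ?r" "0 < ?r" "0 \<le> ?s" using l\<rho> K \<rho> l by auto
  have rsub: "cball y ?r \<subseteq> cball y (3 * R)" using \<rho>(2) by (rule subset_cball)
  have bsub: "ball y ?r \<subseteq> cball y (3 * R)" using rsub ball_subset_cball by blast
  let ?U = "param c ` ball y ?r" and ?V = "param c ` cball y ?s"
  have oU: "open ?U" by (rule open_param_image[OF c]) (use bsub sub in auto)
  have "cball y ?s \<subseteq> ball y ?r" using sr by auto
  then have VU: "?V \<subseteq> ?U" by blast
  have clV: "closed ?V"
    by (intro compact_imp_closed compact_param_image c compact_cball) (use \<open>cball y ?s \<subseteq> ball y ?r\<close> bsub sub in blast)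
  have contg: "continuous_on {0..1} \<gamma>" using \<gamma>(1) by (simp add: pw_C1_curve_def)
  have yi: "y \<in> im c" using sub R by auto
  have start: "\<gamma> 0 \<in> ?U" unfolding \<gamma>(2) using sr by (intro imageI) simp
  \<comment> \<open>As long as the curve has stayed in the big ball, the length bound keeps it in the smaller closed ball.\<close>
  have inV: "\<gamma> t \<in> ?V" if t: "0 \<le> t" "t \<le> 1" and stay: "\<And>u. u \<in> {0..t} \<Longrightarrow> \<gamma> u \<in> ?U" for t
  proof -
    have "ennreal (norm (coord c (\<gamma> t) - coord c (\<gamma> 0)) / sqrt K) \<le> ennreal l"
      unfolding l(2)[symmetric] by (rule coord_displacement_le[OF gd \<gamma>(1) t]) (use stay bsub in blast)
    then have "norm (coord c (\<gamma> t) - coord c (\<gamma> 0)) \<le> ?s"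
      using l(1) K by (simp add: ennreal_le_iff pos_divide_le_eq mult.commute)
    then have "norm (coord c (\<gamma> t) - y) \<le> ?s" unfolding \<gamma>(2) coord_param[OF c yi] .
    moreover have "?U \<subseteq> dom c" using param_in[OF c] bsub sub by blast
    then have "\<gamma> t \<in> dom c" using stay[of t] t(1) by (meson atLeastAtMost_iff order_refl subsetD)
    ultimately show ?thesis by (intro in_param_image[OF c]) (auto simp: dist_norm norm_minus_commute)
  qed
  have "\<gamma> t \<in> ?U" if t: "t \<in> {0..1}" for t
  proof (rule ccontr)
    assume nt: "\<gamma> t \<notin> ?U"
    \<comment> \<open>The first exit time is the infimum of this closed set.\<close>
    define B where "B = {0..1} \<inter> \<gamma> -` (- ?U)"
    have "closed B" unfolding B_def
      by (rule continuous_closed_preimage[OF contg closed_atLeastAtMost closed_Compl[OF oU]])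
    moreover have Bne: "B \<noteq> {}" "bdd_below B" using nt t by (auto simp: B_def intro!: bdd_belowI[of _ 0])
    ultimately have T: "Inf B \<in> B" using closed_contains_Inf by blast
    let ?T = "Inf B"
    have T01: "?T \<in> {0..1}" and Tn: "\<gamma> ?T \<notin> ?U" using T by (auto simp: B_def)
    have before: "\<gamma> u \<in> ?U" if "0 \<le> u" "u < ?T" for u
    proof (rule ccontr)
      assume "\<gamma> u \<notin> ?U"
      then have "u \<in> B" using that T01 by (auto simp: B_def)
      then show False using cInf_lower[OF _ Bne(2)] that by fastforce
    qed
    have "?T \<noteq> 0" using start Tn by auto
    then have T0: "0 < ?T" using T01 by simp
    have inV': "\<gamma> u \<in> ?V" if "0 \<le> u" "u < ?T" for u
      by (rule inV) (use that before T01 in auto)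
    have "(\<gamma> \<longlongrightarrow> \<gamma> ?T) (at ?T within {0..<?T})"
    proof (rule tendsto_within_subset)
      show "(\<gamma> \<longlongrightarrow> \<gamma> ?T) (at ?T within {0..1})" using contg T01 unfolding continuous_on_def by blast
      show "{0..<?T} \<subseteq> {0..1}" using T01 by auto
    qed
    moreover have "\<forall>\<^sub>F u in at ?T within {0..<?T}. \<gamma> u \<in> ?V"
      by (auto simp: eventually_at_filter inV')
    moreover have "at ?T within {0..<?T} \<noteq> bot"
      using T0 by (simp add: trivial_limit_within islimpt_Ico)
    ultimately have "\<gamma> ?T \<in> ?V" using Lim_in_closed_set[OF clV] by blast
    then show False using Tn VU by blast
  qed
  from this[of 1] show "q \<in> ?U" using \<gamma>(3) by simp
qed

text \<open>The coordinate segment is an admissible curve of speed at most \<open>sqrt K * norm (w - z)\<close>.\<close>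

lemma riem_dist_param_le:
  assumes gd: "good K c y R" and zw: "z \<in> cball y (3 * R)" "w \<in> cball y (3 * R)"
  shows "riem_dist A g (param c z) (param c w) \<le> ennreal (sqrt K * norm (w - z))"
proof -
  have c: "c \<in> A" and K: "1 \<le> K" and sub: "cball y (3 * R) \<subseteq> im c" using gd by (auto simp: good_def)
  define l where "l t = z + t *\<^sub>R (w - z)" for t :: real
  define \<gamma> where "\<gamma> t = param c (l t)" for t
  have l_in: "l t \<in> cball y (3 * R)" if "t \<in> {0..1}" for t
  proof -
    have "l t = (1 - t) *\<^sub>R z + t *\<^sub>R w" by (simp add: l_def algebra_simps)
    then show ?thesis using convexD_alt[OF convex_cball zw, of t] that by simp
  qed
  have dl: "(l has_vector_derivative (w - z)) (at t)" for t
    unfolding l_def by (auto intro!: derivative_eq_intros)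
  have contl: "continuous_on S l" for S unfolding l_def by (intro continuous_intros)
  have contg: "continuous_on {0..1} \<gamma>"
    unfolding \<gamma>_def by (rule continuous_on_compose2[OF continuous_param[OF c] contl]) (use l_in sub in blast)
  have pw: "pw_C1_curve A \<gamma>"
    unfolding pw_C1_curve_def
  proof (intro conjI contg ballI allI impI)
    fix c' a b assume c': "c' \<in> A" and ab: "0 \<le> a \<and> a \<le> b \<and> b \<le> 1 \<and> \<gamma> ` {a..b} \<subseteq> dom c'"
    let ?T = "coord c' \<circ> param c" and ?O = "coord c ` (dom c \<inter> dom c')"
    have lO: "l t \<in> ?O" if "t \<in> {a..b}" for t
    proof -
      have li: "l t \<in> im c" using l_in[of t] that ab sub by auto
      have "\<gamma> t \<in> dom c'" using that ab by blast
      then have "param c (l t) \<in> dom c \<inter> dom c'" using param_in[OF c li] by (simp add: \<gamma>_def)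
      from imageI[OF this, of "coord c"] show ?thesis unfolding coord_param[OF c li] .
    qed
    have sT: "smooth_on ?O ?T" by (rule transition_smooth[OF c c'])
    have eq: "coord c' \<circ> \<gamma> = ?T \<circ> l" by (simp add: \<gamma>_def fun_eq_iff)
    let ?D = "\<lambda>t. frechet_derivative ?T (at (l t)) (w - z)"
    have D: "((?T \<circ> l) has_vector_derivative ?D t) (at t)" if "t \<in> {a..b}" for t
    proof -
      have dT: "(?T has_derivative frechet_derivative ?T (at (l t))) (at (l t))" by (rule smooth_onD[OF sT lO[OF that]])
      have "((\<lambda>s. ?T (l s)) has_derivative (\<lambda>h. frechet_derivative ?T (at (l t)) (h *\<^sub>R (w - z)))) (at t)"
        by (rule has_derivative_compose[OF dl[unfolded has_vector_derivative_def] dT])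
      then show ?thesis
        unfolding has_vector_derivative_def comp_def[of ?T] linear_cmul[OF has_derivative_linear[OF dT]] .
    qed
    have "(?T \<circ> l) C1_differentiable_on {a..b}"
      unfolding C1_differentiable_on_def
    proof (intro exI conjI ballI)
      show "continuous_on {a..b} ?D"
        by (rule continuous_on_compose2[OF smooth_on_frechet_continuous[OF sT] contl]) (use lO in blast)
    qed (rule D)
    then show "(coord c' \<circ> \<gamma>) piecewise_C1_differentiable_on {a..b}"
      unfolding eq by (rule C1_differentiable_imp_piecewise)
  qed
  have sp: "speed A g \<gamma> t \<le> sqrt K * norm (w - z)" if t: "t \<in> {0..1}" for t
  proof -
    let ?U = "l -` im c"
    have oU: "open ?U" using contl[of UNIV] open_im[OF c] by (intro open_vimage) auto
    have tU: "t \<in> ?U" using l_in[OF t] sub by auto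
    have gU: "\<gamma> ` ?U \<subseteq> dom c" using param_in[OF c] by (auto simp: \<gamma>_def)
    have "continuous_on ?U \<gamma>"
      unfolding \<gamma>_def by (rule continuous_on_compose2[OF continuous_param[OF c] contl]) blast
    then have ct: "continuous (at t) \<gamma>" using oU tU continuous_on_eq_continuous_at by blast
    have D: "((coord c \<circ> \<gamma>) has_vector_derivative (w - z)) (at t)"
    proof (rule has_vector_derivative_transform_within_open[OF dl oU tU])
      fix s assume "s \<in> ?U"
      then show "l s = (coord c \<circ> \<gamma>) s" using coord_param[OF c, of "l s"] by (simp add: \<gamma>_def)
    qed
    have "(w - z) \<bullet> (g c (param c (l t)) *v (w - z)) \<le> K * (norm (w - z))\<^sup>2"
      using gd l_in[OF t] unfolding good_def by blast
    then have "sqrt ((w - z) \<bullet> (g c (\<gamma> t) *v (w - z))) \<le> sqrt (K * (norm (w - z))\<^sup>2)"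
      unfolding \<gamma>_def by (rule real_sqrt_le_mono)
    also have "\<dots> = sqrt K * norm (w - z)" by (simp add: real_sqrt_mult)
    finally show ?thesis unfolding speed_chart[OF c oU tU gU ct D] .
  qed
  have "riem_dist A g (param c z) (param c w) \<le> curve_length A g \<gamma>"
    unfolding riem_dist_def by (rule INF_lower) (use pw in \<open>simp add: \<gamma>_def l_def\<close>)
  also have "\<dots> \<le> (\<integral>\<^sup>+ t. ennreal (sqrt K * norm (w - z)) * indicator {0..1::real} t \<partial>lborel)"
    unfolding curve_length_def using sp by (intro nn_integral_mono) (auto simp: indicator_def intro!: ennreal_leI)
  also have "\<dots> = ennreal (sqrt K * norm (w - z))" by (simp add: nn_integral_cmult_indicator)
  finally show ?thesis .
qed

section \<open>Growth on Riemannian balls, atoms and Hausdorff dimension\<close>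

text \<open>Enclosing Riemannian balls in Borel sets of small measure makes them usable in covering arguments,
  where countable intersections and unions are formed.\<close>

lemma riem_ball_growth:
  assumes m: "CARD('m) \<ge> 2"
  obtains C r0 where "0 < C" "0 < r0"
    "\<And>x \<rho>. 0 < \<rho> \<Longrightarrow> \<rho> \<le> r0 / 4 \<Longrightarrow> \<exists>W\<in>sets borel. riem_ball A g x \<rho> \<subseteq> W \<and> x \<in> W \<and>
      (\<forall>\<mu> N. smooth_trace \<mu> N \<longrightarrow> measure \<mu> W \<le> C * N * growth_gauge r0 \<rho>)"
proof -
  obtain K r where K: "1 \<le> K" and r: "0 < r" and gd: "\<And>p. \<exists>c\<in>A. p \<in> dom c \<and> good K c (coord c p) r"
    using uniform_good by blast
  obtain C where C: "0 < C" "\<And>c y \<mu> N \<rho>. good K c y r \<Longrightarrow> smooth_trace \<mu> N \<Longrightarrow> 0 < \<rho> \<Longrightarrow> \<rho> \<le> r / 4 \<Longrightarrow>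
      measure \<mu> (param c ` cball y \<rho>) \<le> C * N * growth_gauge r \<rho>"
    using ball_growth[OF m K r] by blast
  let ?k = "sqrt K"
  have k: "1 \<le> ?k" using K by simp
  let ?r0 = "r / ?k"
  have gauge: "growth_gauge r (?k * \<rho>) = ?k ^ (CARD('m) - 2) * growth_gauge ?r0 \<rho>" if "0 < \<rho>" for \<rho>
    using m by (auto simp: growth_gauge_def power_mult_distrib not_le)
  show ?thesis
  proof (rule that[of "C * ?k ^ (CARD('m) - 2)" ?r0])
    fix x \<rho> assume \<rho>: "0 < \<rho>" "\<rho> \<le> ?r0 / 4"
    have k\<rho>: "0 < ?k * \<rho>" "?k * \<rho> \<le> r / 4"
      using \<rho> K by (auto simp: field_simps)
    obtain c where c: "c \<in> A" "x \<in> dom c" "good K c (coord c x) r" using gd by blast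
    have px: "param c (coord c x) = x" by (rule param_coord[OF c(1,2)])
    let ?W = "param c ` cball (coord c x) (?k * \<rho>)"
    have "cball (coord c x) (?k * \<rho>) \<subseteq> im c"
    proof (rule order_trans[OF subset_cball])
      show "?k * \<rho> \<le> 3 * r" using k\<rho> r by linarith
      show "cball (coord c x) (3 * r) \<subseteq> im c" using c(3) unfolding good_def by blast
    qed
    then have W: "?W \<in> sets borel" by (rule param_image_borel[OF c(1) borel_closed[OF closed_cball]])
    have "riem_ball A g x \<rho> \<subseteq> param c ` ball (coord c x) (?k * \<rho>)"
      using riem_ball_subset[OF c(3) \<rho>(1)] k\<rho> r unfolding px by simp
    then have sub: "riem_ball A g x \<rho> \<subseteq> ?W" using ball_subset_cball by blast
    have xW: "x \<in> ?W" by (rule in_param_image[OF c(1,2)]) (use k\<rho> in simp)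
    have "measure \<mu> ?W \<le> C * ?k ^ (CARD('m) - 2) * N * growth_gauge ?r0 \<rho>" if "smooth_trace \<mu> N" for \<mu> N
      using C(2)[OF c(3) that k\<rho>] unfolding gauge[OF \<rho>(1)] by (simp add: mult_ac)
    then show "\<exists>W\<in>sets borel. riem_ball A g x \<rho> \<subseteq> W \<and> x \<in> W \<and>
      (\<forall>\<mu> N. smooth_trace \<mu> N \<longrightarrow> measure \<mu> W \<le> C * ?k ^ (CARD('m) - 2) * N * growth_gauge ?r0 \<rho>)"
      using W sub xW by blast
  qed (use C K r in auto)
qed

lemma measure_riem_ball_le:
  assumes m: "CARD('m) \<ge> 2"
  obtains C r0 where "0 < C" "0 < r0"
    "\<And>\<mu> N x \<rho>. smooth_trace \<mu> N \<Longrightarrow> 0 < \<rho> \<Longrightarrow> \<rho> \<le> r0 / 4 \<Longrightarrow>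
      measure \<mu> (riem_ball A g x \<rho>) \<le> C * N * growth_gauge r0 \<rho>"
proof -
  obtain C r0 where C: "0 < C" "0 < r0"
    "\<And>x \<rho>. 0 < \<rho> \<Longrightarrow> \<rho> \<le> r0 / 4 \<Longrightarrow> \<exists>W\<in>sets borel. riem_ball A g x \<rho> \<subseteq> W \<and> x \<in> W \<and>
      (\<forall>\<mu> N. smooth_trace \<mu> N \<longrightarrow> measure \<mu> W \<le> C * N * growth_gauge r0 \<rho>)"
    using riem_ball_growth[OF m] by blast
  show ?thesis
  proof (rule that[OF C(1,2)])
    fix \<mu> N x \<rho> assume \<mu>: "smooth_trace \<mu> N" and \<rho>: "0 < \<rho>" "\<rho> \<le> r0 / 4"
    from C(3)[OF \<rho>, of x] obtain W where W: "W \<in> sets borel" "riem_ball A g x \<rho> \<subseteq> W"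
      "\<forall>\<mu> N. smooth_trace \<mu> N \<longrightarrow> measure \<mu> W \<le> C * N * growth_gauge r0 \<rho>" by (elim bexE conjE)
    have "measure \<mu> (riem_ball A g x \<rho>) \<le> measure \<mu> W"
      using \<mu> W by (intro finite_measure.finite_measure_mono) (auto simp: smooth_trace_def finite_borel_measure_def)
    also have "\<dots> \<le> C * N * growth_gauge r0 \<rho>" using W(3) \<mu> by blast
    finally show "measure \<mu> (riem_ball A g x \<rho>) \<le> C * N * growth_gauge r0 \<rho>" .
  qed
qed

text \<open>Along the radii \<open>r0 e\<^sup>-\<^sup>n\<close> the logarithmic bound is of order \<open>1 / n\<close>.\<close>

lemma smooth_trace_no_atoms:
  assumes m: "CARD('m) = 2" and \<mu>: "smooth_trace \<mu> N"
  shows "emeasure \<mu> {x} = 0"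
proof -
  have m2: "CARD('m) \<ge> 2" using m by simp
  obtain C r0 where C: "0 < C" "0 < r0"
    "\<And>x \<rho>. 0 < \<rho> \<Longrightarrow> \<rho> \<le> r0 / 4 \<Longrightarrow> \<exists>W\<in>sets borel. riem_ball A g x \<rho> \<subseteq> W \<and> x \<in> W \<and>
      (\<forall>\<mu> N. smooth_trace \<mu> N \<longrightarrow> measure \<mu> W \<le> C * N * growth_gauge r0 \<rho>)"
    using riem_ball_growth[OF m2] by blast
  have fin: "finite_measure \<mu>" and sets: "sets \<mu> = sets borel"
    using \<mu> by (auto simp: smooth_trace_def finite_borel_measure_def)
  have b: "measure \<mu> {x} \<le> C * N * inverse (1 + real n)" if n: "n \<ge> 4" for n :: nat
  proof -
    let ?\<rho> = "r0 * exp (- real n)"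
    have "4 \<le> exp (real n)" using exp_ge_add_one_self[of "real n"] n by linarith
    then have "exp (- real n) \<le> 1 / 4" by (simp add: exp_minus field_simps)
    then have \<rho>: "0 < ?\<rho>" "?\<rho> \<le> r0 / 4" using C(2) by auto
    from C(3)[OF \<rho>, of x] obtain W where W: "W \<in> sets borel" "x \<in> W"
      "\<forall>\<mu> N. smooth_trace \<mu> N \<longrightarrow> measure \<mu> W \<le> C * N * growth_gauge r0 ?\<rho>" by (elim bexE conjE)
    then have W3: "measure \<mu> W \<le> C * N * growth_gauge r0 ?\<rho>" using \<mu> by blast
    have "r0 / ?\<rho> = exp (real n)" using C(2) by (simp add: exp_minus field_simps)
    then have "growth_gauge r0 ?\<rho> = inverse (1 + real n)" using m by (simp add: growth_gauge_def)
    moreover have "measure \<mu> {x} \<le> measure \<mu> W"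
      using W sets by (intro finite_measure.finite_measure_mono[OF fin]) auto
    ultimately show ?thesis using W3 by simp
  qed
  have "(\<lambda>n. C * N * inverse (1 + real n)) \<longlonglongrightarrow> C * N * 0"
    using LIMSEQ_inverse_real_of_nat by (intro tendsto_mult tendsto_const) (simp add: add.commute)
  then have "measure \<mu> {x} \<le> C * N * 0"
    by (rule LIMSEQ_le_const) (use b in blast)
  then have "measure \<mu> {x} = 0" using measure_nonneg[of \<mu> "{x}"] by simp
  then show ?thesis using finite_measure.emeasure_eq_measure[OF fin] by simp
qed

text \<open>The mass distribution principle. A set of diameter \<open>d\<close> lies in the balls of radius \<open>d + \<epsilon>\<close> around
  any of its points, hence in a Borel set of measure at most \<open>C N d\<^sup>m\<^sup>-\<^sup>2\<close>, which is at most \<open>C N d\<^sup>s\<close> if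
  \<open>s < m - 2\<close> and \<open>d \<le> 1\<close>. If the \<open>s\<close>-dimensional measure of \<open>S\<close> vanished, then so would \<open>\<mu>\<close>.\<close>

lemma hausdorff_dim_ge:
  assumes m: "CARD('m) \<ge> 3" and \<mu>: "smooth_trace \<mu> N" and nz: "emeasure \<mu> UNIV \<noteq> 0"
    and S: "S \<in> sets borel" "carries S \<mu>"
  shows "ereal (real CARD('m) - 2) \<le> hausdorff_dim (riem_dist A g) S"
  unfolding hausdorff_dim_def
proof (rule INF_greatest, clarify)
  have m2: "CARD('m) \<ge> 2" using m by simp
  fix s :: real assume s: "0 < s" and H0: "hausdorff_measure (riem_dist A g) s S = 0"
  obtain C r0 where C: "0 < C" "0 < r0"
    "\<And>x \<rho>. 0 < \<rho> \<Longrightarrow> \<rho> \<le> r0 / 4 \<Longrightarrow> \<exists>W\<in>sets borel. riem_ball A g x \<rho> \<subseteq> W \<and> x \<in> W \<and>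
      (\<forall>\<mu> N. smooth_trace \<mu> N \<longrightarrow> measure \<mu> W \<le> C * N * growth_gauge r0 \<rho>)"
    using riem_ball_growth[OF m2] by blast
  have fin: "finite_measure \<mu>" and sets: "sets \<mu> = sets borel" and N: "0 \<le> N"
    using \<mu> by (auto simp: smooth_trace_def finite_borel_measure_def)
  define k where "k = CARD('m) - 2"
  have k: "k \<ge> 1" "real k = real CARD('m) - 2" using m by (auto simp: k_def)
  have gauge: "growth_gauge r0 \<rho> = \<rho> ^ k" for \<rho> using m by (simp add: growth_gauge_def k_def)
  show "ereal (real CARD('m) - 2) \<le> ereal s"
  proof (rule ccontr)
    assume "\<not> ereal (real CARD('m) - 2) \<le> ereal s"
    then have sk: "s < real k" using k by simp
    define \<delta> where "\<delta> = min 1 (r0 / 8)"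
    have \<delta>: "0 < \<delta>" "\<delta> \<le> 1" "2 * \<delta> \<le> r0 / 4" using C by (auto simp: \<delta>_def)
    have cover: "\<exists>V\<in>sets borel. E \<subseteq> V \<and> emeasure \<mu> V \<le> ennreal (C * N * enn2real (diam (riem_dist A g) E) powr s)"
      if E: "diam (riem_dist A g) E \<le> ennreal \<delta>" for E
    proof (cases "E = {}")
      case False
      then obtain x where x: "x \<in> E" by blast
      define d where "d = enn2real (diam (riem_dist A g) E)"
      have dd: "diam (riem_dist A g) E = ennreal d"
        using E unfolding d_def by (metis ennreal_enn2real ennreal_less_top le_less_trans)
      have d: "0 \<le> d" "d \<le> \<delta>" using E \<delta> unfolding dd by (auto simp: d_def ennreal_le_iff)
      \<comment> \<open>Radii above \<open>d\<close> are needed since balls are open and \<open>d\<close> may vanish; the intersection recovers \<open>d\<close>.\<close>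
      define \<rho> where "\<rho> n = d + \<delta> * inverse (real (Suc n))" for n :: nat
      have \<rho>: "0 < \<rho> n" "d < \<rho> n" "\<rho> n \<le> r0 / 4" for n
      proof -
        have i: "0 < inverse (real (Suc n))" "inverse (real (Suc n)) \<le> 1" by (auto simp: inverse_le_1_iff)
        show "d < \<rho> n" using \<delta> i by (simp add: \<rho>_def)
        then show "0 < \<rho> n" using d by simp
        have "\<delta> * inverse (real (Suc n)) \<le> \<delta> * 1" using i \<delta> by (intro mult_left_mono) auto
        then show "\<rho> n \<le> r0 / 4" using d \<delta> unfolding \<rho>_def by linarith
      qed
      have "\<exists>W\<in>sets borel. riem_ball A g x (\<rho> n) \<subseteq> W \<and> measure \<mu> W \<le> C * N * \<rho> n ^ k" for n
      proof -
        from C(3)[OF \<rho>(1)[of n] \<rho>(3)[of n], of x] obtain W where W: "W \<in> sets borel" "riem_ball A g x (\<rho> n) \<subseteq> W"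
          "\<forall>\<mu> N. smooth_trace \<mu> N \<longrightarrow> measure \<mu> W \<le> C * N * growth_gauge r0 (\<rho> n)" by (elim bexE conjE)
        then show ?thesis using \<mu> unfolding gauge by blast
      qed
      then have "\<exists>W. \<forall>n. W n \<in> sets borel \<and> riem_ball A g x (\<rho> n) \<subseteq> W n \<and> measure \<mu> (W n) \<le> C * N * \<rho> n ^ k"
        by (intro choice) blast
      then obtain W where W: "\<And>n. W n \<in> sets borel" "\<And>n. riem_ball A g x (\<rho> n) \<subseteq> W n" "\<And>n. measure \<mu> (W n) \<le> C * N * \<rho> n ^ k"
        by blast
      have Ball: "E \<subseteq> riem_ball A g x (\<rho> n)" for n
      proof
        fix q assume "q \<in> E"
        then have "riem_dist A g x q \<le> diam (riem_dist A g) E"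
          unfolding diam_def using x by (meson SUP_upper2 order_refl)
        also have "\<dots> < ennreal (\<rho> n)" unfolding dd using \<rho>[of n] d by (simp add: ennreal_less_iff)
        finally show "q \<in> riem_ball A g x (\<rho> n)" by (simp add: riem_ball_def)
      qed
      let ?V = "\<Inter>n. W n"
      have V: "?V \<in> sets borel" using W(1) by (intro sets.countable_INT'') auto
      have "measure \<mu> ?V \<le> C * N * \<rho> n ^ k" for n
      proof -
        have "measure \<mu> ?V \<le> measure \<mu> (W n)"
          using W(1) sets by (intro finite_measure.finite_measure_mono[OF fin]) auto
        then show ?thesis using W(3)[of n] by simp
      qed
      moreover have "(\<lambda>n. C * N * \<rho> n ^ k) \<longlonglongrightarrow> C * N * (d + \<delta> * 0) ^ k"
        unfolding \<rho>_def by (intro tendsto_intros LIMSEQ_inverse_real_of_nat)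
      ultimately have "measure \<mu> ?V \<le> C * N * (d + \<delta> * 0) ^ k"
        by (intro LIMSEQ_le_const) auto
      also have "\<dots> \<le> C * N * d powr s"
      proof (intro mult_left_mono mult_nonneg_nonneg)
        show "(d + \<delta> * 0) ^ k \<le> d powr s"
        proof (cases "d = 0")
          case False
          then have "d ^ k = d powr real k" using d by (simp add: powr_realpow)
          also have "\<dots> \<le> d powr s" using False d \<delta> sk by (intro powr_mono') auto
          finally show ?thesis by simp
        qed (use k in \<open>simp add: power_0_left\<close>)
      qed (use C N in auto)
      finally have "emeasure \<mu> ?V \<le> ennreal (C * N * d powr s)"
        unfolding finite_measure.emeasure_eq_measure[OF fin] by (rule ennreal_leI)
      moreover have "E \<subseteq> ?V" using Ball W(2) by blast
      ultimately show ?thesis using V unfolding d_def by blast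
    next
      case True
      then show ?thesis by (intro bexI[of _ "{}"]) auto
    qed
    have small: "emeasure \<mu> UNIV \<le> ennreal (C * N) * ennreal e" if e: "0 < e" for e
    proof -
      have "hausdorff_premeasure (riem_dist A g) s \<delta> S \<le> hausdorff_measure (riem_dist A g) s S"
        unfolding hausdorff_measure_def using \<delta> by (intro SUP_upper) auto
      then have "hausdorff_premeasure (riem_dist A g) s \<delta> S < ennreal e" using H0 e by simp
      then obtain E :: "nat \<Rightarrow> 'a set" where E: "S \<subseteq> (\<Union>n. E n)" "\<And>n. diam (riem_dist A g) (E n) \<le> ennreal \<delta>"
        "(\<Sum>n. ennreal (enn2real (diam (riem_dist A g) (E n)) powr s)) < ennreal e"
        unfolding hausdorff_premeasure_def INF_less_iff by blast
      have "\<exists>V. \<forall>n. V n \<in> sets borel \<and> E n \<subseteq> V n \<and> emeasure \<mu> (V n) \<le> ennreal (C * N * enn2real (diam (riem_dist A g) (E n)) powr s)"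
        by (rule choice) (use cover[OF E(2)] in blast)
      then obtain V where V: "\<And>n. V n \<in> sets borel" "\<And>n. E n \<subseteq> V n"
        "\<And>n. emeasure \<mu> (V n) \<le> ennreal (C * N * enn2real (diam (riem_dist A g) (E n)) powr s)" by blast
      have "emeasure \<mu> UNIV \<le> emeasure \<mu> ((space \<mu> - S) \<union> (\<Union>n. V n))"
        using S V sets E(1) V(2) sets_eq_imp_space_eq[OF sets]
        by (intro emeasure_mono) (auto, blast)
      also have "\<dots> \<le> emeasure \<mu> (space \<mu> - S) + emeasure \<mu> (\<Union>n. V n)"
        using S V sets by (intro emeasure_subadditive) auto
      also have "\<dots> = emeasure \<mu> (\<Union>n. V n)" using S(2) by (simp add: carries_def)
      also have "\<dots> \<le> (\<Sum>n. emeasure \<mu> (V n))" using V sets by (intro emeasure_subadditive_countably) auto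
      also have "\<dots> \<le> (\<Sum>n. ennreal (C * N) * ennreal (enn2real (diam (riem_dist A g) (E n)) powr s))"
        using V(3) C N by (intro suminf_le summableI) (simp add: ennreal_mult'[symmetric] mult.assoc)
      also have "\<dots> = ennreal (C * N) * (\<Sum>n. ennreal (enn2real (diam (riem_dist A g) (E n)) powr s))"
        by (rule ennreal_suminf_cmult)
      also have "\<dots> \<le> ennreal (C * N) * ennreal e" using E(3) by (intro mult_left_mono) auto
      finally show ?thesis .
    qed
    have "measure \<mu> UNIV \<le> C * N * e" if "0 < e" for e
      using small[OF that] C N that unfolding finite_measure.emeasure_eq_measure[OF fin]
      by (simp add: ennreal_mult'[symmetric] ennreal_le_iff)
    from this[of "\<epsilon> / (C * N + 1)" for \<epsilon>] have "measure \<mu> UNIV \<le> 0"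
    proof -
      assume *: "\<And>\<epsilon>. 0 < \<epsilon> / (C * N + 1) \<Longrightarrow> measure \<mu> UNIV \<le> C * N * (\<epsilon> / (C * N + 1))"
      show ?thesis
      proof (rule field_le_epsilon)
        fix \<epsilon> :: real assume "0 < \<epsilon>"
        have CN: "0 \<le> C * N" using C N by simp
        then have "measure \<mu> UNIV \<le> C * N * (\<epsilon> / (C * N + 1))" using *[of \<epsilon>] \<open>0 < \<epsilon>\<close> by simp
        also have "\<dots> \<le> \<epsilon>" using CN \<open>0 < \<epsilon>\<close> by (simp add: field_simps)
        finally show "measure \<mu> UNIV \<le> 0 + \<epsilon>" by simp
      qed
    qed
    then have "measure \<mu> UNIV = 0" using measure_nonneg[of \<mu> UNIV] by simp
    then show False using nz finite_measure.emeasure_eq_measure[OF fin] by simp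
  qed
qed

end


section \<open>Closability of the Dirichlet form\<close>

lemma integrable_continuous_compact_support:
  fixes F :: "'e::euclidean_space \<Rightarrow> real"
  assumes "continuous_on UNIV F" "\<And>z. z \<notin> cball y r \<Longrightarrow> F z = 0"
  shows "integrable lborel F"
proof -
  have "integrable lborel (\<lambda>z. indicator (cball y r) z *\<^sub>R F z)"
    by (rule borel_integrable_compact) (use assms(1) in \<open>auto intro: continuous_on_subset\<close>)
  moreover have "(\<lambda>z. indicator (cball y r) z *\<^sub>R F z) = F"
    using assms(2) by (auto simp: fun_eq_iff indicator_def)
  ultimately show ?thesis by simp
qed

lemma bounded_compact_support:
  fixes F :: "'e::euclidean_space \<Rightarrow> real"
  assumes "continuous_on UNIV F" "\<And>z. z \<notin> cball y r \<Longrightarrow> F z = 0"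
  obtains B where "0 \<le> B" "\<And>z. \<bar>F z\<bar> \<le> B"
proof -
  have "bounded (F ` cball y r)"
    by (intro compact_imp_bounded compact_continuous_image continuous_on_subset[OF assms(1)]) auto
  then obtain B where B: "\<And>z. z \<in> cball y r \<Longrightarrow> \<bar>F z\<bar> \<le> B" unfolding bounded_iff by (metis imageI real_norm_def)
  show ?thesis
  proof (rule that[of "\<bar>B\<bar>"])
    fix z show "\<bar>F z\<bar> \<le> \<bar>B\<bar>" using B[of z] assms(2)[of z] by (cases "z \<in> cball y r") auto
  qed simp
qed

lemma frechet_zero_outside:
  assumes "\<And>z. z \<notin> cball y r \<Longrightarrow> F z = (0 :: real)" "z \<notin> cball y r"
  shows "frechet_derivative F (at z) v = 0"
proof -
  have "((\<lambda>z. 0) has_derivative (\<lambda>v. 0)) (at z)" by simp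
  then have "(F has_derivative (\<lambda>v. 0)) (at z)"
    by (rule has_derivative_transform_open[rotated 3, where S = "- cball y r"]) (use assms in auto)
  from frechet_derivative_at[OF this] show ?thesis by metis
qed

text \<open>Translation invariance of Lebesgue measure, differentiated.\<close>

lemma integral_derivative_zero:
  fixes F :: "'e::euclidean_space \<Rightarrow> real"
  assumes F: "smooth_on UNIV F" and supp: "\<And>z. z \<notin> cball y r \<Longrightarrow> F z = 0"
  shows "(LINT z|lborel. frechet_derivative F (at z) v) = 0"
proof -
  let ?D = "\<lambda>z. frechet_derivative F (at z) v"
  have contF: "continuous_on UNIV F" by (rule smooth_on_continuous[OF F])
  have contD: "continuous_on UNIV ?D" by (rule smooth_on_frechet_continuous[OF F])
  have suppD: "?D z = 0" if "z \<notin> cball y r" for z using frechet_zero_outside[of y r F] supp that by blast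
  obtain B where B: "0 \<le> B" "\<And>z. \<bar>?D z\<bar> \<le> B"
    using bounded_compact_support[OF contD suppD] by blast
  have dF: "((\<lambda>t. F (z + t *\<^sub>R v)) has_real_derivative ?D (z + t *\<^sub>R v)) (at t)" for z t
  proof -
    have D: "(F has_derivative frechet_derivative F (at (z + t *\<^sub>R v))) (at (z + t *\<^sub>R v))"
      by (rule smooth_onD[OF F]) simp
    have "((\<lambda>t. z + t *\<^sub>R v) has_derivative (\<lambda>h. h *\<^sub>R v)) (at t)"
      by (auto intro!: derivative_eq_intros)
    from has_derivative_compose[OF this D]
    show ?thesis
      unfolding has_field_derivative_def linear_cmul[OF has_derivative_linear[OF D]]
      by (simp add: mult.commute[of "?D _"] mult_commute_abs)
  qed
  \<comment> \<open>Difference quotients have integral zero by translation invariance; let the step tend to zero.\<close>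
  define q where "q n z = real (Suc n) * (F (z + inverse (real (Suc n)) *\<^sub>R v) - F z)" for n z
  have trans: "(LINT z|lborel. F (z + w)) = (LINT z|lborel. F z)" "integrable lborel (\<lambda>z. F (z + w))" for w
  proof -
    have "integrable lborel F" by (rule integrable_continuous_compact_support[OF contF supp])
    moreover have lb: "lborel = distr lborel borel ((+) w)" by (rule lborel_distr_plus[symmetric])
    ultimately have "integrable (distr lborel borel ((+) w)) F" by simp
    then show "integrable lborel (\<lambda>z. F (z + w))"
      by (subst (asm) integrable_distr_eq) (auto simp: add.commute borel_measurable_continuous_onI contF)
    have "(LINT z|lborel. F z) = (LINT z|distr lborel borel ((+) w). F z)" using lb by simp
    also have "\<dots> = (LINT z|lborel. F (w + z))"
      by (rule integral_distr) (auto simp: borel_measurable_continuous_onI contF)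
    finally show "(LINT z|lborel. F (z + w)) = (LINT z|lborel. F z)" by (simp add: add.commute)
  qed
  have int_q: "(LINT z|lborel. q n z) = 0" for n
    unfolding q_def using trans trans(2)[of 0] by simp
  have "(\<lambda>n. LINT z|lborel. q n z) \<longlonglongrightarrow> (LINT z|lborel. ?D z)"
  proof (rule integral_dominated_convergence[where w = "\<lambda>z. B * indicator (cball y (r + norm v)) z"])
    show "?D \<in> borel_measurable lborel" using contD by (simp add: borel_measurable_continuous_onI)
    show "q n \<in> borel_measurable lborel" for n
      unfolding q_def using trans(2)[of "inverse (real (Suc n)) *\<^sub>R v"] trans(2)[of 0]
      by (simp add: borel_measurable_integrable)
    show "integrable lborel (\<lambda>z. B * indicator (cball y (r + norm v)) z)"
      using emeasure_lborel_cball_finite[of y "r + norm v"] by (intro integrable_mult_right integrable_real_indicator) auto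
    show "AE z in lborel. (\<lambda>n. q n z) \<longlonglongrightarrow> ?D z"
    proof (rule AE_I2)
      fix z
      have "((\<lambda>h. (F (z + h *\<^sub>R v) - F z) / h) \<longlongrightarrow> ?D z) (at 0)"
        using dF[of z 0] unfolding DERIV_def by simp
      moreover have "filterlim (\<lambda>n. inverse (real (Suc n))) (at 0) sequentially"
        unfolding filterlim_at using LIMSEQ_inverse_real_of_nat by auto
      ultimately have "(\<lambda>n. (F (z + inverse (real (Suc n)) *\<^sub>R v) - F z) / inverse (real (Suc n))) \<longlonglongrightarrow> ?D z"
        by (rule filterlim_compose)
      then show "(\<lambda>n. q n z) \<longlonglongrightarrow> ?D z" by (simp add: q_def field_simps del: of_nat_Suc)
    qed
    show "AE z in lborel. norm (q n z) \<le> B * indicator (cball y (r + norm v)) z" for n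
    proof (rule AE_I2)
      fix z
      let ?i = "inverse (real (Suc n))"
      have i: "0 < ?i" "?i \<le> 1" by (auto simp: inverse_le_1_iff)
      show "norm (q n z) \<le> B * indicator (cball y (r + norm v)) z"
      proof (cases "z \<in> cball y (r + norm v)")
        case True
        obtain t where t: "F (z + ?i *\<^sub>R v) - F (z + 0 *\<^sub>R v) = (?i - 0) * ?D (z + t *\<^sub>R v)"
          using MVT2[OF i(1), of "\<lambda>t. F (z + t *\<^sub>R v)" "\<lambda>t. ?D (z + t *\<^sub>R v)"] dF by blast
        have "q n z = ?D (z + t *\<^sub>R v)"
          unfolding q_def using t by (simp del: of_nat_Suc)
        then show ?thesis using B(2) True by simp
      next
        case False
        have iv: "norm (?i *\<^sub>R v) \<le> norm v" using i by (simp add: mult_left_le_one_le del: of_nat_Suc)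
        have d: "dist y z > r + norm v" using False by simp
        have "dist y z \<le> dist y (z + ?i *\<^sub>R v) + norm (?i *\<^sub>R v)"
          using dist_triangle[of y z "z + ?i *\<^sub>R v"] by (simp add: dist_norm)
        then have "F (z + ?i *\<^sub>R v) = 0" by (intro supp) (use d iv in \<open>simp del: of_nat_Suc norm_scaleR\<close>)
        moreover have "F z = 0" by (rule supp) (use d norm_ge_zero[of v] in \<open>simp, linarith\<close>)
        ultimately show ?thesis using False by (simp add: q_def)
      qed
    qed
  qed
  then show ?thesis unfolding int_q using LIMSEQ_unique tendsto_const by metis
qed

definition test_fun :: "'e::euclidean_space \<Rightarrow> real \<Rightarrow> ('e \<Rightarrow> real) \<Rightarrow> bool" where
  "test_fun y r \<phi> \<longleftrightarrow> smooth_on UNIV \<phi> \<and> (\<forall>z. z \<notin> cball y r \<longrightarrow> \<phi> z = 0)"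

lemma test_fun_frechet: "test_fun y r \<phi> \<Longrightarrow> test_fun y r (\<lambda>z. frechet_derivative \<phi> (at z) v)"
  unfolding test_fun_def using smooth_on_frechet frechet_zero_outside by blast

lemma test_fun_mult: "test_fun y r \<phi> \<Longrightarrow> test_fun y r \<psi> \<Longrightarrow> test_fun y r (\<lambda>z. \<phi> z * \<psi> z)"
  unfolding test_fun_def by (auto intro: smooth_on_mult)

lemma test_fun_diff: "test_fun y r \<phi> \<Longrightarrow> test_fun y r \<psi> \<Longrightarrow> test_fun y r (\<lambda>z. \<phi> z - \<psi> z)"
  unfolding test_fun_def
  using smooth_on_add[of UNIV \<phi> "\<lambda>z. -1 * \<psi> z"] smooth_on_mult[OF open_UNIV smooth_on_const[OF open_UNIV], of \<psi> "-1"]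
  by simp

lemma test_fun_sum: "(\<And>i. i \<in> I \<Longrightarrow> test_fun y r (f i)) \<Longrightarrow> test_fun y r (\<lambda>z. \<Sum>i\<in>I. f i z)"
  unfolding test_fun_def by (auto intro!: smooth_on_sum sum.neutral)

lemma test_fun_integrable: "test_fun y r \<phi> \<Longrightarrow> integrable lborel \<phi>"
  unfolding test_fun_def using integrable_continuous_compact_support smooth_on_continuous by blast

text \<open>The integral of the derivative of the product vanishes.\<close>

lemma integration_by_parts:
  assumes \<phi>: "test_fun y r \<phi>" and \<psi>: "test_fun y r \<psi>"
  shows "(LINT z|lborel. frechet_derivative \<phi> (at z) v * \<psi> z) = - (LINT z|lborel. \<phi> z * frechet_derivative \<psi> (at z) v)"
proof -
  let ?D = "\<lambda>\<phi> z. frechet_derivative \<phi> (at z) v"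
  have D: "?D (\<lambda>z. \<phi> z * \<psi> z) z = \<phi> z * ?D \<psi> z + ?D \<phi> z * \<psi> z" for z
  proof -
    have d: "(\<phi> has_derivative frechet_derivative \<phi> (at z)) (at z)" "(\<psi> has_derivative frechet_derivative \<psi> (at z)) (at z)"
      using \<phi> \<psi> by (auto simp: test_fun_def intro: smooth_onD)
    from frechet_derivative_at[OF has_derivative_mult[OF d]] show ?thesis by metis
  qed
  have "(LINT z|lborel. ?D (\<lambda>z. \<phi> z * \<psi> z) z) = 0"
    using test_fun_mult[OF \<phi> \<psi>] by (intro integral_derivative_zero) (auto simp: test_fun_def)
  moreover have "integrable lborel (\<lambda>z. \<phi> z * ?D \<psi> z)" "integrable lborel (\<lambda>z. ?D \<phi> z * \<psi> z)"
    by (intro test_fun_integrable[of y r] test_fun_mult test_fun_frechet \<phi> \<psi>)+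
  ultimately show ?thesis unfolding D by simp
qed

definition dirichlet :: "(real ^ 'm::finite \<Rightarrow> real) \<Rightarrow> (real ^ 'm \<Rightarrow> real) \<Rightarrow> real" where
  "dirichlet \<phi> \<psi> = (LINT z|lborel. egrad \<phi> z \<bullet> egrad \<psi> z)"

lemma egrad_nth: "egrad \<phi> z $ i = frechet_derivative \<phi> (at z) (axis i 1)"
  by (simp add: egrad_def)

lemma egrad_inner: "egrad \<phi> z \<bullet> egrad \<psi> z =
    (\<Sum>i\<in>UNIV. frechet_derivative \<phi> (at z) (axis i 1) * frechet_derivative \<psi> (at z) (axis i 1))"
  by (simp add: inner_vec_def egrad_nth)

lemma test_fun_egrad_inner:
  "test_fun y r \<phi> \<Longrightarrow> test_fun y r \<psi> \<Longrightarrow> test_fun y r (\<lambda>z. egrad \<phi> z \<bullet> egrad \<psi> z)"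
  unfolding egrad_inner by (intro test_fun_sum test_fun_mult test_fun_frechet)

lemma egrad_diff:
  "smooth_on UNIV \<phi> \<Longrightarrow> smooth_on UNIV \<psi> \<Longrightarrow> egrad (\<lambda>z. \<phi> z - \<psi> z) z = egrad \<phi> z - egrad \<psi> z"
proof -
  assume "smooth_on UNIV \<phi>" "smooth_on UNIV \<psi>"
  then have "(\<phi> has_derivative frechet_derivative \<phi> (at z)) (at z)" "(\<psi> has_derivative frechet_derivative \<psi> (at z)) (at z)"
    by (auto intro: smooth_onD)
  from frechet_derivative_at[OF has_derivative_diff[OF this], symmetric]
  show ?thesis by (simp add: egrad_def vec_eq_iff)
qed

text \<open>The Euclidean Dirichlet form is closable: pair the sequence with one of its own members and
  integrate by parts.\<close>

lemma dirichlet_closable: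
  fixes h :: "nat \<Rightarrow> real ^ 'm::finite \<Rightarrow> real"
  assumes h: "\<And>n. test_fun y r (h n)"
    and L2: "(\<lambda>n. LINT z|lborel. (h n z)\<^sup>2) \<longlonglongrightarrow> 0"
    and cauchy: "\<And>e. 0 < e \<Longrightarrow> \<exists>M. \<forall>i\<ge>M. \<forall>j\<ge>M. dirichlet (\<lambda>z. h i z - h j z) (\<lambda>z. h i z - h j z) < e"
  shows "(\<lambda>n. dirichlet (h n) (h n)) \<longlonglongrightarrow> 0"
proof (rule LIMSEQ_I)
  fix e :: real assume e: "0 < e"
  obtain k where k: "\<And>n. n \<ge> k \<Longrightarrow> dirichlet (\<lambda>z. h n z - h k z) (\<lambda>z. h n z - h k z) < e / 2"
    using cauchy[of "e / 2"] e by (metis half_gt_zero order_refl)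
  \<comment> \<open>The Laplacian of a fixed late member of the sequence.\<close>
  define \<Delta> where "\<Delta> z = (\<Sum>i\<in>UNIV. frechet_derivative (\<lambda>z. frechet_derivative (h k) (at z) (axis i 1)) (at z) (axis i 1))" for z
  have \<Delta>: "test_fun y r \<Delta>" unfolding \<Delta>_def by (intro test_fun_sum test_fun_frechet h)
  have cross: "dirichlet (h n) (h k) = - (LINT z|lborel. h n z * \<Delta> z)" for n
  proof -
    have i1: "integrable lborel (\<lambda>z. frechet_derivative (h n) (at z) (axis i 1) * frechet_derivative (h k) (at z) (axis i 1))" for i
      by (intro test_fun_integrable[of y r] test_fun_mult test_fun_frechet h)
    have i2: "integrable lborel (\<lambda>z. h n z * frechet_derivative (\<lambda>z. frechet_derivative (h k) (at z) (axis i 1)) (at z) (axis i 1))" for i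
      by (intro test_fun_integrable[of y r] test_fun_mult test_fun_frechet h)
    have "dirichlet (h n) (h k) = (\<Sum>i\<in>UNIV. LINT z|lborel. frechet_derivative (h n) (at z) (axis i 1) * frechet_derivative (h k) (at z) (axis i 1))"
      unfolding dirichlet_def egrad_inner by (rule Bochner_Integration.integral_sum) (rule i1)
    also have "\<dots> = (\<Sum>i\<in>UNIV. - (LINT z|lborel. h n z * frechet_derivative (\<lambda>z. frechet_derivative (h k) (at z) (axis i 1)) (at z) (axis i 1)))"
      by (intro sum.cong refl integration_by_parts[of y r] h test_fun_frechet)
    also have "\<dots> = - (LINT z|lborel. h n z * \<Delta> z)"
      unfolding \<Delta>_def sum_distrib_left by (subst Bochner_Integration.integral_sum) (auto intro: i2 simp: sum_negf)
    finally show ?thesis .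
  qed
  let ?D2 = "LINT z|lborel. (\<Delta> z)\<^sup>2"
  have D2: "0 \<le> ?D2" by simp
  \<comment> \<open>Weight in the inequality between arithmetic and geometric means: it makes the constant term small.\<close>
  define T where "T = 4 * (?D2 + 1) / e"
  have T0: "0 < T" unfolding T_def using e D2 by (intro divide_pos_pos mult_pos_pos add_nonneg_pos) simp_all
  have "e / 4 * T = ?D2 + 1" using e by (simp add: T_def)
  then have T: "0 < T" "?D2 / T \<le> e / 4" using T0 by (simp_all add: pos_divide_le_eq[OF T0])
  have cross_le: "2 * dirichlet (h n) (h k) \<le> T * (LINT z|lborel. (h n z)\<^sup>2) + ?D2 / T" for n
  proof -
    have ih: "integrable lborel (\<lambda>z. (h n z)\<^sup>2)" "integrable lborel (\<lambda>z. (\<Delta> z)\<^sup>2)" "integrable lborel (\<lambda>z. h n z * \<Delta> z)"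
      unfolding power2_eq_square by (intro test_fun_integrable[of y r] test_fun_mult h \<Delta>)+
    have "(LINT z|lborel. - 2 * (h n z * \<Delta> z)) \<le> (LINT z|lborel. T * (h n z)\<^sup>2 + (\<Delta> z)\<^sup>2 / T)"
    proof (rule integral_mono)
      fix z
      have "0 \<le> (T * h n z + \<Delta> z)\<^sup>2 / T" using T by simp
      also have "\<dots> = T * (h n z)\<^sup>2 + (\<Delta> z)\<^sup>2 / T + 2 * (h n z * \<Delta> z)"
        using T by (simp add: power2_sum power_mult_distrib field_simps power2_eq_square)
      finally show "- 2 * (h n z * \<Delta> z) \<le> T * (h n z)\<^sup>2 + (\<Delta> z)\<^sup>2 / T" by simp
    qed (use ih in auto)
    then show ?thesis unfolding cross using ih by simp
  qed
  have a_le: "dirichlet (h n) (h n) \<le> dirichlet (\<lambda>z. h n z - h k z) (\<lambda>z. h n z - h k z) + 2 * dirichlet (h n) (h k)" for n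
  proof -
    have i: "integrable lborel (\<lambda>z. egrad (h n) z \<bullet> egrad (h n) z)" "integrable lborel (\<lambda>z. egrad (h n) z \<bullet> egrad (h k) z)"
      "integrable lborel (\<lambda>z. egrad (h k) z \<bullet> egrad (h k) z)"
      by (intro test_fun_integrable[of y r] test_fun_egrad_inner h)+
    have "dirichlet (\<lambda>z. h n z - h k z) (\<lambda>z. h n z - h k z) =
        (LINT z|lborel. (egrad (h n) z \<bullet> egrad (h n) z) - 2 * (egrad (h n) z \<bullet> egrad (h k) z) + egrad (h k) z \<bullet> egrad (h k) z)"
      unfolding dirichlet_def using h
      by (intro Bochner_Integration.integral_cong refl)
         (simp add: egrad_diff test_fun_def inner_diff_left inner_diff_right inner_commute)
    also have "\<dots> = dirichlet (h n) (h n) - 2 * dirichlet (h n) (h k) + dirichlet (h k) (h k)"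
      unfolding dirichlet_def using i by simp
    finally have "dirichlet (h n) (h n) + dirichlet (h k) (h k) =
        dirichlet (\<lambda>z. h n z - h k z) (\<lambda>z. h n z - h k z) + 2 * dirichlet (h n) (h k)" by simp
    moreover have "0 \<le> dirichlet (h k) (h k)" unfolding dirichlet_def by simp
    ultimately show ?thesis by linarith
  qed
  obtain M where M: "\<And>n. n \<ge> M \<Longrightarrow> \<bar>LINT z|lborel. (h n z)\<^sup>2\<bar> < e / (4 * T)"
    using LIMSEQ_D[OF L2, of "e / (4 * T)"] e T by auto
  show "\<exists>no. \<forall>n\<ge>no. norm (dirichlet (h n) (h n) - 0) < e"
  proof (intro exI allI impI)
    fix n assume n: "max k M \<le> n"
    have "T * (LINT z|lborel. (h n z)\<^sup>2) < T * (e / (4 * T))"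
      using M[of n] n T by (intro mult_strict_left_mono) auto
    also have "\<dots> = e / 4" using T by simp
    finally have "dirichlet (h n) (h n) < e"
      using k[of n] n a_le[of n] cross_le[of n] T(2) by linarith
    moreover have "0 \<le> dirichlet (h n) (h n)" unfolding dirichlet_def by simp
    ultimately show "norm (dirichlet (h n) (h n) - 0) < e" by simp
  qed
qed

text \<open>Used to regard a function with support inside a chart as a test function on the whole space.\<close>

lemma smooth_on_zero_extension:
  fixes F :: "'e::euclidean_space \<Rightarrow> real"
  assumes F: "smooth_on U F" and U: "open U" and Z: "closed Z" "Z \<subseteq> U" "\<And>z. z \<in> U - Z \<Longrightarrow> F z = 0"
  shows "smooth_on UNIV (\<lambda>z. if z \<in> U then F z else 0)"
proof (rule smooth_on_local)
  fix x
  let ?E = "\<lambda>z. if z \<in> U then F z else 0"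
  show "\<exists>V. open V \<and> x \<in> V \<and> smooth_on V ?E"
  proof (cases "x \<in> U")
    case True
    have "smooth_on U ?E" by (rule smooth_on_cong[OF U _ F]) simp
    then show ?thesis using U True by blast
  next
    case False
    have o: "open (- Z)" using Z by auto
    have "smooth_on (- Z) ?E"
      by (rule smooth_on_cong[OF o _ smooth_on_const[OF o, of 0]]) (use Z in auto)
    then show ?thesis using o False Z by blast
  qed
qed

context closed_riemannian
begin

definition h1_cauchy :: "(nat \<Rightarrow> 'a \<Rightarrow> real) \<Rightarrow> bool" where
  "h1_cauchy F \<longleftrightarrow> (\<forall>n. smooth_fun A (F n)) \<and>
    (\<forall>e>0. \<exists>M. \<forall>i\<ge>M. \<forall>j\<ge>M. (h1n (\<lambda>p. F i p - F j p))\<^sup>2 < e)"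

lemma h1_approx_cauchy: "h1_approx A g f u \<Longrightarrow> h1_cauchy f"
  unfolding h1_cauchy_def
proof (intro conjI allI impI)
  assume f: "h1_approx A g f u"
  then show "smooth_fun A (f n)" for n by (simp add: h1_approx_def)
  fix e :: real assume "0 < e"
  then obtain M where M: "\<And>i j. i \<ge> M \<Longrightarrow> j \<ge> M \<Longrightarrow> h1n (\<lambda>p. f i p - f j p) < sqrt e"
    using f unfolding h1_approx_def by (meson real_sqrt_gt_zero)
  have "(h1n (\<lambda>p. f i p - f j p))\<^sup>2 < (sqrt e)\<^sup>2" if "i \<ge> M" "j \<ge> M" for i j
    using M[OF that] by (intro power_strict_mono h1n_nonneg) auto
  then show "\<exists>M. \<forall>i\<ge>M. \<forall>j\<ge>M. (h1n (\<lambda>p. f i p - f j p))\<^sup>2 < e" using \<open>0 < e\<close> by auto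
qed

text \<open>Sequences supported in a good ball are sequences of test functions in its coordinates, with
  comparable norms.\<close>

lemma chart_closable:
  assumes gd: "good K c y R" and h: "h1_cauchy h"
    and supp: "\<And>n p. p \<notin> param c ` cball y (2 * R) \<Longrightarrow> h n p = 0"
    and L2: "(\<lambda>n. \<integral>\<^sup>+ p. ennreal ((h n p)\<^sup>2) \<partial>vol) \<longlonglongrightarrow> 0"
  shows "(\<lambda>n. (h1n (h n))\<^sup>2) \<longlonglongrightarrow> 0"
proof -
  have c: "c \<in> A" and K: "1 \<le> K" and R: "0 < R" and sub3: "cball y (3 * R) \<subseteq> im c" using gd by (auto simp: good_def)
  let ?B = "cball y (2 * R)"
  have B3: "?B \<subseteq> cball y (3 * R)" using R by auto
  then have Bim: "?B \<subseteq> im c" using sub3 by blast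
  have Bb: "?B \<in> sets borel" by (rule borel_closed) (rule closed_cball)
  have sm: "smooth_fun A (h n)" for n using h by (simp add: h1_cauchy_def)
  define \<phi> where "\<phi> n z = (if z \<in> im c then (h n \<circ> param c) z else 0)" for n z
  have outB: "(h n \<circ> param c) z = 0" if z: "z \<in> im c - ?B" for n z
  proof -
    have "param c z \<notin> param c ` ?B"
    proof
      assume "param c z \<in> param c ` ?B"
      then obtain w where w: "w \<in> ?B" "param c z = param c w" by blast
      have cz: "coord c (param c z) = z" by (rule coord_param[OF c]) (use z in blast)
      have cw: "coord c (param c w) = w" by (rule coord_param[OF c]) (use w Bim in blast)
      have "z = w" using cz cw unfolding w(2) by (rule trans[OF sym])
      then show False using w(1) z by blast
    qed
    then show ?thesis using supp by simp
  qed
  have tf: "test_fun y (2 * R) (\<phi> n)" for n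
    unfolding test_fun_def
  proof (intro conjI allI impI)
    show "smooth_on UNIV (\<phi> n)" unfolding \<phi>_def
      by (rule smooth_on_zero_extension[OF smooth_funD[OF sm c] open_im[OF c] closed_cball Bim outB])
    show "\<phi> n z = 0" if "z \<notin> ?B" for z using outB[of z n] that by (simp add: \<phi>_def)
  qed
  have hp: "h n = in_chart c (\<phi> n)" for n
  proof
    fix p
    show "h n p = in_chart c (\<phi> n) p"
    proof (cases "p \<in> dom c")
      case True
      then show ?thesis using param_coord[OF c True] by (simp add: in_chart_def \<phi>_def)
    next
      case False
      have "param c ` ?B \<subseteq> dom c" using param_in[OF c] Bim by blast
      then show ?thesis using False supp[of p n] by (auto simp: in_chart_def)
    qed
  qed
  have energy_nn: "(\<integral>\<^sup>+ z. ennreal ((\<psi> z)\<^sup>2 + (norm (egrad \<psi> z))\<^sup>2) * indicator ?B z \<partial>lborel) =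
      ennreal ((LINT z|lborel. (\<psi> z)\<^sup>2) + dirichlet \<psi> \<psi>)" if \<psi>: "test_fun y (2 * R) \<psi>" for \<psi>
  proof -
    have i: "integrable lborel (\<lambda>z. (\<psi> z)\<^sup>2)" "integrable lborel (\<lambda>z. egrad \<psi> z \<bullet> egrad \<psi> z)"
      unfolding power2_eq_square by (intro test_fun_integrable[of y "2 * R"] test_fun_mult test_fun_egrad_inner \<psi>)+
    have z0: "(\<psi> z)\<^sup>2 + (norm (egrad \<psi> z))\<^sup>2 = 0" if "z \<notin> ?B" for z
      using \<psi> that frechet_zero_outside[of y "2 * R" \<psi> z] by (simp add: test_fun_def egrad_def vec_eq_iff)
    have "(\<integral>\<^sup>+ z. ennreal ((\<psi> z)\<^sup>2 + (norm (egrad \<psi> z))\<^sup>2) * indicator ?B z \<partial>lborel) =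
        (\<integral>\<^sup>+ z. ennreal ((\<psi> z)\<^sup>2 + egrad \<psi> z \<bullet> egrad \<psi> z) \<partial>lborel)"
      using z0 by (intro nn_integral_cong) (auto simp: indicator_def power2_norm_eq_inner simp del: ennreal_plus)
    also have "\<dots> = ennreal (LINT z|lborel. (\<psi> z)\<^sup>2 + egrad \<psi> z \<bullet> egrad \<psi> z)"
      using i by (intro nn_integral_eq_integral) auto
    finally show ?thesis using i by (simp add: dirichlet_def del: ennreal_plus)
  qed
  have dir0: "0 \<le> dirichlet \<psi> \<psi>" for \<psi> :: "real ^ 'm \<Rightarrow> real" unfolding dirichlet_def by simp
  have dle: "dirichlet (\<lambda>z. \<phi> i z - \<phi> j z) (\<lambda>z. \<phi> i z - \<phi> j z) \<le> K\<^sup>2 * (h1n (\<lambda>p. h i p - h j p))\<^sup>2" for i j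
  proof -
    let ?d = "\<lambda>z. \<phi> i z - \<phi> j z" and ?f = "\<lambda>p. h i p - h j p"
    have tfd: "test_fun y (2 * R) ?d" by (rule test_fun_diff[OF tf tf])
    have sf: "smooth_fun A ?f" by (rule smooth_fun_diff[OF sm sm])
    have eq: "ennreal ((?f (param c z))\<^sup>2 + (norm (egrad (?f \<circ> param c) z))\<^sup>2) * indicator ?B z =
        ennreal ((?d z)\<^sup>2 + (norm (egrad ?d z))\<^sup>2) * indicator ?B z" for z
    proof (cases "z \<in> ?B")
      case True
      then have zi: "z \<in> im c" using Bim by blast
      have D: "(?f \<circ> param c has_derivative frechet_derivative (?f \<circ> param c) (at z)) (at z)"
        by (rule smooth_onD[OF smooth_funD[OF sf c] zi])
      have "(?d has_derivative frechet_derivative (?f \<circ> param c) (at z)) (at z)"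
        by (rule has_derivative_transform_open[OF open_im[OF c] zi _ D]) (simp add: \<phi>_def)
      from frechet_derivative_at[OF this] have "egrad ?d z = egrad (?f \<circ> param c) z" by (simp add: egrad_def)
      moreover have "?d z = ?f (param c z)" using zi by (simp add: \<phi>_def)
      ultimately show ?thesis by simp
    qed simp
    have "ennreal ((LINT z|lborel. (?d z)\<^sup>2) + dirichlet ?d ?d) \<le> ennreal (K\<^sup>2 * (h1n ?f)\<^sup>2)"
      unfolding energy_nn[OF tfd, symmetric] eq[symmetric] by (rule good_energy(2)[OF gd sf Bb B3])
    then have "(LINT z|lborel. (?d z)\<^sup>2) + dirichlet ?d ?d \<le> K\<^sup>2 * (h1n ?f)\<^sup>2"
      by (subst (asm) ennreal_le_iff) auto
    moreover have "0 \<le> (LINT z|lborel. (?d z)\<^sup>2)" by simp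
    ultimately show ?thesis by linarith
  qed
  have L2': "(\<lambda>n. LINT z|lborel. (\<phi> n z)\<^sup>2) \<longlonglongrightarrow> 0"
  proof -
    have le: "ennreal (LINT z|lborel. (\<phi> n z)\<^sup>2) \<le> ennreal K * (\<integral>\<^sup>+ p. ennreal ((h n p)\<^sup>2) \<partial>vol)" for n
    proof -
      have "integrable lborel (\<lambda>z. (\<phi> n z)\<^sup>2)"
        unfolding power2_eq_square by (intro test_fun_integrable[of y "2 * R"] test_fun_mult tf)
      then have "ennreal (LINT z|lborel. (\<phi> n z)\<^sup>2) = (\<integral>\<^sup>+ z. ennreal ((\<phi> n z)\<^sup>2) \<partial>lborel)"
        by (intro nn_integral_eq_integral[symmetric]) auto
      also have "\<dots> = (\<integral>\<^sup>+ z. ennreal ((h n (param c z))\<^sup>2) * indicator ?B z \<partial>lborel)"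
      proof (rule nn_integral_cong)
        fix z show "ennreal ((\<phi> n z)\<^sup>2) = ennreal ((h n (param c z))\<^sup>2) * indicator ?B z"
          using tf[of n] Bim by (auto simp: test_fun_def \<phi>_def indicator_def)
      qed
      also have "\<dots> \<le> ennreal K * (\<integral>\<^sup>+ p. ennreal ((h n p)\<^sup>2) * indicator (param c ` ?B) p \<partial>vol)"
        by (rule good_integral_le(2)[OF gd _ Bb B3])
           (intro measurable_compose[OF _ measurable_ennreal] continuous_imp_borel continuous_intros continuous_smooth_fun sm)
      also have "\<dots> \<le> ennreal K * (\<integral>\<^sup>+ p. ennreal ((h n p)\<^sup>2) \<partial>vol)"
        by (intro mult_left_mono nn_integral_mono) (auto simp: indicator_def)
      finally show ?thesis .
    qed
    have "(\<lambda>n. ennreal K * (\<integral>\<^sup>+ p. ennreal ((h n p)\<^sup>2) \<partial>vol)) \<longlonglongrightarrow> ennreal K * 0"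
      by (intro ennreal_tendsto_cmult L2) simp
    then have lim0: "(\<lambda>n. ennreal K * (\<integral>\<^sup>+ p. ennreal ((h n p)\<^sup>2) \<partial>vol)) \<longlonglongrightarrow> 0" by simp
    have "(\<lambda>n. ennreal (LINT z|lborel. (\<phi> n z)\<^sup>2)) \<longlonglongrightarrow> 0"
      by (rule tendsto_sandwich[OF _ _ tendsto_const lim0]) (simp_all only: le zero_le always_eventually simp_thms)
    then have "(\<lambda>n. ennreal (LINT z|lborel. (\<phi> n z)\<^sup>2)) \<longlonglongrightarrow> ennreal 0" unfolding ennreal_0 .
    then show ?thesis by (subst (asm) tendsto_ennreal_iff) simp_all
  qed
  have "(\<lambda>n. dirichlet (\<phi> n) (\<phi> n)) \<longlonglongrightarrow> 0"
  proof (rule dirichlet_closable[OF tf L2'])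
    fix e :: real assume e: "0 < e"
    then have "0 < e / K\<^sup>2" using K by simp
    then obtain M where M: "\<And>i j. i \<ge> M \<Longrightarrow> j \<ge> M \<Longrightarrow> (h1n (\<lambda>p. h i p - h j p))\<^sup>2 < e / K\<^sup>2"
      using h unfolding h1_cauchy_def by blast
    have "dirichlet (\<lambda>z. \<phi> i z - \<phi> j z) (\<lambda>z. \<phi> i z - \<phi> j z) < e" if "i \<ge> M" "j \<ge> M" for i j
    proof -
      have "K\<^sup>2 * (h1n (\<lambda>p. h i p - h j p))\<^sup>2 < K\<^sup>2 * (e / K\<^sup>2)"
        using M[OF that] K by (intro mult_strict_left_mono) auto
      then show ?thesis using dle[of i j] K by simp
    qed
    then show "\<exists>M. \<forall>i\<ge>M. \<forall>j\<ge>M. dirichlet (\<lambda>z. \<phi> i z - \<phi> j z) (\<lambda>z. \<phi> i z - \<phi> j z) < e" by blast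
  qed
  then have lim: "(\<lambda>n. K\<^sup>2 * ((LINT z|lborel. (\<phi> n z)\<^sup>2) + dirichlet (\<phi> n) (\<phi> n))) \<longlonglongrightarrow> K\<^sup>2 * (0 + 0)"
    by (intro tendsto_intros L2')
  have "(h1n (h n))\<^sup>2 \<le> K\<^sup>2 * ((LINT z|lborel. (\<phi> n z)\<^sup>2) + dirichlet (\<phi> n) (\<phi> n))" for n
  proof -
    have "ennreal ((h1n (h n))\<^sup>2) \<le> ennreal (K\<^sup>2) * ennreal ((LINT z|lborel. (\<phi> n z)\<^sup>2) + dirichlet (\<phi> n) (\<phi> n))"
      unfolding energy_nn[OF tf, symmetric] hp[of n]
      by (rule in_chart_energy(1)[OF gd]) (use tf[of n] in \<open>simp_all add: test_fun_def\<close>)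
    also have "\<dots> = ennreal (K\<^sup>2 * ((LINT z|lborel. (\<phi> n z)\<^sup>2) + dirichlet (\<phi> n) (\<phi> n)))"
      by (simp add: ennreal_mult' del: ennreal_plus)
    finally show ?thesis using dir0 by (subst (asm) ennreal_le_iff) auto
  qed
  then show ?thesis
    by (intro tendsto_sandwich[OF _ _ tendsto_const lim[simplified]]) auto
qed

end


section \<open>Smooth truncations of Cauchy sequences\<close>

text \<open>Truncations with values in \<open>[0, 1]\<close> and compactly supported derivative. In contrast to piecewise
  linear truncations they preserve smoothness, and they are Lipschitz together with their derivative.\<close>

definition profile :: "(real \<Rightarrow> real) \<Rightarrow> bool" where
  "profile \<Phi> \<longleftrightarrow> smooth_on UNIV \<Phi> \<and> (\<forall>t. 0 \<le> \<Phi> t \<and> \<Phi> t \<le> 1) \<and>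
    (\<exists>\<alpha> r. \<forall>t. t \<notin> cball \<alpha> r \<longrightarrow> frechet_derivative \<Phi> (at t) 1 = 0)"

lemma frechet_locally_const:
  assumes "open U" "t \<in> U" "\<And>s. s \<in> U \<Longrightarrow> \<Phi> s = k"
  shows "frechet_derivative \<Phi> (at t) v = 0"
proof -
  have "((\<lambda>t. k) has_derivative (\<lambda>v. 0)) (at t)" by simp
  then have "(\<Phi> has_derivative (\<lambda>v. 0)) (at t)"
    by (rule has_derivative_transform_open[OF assms(1,2), rotated]) (simp add: assms(3))
  from frechet_derivative_at[OF this] show ?thesis by metis
qed

lemma profile_const_1: "profile (\<lambda>t. 1)"
  unfolding profile_def using frechet_locally_const[of UNIV _ "\<lambda>t. 1" 1] by (auto intro: smooth_on_const)

text \<open>Equal to \<open>1\<close> on \<open>t \<le> 1 / 2\<close> and to \<open>0\<close> on \<open>t \<ge> 1\<close>: selects the points where a capacity potential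
  is still small.\<close>

lemma profile_low: "profile (\<lambda>t. smooth_step (2 * t))"
proof -
  have lin: "smooth_on UNIV (\<lambda>t::real. 2 * t)"
    by (intro smooth_on_bounded_linear bounded_linear_mult_right) auto
  have "smooth_on UNIV (\<lambda>t. smooth_step (2 * t))"
    by (rule smooth_on_compose[OF _ _ _ smooth_smooth_step lin]) auto
  moreover have "frechet_derivative (\<lambda>t. smooth_step (2 * t)) (at t) 1 = 0" if "t \<notin> cball 0 1" for t
  proof (cases "t > 1")
    case True
    show ?thesis
      by (rule frechet_locally_const[of "{1<..}" _ _ 0]) (use True smooth_step_eq_0 in auto)
  next
    case False
    with that have "t < 0" by (auto simp: dist_real_def)
    then show ?thesis
      by (intro frechet_locally_const[of "{..<0}" _ _ 1]) (use smooth_step_eq_1 in auto)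
  qed
  ultimately show ?thesis unfolding profile_def using smooth_step_bounds by blast
qed

text \<open>Equal to \<open>0\<close> for \<open>\<bar>t - a\<bar> \<le> \<delta>\<close> and to \<open>1\<close> for \<open>\<bar>t - a\<bar> \<ge> 2 \<delta>\<close>: selects the points where a
  function is far from the value \<open>a\<close>.\<close>

lemma profile_away:
  assumes "0 < \<delta>"
  shows "profile (\<lambda>t. 1 - smooth_step (((t - a) / \<delta>)\<^sup>2))"
proof -
  let ?q = "\<lambda>t. ((t - a) / \<delta>)\<^sup>2"
  have "smooth_on UNIV (\<lambda>t. (norm (t - a))\<^sup>2 * inverse (\<delta>\<^sup>2))"
    by (intro smooth_on_mult smooth_norm_sq smooth_on_const) auto
  moreover have "(norm (t - a))\<^sup>2 * inverse (\<delta>\<^sup>2) = ?q t" for t by (simp add: divide_inverse power_mult_distrib power_inverse)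
  ultimately have q: "smooth_on UNIV ?q" by simp
  have "smooth_on UNIV (\<lambda>t. smooth_step (?q t))" by (rule smooth_on_compose[OF _ _ _ smooth_smooth_step q]) auto
  then have "smooth_on UNIV (\<lambda>t. 1 + (-1) * smooth_step (?q t))"
    by (intro smooth_on_add smooth_on_mult smooth_on_const) auto
  then have "smooth_on UNIV (\<lambda>t. 1 - smooth_step (?q t))" by simp
  moreover have "frechet_derivative (\<lambda>t. 1 - smooth_step (?q t)) (at t) 1 = 0" if "t \<notin> cball a (2 * \<delta>)" for t
  proof (rule frechet_locally_const[of "- cball a (2 * \<delta>)" _ _ 1])
    fix s assume "s \<in> - cball a (2 * \<delta>)"
    then have "2 * \<delta> \<le> \<bar>s - a\<bar>" by (auto simp: dist_real_def)
    then have "2 \<le> \<bar>(s - a) / \<delta>\<bar>" using assms by (simp add: pos_le_divide_eq)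
    then have "2\<^sup>2 \<le> \<bar>(s - a) / \<delta>\<bar>\<^sup>2" by (intro power_mono) auto
    moreover have "(2::real)\<^sup>2 = 4" by simp
    ultimately have "2 \<le> ?q s" unfolding power2_abs by linarith
    from smooth_step_eq_0[OF this] show "1 - smooth_step (?q s) = 1" by simp
  qed (use that in auto)
  ultimately show ?thesis unfolding profile_def using smooth_step_bounds by auto
qed

lemma profile_derivative:
  assumes "profile \<Phi>"
  obtains \<Phi>' B where "0 \<le> B" "\<And>t. (\<Phi> has_real_derivative \<Phi>' t) (at t)" "continuous_on UNIV \<Phi>'"
    "\<And>t. \<bar>\<Phi>' t\<bar> \<le> B" "\<And>s t. \<bar>\<Phi>' s - \<Phi>' t\<bar> \<le> B * \<bar>s - t\<bar>" "\<And>s t. \<bar>\<Phi> s - \<Phi> t\<bar> \<le> B * \<bar>s - t\<bar>"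
proof -
  have sm: "smooth_on UNIV \<Phi>" using assms by (simp add: profile_def)
  let ?d = "\<lambda>\<Phi> t. frechet_derivative \<Phi> (at t) (1::real)"
  have deriv: "(\<Phi> has_real_derivative ?d \<Phi> t) (at t)" if "smooth_on UNIV \<Phi>" for \<Phi> :: "real \<Rightarrow> real" and t
  proof -
    have D: "(\<Phi> has_derivative frechet_derivative \<Phi> (at t)) (at t)"
      by (rule smooth_onD[OF that]) simp
    have "frechet_derivative \<Phi> (at t) = (\<lambda>h. ?d \<Phi> t * h)"
    proof
      fix h show "frechet_derivative \<Phi> (at t) h = ?d \<Phi> t * h"
        using linear_cmul[OF has_derivative_linear[OF D], of h 1] by simp
    qed
    with D show ?thesis by (simp add: has_field_derivative_def)
  qed
  have lip: "\<bar>\<Phi> s - \<Phi> t\<bar> \<le> B * \<bar>s - t\<bar>" if "smooth_on UNIV \<Phi>" "\<And>t. \<bar>?d \<Phi> t\<bar> \<le> B" for \<Phi> :: "real \<Rightarrow> real" and B s t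
    using field_differentiable_bound[of UNIV \<Phi> "?d \<Phi>" B s t] deriv[OF that(1)] that(2) by auto
  obtain \<alpha> r where z: "\<And>t. t \<notin> cball \<alpha> r \<Longrightarrow> ?d \<Phi> t = 0" using assms unfolding profile_def by blast
  have sm1: "smooth_on UNIV (?d \<Phi>)" and sm2: "smooth_on UNIV (?d (?d \<Phi>))"
    by (intro smooth_on_frechet sm)+
  have z2: "?d (?d \<Phi>) t = 0" if "t \<notin> cball \<alpha> r" for t using frechet_zero_outside[of \<alpha> r "?d \<Phi>"] z that by blast
  obtain B1 where B1: "0 \<le> B1" "\<And>t. \<bar>?d \<Phi> t\<bar> \<le> B1"
    using bounded_compact_support[OF smooth_on_continuous[OF sm1] z] by blast
  obtain B2 where B2: "0 \<le> B2" "\<And>t. \<bar>?d (?d \<Phi>) t\<bar> \<le> B2"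
    using bounded_compact_support[OF smooth_on_continuous[OF sm2] z2] by blast
  let ?B = "max B1 B2"
  have b: "\<bar>?d \<Phi> t\<bar> \<le> ?B" "\<bar>?d (?d \<Phi>) t\<bar> \<le> ?B" for t
    using B1(2)[of t] B2(2)[of t] by (auto simp: le_max_iff_disj)
  show ?thesis
  proof (rule that[of ?B "?d \<Phi>"])
    show "0 \<le> ?B" using B1 by simp
    show "(\<Phi> has_real_derivative ?d \<Phi> t) (at t)" for t by (rule deriv[OF sm])
    show "continuous_on UNIV (?d \<Phi>)" by (rule smooth_on_continuous[OF sm1])
    show "\<bar>?d \<Phi> t\<bar> \<le> ?B" for t by (rule b)
    show "\<bar>?d \<Phi> s - ?d \<Phi> t\<bar> \<le> ?B * \<bar>s - t\<bar>" for s t by (rule lip[OF sm1 b(2)])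
    show "\<bar>\<Phi> s - \<Phi> t\<bar> \<le> ?B * \<bar>s - t\<bar>" for s t by (rule lip[OF sm b(1)])
  qed
qed

context closed_riemannian
begin

definition l2_sq :: "('a \<Rightarrow> real) \<Rightarrow> real" where "l2_sq f = (LINT p|vol. (f p)\<^sup>2)"
definition energy :: "('a \<Rightarrow> real) \<Rightarrow> real" where "energy f = (LINT p|vol. grad_sq A g f p)"

lemma h1n_split:
  assumes f: "smooth_fun A f"
  shows "(h1n f)\<^sup>2 = l2_sq f + energy f"
proof -
  have "integrable vol (\<lambda>p. (f p)\<^sup>2)" "integrable vol (grad_sq A g f)"
    by (intro integrable_vol continuous_intros continuous_smooth_fun continuous_grad_sq f)+
  then show ?thesis
    unfolding h1n_sq h1_inner_def grad_sq_eq[symmetric] l2_sq_def energy_def by (simp add: power2_eq_square)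
qed

lemma l2_sq_nonneg: "0 \<le> l2_sq f" by (simp add: l2_sq_def)
lemma energy_nonneg: "0 \<le> energy f" by (simp add: energy_def grad_sq_nonneg)

lemma lint_mono:
  fixes f h :: "'a \<Rightarrow> real"
  assumes "continuous_on UNIV f" "continuous_on UNIV h" "\<And>p. f p \<le> h p"
  shows "(LINT p|vol. f p) \<le> (LINT p|vol. h p)"
  by (rule integral_mono) (simp_all add: integrable_vol assms)

lemma square_sum_le: "((a::real) + b)\<^sup>2 \<le> 2 * a\<^sup>2 + 2 * b\<^sup>2"
  using zero_le_power2[of "a - b"] by (simp add: power2_sum power2_diff)

lemma grad_sq_le_2:
  assumes "diff_at f p = v + w"
  shows "grad_sq A g f p \<le> 2 * (conorm p v)\<^sup>2 + 2 * (conorm p w)\<^sup>2"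
proof -
  have "grad_sq A g f p \<le> (conorm p v + conorm p w)\<^sup>2"
    unfolding grad_sq_conorm assms by (intro power_mono conorm_triangle conorm_nonneg)
  also have "\<dots> \<le> 2 * (conorm p v)\<^sup>2 + 2 * (conorm p w)\<^sup>2" by (rule square_sum_le)
  finally show ?thesis .
qed

lemma conorm_scaleR_sq: "(conorm p (r *\<^sub>R v))\<^sup>2 = r\<^sup>2 * (conorm p v)\<^sup>2"
  by (simp add: conorm_scaleR power_mult_distrib)

text \<open>Weights that tend to zero in \<open>L\<^sup>2\<close> and stay bounded kill the energies of a Cauchy sequence, since
  these energies are uniformly integrable: a fixed member has a bounded gradient.\<close>

lemma weighted_energy_small:
  assumes f: "h1_cauchy f" and W: "\<And>i j. continuous_on UNIV (W i j)" "\<And>i j p. \<bar>W i j p\<bar> \<le> M"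
    and W0: "\<And>e. 0 < e \<Longrightarrow> \<exists>N. \<forall>i\<ge>N. \<forall>j\<ge>N. l2_sq (W i j) < e"
    and e: "0 < (e :: real)"
  shows "\<exists>N :: nat. \<forall>i\<ge>N. \<forall>j\<ge>N. (LINT p|vol. (W i j p)\<^sup>2 * grad_sq A g (f j) p) < e"
proof -
  have sm: "smooth_fun A (f n)" for n using f by (simp add: h1_cauchy_def)
  have M: "0 \<le> M\<^sup>2" by simp
  have "0 < e / (4 * (M\<^sup>2 + 1))" using e M by (intro divide_pos_pos) (auto intro: add_nonneg_pos)
  then obtain k where k: "\<And>j. j \<ge> k \<Longrightarrow> (h1n (\<lambda>p. f j p - f k p))\<^sup>2 < e / (4 * (M\<^sup>2 + 1))"
    using f unfolding h1_cauchy_def by (metis order_refl)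
  \<comment> \<open>Split off a fixed late member: its gradient is bounded, and the remainder has small energy.\<close>
  obtain G where G: "0 < G" "\<And>p. grad_sq A g (f k) p \<le> G"
  proof -
    have "bounded (range (grad_sq A g (f k)))"
      by (rule compact_imp_bounded[OF compact_continuous_image[OF continuous_grad_sq[OF sm] compact_X]])
    then obtain b where "\<And>p. \<bar>grad_sq A g (f k) p\<bar> \<le> b" unfolding bounded_iff by auto
    then have "grad_sq A g (f k) p \<le> \<bar>b\<bar> + 1" for p by (metis abs_ge_self add_increasing2 order_trans zero_le_one)
    then show ?thesis by (intro that[of "\<bar>b\<bar> + 1"]) auto
  qed
  have "0 < e / (4 * G)" using e G by simp
  then obtain N where N: "\<And>i j. i \<ge> N \<Longrightarrow> j \<ge> N \<Longrightarrow> l2_sq (W i j) < e / (4 * G)" using W0 by blast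
  show ?thesis
  proof (intro exI allI impI)
    fix i j assume ij: "max N k \<le> i" "max N k \<le> j"
    let ?d = "\<lambda>p. f j p - f k p"
    have sd: "smooth_fun A ?d" by (rule smooth_fun_diff[OF sm sm])
    have pw: "(W i j p)\<^sup>2 * grad_sq A g (f j) p \<le> 2 * M\<^sup>2 * grad_sq A g ?d p + 2 * G * (W i j p)\<^sup>2" for p
    proof -
      have "diff_at (f j) p = diff_at ?d p + diff_at (f k) p"
        by (simp add: differential_diff[OF chart_at sm sm])
      then have g2: "grad_sq A g (f j) p \<le> 2 * grad_sq A g ?d p + 2 * grad_sq A g (f k) p"
        using grad_sq_le_2 by (simp add: grad_sq_conorm)
      have W2: "(W i j p)\<^sup>2 \<le> M\<^sup>2" using W(2)[of i j p] by (metis abs_le_square_iff abs_of_nonneg abs_ge_zero order_trans)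
      have "(W i j p)\<^sup>2 * grad_sq A g (f j) p \<le> (W i j p)\<^sup>2 * (2 * grad_sq A g ?d p + 2 * grad_sq A g (f k) p)"
        by (intro mult_left_mono g2) simp
      also have "\<dots> = 2 * ((W i j p)\<^sup>2 * grad_sq A g ?d p) + 2 * ((W i j p)\<^sup>2 * grad_sq A g (f k) p)" by (simp add: algebra_simps)
      also have "(W i j p)\<^sup>2 * grad_sq A g ?d p \<le> M\<^sup>2 * grad_sq A g ?d p" by (intro mult_right_mono W2 grad_sq_nonneg)
      also have "(W i j p)\<^sup>2 * grad_sq A g (f k) p \<le> (W i j p)\<^sup>2 * G" by (intro mult_left_mono G) simp
      finally show ?thesis by (simp add: mult_ac)
    qed
    have "(LINT p|vol. (W i j p)\<^sup>2 * grad_sq A g (f j) p) \<le> (LINT p|vol. 2 * M\<^sup>2 * grad_sq A g ?d p + 2 * G * (W i j p)\<^sup>2)"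
      by (intro lint_mono pw continuous_intros continuous_grad_sq sm sd W(1))
    also have "\<dots> = 2 * M\<^sup>2 * energy ?d + 2 * G * l2_sq (W i j)"
    proof -
      have "integrable vol (grad_sq A g ?d)" "integrable vol (\<lambda>p. (W i j p)\<^sup>2)"
        by (intro integrable_vol continuous_intros continuous_grad_sq sd W(1))+
      then show ?thesis by (simp add: energy_def l2_sq_def)
    qed
    also have "\<dots> < e"
    proof -
      have "energy ?d \<le> (h1n ?d)\<^sup>2" using h1n_split[OF sd] l2_sq_nonneg[of ?d] by simp
      also have "\<dots> < e / (4 * (M\<^sup>2 + 1))" using k ij by simp
      finally have "energy ?d * (4 * (M\<^sup>2 + 1)) < e" using M by (subst (asm) pos_less_divide_eq) (auto intro: add_nonneg_pos)
      then have 1: "4 * (M\<^sup>2 * energy ?d) + 4 * energy ?d < e" by (simp add: algebra_simps)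
      have "l2_sq (W i j) < e / (4 * G)" using N ij by simp
      then have 2: "4 * (G * l2_sq (W i j)) < e" using G by (simp add: pos_less_divide_eq mult_ac)
      show ?thesis using 1 2 energy_nonneg[of ?d] by (simp add: mult.assoc)
    qed
    finally show "(LINT p|vol. (W i j p)\<^sup>2 * grad_sq A g (f j) p) < e" .
  qed
qed

text \<open>The gradient of the difference of \<open>\<Phi> (f i)\<close> and \<open>\<Phi> (f j)\<close> splits into \<open>\<Phi>' (f i) \<nabla>(f i - f j)\<close>, which is
  small since \<open>\<Phi>'\<close> is bounded, and \<open>(\<Phi>' (f i) - \<Phi>' (f j)) \<nabla>(f j)\<close>, which is small by
  \<open>weighted_energy_small\<close>.\<close>

lemma h1_cauchy_profile:
  assumes f: "h1_cauchy f" and \<Phi>: "profile \<Phi>"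
  shows "h1_cauchy (\<lambda>n p. \<Phi> (f n p))"
proof -
  obtain \<Phi>' B where B: "0 \<le> B" and D: "\<And>t. (\<Phi> has_real_derivative \<Phi>' t) (at t)" and cont': "continuous_on UNIV \<Phi>'"
    and b: "\<And>t. \<bar>\<Phi>' t\<bar> \<le> B" "\<And>s t. \<bar>\<Phi>' s - \<Phi>' t\<bar> \<le> B * \<bar>s - t\<bar>" "\<And>s t. \<bar>\<Phi> s - \<Phi> t\<bar> \<le> B * \<bar>s - t\<bar>"
    by (rule profile_derivative[OF \<Phi>]) (rule that)
  have sm: "smooth_fun A (f n)" for n using f by (simp add: h1_cauchy_def)
  have smP: "smooth_fun A (\<lambda>p. \<Phi> (f n p))" for n
    by (rule smooth_fun_compose[OF _ sm]) (use \<Phi> in \<open>simp add: profile_def\<close>)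
  define W where "W i j p = \<Phi>' (f i p) - \<Phi>' (f j p)" for i j p
  have contW: "continuous_on UNIV (W i j)" for i j
    unfolding W_def by (intro continuous_intros continuous_on_compose2[OF cont' continuous_smooth_fun[OF sm]]) auto
  have Wb: "\<bar>W i j p\<bar> \<le> 2 * B" for i j p unfolding W_def using b(1)[of "f i p"] b(1)[of "f j p"] by simp
  have sq: "x\<^sup>2 \<le> B\<^sup>2 * y\<^sup>2" if "\<bar>x\<bar> \<le> B * \<bar>y\<bar>" for x y :: real
    using power_mono[OF that, of 2] by (simp add: power_mult_distrib)
  have l2W: "l2_sq (W i j) \<le> B\<^sup>2 * (h1n (\<lambda>p. f i p - f j p))\<^sup>2" for i j
  proof -
    have "l2_sq (W i j) \<le> (LINT p|vol. B\<^sup>2 * (f i p - f j p)\<^sup>2)"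
      unfolding l2_sq_def
      by (intro lint_mono continuous_intros contW continuous_smooth_fun sm) (simp add: W_def sq b(2))
    also have "\<dots> = B\<^sup>2 * l2_sq (\<lambda>p. f i p - f j p)" by (simp add: l2_sq_def)
    also have "\<dots> \<le> B\<^sup>2 * (h1n (\<lambda>p. f i p - f j p))\<^sup>2"
      using h1n_split[OF smooth_fun_diff[OF sm[of i] sm[of j]]] energy_nonneg by (intro mult_left_mono) simp_all
    finally show ?thesis .
  qed
  have B1: "0 < B\<^sup>2 + 1" by (simp add: add_nonneg_pos)
  have W0: "\<exists>N. \<forall>i\<ge>N. \<forall>j\<ge>N. l2_sq (W i j) < e" if e: "0 < e" for e
  proof -
    have "0 < e / (B\<^sup>2 + 1)" using e B1 by simp
    then obtain N where N: "\<And>i j. i \<ge> N \<Longrightarrow> j \<ge> N \<Longrightarrow> (h1n (\<lambda>p. f i p - f j p))\<^sup>2 < e / (B\<^sup>2 + 1)"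
      using f unfolding h1_cauchy_def by blast
    have "l2_sq (W i j) < e" if "i \<ge> N" "j \<ge> N" for i j
    proof -
      let ?n = "(h1n (\<lambda>p. f i p - f j p))\<^sup>2"
      have "?n * (B\<^sup>2 + 1) < e" using N[OF that] B1 by (simp add: pos_less_divide_eq)
      moreover have "?n * (B\<^sup>2 + 1) = B\<^sup>2 * ?n + ?n" by (simp add: algebra_simps)
      ultimately have "B\<^sup>2 * ?n < e" using zero_le_power2[of "h1n (\<lambda>p. f i p - f j p)"] by linarith
      then show ?thesis using l2W[of i j] by linarith
    qed
    then show ?thesis by blast
  qed
  have bound: "(h1n (\<lambda>p. \<Phi> (f i p) - \<Phi> (f j p)))\<^sup>2 \<le> 2 * B\<^sup>2 * (h1n (\<lambda>p. f i p - f j p))\<^sup>2 +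
      2 * (LINT p|vol. (W i j p)\<^sup>2 * grad_sq A g (f j) p)" for i j
  proof -
    let ?d = "\<lambda>p. f i p - f j p" and ?P = "\<lambda>p. \<Phi> (f i p) - \<Phi> (f j p)"
    have sd: "smooth_fun A ?d" and sP: "smooth_fun A ?P" by (intro smooth_fun_diff sm smP)+
    have gP: "grad_sq A g ?P p \<le> 2 * B\<^sup>2 * grad_sq A g ?d p + 2 * ((W i j p)\<^sup>2 * grad_sq A g (f j) p)" for p
    proof -
      have "diff_at ?P p = \<Phi>' (f i p) *\<^sub>R diff_at (f i) p - \<Phi>' (f j p) *\<^sub>R diff_at (f j) p"
        by (simp add: differential_diff[OF chart_at smP smP] differential_compose[OF chart_at sm D])
      also have "\<dots> = \<Phi>' (f i p) *\<^sub>R diff_at ?d p + W i j p *\<^sub>R diff_at (f j) p"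
        by (simp add: differential_diff[OF chart_at sm sm] W_def algebra_simps)
      finally have "grad_sq A g ?P p \<le> 2 * (conorm p (\<Phi>' (f i p) *\<^sub>R diff_at ?d p))\<^sup>2 + 2 * (conorm p (W i j p *\<^sub>R diff_at (f j) p))\<^sup>2"
        by (rule grad_sq_le_2)
      also have "\<dots> = 2 * ((\<Phi>' (f i p))\<^sup>2 * grad_sq A g ?d p) + 2 * ((W i j p)\<^sup>2 * grad_sq A g (f j) p)"
        unfolding conorm_scaleR_sq grad_sq_conorm ..
      also have "(\<Phi>' (f i p))\<^sup>2 * grad_sq A g ?d p \<le> B\<^sup>2 * grad_sq A g ?d p"
        using sq[of "\<Phi>' (f i p)" 1] b(1)[of "f i p"] by (intro mult_right_mono grad_sq_nonneg) simp
      finally show ?thesis by simp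
    qed
    have "l2_sq ?P \<le> (LINT p|vol. B\<^sup>2 * (?d p)\<^sup>2)"
      unfolding l2_sq_def
      by (intro lint_mono continuous_intros continuous_smooth_fun sm smP) (simp add: sq b(3))
    also have "\<dots> = B\<^sup>2 * l2_sq ?d" by (simp add: l2_sq_def)
    finally have l2P: "l2_sq ?P \<le> B\<^sup>2 * l2_sq ?d" .
    have "energy ?P \<le> (LINT p|vol. 2 * B\<^sup>2 * grad_sq A g ?d p + 2 * ((W i j p)\<^sup>2 * grad_sq A g (f j) p))"
      unfolding energy_def by (intro lint_mono gP continuous_intros continuous_grad_sq sP sd sm contW)
    also have "\<dots> = 2 * B\<^sup>2 * energy ?d + 2 * (LINT p|vol. (W i j p)\<^sup>2 * grad_sq A g (f j) p)"
    proof -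
      have "integrable vol (grad_sq A g ?d)" "integrable vol (\<lambda>p. (W i j p)\<^sup>2 * grad_sq A g (f j) p)"
        by (intro integrable_vol continuous_intros continuous_grad_sq sd sm contW)+
      then show ?thesis by (simp add: energy_def)
    qed
    finally have eP: "energy ?P \<le> 2 * B\<^sup>2 * energy ?d + 2 * (LINT p|vol. (W i j p)\<^sup>2 * grad_sq A g (f j) p)" .
    have "0 \<le> B\<^sup>2 * l2_sq ?d" by (simp add: l2_sq_nonneg)
    then show ?thesis unfolding h1n_split[OF sP] h1n_split[OF sd] distrib_left using l2P eP by linarith
  qed
  show ?thesis
    unfolding h1_cauchy_def
  proof (intro conjI allI impI smP)
    fix e :: real assume e: "0 < e"
    have "0 < e / (4 * (B\<^sup>2 + 1))" using e B1 by simp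
    then obtain N1 where N1: "\<And>i j. i \<ge> N1 \<Longrightarrow> j \<ge> N1 \<Longrightarrow> (h1n (\<lambda>p. f i p - f j p))\<^sup>2 < e / (4 * (B\<^sup>2 + 1))"
      using f unfolding h1_cauchy_def by blast
    obtain N2 where N2: "\<And>i j. i \<ge> N2 \<Longrightarrow> j \<ge> N2 \<Longrightarrow> (LINT p|vol. (W i j p)\<^sup>2 * grad_sq A g (f j) p) < e / 4"
      using weighted_energy_small[OF f contW Wb W0, of "e / 4"] e by auto
    have "(h1n (\<lambda>p. \<Phi> (f i p) - \<Phi> (f j p)))\<^sup>2 < e" if ij: "i \<ge> max N1 N2" "j \<ge> max N1 N2" for i j
    proof -
      let ?n = "(h1n (\<lambda>p. f i p - f j p))\<^sup>2"
      have "?n < e / (4 * (B\<^sup>2 + 1))" using N1 ij by simp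
      then have "?n * (4 * (B\<^sup>2 + 1)) < e" using B1 by (subst (asm) pos_less_divide_eq) auto
      then have "4 * (B\<^sup>2 * ?n) + 4 * ?n < e" by (simp add: algebra_simps)
      then have "2 * B\<^sup>2 * ?n < e / 2"
        using zero_le_power2[of "h1n (\<lambda>p. f i p - f j p)"] unfolding mult.assoc by linarith
      moreover have "(LINT p|vol. (W i j p)\<^sup>2 * grad_sq A g (f j) p) < e / 4" using N2 ij by simp
      ultimately show ?thesis using bound[of i j] by linarith
    qed
    then show "\<exists>M. \<forall>i\<ge>M. \<forall>j\<ge>M. (h1n (\<lambda>p. \<Phi> (f i p) - \<Phi> (f j p)))\<^sup>2 < e" by blast
  qed
qed

lemma h1_cauchy_l2: "h1_cauchy F \<Longrightarrow> 0 < e \<Longrightarrow> \<exists>N. \<forall>i\<ge>N. \<forall>j\<ge>N. l2_sq (\<lambda>p. F i p - F j p) < e"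
proof -
  assume F: "h1_cauchy F" and e: "0 < e"
  then obtain N where N: "\<And>i j. i \<ge> N \<Longrightarrow> j \<ge> N \<Longrightarrow> (h1n (\<lambda>p. F i p - F j p))\<^sup>2 < e"
    unfolding h1_cauchy_def by blast
  have "l2_sq (\<lambda>p. F i p - F j p) < e" if "i \<ge> N" "j \<ge> N" for i j
    using N[OF that] h1n_split[of "\<lambda>p. F i p - F j p"] smooth_fun_diff[of "F i" "F j"] F energy_nonneg[of "\<lambda>p. F i p - F j p"]
    by (simp add: h1_cauchy_def)
  then show ?thesis by blast
qed

text \<open>The product rule leaves the terms \<open>(F i - F j) \<nabla>(G j)\<close> and \<open>(G i - G j) \<nabla>(F j)\<close>, in which the weights
  are bounded and tend to zero in \<open>L\<^sup>2\<close>.\<close>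

lemma h1_cauchy_mult:
  assumes F: "h1_cauchy F" and G: "h1_cauchy G" and F1: "\<And>n p. \<bar>F n p\<bar> \<le> 1" and G1: "\<And>n p. \<bar>G n p\<bar> \<le> 1"
  shows "h1_cauchy (\<lambda>n p. F n p * G n p)"
proof -
  have sF: "smooth_fun A (F n)" and sG: "smooth_fun A (G n)" for n using F G by (auto simp: h1_cauchy_def)
  have sP: "smooth_fun A (\<lambda>p. F n p * G n p)" for n by (intro smooth_fun_mult sF sG)
  define U where "U i j p = F i p - F j p" for i j p
  define V where "V i j p = G i p - G j p" for i j p
  have sU: "smooth_fun A (U i j)" and sV: "smooth_fun A (V i j)" for i j
    unfolding U_def[abs_def] V_def[abs_def] by (intro smooth_fun_diff sF sG)+
  have cU: "continuous_on UNIV (U i j)" and cV: "continuous_on UNIV (V i j)" for i j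
    by (intro continuous_smooth_fun sU sV)+
  have Ub: "\<bar>U i j p\<bar> \<le> 2" and Vb: "\<bar>V i j p\<bar> \<le> 2" for i j p
    unfolding U_def V_def using F1[of i p] F1[of j p] G1[of i p] G1[of j p] by simp_all
  have U0: "\<exists>N. \<forall>i\<ge>N. \<forall>j\<ge>N. l2_sq (U i j) < e" if "0 < e" for e
    using h1_cauchy_l2[OF F that] by (simp add: U_def[abs_def])
  have V0: "\<exists>N. \<forall>i\<ge>N. \<forall>j\<ge>N. l2_sq (V i j) < e" if "0 < e" for e
    using h1_cauchy_l2[OF G that] by (simp add: V_def[abs_def])
  let ?IU = "\<lambda>i j. LINT p|vol. (U i j p)\<^sup>2 * grad_sq A g (G j) p"
  let ?IV = "\<lambda>i j. LINT p|vol. (V i j p)\<^sup>2 * grad_sq A g (F j) p"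
  have bound: "(h1n (\<lambda>p. F i p * G i p - F j p * G j p))\<^sup>2 \<le>
      4 * (h1n (U i j))\<^sup>2 + 4 * (h1n (V i j))\<^sup>2 + 4 * ?IU i j + 4 * ?IV i j" for i j
  proof -
    let ?P = "\<lambda>p. F i p * G i p - F j p * G j p"
    have sPd: "smooth_fun A ?P" by (intro smooth_fun_diff sP)
    have one: "x\<^sup>2 * y \<le> y" if "\<bar>x\<bar> \<le> 1" "0 \<le> y" for x y :: real
      using mult_right_mono[of "x\<^sup>2" 1 y] that by (simp add: abs_square_le_1)
    have gP: "grad_sq A g ?P p \<le> 4 * grad_sq A g (V i j) p + 4 * ((U i j p)\<^sup>2 * grad_sq A g (G j) p) +
        (4 * grad_sq A g (U i j) p + 4 * ((V i j p)\<^sup>2 * grad_sq A g (F j) p))" for p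
    proof -
      have dU: "diff_at (U i j) p = diff_at (F i) p - diff_at (F j) p" and dV: "diff_at (V i j) p = diff_at (G i) p - diff_at (G j) p"
        unfolding U_def[abs_def] V_def[abs_def] by (simp_all add: differential_diff[OF chart_at] sF sG)
      have "diff_at ?P p = (F i p *\<^sub>R diff_at (G i) p + G i p *\<^sub>R diff_at (F i) p) - (F j p *\<^sub>R diff_at (G j) p + G j p *\<^sub>R diff_at (F j) p)"
        by (simp add: differential_diff[OF chart_at sP sP] differential_mult[OF chart_at] sF sG)
      also have "\<dots> = (F i p *\<^sub>R diff_at (V i j) p + U i j p *\<^sub>R diff_at (G j) p) + (G i p *\<^sub>R diff_at (U i j) p + V i j p *\<^sub>R diff_at (F j) p)"
        by (simp add: dU dV U_def V_def algebra_simps)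
      finally have "grad_sq A g ?P p \<le> 2 * (conorm p (F i p *\<^sub>R diff_at (V i j) p + U i j p *\<^sub>R diff_at (G j) p))\<^sup>2 +
          2 * (conorm p (G i p *\<^sub>R diff_at (U i j) p + V i j p *\<^sub>R diff_at (F j) p))\<^sup>2"
        by (rule grad_sq_le_2)
      moreover have two: "(conorm p (a *\<^sub>R v + b *\<^sub>R w))\<^sup>2 \<le> 2 * (a\<^sup>2 * (conorm p v)\<^sup>2) + 2 * (b\<^sup>2 * (conorm p w)\<^sup>2)" for a b v w
      proof -
        have "(conorm p (a *\<^sub>R v + b *\<^sub>R w))\<^sup>2 \<le> (conorm p (a *\<^sub>R v) + conorm p (b *\<^sub>R w))\<^sup>2"
          by (intro power_mono conorm_triangle conorm_nonneg)
        also have "\<dots> \<le> 2 * (conorm p (a *\<^sub>R v))\<^sup>2 + 2 * (conorm p (b *\<^sub>R w))\<^sup>2" by (rule square_sum_le)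
        finally show ?thesis unfolding conorm_scaleR_sq .
      qed
      moreover have "(F i p)\<^sup>2 * (conorm p (diff_at (V i j) p))\<^sup>2 \<le> grad_sq A g (V i j) p"
        "(G i p)\<^sup>2 * (conorm p (diff_at (U i j) p))\<^sup>2 \<le> grad_sq A g (U i j) p"
        unfolding grad_sq_conorm by (intro one F1 G1 zero_le_power2)+
      ultimately show ?thesis
        using two[of "F i p" "diff_at (V i j) p" "U i j p" "diff_at (G j) p"] two[of "G i p" "diff_at (U i j) p" "V i j p" "diff_at (F j) p"]
        unfolding grad_sq_conorm by linarith
    qed
    have lP: "(?P p)\<^sup>2 \<le> 2 * (V i j p)\<^sup>2 + 2 * (U i j p)\<^sup>2" for p
    proof -
      have "?P p = F i p * V i j p + G j p * U i j p" by (simp add: U_def V_def algebra_simps)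
      then have "(?P p)\<^sup>2 \<le> 2 * ((F i p)\<^sup>2 * (V i j p)\<^sup>2) + 2 * ((G j p)\<^sup>2 * (U i j p)\<^sup>2)"
        using square_sum_le[of "F i p * V i j p" "G j p * U i j p"] by (simp add: power_mult_distrib)
      then show ?thesis
        using one[OF F1[of i p], of "(V i j p)\<^sup>2"] one[OF G1[of j p], of "(U i j p)\<^sup>2"] by simp
    qed
    have cont: "continuous_on UNIV ?P" by (rule continuous_smooth_fun[OF sPd])
    have "l2_sq ?P \<le> (LINT p|vol. 2 * (V i j p)\<^sup>2 + 2 * (U i j p)\<^sup>2)"
      unfolding l2_sq_def by (intro lint_mono lP continuous_intros cont cU cV)
    also have "\<dots> = 2 * l2_sq (V i j) + 2 * l2_sq (U i j)"
    proof -
      have "integrable vol (\<lambda>p. (V i j p)\<^sup>2)" "integrable vol (\<lambda>p. (U i j p)\<^sup>2)"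
        by (intro integrable_vol continuous_intros cU cV)+
      then show ?thesis by (simp add: l2_sq_def)
    qed
    finally have 1: "l2_sq ?P \<le> 2 * l2_sq (V i j) + 2 * l2_sq (U i j)" .
    have "energy ?P \<le> (LINT p|vol. 4 * grad_sq A g (V i j) p + 4 * ((U i j p)\<^sup>2 * grad_sq A g (G j) p) +
        (4 * grad_sq A g (U i j) p + 4 * ((V i j p)\<^sup>2 * grad_sq A g (F j) p)))"
      unfolding energy_def by (intro lint_mono gP continuous_intros continuous_grad_sq sPd sU sV sF sG cU cV)
    also have "\<dots> = 4 * energy (V i j) + 4 * ?IU i j + (4 * energy (U i j) + 4 * ?IV i j)"
    proof -
      have "integrable vol (grad_sq A g (V i j))" "integrable vol (grad_sq A g (U i j))"
        "integrable vol (\<lambda>p. (U i j p)\<^sup>2 * grad_sq A g (G j) p)" "integrable vol (\<lambda>p. (V i j p)\<^sup>2 * grad_sq A g (F j) p)"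
        by (intro integrable_vol continuous_intros continuous_grad_sq sU sV sF sG cU cV)+
      then show ?thesis by (simp add: energy_def)
    qed
    finally have 2: "energy ?P \<le> 4 * energy (V i j) + 4 * ?IU i j + (4 * energy (U i j) + 4 * ?IV i j)" .
    show ?thesis
      unfolding h1n_split[OF sPd] h1n_split[OF sU] h1n_split[OF sV] distrib_left
      using 1 2 l2_sq_nonneg[of "U i j"] l2_sq_nonneg[of "V i j"] by linarith
  qed
  show ?thesis
    unfolding h1_cauchy_def
  proof (intro conjI allI impI sP)
    fix e :: real assume e: "0 < e"
    then have e16: "0 < e / 16" by simp
    obtain N1 where N1: "\<And>i j. i \<ge> N1 \<Longrightarrow> j \<ge> N1 \<Longrightarrow> (h1n (U i j))\<^sup>2 < e / 16"
      using F e16 unfolding h1_cauchy_def U_def[abs_def] by blast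
    obtain N2 where N2: "\<And>i j. i \<ge> N2 \<Longrightarrow> j \<ge> N2 \<Longrightarrow> (h1n (V i j))\<^sup>2 < e / 16"
      using G e16 unfolding h1_cauchy_def V_def[abs_def] by blast
    obtain N3 where N3: "\<And>i j. i \<ge> N3 \<Longrightarrow> j \<ge> N3 \<Longrightarrow> ?IU i j < e / 16"
      using weighted_energy_small[OF G cU Ub U0 e16] by auto
    obtain N4 where N4: "\<And>i j. i \<ge> N4 \<Longrightarrow> j \<ge> N4 \<Longrightarrow> ?IV i j < e / 16"
      using weighted_energy_small[OF F cV Vb V0 e16] by auto
    have "(h1n (\<lambda>p. F i p * G i p - F j p * G j p))\<^sup>2 < e"
      if ij: "i \<ge> max (max N1 N2) (max N3 N4)" "j \<ge> max (max N1 N2) (max N3 N4)" for i j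
      using bound[of i j] N1[of i j] N2[of i j] N3[of i j] N4[of i j] ij by simp
    then show "\<exists>M. \<forall>i\<ge>M. \<forall>j\<ge>M. (h1n (\<lambda>p. F i p * G i p - F j p * G j p))\<^sup>2 < e" by blast
  qed
qed

lemma h1_cauchy_const: "smooth_fun A f \<Longrightarrow> h1_cauchy (\<lambda>n. f)"
  by (simp add: h1_cauchy_def h1n_zero)

end


context closed_riemannian
begin

section \<open>Trace inequalities control capacity and quasi-continuous representatives\<close>

lemma small_good_ball:
  assumes V: "open V" "x \<in> V"
  obtains K c R where "good K c (coord c x) R" "x \<in> dom c" "param c ` cball (coord c x) (2 * R) \<subseteq> V"
proof -
  let ?c = "chart_at A x"
  have c: "?c \<in> A" "x \<in> dom ?c" by (rule chart_at)+
  obtain K R0 where gd: "good K ?c (coord ?c x) R0" using good_exists[OF c] by blast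
  have R0: "0 < R0" using gd by (simp add: good_def)
  have "open (coord ?c ` (V \<inter> dom ?c))" by (intro open_coord_image[OF c(1)] open_Int V open_dom[OF c(1)] Int_lower2)
  moreover have "coord ?c x \<in> coord ?c ` (V \<inter> dom ?c)" using V c by blast
  ultimately obtain e where e: "e > 0" "cball (coord ?c x) e \<subseteq> coord ?c ` (V \<inter> dom ?c)"
    by (meson open_contains_cball)
  define R where "R = min R0 (e / 2)"
  have R: "0 < R" "R \<le> R0" "2 * R \<le> e" using R0 e by (auto simp: R_def)
  show ?thesis
  proof (rule that)
    show "good K ?c (coord ?c x) R"
      by (rule good_subset[OF gd _ R(1)]) (use R in \<open>intro subset_cball, simp\<close>)
    show "x \<in> dom ?c" by (rule c)
    show "param ?c ` cball (coord ?c x) (2 * R) \<subseteq> V"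
    proof
      fix p assume "p \<in> param ?c ` cball (coord ?c x) (2 * R)"
      then obtain z where z: "z \<in> cball (coord ?c x) (2 * R)" "p = param ?c z" by blast
      have "cball (coord ?c x) (2 * R) \<subseteq> cball (coord ?c x) e" using R by (intro subset_cball) simp
      then obtain q where q: "q \<in> V" "q \<in> dom ?c" "z = coord ?c q" using z(1) e(2) by blast
      have "p = q" unfolding z(2) q(3) by (rule param_coord[OF c(1) q(2)])
      then show "p \<in> V" using q(1) by simp
    qed
  qed
qed

text \<open>The core of the argument: if \<open>\<Psi> u\<close> and \<open>\<Phi> z\<close> have product zero almost everywhere near a point,
  then the corresponding truncations of the approximating smooth functions tend to zero in \<open>L\<^sup>2\<close>, hence
  in \<open>H\<^sup>1\<close> by closability, hence in \<open>L\<^sup>2(\<mu>)\<close> by the trace inequality.\<close>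

lemma truncation_trace_vanishes:
  assumes \<mu>: "smooth_trace \<mu> N" and gd: "good K c y R"
    and f: "h1_approx A g f u" and \<zeta>: "h1_approx A g \<zeta> z"
    and um: "u \<in> borel_measurable borel" and zm: "z \<in> borel_measurable borel"
    and \<Psi>: "profile \<Psi>" and \<Phi>: "profile \<Phi>"
    and ae: "AE p in vol. p \<in> param c ` cball y (2 * R) \<longrightarrow> \<Psi> (u p) * \<Phi> (z p) = 0"
  shows "(\<lambda>n. \<integral>\<^sup>+ p. ennreal ((in_chart c (bump y R) p * (\<Psi> (f n p) * \<Phi> (\<zeta> n p)))\<^sup>2) \<partial>\<mu>) \<longlonglongrightarrow> 0"
proof -
  have c: "c \<in> A" and R: "0 < R" and sub3: "cball y (3 * R) \<subseteq> im c" using gd by (auto simp: good_def)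
  let ?B = "param c ` cball y (2 * R)"
  let ?\<chi> = "in_chart c (bump y R)"
  define h where "h n p = ?\<chi> p * (\<Psi> (f n p) * \<Phi> (\<zeta> n p))" for n p
  have b0: "bump y R z = 0" if "z \<notin> cball y (2 * R)" for z
    using that R by (intro bump_eq_0) (auto simp: dist_norm norm_minus_commute)
  have \<chi>s: "smooth_fun A ?\<chi>" by (rule in_chart_energy(2)[OF gd smooth_bump b0])
  have \<chi>b: "0 \<le> ?\<chi> p" "?\<chi> p \<le> 1" for p by (simp_all add: in_chart_def bump_bounds)
  have \<chi>0: "?\<chi> p = 0" if "p \<notin> ?B" for p
    using that in_param_image[OF c, of p "cball y (2 * R)"] b0 by (auto simp: in_chart_def)
  have \<Psi>b: "0 \<le> \<Psi> t" "\<Psi> t \<le> 1" and \<Phi>b: "0 \<le> \<Phi> t" "\<Phi> t \<le> 1" for t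
    using \<Psi> \<Phi> by (auto simp: profile_def)
  have prod_b: "\<bar>\<Psi> s * \<Phi> t\<bar> \<le> 1" for s t using \<Psi>b[of s] \<Phi>b[of t] by (simp add: abs_mult mult_le_one)
  have abs_b: "\<bar>\<Psi> t\<bar> \<le> 1" "\<bar>\<Phi> t\<bar> \<le> 1" for t using \<Psi>b[of t] \<Phi>b[of t] by simp_all
  have hc: "h1_cauchy h"
    unfolding h_def[abs_def]
  proof (rule h1_cauchy_mult)
    show "h1_cauchy (\<lambda>n. ?\<chi>)" by (rule h1_cauchy_const[OF \<chi>s])
    show "h1_cauchy (\<lambda>n p. \<Psi> (f n p) * \<Phi> (\<zeta> n p))"
      by (rule h1_cauchy_mult[OF h1_cauchy_profile[OF h1_approx_cauchy[OF f] \<Psi>]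
            h1_cauchy_profile[OF h1_approx_cauchy[OF \<zeta>] \<Phi>]]) (rule abs_b)+
    show "\<bar>?\<chi> p\<bar> \<le> 1" for p using \<chi>b[of p] by simp
  qed (rule prod_b)
  have hs: "smooth_fun A (h n)" for n using hc by (simp add: h1_cauchy_def)
  obtain \<Psi>' B1 where B1: "0 \<le> B1" "\<And>s t. \<bar>\<Psi> s - \<Psi> t\<bar> \<le> B1 * \<bar>s - t\<bar>"
    by (rule profile_derivative[OF \<Psi>]) (rule that)
  obtain \<Phi>' B2 where B2: "0 \<le> B2" "\<And>s t. \<bar>\<Phi> s - \<Phi> t\<bar> \<le> B2 * \<bar>s - t\<bar>"
    by (rule profile_derivative[OF \<Phi>]) (rule that)
  have sf: "smooth_fun A (f n)" "smooth_fun A (\<zeta> n)" for n using f \<zeta> by (auto simp: h1_approx_def)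
  have fm: "f n \<in> borel_measurable borel" "\<zeta> n \<in> borel_measurable borel" for n
    by (intro continuous_imp_borel continuous_smooth_fun sf)+
  have pw: "AE p in vol. ennreal ((h n p)\<^sup>2) \<le> ennreal (2 * B1\<^sup>2) * ennreal ((f n p - u p)\<^sup>2) + ennreal (2 * B2\<^sup>2) * ennreal ((\<zeta> n p - z p)\<^sup>2)" for n
    using ae
  proof eventually_elim
    fix p assume zero: "p \<in> ?B \<longrightarrow> \<Psi> (u p) * \<Phi> (z p) = 0"
    have "\<bar>h n p\<bar> \<le> B1 * \<bar>f n p - u p\<bar> + B2 * \<bar>\<zeta> n p - z p\<bar>"
    proof (cases "p \<in> ?B")
      case False
      then show ?thesis using \<chi>0 B1 B2 by (simp add: h_def)
    next
      case True
      then have z0: "\<Psi> (u p) * \<Phi> (z p) = 0" using zero by blast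
      have "\<bar>h n p\<bar> \<le> 1 * \<bar>\<Psi> (f n p) * \<Phi> (\<zeta> n p)\<bar>"
        unfolding h_def abs_mult[of "?\<chi> p"] using \<chi>b[of p] by (intro mult_right_mono) auto
      also have "\<Psi> (f n p) * \<Phi> (\<zeta> n p) = (\<Psi> (f n p) - \<Psi> (u p)) * \<Phi> (\<zeta> n p) + \<Psi> (u p) * (\<Phi> (\<zeta> n p) - \<Phi> (z p))"
        using z0 by (simp add: algebra_simps)
      also have "1 * \<bar>\<dots>\<bar> \<le> \<bar>\<Psi> (f n p) - \<Psi> (u p)\<bar> * 1 + 1 * \<bar>\<Phi> (\<zeta> n p) - \<Phi> (z p)\<bar>"
      proof -
        have 1: "\<bar>(\<Psi> (f n p) - \<Psi> (u p)) * \<Phi> (\<zeta> n p)\<bar> \<le> \<bar>\<Psi> (f n p) - \<Psi> (u p)\<bar> * 1"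
          unfolding abs_mult using \<Phi>b[of "\<zeta> n p"] by (intro mult_left_mono) auto
        have 2: "\<bar>\<Psi> (u p) * (\<Phi> (\<zeta> n p) - \<Phi> (z p))\<bar> \<le> 1 * \<bar>\<Phi> (\<zeta> n p) - \<Phi> (z p)\<bar>"
          unfolding abs_mult using \<Psi>b[of "u p"] by (intro mult_right_mono) auto
        show ?thesis using order_trans[OF abs_triangle_ineq add_mono[OF 1 2]] by (simp only: mult_1_left)
      qed
      also have "\<dots> \<le> B1 * \<bar>f n p - u p\<bar> + B2 * \<bar>\<zeta> n p - z p\<bar>" using B1(2) B2(2) by (simp add: add_mono)
      finally show ?thesis .
    qed
    then have "\<bar>h n p\<bar>\<^sup>2 \<le> (B1 * \<bar>f n p - u p\<bar> + B2 * \<bar>\<zeta> n p - z p\<bar>)\<^sup>2" by (intro power_mono) auto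
    also have "\<dots> \<le> 2 * (B1 * \<bar>f n p - u p\<bar>)\<^sup>2 + 2 * (B2 * \<bar>\<zeta> n p - z p\<bar>)\<^sup>2" by (rule square_sum_le)
    also have "\<dots> = (2 * B1\<^sup>2) * (f n p - u p)\<^sup>2 + (2 * B2\<^sup>2) * (\<zeta> n p - z p)\<^sup>2" by (simp add: power_mult_distrib)
    finally have "ennreal ((h n p)\<^sup>2) \<le> ennreal ((2 * B1\<^sup>2) * (f n p - u p)\<^sup>2 + (2 * B2\<^sup>2) * (\<zeta> n p - z p)\<^sup>2)"
      unfolding power2_abs by (rule ennreal_leI)
    then show "ennreal ((h n p)\<^sup>2) \<le> ennreal (2 * B1\<^sup>2) * ennreal ((f n p - u p)\<^sup>2) + ennreal (2 * B2\<^sup>2) * ennreal ((\<zeta> n p - z p)\<^sup>2)"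
      by (simp add: ennreal_mult')
  qed
  have le: "(\<integral>\<^sup>+ p. ennreal ((h n p)\<^sup>2) \<partial>vol) \<le> ennreal (2 * B1\<^sup>2) * (\<integral>\<^sup>+ p. ennreal ((f n p - u p)\<^sup>2) \<partial>vol) +
      ennreal (2 * B2\<^sup>2) * (\<integral>\<^sup>+ p. ennreal ((\<zeta> n p - z p)\<^sup>2) \<partial>vol)" for n
  proof -
    have m: "(\<lambda>p. ennreal ((f n p - u p)\<^sup>2)) \<in> borel_measurable borel" "(\<lambda>p. ennreal ((\<zeta> n p - z p)\<^sup>2)) \<in> borel_measurable borel"
      using fm[of n] um zm by measurable
    show ?thesis
      using nn_integral_mono_AE[OF pw[of n]] m by (simp add: nn_integral_add nn_integral_cmult)
  qed
  have "(\<lambda>n. ennreal (2 * B1\<^sup>2) * (\<integral>\<^sup>+ p. ennreal ((f n p - u p)\<^sup>2) \<partial>vol) +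
      ennreal (2 * B2\<^sup>2) * (\<integral>\<^sup>+ p. ennreal ((\<zeta> n p - z p)\<^sup>2) \<partial>vol)) \<longlonglongrightarrow> ennreal (2 * B1\<^sup>2) * 0 + ennreal (2 * B2\<^sup>2) * 0"
    using f \<zeta> unfolding h1_approx_def by (intro tendsto_add ennreal_tendsto_cmult) auto
  then have lim0: "(\<lambda>n. ennreal (2 * B1\<^sup>2) * (\<integral>\<^sup>+ p. ennreal ((f n p - u p)\<^sup>2) \<partial>vol) +
      ennreal (2 * B2\<^sup>2) * (\<integral>\<^sup>+ p. ennreal ((\<zeta> n p - z p)\<^sup>2) \<partial>vol)) \<longlonglongrightarrow> 0" by simp
  have L2: "(\<lambda>n. \<integral>\<^sup>+ p. ennreal ((h n p)\<^sup>2) \<partial>vol) \<longlonglongrightarrow> 0"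
    by (rule tendsto_sandwich[OF _ _ tendsto_const lim0]) (simp_all only: le zero_le always_eventually simp_thms)
  have "(\<lambda>n. (h1n (h n))\<^sup>2) \<longlonglongrightarrow> 0"
    by (rule chart_closable[OF gd hc _ L2]) (simp add: h_def \<chi>0)
  then have "(\<lambda>n. N * (h1n (h n))\<^sup>2) \<longlonglongrightarrow> N * 0" by (intro tendsto_intros)
  then have "(\<lambda>n. ennreal (N * (h1n (h n))\<^sup>2)) \<longlonglongrightarrow> ennreal (N * 0)" by (rule tendsto_ennrealI)
  then have limN: "(\<lambda>n. ennreal (N * (h1n (h n))\<^sup>2)) \<longlonglongrightarrow> 0" by simp
  have leN: "(\<integral>\<^sup>+ p. ennreal ((h n p)\<^sup>2) \<partial>\<mu>) \<le> ennreal (N * (h1n (h n))\<^sup>2)" for n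
    using \<mu> hs[of n] unfolding smooth_trace_def by blast
  have "(\<lambda>n. \<integral>\<^sup>+ p. ennreal ((h n p)\<^sup>2) \<partial>\<mu>) \<longlonglongrightarrow> 0"
    by (rule tendsto_sandwich[OF _ _ tendsto_const limN]) (simp_all only: leN zero_le always_eventually simp_thms)
  then show ?thesis by (simp only: h_def)
qed

lemma smooth_trace_measure:
  assumes "smooth_trace \<mu> N"
  shows "finite_measure \<mu>" "sets \<mu> = sets borel" "space \<mu> = UNIV" "0 \<le> N"
  using assms sets_eq_imp_space_eq[of \<mu> borel] by (auto simp: smooth_trace_def finite_borel_measure_def)

lemma borel_level_sets:
  fixes f \<zeta> :: "'a \<Rightarrow> real"
  assumes "f \<in> borel_measurable borel"
  shows "{p. f p \<le> a} \<in> sets borel" "{p. f p > a} \<in> sets borel"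
  using assms by measurable

text \<open>Near a point, \<open>Q n\<close> is contained in the set where the truncated product equals \<open>1\<close>, and Chebyshev's
  inequality applies.\<close>

lemma local_trace_vanishes:
  assumes \<mu>: "smooth_trace \<mu> N" and gd: "good K c y R"
    and f: "h1_approx A g f u" and \<zeta>: "h1_approx A g \<zeta> z"
    and um: "u \<in> borel_measurable borel" and zm: "z \<in> borel_measurable borel"
    and \<Psi>: "profile \<Psi>"
    and ae: "AE p in vol. p \<in> param c ` cball y (2 * R) \<longrightarrow> \<Psi> (u p) = 0 \<or> 1 \<le> z p"
    and Q: "\<And>n. Q n \<in> sets borel"
      "\<And>n p. p \<in> Q n \<Longrightarrow> p \<in> param c ` cball y R \<and> \<Psi> (f n p) = 1 \<and> \<zeta> n p \<le> 1 / 2"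
  shows "(\<lambda>n. measure \<mu> (Q n)) \<longlonglongrightarrow> 0"
proof -
  let ?\<Phi> = "\<lambda>t. smooth_step (2 * t)"
  let ?h = "\<lambda>n p. in_chart c (bump y R) p * (\<Psi> (f n p) * ?\<Phi> (\<zeta> n p))"
  note m = smooth_trace_measure[OF \<mu>]
  have c: "c \<in> A" and R: "0 < R" and sub3: "cball y (3 * R) \<subseteq> im c" using gd by (auto simp: good_def)
  have "AE p in vol. p \<in> param c ` cball y (2 * R) \<longrightarrow> \<Psi> (u p) * ?\<Phi> (z p) = 0"
    using ae by eventually_elim (use smooth_step_eq_0 in auto)
  from truncation_trace_vanishes[OF \<mu> gd f \<zeta> um zm \<Psi> profile_low this]
  have lim: "(\<lambda>n. \<integral>\<^sup>+ p. ennreal ((?h n p)\<^sup>2) \<partial>\<mu>) \<longlonglongrightarrow> 0" .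
  have h1: "?h n p = 1" if "p \<in> Q n" for n p
  proof -
    obtain w where w: "w \<in> cball y R" "p = param c w" using Q(2)[OF \<open>p \<in> Q n\<close>] by blast
    have "cball y R \<subseteq> cball y (3 * R)" using R by (intro subset_cball) simp
    then have wi: "w \<in> im c" using w(1) sub3 by blast
    have "in_chart c (bump y R) (param c w) = bump y R w"
      using param_in[OF c wi] coord_param[OF c wi] by (simp add: in_chart_def)
    also have "\<dots> = 1" using w(1) R by (intro bump_eq_1) (auto simp: dist_norm norm_minus_commute)
    finally have "in_chart c (bump y R) p = 1" unfolding w(2) .
    moreover have "?\<Phi> (\<zeta> n p) = 1" using Q(2)[OF that] by (intro smooth_step_eq_1) auto
    ultimately show ?thesis using Q(2)[OF that] by simp
  qed
  have le: "ennreal (measure \<mu> (Q n)) \<le> (\<integral>\<^sup>+ p. ennreal ((?h n p)\<^sup>2) \<partial>\<mu>)" for n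
  proof -
    have "ennreal (measure \<mu> (Q n)) = emeasure \<mu> (Q n)" using finite_measure.emeasure_eq_measure[OF m(1)] by simp
    also have "\<dots> = (\<integral>\<^sup>+ p. indicator (Q n) p \<partial>\<mu>)" using Q(1) m(2) by (intro nn_integral_indicator[symmetric]) simp
    also have "\<dots> \<le> (\<integral>\<^sup>+ p. ennreal ((?h n p)\<^sup>2) \<partial>\<mu>)"
      by (rule nn_integral_mono) (simp add: indicator_def h1)
    finally show ?thesis .
  qed
  have "(\<lambda>n. ennreal (measure \<mu> (Q n))) \<longlonglongrightarrow> 0"
    by (rule tendsto_sandwich[OF _ _ tendsto_const lim]) (simp_all only: le zero_le always_eventually simp_thms)
  then have "(\<lambda>n. ennreal (measure \<mu> (Q n))) \<longlonglongrightarrow> ennreal 0" unfolding ennreal_0 .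
  then show ?thesis by (subst (asm) tendsto_ennreal_iff) simp_all
qed

text \<open>Summing the local statements over a finite cover, apart from the set where \<open>\<zeta> n\<close> is large.\<close>

lemma cover_measure_le:
  assumes \<mu>: "smooth_trace \<mu> N" and \<zeta>: "h1_approx A g \<zeta> z" and l: "(\<lambda>n. h1n (\<zeta> n)) \<longlonglongrightarrow> l"
    and I: "finite I" and T: "\<And>n. T n \<in> sets borel" "\<And>n. T n \<subseteq> (\<Union>i\<in>I. V i)" and V: "\<And>i. i \<in> I \<Longrightarrow> V i \<in> sets borel"
    and lim: "\<And>i. i \<in> I \<Longrightarrow> (\<lambda>n. measure \<mu> (T n \<inter> V i \<inter> {p. \<zeta> n p \<le> 1 / 2})) \<longlonglongrightarrow> 0"
    and \<eta>: "0 < \<eta>"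
  shows "\<exists>M. \<forall>n\<ge>M. measure \<mu> (T n) < 4 * N * l\<^sup>2 + \<eta>"
proof -
  note m = smooth_trace_measure[OF \<mu>]
  have sz: "smooth_fun A (\<zeta> n)" for n using \<zeta> by (auto simp: h1_approx_def)
  have zm: "\<zeta> n \<in> borel_measurable borel" for n by (intro continuous_imp_borel continuous_smooth_fun sz)
  note lev = borel_level_sets[OF zm]
  have big: "measure \<mu> {p. \<zeta> n p > 1 / 2} \<le> 4 * N * (h1n (\<zeta> n))\<^sup>2" for n
  proof -
    have "ennreal (measure \<mu> {p. \<zeta> n p > 1 / 2}) = emeasure \<mu> {p. \<zeta> n p > 1 / 2}"
      by (rule finite_measure.emeasure_eq_measure[OF m(1), symmetric])
    also have "\<dots> = (\<integral>\<^sup>+ p. indicator {p. \<zeta> n p > 1 / 2} p \<partial>\<mu>)"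
      by (rule nn_integral_indicator[symmetric]) (unfold m(2), rule lev)
    also have "\<dots> \<le> (\<integral>\<^sup>+ p. ennreal 4 * ennreal ((\<zeta> n p)\<^sup>2) \<partial>\<mu>)"
    proof (rule nn_integral_mono)
      fix p
      have q: "1 \<le> 4 * (\<zeta> n p)\<^sup>2" if "\<zeta> n p > 1 / 2"
        using power_mono[of "1 / 2" "\<zeta> n p" 2] that by (simp add: power2_eq_square)
      have "(1::ennreal) \<le> ennreal 4 * ennreal ((\<zeta> n p)\<^sup>2)" if "\<zeta> n p > 1 / 2"
      proof -
        have "ennreal 1 \<le> ennreal (4 * (\<zeta> n p)\<^sup>2)" by (rule ennreal_leI[OF q[OF that]])
        also have "\<dots> = ennreal 4 * ennreal ((\<zeta> n p)\<^sup>2)" by (rule ennreal_mult') simp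
        finally show ?thesis unfolding ennreal_1 .
      qed
      note big1 = this
      show "indicator {p. \<zeta> n p > 1 / 2} p \<le> ennreal 4 * ennreal ((\<zeta> n p)\<^sup>2)"
      proof (cases "\<zeta> n p > 1 / 2")
        case True
        then show ?thesis using big1[OF True] by (simp only: indicator_simps mem_Collect_eq simp_thms)
      qed simp
    qed
    also have "\<dots> = ennreal 4 * (\<integral>\<^sup>+ p. ennreal ((\<zeta> n p)\<^sup>2) \<partial>\<mu>)"
    proof (rule nn_integral_cmult)
      have "(\<lambda>p. ennreal ((\<zeta> n p)\<^sup>2)) \<in> borel_measurable borel" using zm[of n] by measurable
      then show "(\<lambda>p. ennreal ((\<zeta> n p)\<^sup>2)) \<in> borel_measurable \<mu>" using measurable_cong_sets[OF m(2) refl] by blast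
    qed
    also have "\<dots> \<le> ennreal 4 * ennreal (N * (h1n (\<zeta> n))\<^sup>2)"
    proof (rule mult_left_mono)
      show "(\<integral>\<^sup>+ p. ennreal ((\<zeta> n p)\<^sup>2) \<partial>\<mu>) \<le> ennreal (N * (h1n (\<zeta> n))\<^sup>2)"
        using \<mu> sz[of n] unfolding smooth_trace_def by blast
    qed simp
    also have "\<dots> = ennreal (4 * N * (h1n (\<zeta> n))\<^sup>2)"
      unfolding mult.assoc[of 4] by (rule ennreal_mult'[symmetric]) simp
    finally show ?thesis using m(4) by (subst (asm) ennreal_le_iff) auto
  qed
  let ?Q = "\<lambda>n i. T n \<inter> V i \<inter> {p. \<zeta> n p \<le> 1 / 2}"
  have le: "measure \<mu> (T n) \<le> 4 * N * (h1n (\<zeta> n))\<^sup>2 + (\<Sum>i\<in>I. measure \<mu> (?Q n i))" for n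
  proof -
    have Qs: "?Q n i \<in> sets \<mu>" if "i \<in> I" for i
      unfolding m(2) by (intro sets.Int T(1) V[OF that] lev)
    have Ps: "{p. \<zeta> n p > 1 / 2} \<in> sets \<mu>" unfolding m(2) by (rule lev)
    have Us: "(\<Union>i\<in>I. ?Q n i) \<in> sets \<mu>" by (rule sets.finite_UN[OF I]) (rule Qs)
    have "measure \<mu> (T n) \<le> measure \<mu> ({p. \<zeta> n p > 1 / 2} \<union> (\<Union>i\<in>I. ?Q n i))"
    proof (rule finite_measure.finite_measure_mono[OF m(1)])
      show "T n \<subseteq> {p. \<zeta> n p > 1 / 2} \<union> (\<Union>i\<in>I. ?Q n i)"
      proof
        fix p assume p: "p \<in> T n"
        then obtain i where "i \<in> I" "p \<in> V i" using T(2) by blast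
        with p show "p \<in> {p. \<zeta> n p > 1 / 2} \<union> (\<Union>i\<in>I. ?Q n i)" by (cases "\<zeta> n p > 1 / 2") auto
      qed
      show "{p. \<zeta> n p > 1 / 2} \<union> (\<Union>i\<in>I. ?Q n i) \<in> sets \<mu>"
        by (rule sets.Un[OF Ps Us])
    qed
    also have "\<dots> \<le> measure \<mu> {p. \<zeta> n p > 1 / 2} + measure \<mu> (\<Union>i\<in>I. ?Q n i)"
      by (rule measure_Un_le[OF Ps Us])
    also have "measure \<mu> (\<Union>i\<in>I. ?Q n i) \<le> (\<Sum>i\<in>I. measure \<mu> (?Q n i))"
      by (rule measure_UNION_le[OF I]) (rule Qs)
    finally show ?thesis using big[of n] by linarith
  qed
  have "(\<lambda>n. 4 * N * (h1n (\<zeta> n))\<^sup>2 + (\<Sum>i\<in>I. measure \<mu> (?Q n i))) \<longlonglongrightarrow> 4 * N * l\<^sup>2 + (\<Sum>i\<in>I. 0)"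
    by (intro tendsto_intros l lim)
  then have "\<forall>\<^sub>F n in sequentially. 4 * N * (h1n (\<zeta> n))\<^sup>2 + (\<Sum>i\<in>I. measure \<mu> (?Q n i)) < 4 * N * l\<^sup>2 + \<eta>"
    by (rule order_tendstoD) (use \<eta> in simp)
  then obtain M where "\<And>n. n \<ge> M \<Longrightarrow> 4 * N * (h1n (\<zeta> n))\<^sup>2 + (\<Sum>i\<in>I. measure \<mu> (?Q n i)) < 4 * N * l\<^sup>2 + \<eta>"
    unfolding eventually_sequentially by blast
  then show ?thesis using le by (meson le_less_trans)
qed

text \<open>Where \<open>\<zeta> n > 1 / 2\<close>, Chebyshev's inequality and the trace inequality give the bound. The part of
  \<open>W\<close> where \<open>\<zeta> n \<le> 1 / 2\<close> disappears in the limit, because \<open>z \<ge> 1\<close> there; this is a local statement,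
  and \<open>W\<close> is exhausted by finite unions of good balls.\<close>

lemma measure_le_capacity_potential:
  assumes \<mu>: "smooth_trace \<mu> N" and W: "open W" and z: "z \<in> H1 A g" and ae: "AE p in vol. p \<in> W \<longrightarrow> 1 \<le> z p"
    and \<zeta>: "h1_approx A g \<zeta> z" and l: "(\<lambda>n. h1n (\<zeta> n)) \<longlonglongrightarrow> l"
  shows "measure \<mu> W \<le> 4 * N * l\<^sup>2"
proof -
  note m = smooth_trace_measure[OF \<mu>]
  have zm: "z \<in> borel_measurable borel" using z by (simp add: H1_def)
  have sz: "smooth_fun A (\<zeta> n)" for n using \<zeta> by (auto simp: h1_approx_def)
  have zm': "\<zeta> n \<in> borel_measurable borel" for n by (intro continuous_imp_borel continuous_smooth_fun sz)
  \<comment> \<open>Good balls whose doubles lie in \<open>W\<close>; a countable subfamily covers \<open>W\<close>.\<close>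
  define \<V> where "\<V> = {param c ` ball y R | K c y R. good K c y R \<and> param c ` cball y (2 * R) \<subseteq> W}"
  have open_V: "open V" if V: "V \<in> \<V>" for V
  proof -
    obtain K c y R where V': "V = param c ` ball y R" "good K c y R" using V unfolding \<V>_def by blast
    have c: "c \<in> A" and R: "0 < R" and sub: "cball y (3 * R) \<subseteq> im c" using V'(2) by (auto simp: good_def)
    have "ball y R \<subseteq> cball y (3 * R)" using R by auto
    then show ?thesis unfolding V'(1) using sub by (intro open_param_image[OF c]) auto
  qed
  have cov: "W \<subseteq> \<Union>\<V>"
  proof
    fix x assume "x \<in> W"
    then obtain K c R where b: "good K c (coord c x) R" "x \<in> dom c" "param c ` cball (coord c x) (2 * R) \<subseteq> W"
      using small_good_ball[OF W] by blast
    have "x \<in> param c ` ball (coord c x) R"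
      by (rule in_param_image) (use b in \<open>auto simp: good_def\<close>)
    then show "x \<in> \<Union>\<V>" unfolding \<V>_def using b by blast
  qed
  obtain \<V>' where \<V>': "\<V>' \<subseteq> \<V>" "countable \<V>'" "\<Union>\<V>' = \<Union>\<V>" using Lindelof[of \<V>] open_V by metis
  have fin_le: "measure \<mu> (\<Union>\<F>) \<le> 4 * N * l\<^sup>2" if \<F>: "finite \<F>" "\<F> \<subseteq> \<V>" for \<F>
  proof (rule field_le_epsilon)
    fix e :: real assume e: "0 < e"
    have Vb: "V \<in> sets borel" if "V \<in> \<F>" for V using open_V that \<F>(2) by (auto intro: borel_open)
    have lim: "(\<lambda>n. measure \<mu> (\<Union>\<F> \<inter> V \<inter> {p. \<zeta> n p \<le> 1 / 2})) \<longlonglongrightarrow> 0" if V: "V \<in> \<F>" for V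
    proof -
      obtain K c y R where V': "V = param c ` ball y R" "good K c y R" "param c ` cball y (2 * R) \<subseteq> W"
        using V \<F>(2) unfolding \<V>_def by blast
      have ae': "AE p in vol. p \<in> param c ` cball y (2 * R) \<longrightarrow> (1::real) = 0 \<or> 1 \<le> z p"
        using ae by eventually_elim (use V'(3) in blast)
      show ?thesis
      proof (rule local_trace_vanishes[OF \<mu> V'(2) \<zeta> \<zeta> zm zm profile_const_1 ae'])
        show "\<Union>\<F> \<inter> V \<inter> {p. \<zeta> n p \<le> 1 / 2} \<in> sets borel" for n
          by (intro sets.Int sets.finite_Union \<F>(1) borel_level_sets[OF zm'] Vb V subsetI)
        fix n p assume p: "p \<in> \<Union>\<F> \<inter> V \<inter> {p. \<zeta> n p \<le> 1 / 2}"
        have "p \<in> param c ` cball y R" using p ball_subset_cball unfolding V'(1) by blast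
        then show "p \<in> param c ` cball y R \<and> (1::real) = 1 \<and> \<zeta> n p \<le> 1 / 2" using p by blast
      qed
    qed
    have "\<exists>M :: nat. \<forall>n\<ge>M. measure \<mu> (\<Union>\<F>) < 4 * N * l\<^sup>2 + e"
    proof (rule cover_measure_le[OF \<mu> \<zeta> l \<F>(1), where T = "\<lambda>n. \<Union>\<F>" and V = "\<lambda>V. V"])
      show "\<Union>\<F> \<in> sets borel" by (intro sets.finite_Union \<F>(1) subsetI Vb)
    qed (use lim e Vb in auto)
    then show "measure \<mu> (\<Union>\<F>) \<le> 4 * N * l\<^sup>2 + e" by auto
  qed
  have le: "measure \<mu> (\<Union>\<V>') \<le> 4 * N * l\<^sup>2"
  proof (cases "\<V>' = {}")
    case True
    then show ?thesis using m(4) by simp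
  next
    case False
    define F where "F n = \<Union> (from_nat_into \<V>' ` {..n})" for n
    have un: "(\<Union>n. F n) = \<Union>\<V>'"
    proof -
      have "(\<Union>n. F n) = \<Union> (range (from_nat_into \<V>'))" unfolding F_def by auto
      then show ?thesis unfolding range_from_nat_into[OF False \<V>'(2)] .
    qed
    have sub: "from_nat_into \<V>' ` {..n} \<subseteq> \<V>" for n
      using from_nat_into[OF False] \<V>'(1) by (meson image_subsetI subsetD)
    have "(\<lambda>n. measure \<mu> (F n)) \<longlonglongrightarrow> measure \<mu> (\<Union>n. F n)"
    proof (rule finite_measure.finite_Lim_measure_incseq[OF m(1)])
      have "F n \<in> sets borel" for n
        unfolding F_def using sub open_V by (intro borel_open open_Union) blast
      then show "range F \<subseteq> sets \<mu>" using m(2) by auto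
      show "incseq F" unfolding F_def by (intro monoI Union_mono image_mono) auto
    qed
    then show ?thesis unfolding un
      by (rule LIMSEQ_le_const2) (use fin_le[OF _ sub] in \<open>auto simp: F_def\<close>)
  qed
  have "measure \<mu> W \<le> measure \<mu> (\<Union>\<V>')"
  proof (rule finite_measure.finite_measure_mono[OF m(1)])
    show "W \<subseteq> \<Union>\<V>'" using cov \<V>'(3) by simp
    show "\<Union>\<V>' \<in> sets \<mu>" unfolding \<V>'(3) m(2) using open_V by (intro borel_open open_Union) blast
  qed
  with le show ?thesis by linarith
qed

lemma small_capacity_potential:
  assumes "h1_capacity A g E < e"
  obtains z W \<zeta> l where "z \<in> H1 A g" "open W" "E \<subseteq> W" "AE p in vol. p \<in> W \<longrightarrow> 1 \<le> z p"
    "h1_approx A g \<zeta> z" "(\<lambda>n. h1n (\<zeta> n)) \<longlonglongrightarrow> l" "l\<^sup>2 < e"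
proof -
  let ?S = "{(h1_norm A g u)\<^sup>2 | u. u \<in> H1 A g \<and> (\<exists>W. open W \<and> E \<subseteq> W \<and> (AE p in vol. p \<in> W \<longrightarrow> 1 \<le> u p))}"
  have "(h1_norm A g (\<lambda>p. 1))\<^sup>2 \<in> ?S"
    using smooth_fun_H1[OF smooth_fun_const[of 1]] by (auto intro!: exI[of _ "\<lambda>p. 1"] exI[of _ UNIV])
  then have "?S \<noteq> {}" by blast
  from cInf_lessD[OF this assms[unfolded h1_capacity_def]]
  obtain z W where z: "z \<in> H1 A g" "(h1_norm A g z)\<^sup>2 < e" and W: "open W" "E \<subseteq> W" "AE p in vol. p \<in> W \<longrightarrow> 1 \<le> z p"
    by blast
  have "h1_norm A g z < sqrt e" using z(2) by (rule real_less_rsqrt)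
  then obtain \<zeta> l where \<zeta>: "h1_approx A g \<zeta> z" "(\<lambda>n. h1n (\<zeta> n)) \<longlonglongrightarrow> l" "0 \<le> l" "l < sqrt e"
    using h1_norm_less[OF z(1)] by blast
  have e0: "0 < e" using z(2) zero_le_power2[of "h1_norm A g z"] by linarith
  have "l\<^sup>2 < (sqrt e)\<^sup>2" using \<zeta> by (intro power_strict_mono) auto
  then have "l\<^sup>2 < e" using e0 by simp
  with z(1) W \<zeta>(1,2) show ?thesis using that by blast
qed

text \<open>Open sets that contain \<open>E\<close> have capacity potentials of arbitrarily small norm.\<close>

lemma polar_null:
  assumes \<mu>: "smooth_trace \<mu> N" and E: "polar A g E"
  shows "emeasure \<mu> E = 0"
proof -
  note m = smooth_trace_measure[OF \<mu>]
  have "measure \<mu> E \<le> 0 + \<epsilon>" if \<epsilon>: "0 < \<epsilon>" for \<epsilon>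
  proof -
    define e where "e = \<epsilon> / (4 * N + 1)"
    have e: "0 < e" using \<epsilon> m(4) by (simp add: e_def add_nonneg_pos)
    have "h1_capacity A g E < e" using E e by (simp add: polar_def)
    then obtain z W \<zeta> l where *: "z \<in> H1 A g" "open W" "E \<subseteq> W" "AE p in vol. p \<in> W \<longrightarrow> 1 \<le> z p"
      "h1_approx A g \<zeta> z" "(\<lambda>n. h1n (\<zeta> n)) \<longlonglongrightarrow> l" "l\<^sup>2 < e" by (rule small_capacity_potential)
    have "measure \<mu> E \<le> measure \<mu> W"
      using *(2,3) m(2) by (intro finite_measure.finite_measure_mono[OF m(1)]) auto
    also have "\<dots> \<le> 4 * N * l\<^sup>2" by (rule measure_le_capacity_potential[OF \<mu> *(2,1,4,5,6)])
    also have "\<dots> \<le> 4 * N * e" using *(7) m(4) by (intro mult_left_mono) auto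
    also have "\<dots> \<le> \<epsilon>" using \<epsilon> m(4) by (simp add: e_def field_simps)
    finally show ?thesis by simp
  qed
  then have "measure \<mu> E \<le> 0" by (rule field_le_epsilon)
  then have "measure \<mu> E = 0" using measure_nonneg[of \<mu> E] by simp
  then show ?thesis using finite_measure.emeasure_eq_measure[OF m(1)] by simp
qed

text \<open>Off an open set of small capacity, hence of small measure, \<open>v\<close> is continuous. Near a point of the
  complement its values stay within \<open>\<delta>\<close> of a constant \<open>a\<close>, so \<open>u\<close> avoids the set selected by
  \<open>profile_away\<close>, except where the capacity potential is at least \<open>1\<close>. By \<open>local_trace_vanishes\<close> the
  approximating functions then avoid it \<open>\<mu>\<close>-asymptotically, and the complement is compact.\<close>

lemma approx_converges_in_measure:
  assumes \<mu>: "smooth_trace \<mu> N" and u: "u \<in> H1 A g" and f: "h1_approx A g f u"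
    and v: "qc_representative A g u v" and \<delta>: "0 < \<delta>" and \<eta>: "0 < \<eta>"
  shows "\<exists>M. \<forall>n\<ge>M. measure \<mu> {p. 3 * \<delta> \<le> \<bar>f n p - v p\<bar>} < \<eta>"
proof -
  note m = smooth_trace_measure[OF \<mu>]
  have um: "u \<in> borel_measurable borel" using u by (simp add: H1_def)
  have vm: "v \<in> borel_measurable borel" and qc: "quasi_continuous A g v" and vu: "AE p in vol. v p = u p"
    using v by (auto simp: qc_representative_def)
  have fm: "f n \<in> borel_measurable borel" for n
    using f by (intro continuous_imp_borel continuous_smooth_fun) (auto simp: h1_approx_def)
  \<comment> \<open>Both the exceptional set and the potential cost \<open>4 N e\<close>.\<close>
  define e where "e = \<eta> / (16 * (N + 1))"
  have e: "0 < e" using \<eta> m(4) by (simp add: e_def)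
  have Ne: "8 * N * e \<le> \<eta> / 2" using \<eta> m(4) by (simp add: e_def field_simps)
  obtain W0 where W0: "open W0" "h1_capacity A g W0 < e" "continuous_on (- W0) v"
    using qc e unfolding quasi_continuous_def by blast
  obtain z W \<zeta> l where *: "z \<in> H1 A g" "open W" "W0 \<subseteq> W" "AE p in vol. p \<in> W \<longrightarrow> 1 \<le> z p"
    "h1_approx A g \<zeta> z" "(\<lambda>n. h1n (\<zeta> n)) \<longlonglongrightarrow> l" "l\<^sup>2 < e" using W0(2) by (rule small_capacity_potential)
  have zm: "z \<in> borel_measurable borel" using *(1) by (simp add: H1_def)
  have zm': "\<zeta> n \<in> borel_measurable borel" for n
    using *(5) by (intro continuous_imp_borel continuous_smooth_fun) (auto simp: h1_approx_def)
  let ?F = "- W"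
  have contv: "continuous_on ?F v" using W0(3) *(3) by (auto intro: continuous_on_subset)
  have F: "compact ?F" using compact_Int_closed[OF compact_X, of ?F] *(2) by (simp add: closed_Compl)
  have Fb: "?F \<in> sets borel" using *(2) by auto
  have "measure \<mu> W \<le> 4 * N * l\<^sup>2" by (rule measure_le_capacity_potential[OF \<mu> *(2,1,4,5,6)])
  also have "\<dots> \<le> 4 * N * e" using *(7) m(4) by (intro mult_left_mono) auto
  finally have mW: "measure \<mu> W \<le> 4 * N * e" .
  define T where "T n = ?F \<inter> {p. 3 * \<delta> \<le> \<bar>f n p - v p\<bar>}" for n
  have Db: "{p. 3 * \<delta> \<le> \<bar>f n p - v p\<bar>} \<in> sets borel" for n using fm[of n] vm by measurable
  have Tb: "T n \<in> sets borel" for n unfolding T_def using Fb Db by (rule sets.Int)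
  \<comment> \<open>Around each point of the closed set, a neighbourhood on which \<open>v\<close> oscillates by less than \<open>\<delta>\<close>.\<close>
  have "\<exists>V. x \<in> V \<and> open V \<and> (\<lambda>n. measure \<mu> (T n \<inter> V \<inter> {p. \<zeta> n p \<le> 1 / 2})) \<longlonglongrightarrow> 0" if x: "x \<in> ?F" for x
  proof -
    let ?a = "v x"
    have "\<exists>U. open U \<and> x \<in> U \<and> (\<forall>p\<in>?F. p \<in> U \<longrightarrow> v p \<in> ball ?a \<delta>)"
      using contv[unfolded continuous_on_topological] x \<delta> by (metis centre_in_ball open_ball)
    then obtain U where U: "open U" "x \<in> U" "\<And>p. p \<in> ?F \<Longrightarrow> p \<in> U \<Longrightarrow> v p \<in> ball ?a \<delta>" by blast
    obtain K c R where b: "good K c (coord c x) R" "x \<in> dom c" "param c ` cball (coord c x) (2 * R) \<subseteq> U"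
      using small_good_ball[OF U(1,2)] by blast
    have c: "c \<in> A" and R: "0 < R" and sub: "cball (coord c x) (3 * R) \<subseteq> im c" using b(1) by (auto simp: good_def)
    let ?V = "param c ` ball (coord c x) R"
    have "ball (coord c x) R \<subseteq> cball (coord c x) (3 * R)" using R by auto
    then have oV: "open ?V" using sub by (intro open_param_image[OF c]) auto
    have xV: "x \<in> ?V" by (rule in_param_image[OF c b(2)]) (use R in simp)
    have "ball (coord c x) R \<subseteq> cball (coord c x) (2 * R)" using R by auto
    then have VU: "?V \<subseteq> U" using b(3) by blast
    let ?\<Psi> = "\<lambda>t. 1 - smooth_step (((t - ?a) / \<delta>)\<^sup>2)"
    have ae: "AE p in vol. p \<in> param c ` cball (coord c x) (2 * R) \<longrightarrow> ?\<Psi> (u p) = 0 \<or> 1 \<le> z p"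
      using vu *(4)
    proof eventually_elim
      fix p assume vp: "v p = u p" and zp: "p \<in> W \<longrightarrow> 1 \<le> z p"
      show "p \<in> param c ` cball (coord c x) (2 * R) \<longrightarrow> ?\<Psi> (u p) = 0 \<or> 1 \<le> z p"
      proof (intro impI)
        assume "p \<in> param c ` cball (coord c x) (2 * R)"
        then have pU: "p \<in> U" using b(3) by blast
        show "?\<Psi> (u p) = 0 \<or> 1 \<le> z p"
        proof (cases "p \<in> W")
          case False
          then have "\<bar>u p - ?a\<bar> \<le> \<delta>" using U(3)[of p] pU vp by (simp add: dist_real_def abs_minus_commute)
          then have "\<bar>(u p - ?a) / \<delta>\<bar> \<le> 1" using \<delta> by (simp add: pos_divide_le_eq)
          then have "((u p - ?a) / \<delta>)\<^sup>2 \<le> 1" by (simp add: abs_square_le_1)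
          then show ?thesis using smooth_step_eq_1 by simp
        qed (use zp in simp)
      qed
    qed
    have "(\<lambda>n. measure \<mu> (T n \<inter> ?V \<inter> {p. \<zeta> n p \<le> 1 / 2})) \<longlonglongrightarrow> 0"
    proof (rule local_trace_vanishes[OF \<mu> b(1) f *(5) um zm profile_away[OF \<delta>] ae])
      show "T n \<inter> ?V \<inter> {p. \<zeta> n p \<le> 1 / 2} \<in> sets borel" for n
        by (intro sets.Int Tb borel_open[OF oV] borel_level_sets[OF zm'])
      fix n p assume p: "p \<in> T n \<inter> ?V \<inter> {p. \<zeta> n p \<le> 1 / 2}"
      have "\<bar>v p - ?a\<bar> < \<delta>" using U(3)[of p] VU p by (auto simp: T_def dist_real_def abs_minus_commute)
      moreover have "3 * \<delta> \<le> \<bar>f n p - v p\<bar>" using p by (simp add: T_def)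
      ultimately have "2 * \<delta> \<le> \<bar>f n p - ?a\<bar>" by linarith
      then have "2 \<le> \<bar>(f n p - ?a) / \<delta>\<bar>" using \<delta> by (simp add: pos_le_divide_eq)
      then have "2\<^sup>2 \<le> \<bar>(f n p - ?a) / \<delta>\<bar>\<^sup>2" by (intro power_mono) auto
      moreover have "(2::real)\<^sup>2 = 4" by simp
      ultimately have "2 \<le> ((f n p - ?a) / \<delta>)\<^sup>2" unfolding power2_abs by linarith
      from smooth_step_eq_0[OF this] have "?\<Psi> (f n p) = 1" by simp
      moreover have "p \<in> param c ` cball (coord c x) R" using p ball_subset_cball by blast
      ultimately show "p \<in> param c ` cball (coord c x) R \<and> ?\<Psi> (f n p) = 1 \<and> \<zeta> n p \<le> 1 / 2" using p by simp
    qed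
    with oV xV show ?thesis by blast
  qed
  then have "\<forall>x\<in>?F. \<exists>V. x \<in> V \<and> open V \<and> (\<lambda>n. measure \<mu> (T n \<inter> V \<inter> {p. \<zeta> n p \<le> 1 / 2})) \<longlonglongrightarrow> 0" by blast
  from bchoice[OF this] obtain V where V: "\<And>x. x \<in> ?F \<Longrightarrow> x \<in> V x" "\<And>x. x \<in> ?F \<Longrightarrow> open (V x)"
    "\<And>x. x \<in> ?F \<Longrightarrow> (\<lambda>n. measure \<mu> (T n \<inter> V x \<inter> {p. \<zeta> n p \<le> 1 / 2})) \<longlonglongrightarrow> 0" by blast
  obtain I where I: "finite I" "I \<subseteq> ?F" "?F \<subseteq> (\<Union>x\<in>I. V x)"
    using compactE_image[OF F, of ?F V] V(1,2) by (metis UN_I subsetI)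
  have "\<exists>M. \<forall>n\<ge>M. measure \<mu> (T n) < 4 * N * l\<^sup>2 + \<eta> / 2"
  proof (rule cover_measure_le[OF \<mu> *(5,6) I(1) Tb])
    show "T n \<subseteq> (\<Union>x\<in>I. V x)" for n using I(3) by (auto simp: T_def)
    show "V i \<in> sets borel" if "i \<in> I" for i using V(2) I(2) that by (auto intro: borel_open)
    show "(\<lambda>n. measure \<mu> (T n \<inter> V i \<inter> {p. \<zeta> n p \<le> 1 / 2})) \<longlonglongrightarrow> 0" if "i \<in> I" for i using V(3) I(2) that by blast
  qed (use \<eta> in simp)
  then obtain M where M: "\<And>n. n \<ge> M \<Longrightarrow> measure \<mu> (T n) < 4 * N * l\<^sup>2 + \<eta> / 2" by blast
  have "measure \<mu> {p. 3 * \<delta> \<le> \<bar>f n p - v p\<bar>} < \<eta>" if n: "n \<ge> M" for n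
  proof -
    have "measure \<mu> {p. 3 * \<delta> \<le> \<bar>f n p - v p\<bar>} \<le> measure \<mu> (W \<union> T n)"
      using *(2) Tb m(2) by (intro finite_measure.finite_measure_mono[OF m(1)]) (auto simp: T_def)
    also have "\<dots> \<le> measure \<mu> W + measure \<mu> (T n)"
      using *(2) Tb m(2) by (intro measure_Un_le) auto
    also have "\<dots> < 4 * N * e + (4 * N * l\<^sup>2 + \<eta> / 2)" using mW M[OF n] by linarith
    also have "\<dots> \<le> 4 * N * e + (4 * N * e + \<eta> / 2)" using *(7) m(4) by (intro add_mono mult_left_mono) auto
    also have "\<dots> = 8 * N * e + \<eta> / 2" by simp
    also have "\<dots> \<le> \<eta>" using Ne by simp
    finally show ?thesis .
  qed
  then show ?thesis by blast
qed

text \<open>A subsequence of a smooth approximation converges to the quasi-continuous representative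
  \<open>\<mu>\<close>-almost everywhere by the Borel--Cantelli lemma, and Fatou's lemma transfers the inequality.\<close>

theorem smooth_trace_imp_trace_bound:
  assumes \<mu>: "smooth_trace \<mu> N"
  shows "trace_bound A g \<mu> N"
  unfolding trace_bound_def
proof (intro conjI ballI allI impI)
  note m = smooth_trace_measure[OF \<mu>]
  show "0 \<le> N" by (rule m)
  fix u v assume u: "u \<in> H1 A g" and v: "qc_representative A g u v"
  have vm: "v \<in> borel_measurable borel" using v by (simp add: qc_representative_def)
  have bound: "(\<integral>\<^sup>+ p. ennreal ((v p)\<^sup>2) \<partial>\<mu>) \<le> ennreal (N * l\<^sup>2)"
    if f: "h1_approx A g f u" and l: "(\<lambda>n. h1n (f n)) \<longlonglongrightarrow> l" for f l
  proof -
    have sf: "smooth_fun A (f n)" for n using f by (simp add: h1_approx_def)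
    have fm: "f n \<in> borel_measurable borel" for n by (intro continuous_imp_borel continuous_smooth_fun sf)
    let ?D = "\<lambda>n k. {p. 3 * (1 / 2) ^ k \<le> \<bar>f n p - v p\<bar>}"
    have Db: "?D n k \<in> sets borel" for n k using fm[of n] vm by measurable
    \<comment> \<open>A subsequence with summable measures of the exceptional sets.\<close>
    have "\<exists>n\<ge>k. measure \<mu> (?D n k) < (1 / 2) ^ k" for k :: nat
      using approx_converges_in_measure[OF \<mu> u f v, of "(1 / 2) ^ k" "(1 / 2) ^ k"]
      by (metis le_cases power_one_over zero_less_power half_gt_zero_iff zero_less_one)
    then obtain s where s: "\<And>k. s k \<ge> k" "\<And>k. measure \<mu> (?D (s k) k) < (1 / 2) ^ k" by metis
    have "AE p in \<mu>. \<forall>\<^sub>F k in sequentially. p \<in> space \<mu> - ?D (s k) k"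
    proof (rule borel_cantelli_AE1)
      show "?D (s k) k \<in> sets \<mu>" for k using Db m(2) by simp
      show "emeasure \<mu> (?D (s k) k) < \<infinity>" for k using finite_measure.emeasure_eq_measure[OF m(1)] by simp
      show "summable (\<lambda>k. measure \<mu> (?D (s k) k))"
      proof (rule summable_comparison_test'[of "\<lambda>k. (1 / 2) ^ k" 0])
        show "norm (measure \<mu> (?D (s n) n)) \<le> (1 / 2) ^ n" for n using s(2)[of n] by simp
      qed (simp add: summable_geometric)
    qed
    then have "AE p in \<mu>. (\<lambda>k. f (s k) p) \<longlonglongrightarrow> v p"
    proof eventually_elim
      fix p assume "\<forall>\<^sub>F k in sequentially. p \<in> space \<mu> - ?D (s k) k"
      then have ev: "\<forall>\<^sub>F k in sequentially. norm (f (s k) p - v p) \<le> 3 * (1 / 2) ^ k"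
        by eventually_elim auto
      have "(\<lambda>k. 3 * (1 / 2 :: real) ^ k) \<longlonglongrightarrow> 3 * 0" by (intro tendsto_intros LIMSEQ_power_zero) simp
      then have "(\<lambda>k. f (s k) p - v p) \<longlonglongrightarrow> 0" by (intro Lim_null_comparison[OF ev]) simp
      then show "(\<lambda>k. f (s k) p) \<longlonglongrightarrow> v p" by (simp add: LIM_zero_iff)
    qed
    then have ae: "AE p in \<mu>. ennreal ((v p)\<^sup>2) = liminf (\<lambda>k. ennreal ((f (s k) p)\<^sup>2))"
    proof eventually_elim
      fix p assume "(\<lambda>k. f (s k) p) \<longlonglongrightarrow> v p"
      then have "(\<lambda>k. ennreal ((f (s k) p)\<^sup>2)) \<longlonglongrightarrow> ennreal ((v p)\<^sup>2)" by (intro tendsto_ennrealI tendsto_intros)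
      then show "ennreal ((v p)\<^sup>2) = liminf (\<lambda>k. ennreal ((f (s k) p)\<^sup>2))"
        by (intro lim_imp_Liminf[symmetric]) simp_all
    qed
    have slim: "filterlim s at_top sequentially"
      by (rule filterlim_at_top_mono[OF filterlim_ident]) (simp add: s(1))
    have "(\<integral>\<^sup>+ p. ennreal ((v p)\<^sup>2) \<partial>\<mu>) = (\<integral>\<^sup>+ p. liminf (\<lambda>k. ennreal ((f (s k) p)\<^sup>2)) \<partial>\<mu>)"
      by (rule nn_integral_cong_AE[OF ae])
    also have "\<dots> \<le> liminf (\<lambda>k. \<integral>\<^sup>+ p. ennreal ((f (s k) p)\<^sup>2) \<partial>\<mu>)"
    proof (rule nn_integral_liminf)
      fix k
      have "(\<lambda>p. ennreal ((f (s k) p)\<^sup>2)) \<in> borel_measurable borel" using fm[of "s k"] by measurable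
      then show "(\<lambda>p. ennreal ((f (s k) p)\<^sup>2)) \<in> borel_measurable \<mu>" using measurable_cong_sets[OF m(2) refl] by blast
    qed
    also have "\<dots> \<le> liminf (\<lambda>k. ennreal (N * (h1n (f (s k)))\<^sup>2))"
      using \<mu> sf unfolding smooth_trace_def by (intro Liminf_mono) auto
    also have "\<dots> = ennreal (N * l\<^sup>2)"
    proof (rule lim_imp_Liminf)
      show "(\<lambda>k. ennreal (N * (h1n (f (s k)))\<^sup>2)) \<longlonglongrightarrow> ennreal (N * l\<^sup>2)"
        by (intro tendsto_ennrealI tendsto_intros filterlim_compose[OF l slim])
    qed simp
    finally show ?thesis .
  qed
  let ?b = "h1_norm A g u"
  have "(\<lambda>n. ennreal (N * (?b + inverse (real (Suc n)))\<^sup>2)) \<longlonglongrightarrow> ennreal (N * (?b + 0)\<^sup>2)"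
    by (intro tendsto_ennrealI tendsto_intros LIMSEQ_inverse_real_of_nat)
  moreover have "(\<integral>\<^sup>+ p. ennreal ((v p)\<^sup>2) \<partial>\<mu>) \<le> ennreal (N * (?b + inverse (real (Suc n)))\<^sup>2)" for n
  proof -
    obtain f l where fl: "h1_approx A g f u" "(\<lambda>n. h1n (f n)) \<longlonglongrightarrow> l" "0 \<le> l" "l < ?b + inverse (real (Suc n))"
      using h1_norm_less[OF u, of "?b + inverse (real (Suc n))"] by auto
    have "(\<integral>\<^sup>+ p. ennreal ((v p)\<^sup>2) \<partial>\<mu>) \<le> ennreal (N * l\<^sup>2)" by (rule bound[OF fl(1,2)])
    also have "\<dots> \<le> ennreal (N * (?b + inverse (real (Suc n)))\<^sup>2)"
      using fl(3,4) m(4) by (intro ennreal_leI mult_left_mono power_mono) auto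
    finally show ?thesis .
  qed
  ultimately have "(\<integral>\<^sup>+ p. ennreal ((v p)\<^sup>2) \<partial>\<mu>) \<le> ennreal (N * (?b + 0)\<^sup>2)"
    by (intro LIMSEQ_le_const) auto
  then show "(\<integral>\<^sup>+ p. ennreal ((v p)\<^sup>2) \<partial>\<mu>) \<le> ennreal (N * ?b\<^sup>2)" by simp
qed

end


section \<open>A trace inequality in the plane\<close>

lemma nn_integral_eq_integral_cbox:
  fixes \<phi> :: "'e::euclidean_space \<Rightarrow> real"
  assumes c: "continuous_on (cbox a b) \<phi>" and nn: "\<And>z. z \<in> cbox a b \<Longrightarrow> 0 \<le> \<phi> z"
  shows "(\<integral>\<^sup>+ z. ennreal (\<phi> z) * indicator (cbox a b) z \<partial>lborel) = ennreal (integral (cbox a b) \<phi>)"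
proof -
  let ?g = "\<lambda>z. indicator (cbox a b) z *\<^sub>R \<phi> z"
  have m: "?g \<in> borel_measurable borel" by (rule borel_measurable_continuous_on_indicator) (use c in auto)
  have eq: "?g = (\<lambda>z. if z \<in> cbox a b then \<phi> z else 0)" by auto
  have "(\<phi> has_integral integral (cbox a b) \<phi>) (cbox a b)" by (intro integrable_integral integrable_continuous c)
  then have "(?g has_integral integral (cbox a b) \<phi>) UNIV" unfolding eq has_integral_restrict_UNIV .
  moreover have "0 \<le> ?g z" for z using nn by (auto simp: indicator_def)
  ultimately have "(\<integral>\<^sup>+ z. ennreal (?g z) \<partial>lborel) = ennreal (integral (cbox a b) \<phi>)"
    using m by (intro nn_integral_has_integral_lborel)
  moreover have "ennreal (?g z) = ennreal (\<phi> z) * indicator (cbox a b) z" for z by (simp add: indicator_def)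
  ultimately show ?thesis by simp
qed

lemma content_unit_cube: "measure lborel (cbox 0 (1 :: real ^ 'm::finite)) = 1"
proof -
  have "(0 :: real ^ 'm) \<in> cbox 0 1" by (simp add: mem_box_cart)
  then show ?thesis using content_cbox_cart[of 0 "1 :: real ^ 'm"] by force
qed

text \<open>Jensen's inequality on a set of measure one: the variance is nonnegative.\<close>

lemma unit_cube_square_integral:
  fixes \<phi> :: "real ^ 'm::finite \<Rightarrow> real"
  assumes c: "continuous_on (cbox 0 1) \<phi>"
  shows "(integral (cbox 0 1) \<phi>)\<^sup>2 \<le> integral (cbox 0 1) (\<lambda>z. (\<phi> z)\<^sup>2)"
proof -
  let ?C = "cbox 0 (1 :: real ^ 'm)" and ?I = "integral (cbox 0 1) \<phi>"
  have i: "\<phi> integrable_on ?C" "(\<lambda>z. (\<phi> z)\<^sup>2) integrable_on ?C"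
    by (intro integrable_continuous continuous_intros c)+
  have h: "((\<lambda>z. (\<phi> z)\<^sup>2 - (2 * ?I) * \<phi> z + ?I\<^sup>2) has_integral (integral ?C (\<lambda>z. (\<phi> z)\<^sup>2) - (2 * ?I) * ?I + measure lborel ?C *\<^sub>R ?I\<^sup>2)) ?C"
    by (intro has_integral_add has_integral_diff has_integral_mult_right has_integral_const integrable_integral i)
  have "0 \<le> integral ?C (\<lambda>z. (\<phi> z)\<^sup>2) - (2 * ?I) * ?I + measure lborel ?C *\<^sub>R ?I\<^sup>2"
  proof (rule has_integral_nonneg[OF h])
    fix z
    show "0 \<le> (\<phi> z)\<^sup>2 - (2 * ?I) * \<phi> z + ?I\<^sup>2"
      using zero_le_power2[of "\<phi> z - ?I"] by (simp add: power2_diff mult_ac)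
  qed
  then show ?thesis by (simp add: content_unit_cube power2_eq_square)
qed

lemma in_cube_iff: "x \<in> cbox p (p + t *\<^sub>R 1) \<longleftrightarrow> (\<forall>i. p $ i \<le> x $ i \<and> x $ i \<le> p $ i + t)"
  for p x :: "real ^ 'm::finite"
  by (simp add: mem_box_cart)

lemma cube_scale: "0 \<le> t \<Longrightarrow> z \<in> cbox 0 1 \<Longrightarrow> p + t *\<^sub>R z \<in> cbox p (p + t *\<^sub>R 1)"
  for p z :: "real ^ 'm::finite"
  by (auto simp: mem_box_cart mult_left_le intro: mult_nonneg_nonneg)

lemma nn_integral_cube_scale:
  fixes h :: "real ^ 'm::finite \<Rightarrow> ennreal"
  assumes [measurable]: "h \<in> borel_measurable borel" and t: "0 < t"
  shows "(\<integral>\<^sup>+ x. h x * indicator (cbox p (p + t *\<^sub>R 1)) x \<partial>lborel) =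
    ennreal (t ^ CARD('m)) * (\<integral>\<^sup>+ z. h (p + t *\<^sub>R z) * indicator (cbox 0 1) z \<partial>lborel)"
proof -
  have C: "cbox p (p + t *\<^sub>R 1) \<in> sets borel" by (rule borel_closed) (rule closed_cbox)
  have C1: "cbox 0 (1 :: real ^ 'm) \<in> sets borel" by (rule borel_closed) (rule closed_cbox)
  let ?h = "\<lambda>x. h x * indicator (cbox p (p + t *\<^sub>R 1)) x"
  have hm: "?h \<in> borel_measurable borel"
    by (intro borel_measurable_times_ennreal assms(1) borel_measurable_indicator C)
  have am: "(\<lambda>x. p + t *\<^sub>R x) \<in> borel_measurable borel"
    by (intro borel_measurable_continuous_onI continuous_intros)
  have ind: "indicator (cbox p (p + t *\<^sub>R 1)) (p + t *\<^sub>R z) = (indicator (cbox 0 1) z :: ennreal)" for z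
  proof -
    have "p + t *\<^sub>R z \<in> cbox p (p + t *\<^sub>R 1) \<longleftrightarrow> z \<in> cbox 0 1"
      using t by (simp add: in_cube_iff mem_box_cart zero_le_mult_iff mult_le_cancel_left1)
    then show ?thesis by (simp only: indicator_def)
  qed
  have "(\<integral>\<^sup>+ x. ?h x \<partial>lborel) = (\<integral>\<^sup>+ x. ?h x \<partial>density (distr lborel borel (\<lambda>x. p + t *\<^sub>R x)) (\<lambda>_. ennreal (\<bar>t\<bar> ^ DIM(real ^ 'm))))"
    by (rule arg_cong[where f = "\<lambda>M. nn_integral M ?h"], rule lborel_affine) (use t in simp)
  also have "\<dots> = (\<integral>\<^sup>+ x. ennreal (\<bar>t\<bar> ^ DIM(real ^ 'm)) * ?h x \<partial>distr lborel borel (\<lambda>x. p + t *\<^sub>R x))"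
    by (rule nn_integral_density) (use hm in simp_all)
  also have "\<dots> = (\<integral>\<^sup>+ z. ennreal (\<bar>t\<bar> ^ DIM(real ^ 'm)) * ?h (p + t *\<^sub>R z) \<partial>lborel)"
    by (rule nn_integral_distr) (use hm am in simp_all)
  also have "\<dots> = ennreal (\<bar>t\<bar> ^ DIM(real ^ 'm)) * (\<integral>\<^sup>+ z. ?h (p + t *\<^sub>R z) \<partial>lborel)"
    by (rule nn_integral_cmult) (use measurable_compose[OF am hm] in simp)
  also have "\<dots> = ennreal (t ^ CARD('m)) * (\<integral>\<^sup>+ z. h (p + t *\<^sub>R z) * indicator (cbox 0 1) z \<partial>lborel)"
    using t by (simp add: ind)
  finally show ?thesis .
qed

lemma egrad_has_derivative:
  fixes F :: "real ^ 'm::finite \<Rightarrow> real"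
  assumes "smooth_on U F" "x \<in> U"
  shows "(F has_derivative (\<lambda>v. egrad F x \<bullet> v)) (at x)"
proof -
  let ?D = "frechet_derivative F (at x)"
  have D: "(F has_derivative ?D) (at x)" by (rule smooth_onD[OF assms])
  have "?D v = egrad F x \<bullet> v" for v
  proof -
    have "?D v = ?D (\<Sum>i\<in>UNIV. (v $ i) *\<^sub>R axis i 1)"
      using basis_expansion[of v] by (simp add: scalar_mult_eq_scaleR)
    also have "\<dots> = (\<Sum>i\<in>UNIV. (v $ i) *\<^sub>R ?D (axis i 1))"
      using has_derivative_linear[OF D] by (simp add: linear_sum linear_cmul)
    finally show ?thesis by (simp add: egrad_def inner_vec_def mult.commute)
  qed
  then have "?D = (\<lambda>v. egrad F x \<bullet> v)" by auto
  with D show ?thesis by metis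
qed

lemma continuous_egrad: "smooth_on U F \<Longrightarrow> continuous_on U (egrad F)" for F :: "real ^ 'm::finite \<Rightarrow> real"
  unfolding egrad_def by (intro continuous_on_vec_lambda smooth_on_frechet_continuous)

text \<open>The average of \<open>F\<close> over the cube with lower corner \<open>p\<close> and side \<open>t\<close>, rescaled to the unit cube so that
  it can be differentiated in \<open>t\<close>.\<close>

definition cube_average :: "(real ^ 'm::finite \<Rightarrow> real) \<Rightarrow> real ^ 'm \<Rightarrow> real \<Rightarrow> real" where
  "cube_average F p t = integral (cbox 0 1) (\<lambda>z. F (p + t *\<^sub>R z))"

lemma cube_average_has_derivative:
  fixes F :: "real ^ 'm::finite \<Rightarrow> real"
  assumes F: "smooth_on U F" and cube: "cbox p (p + t *\<^sub>R 1) \<subseteq> U" and s: "s \<in> {0..t}"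
  shows "(cube_average F p has_field_derivative integral (cbox 0 1) (\<lambda>z. egrad F (p + s *\<^sub>R z) \<bullet> z)) (at s within {0..t})"
proof -
  let ?C = "cbox 0 (1 :: real ^ 'm)"
  have inU: "p + s *\<^sub>R z \<in> U" if "s \<in> {0..t}" "z \<in> ?C" for s z
  proof -
    have "p + s *\<^sub>R z \<in> cbox p (p + s *\<^sub>R 1)" using that by (intro cube_scale) auto
    then have "p + s *\<^sub>R z \<in> cbox p (p + t *\<^sub>R 1)"
      using that(1) unfolding in_cube_iff atLeastAtMost_iff by (meson add_left_mono order_trans)
    then show ?thesis using cube by blast
  qed
  let ?G = "\<lambda>s z. egrad F (p + s *\<^sub>R z) \<bullet> z"
  have contF: "continuous_on U F" and contG: "continuous_on U (egrad F)"
    by (intro smooth_on_continuous F continuous_egrad)+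
  show ?thesis
    unfolding cube_average_def[abs_def]
  proof (rule leibniz_rule_field_derivative[where U = "{0..t}"])
    fix s z assume sz: "s \<in> {0..t}" "z \<in> ?C"
    have "((\<lambda>s. p + s *\<^sub>R z) has_derivative (\<lambda>h. h *\<^sub>R z)) (at s within {0..t})"
      by (auto intro!: derivative_eq_intros)
    from has_derivative_compose[OF this egrad_has_derivative[OF F inU[OF sz]]]
    have "((\<lambda>s. F (p + s *\<^sub>R z)) has_derivative (\<lambda>h. h * ?G s z)) (at s within {0..t})" by simp
    then show "((\<lambda>s. F (p + s *\<^sub>R z)) has_field_derivative ?G s z) (at s within {0..t})"
      unfolding has_field_derivative_def by (simp add: mult_commute_abs)
  next
    fix s assume "s \<in> {0..t}"
    then show "(\<lambda>z. F (p + s *\<^sub>R z)) integrable_on ?C"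
      using inU by (intro integrable_continuous continuous_on_compose2[OF contF]) (auto intro!: continuous_intros)
  next
    have "continuous_on ({0..t} \<times> ?C) (\<lambda>x. p + fst x *\<^sub>R snd x)" by (intro continuous_intros)
    then have "continuous_on ({0..t} \<times> ?C) (\<lambda>x. egrad F (p + fst x *\<^sub>R snd x))"
      by (rule continuous_on_compose2[OF contG]) (use inU in auto)
    then have "continuous_on ({0..t} \<times> ?C) (\<lambda>x. egrad F (p + fst x *\<^sub>R snd x) \<bullet> snd x)"
      by (intro continuous_intros)
    then show "continuous_on ({0..t} \<times> ?C) (\<lambda>(s, z). ?G s z)" by (simp add: case_prod_unfold)
  qed (use s in auto)
qed

text \<open>The mean value theorem produces a scale \<open>\<xi>\<close> between \<open>t / 2\<close> and \<open>t\<close> at which the derivative is an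
  average of the gradient. Its square is \<open>\<xi>\<^sup>-\<^sup>2\<close> times an energy in dimension two, which is compensated
  by the square of the increment \<open>t / 2\<close>; so the constant does not depend on the scale.\<close>

lemma cube_average_halving:
  fixes F :: "real ^ 'm::finite \<Rightarrow> real"
  assumes m: "CARD('m) = 2" and F: "smooth_on U F" and t: "0 < t" and cube: "cbox p (p + t *\<^sub>R 1) \<subseteq> U"
    and h: "h \<in> borel_measurable borel" "\<And>x. x \<in> cbox p (p + t *\<^sub>R 1) \<Longrightarrow> ennreal ((norm (egrad F x))\<^sup>2) \<le> h x"
  shows "ennreal ((cube_average F p t - cube_average F p (t / 2))\<^sup>2) \<le>
    ennreal 2 * (\<integral>\<^sup>+ x. h x * indicator (cbox p (p + t *\<^sub>R 1)) x \<partial>lborel)"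
proof -
  let ?C = "cbox 0 (1 :: real ^ 'm)"
  let ?G = "\<lambda>s z. egrad F (p + s *\<^sub>R z) \<bullet> z"
  note D = cube_average_has_derivative[OF F cube]
  obtain \<xi> where \<xi>: "t / 2 < \<xi>" "\<xi> < t" "cube_average F p t - cube_average F p (t / 2) = integral ?C (?G \<xi>) * (t - t / 2)"
  proof -
    have cont: "continuous_on {t / 2..t} (cube_average F p)"
      by (rule continuous_on_subset[OF DERIV_continuous_on[OF D]]) (use t in auto)
    have der: "(cube_average F p has_derivative (\<lambda>v. integral ?C (?G x) * v)) (at x)" if x: "t / 2 < x" "x < t" for x
    proof -
      have "at x within {0..t} = at x" using x t by (intro at_within_interior) auto
      then show ?thesis using D[of x] x t by (simp add: has_field_derivative_def)
    qed
    show ?thesis using mvt[OF _ cont der] t that by auto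
  qed
  have tw: "p + \<xi> *\<^sub>R z \<in> cbox p (p + t *\<^sub>R 1)" if "z \<in> ?C" for z
  proof -
    have "p + \<xi> *\<^sub>R z \<in> cbox p (p + \<xi> *\<^sub>R 1)" using that \<xi> t by (intro cube_scale) auto
    then show ?thesis
      using \<xi>(2) unfolding in_cube_iff by (meson add_left_mono less_imp_le order_trans)
  qed
  have contG: "continuous_on ?C (\<lambda>z. egrad F (p + \<xi> *\<^sub>R z))"
    by (rule continuous_on_compose2[OF continuous_egrad[OF F]]) (use tw cube in \<open>auto intro!: continuous_intros\<close>)
  have nz: "(norm z)\<^sup>2 \<le> 2" if "z \<in> ?C" for z
  proof -
    have "(norm z)\<^sup>2 = (\<Sum>i\<in>UNIV. (z $ i)\<^sup>2)"
      unfolding power2_norm_eq_inner inner_vec_def by (simp add: power2_eq_square)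
    also have "\<dots> \<le> (\<Sum>i\<in>(UNIV :: 'm set). 1)"
      using that by (intro sum_mono) (auto simp: mem_box_cart abs_square_le_1)
    finally show ?thesis using m by simp
  qed
  let ?E = "\<lambda>z. (norm (egrad F (p + \<xi> *\<^sub>R z)))\<^sup>2"
  have "(integral ?C (?G \<xi>))\<^sup>2 \<le> integral ?C (\<lambda>z. (?G \<xi> z)\<^sup>2)"
    by (rule unit_cube_square_integral) (intro continuous_intros contG)
  also have "\<dots> \<le> integral ?C (\<lambda>z. 2 * ?E z)"
  proof (rule integral_le)
    fix z assume z: "z \<in> ?C"
    have "\<bar>?G \<xi> z\<bar> \<le> norm (egrad F (p + \<xi> *\<^sub>R z)) * norm z" by (rule Cauchy_Schwarz_ineq2)
    then have "\<bar>?G \<xi> z\<bar>\<^sup>2 \<le> (norm (egrad F (p + \<xi> *\<^sub>R z)) * norm z)\<^sup>2" by (intro power_mono) auto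
    also have "\<dots> = ?E z * (norm z)\<^sup>2" by (simp add: power_mult_distrib)
    also have "\<dots> \<le> ?E z * 2" by (intro mult_left_mono nz z) simp
    finally show "(?G \<xi> z)\<^sup>2 \<le> 2 * ?E z" by simp
  qed (intro integrable_continuous continuous_intros contG)+
  also have "\<dots> = 2 * integral ?C ?E" by simp
  finally have I2: "(integral ?C (?G \<xi>))\<^sup>2 \<le> 2 * integral ?C ?E" .
  let ?X = "\<integral>\<^sup>+ z. h (p + \<xi> *\<^sub>R z) * indicator ?C z \<partial>lborel"
  have "ennreal (integral ?C ?E) = (\<integral>\<^sup>+ z. ennreal (?E z) * indicator ?C z \<partial>lborel)"
    by (rule nn_integral_eq_integral_cbox[symmetric]) (intro continuous_intros contG, simp)
  also have "\<dots> \<le> ?X"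
    by (rule nn_integral_mono) (use h(2)[OF tw] in \<open>auto simp: indicator_def\<close>)
  finally have EX: "ennreal (integral ?C ?E) \<le> ?X" .
  have \<xi>0: "0 < \<xi>" using \<xi> t by simp
  have "ennreal (\<xi>\<^sup>2) * ?X = (\<integral>\<^sup>+ x. h x * indicator (cbox p (p + \<xi> *\<^sub>R 1)) x \<partial>lborel)"
    using nn_integral_cube_scale[OF h(1) \<xi>0, of p] by (simp add: m)
  also have "\<dots> \<le> (\<integral>\<^sup>+ x. h x * indicator (cbox p (p + t *\<^sub>R 1)) x \<partial>lborel)"
  proof (intro nn_integral_mono mult_left_mono)
    fix x
    have "x \<in> cbox p (p + t *\<^sub>R 1)" if "x \<in> cbox p (p + \<xi> *\<^sub>R 1)"
      using that \<xi>(2) unfolding in_cube_iff by (meson add_left_mono less_imp_le order_trans)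
    then show "indicator (cbox p (p + \<xi> *\<^sub>R 1)) x \<le> (indicator (cbox p (p + t *\<^sub>R 1)) x :: ennreal)"
      by (simp add: indicator_def)
  qed simp
  finally have XY: "ennreal (\<xi>\<^sup>2) * ?X \<le> (\<integral>\<^sup>+ x. h x * indicator (cbox p (p + t *\<^sub>R 1)) x \<partial>lborel)" .
  have "(cube_average F p t - cube_average F p (t / 2))\<^sup>2 = (integral ?C (?G \<xi>))\<^sup>2 * (t / 2)\<^sup>2"
    unfolding \<xi>(3) by (simp add: power_mult_distrib power_divide)
  also have "\<dots> \<le> (2 * integral ?C ?E) * \<xi>\<^sup>2"
    using I2 \<xi> t by (intro mult_mono power_mono) (auto intro!: integral_nonneg integrable_continuous continuous_intros contG)
  finally have "ennreal ((cube_average F p t - cube_average F p (t / 2))\<^sup>2) \<le> ennreal ((2 * integral ?C ?E) * \<xi>\<^sup>2)"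
    by (rule ennreal_leI)
  also have "\<dots> = ennreal 2 * (ennreal (\<xi>\<^sup>2) * ennreal (integral ?C ?E))"
    by (simp add: ennreal_mult'' ennreal_mult' mult_ac)
  also have "\<dots> \<le> ennreal 2 * (ennreal (\<xi>\<^sup>2) * ?X)" by (intro mult_left_mono EX) simp_all
  also have "\<dots> \<le> ennreal 2 * (\<integral>\<^sup>+ x. h x * indicator (cbox p (p + t *\<^sub>R 1)) x \<partial>lborel)"
    by (intro mult_left_mono XY) simp
  finally show ?thesis .
qed

text \<open>Cauchy--Schwarz with the weights \<open>1 / (n + 1)\<close>, whose squares have sum at most \<open>2\<close>.\<close>

lemma telescoping_square:
  fixes a :: "nat \<Rightarrow> real"
  shows "(a M)\<^sup>2 \<le> 2 * (a 0)\<^sup>2 + 4 * (\<Sum>n<M. (real (Suc n))\<^sup>2 * (a n - a (Suc n))\<^sup>2)"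
proof -
  let ?d = "\<lambda>n. a n - a (Suc n)"
  have inv': "(\<Sum>n<Suc M. (1 / real (Suc n))\<^sup>2) \<le> 2 - 1 / real (Suc M)" for M
  proof (induction M)
    case (Suc M)
    have "(1 / (real M + 2))\<^sup>2 \<le> 1 / (real M + 1) * (1 / (real M + 2))"
      unfolding power2_eq_square by (intro mult_right_mono divide_left_mono) auto
    also have "\<dots> = 1 / (real M + 1) - 1 / (real M + 2)" by (simp add: divide_simps)
    finally show ?case using Suc by (simp add: add.commute)
  qed simp
  have inv: "(\<Sum>n<M. (1 / real (Suc n))\<^sup>2) \<le> 2" for M
  proof (cases M)
    case (Suc k)
    have "0 \<le> 1 / real (Suc k)" by simp
    then show ?thesis using inv'[of k] unfolding Suc by linarith
  qed simp
  have "a 0 - a M = (\<Sum>n<M. ?d n)" by (simp add: sum_lessThan_telescope')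
  also have "\<dots> = (\<Sum>n<M. 1 / real (Suc n) * (real (Suc n) * ?d n))" by (intro sum.cong) auto
  finally have "(a 0 - a M)\<^sup>2 = (\<Sum>n<M. 1 / real (Suc n) * (real (Suc n) * ?d n))\<^sup>2" by simp
  also have "\<dots> \<le> (\<Sum>n<M. (1 / real (Suc n))\<^sup>2) * (\<Sum>n<M. (real (Suc n) * ?d n)\<^sup>2)"
    by (rule Cauchy_Schwarz_ineq_sum)
  also have "\<dots> \<le> 2 * (\<Sum>n<M. (real (Suc n) * ?d n)\<^sup>2)"
    by (intro mult_right_mono inv) (simp add: sum_nonneg)
  finally have "(a 0 - a M)\<^sup>2 \<le> 2 * (\<Sum>n<M. (real (Suc n))\<^sup>2 * (?d n)\<^sup>2)" by (simp add: power_mult_distrib)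
  moreover have "(a M)\<^sup>2 \<le> 2 * (a 0)\<^sup>2 + 2 * (a 0 - a M)\<^sup>2"
    using zero_le_power2[of "a M - 2 * a 0"] by (simp add: power2_eq_square algebra_simps)
  ultimately show ?thesis by linarith
qed

text \<open>The value at a point is the limit of its averages over the squares of side \<open>L / 2\<^sup>n\<close>. Telescoping
  bounds its square by energies over these squares with the weights \<open>(n + 1)\<^sup>2\<close>. After integration
  against \<open>\<nu>\<close>, Tonelli's theorem turns the \<open>n\<close>-th term into the energy times the mass that \<open>\<nu>\<close> gives to
  the points whose \<open>n\<close>-th square contains a given point.\<close>

lemma planar_trace:
  fixes F :: "real ^ 'm::finite \<Rightarrow> real" and \<nu> :: "(real ^ 'm) measure"
  assumes m: "CARD('m) = 2" and F: "smooth_on U F" and B: "B \<in> sets borel" "B \<subseteq> U"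
    and L: "0 < L" and \<nu>: "sets \<nu> = sets borel" "finite_measure \<nu>"
    and cube: "AE p in \<nu>. cbox p (p + L *\<^sub>R 1) \<subseteq> B"
    and growth: "\<And>n x. emeasure \<nu> {p. x \<in> cbox p (p + (L / 2 ^ n) *\<^sub>R 1)} \<le> ennreal (b n)"
    and b: "\<And>n. 0 \<le> b n" "summable (\<lambda>n. (real (Suc n))\<^sup>2 * b n)"
  shows "(\<integral>\<^sup>+ p. ennreal ((F p)\<^sup>2) \<partial>\<nu>) \<le> ennreal (2 / L\<^sup>2 * b 0 + 8 * (\<Sum>n. (real (Suc n))\<^sup>2 * b n)) *
    (\<integral>\<^sup>+ x. ennreal ((F x)\<^sup>2 + (norm (egrad F x))\<^sup>2) * indicator B x \<partial>lborel)"
proof -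
  let ?C = "cbox 0 (1 :: real ^ 'm)"
  define h where "h x = ennreal ((F x)\<^sup>2 + (norm (egrad F x))\<^sup>2) * indicator B x" for x
  let ?T = "\<integral>\<^sup>+ x. h x \<partial>lborel"
  define s where "s n = L / 2 ^ n" for n :: nat
  have s: "0 < s n" "s n \<le> L" "s (Suc n) = s n / 2" for n using L by (auto simp: s_def divide_le_eq mult_left_le)
  define Q where "Q n p = cbox p (p + s n *\<^sub>R (1 :: real ^ 'm))" for n p
  have contF: "continuous_on U F" and contG: "continuous_on U (egrad F)"
    by (intro smooth_on_continuous F continuous_egrad)+
  have hm: "h \<in> borel_measurable borel"
  proof -
    have "(\<lambda>x. indicator B x *\<^sub>R ((F x)\<^sup>2 + (norm (egrad F x))\<^sup>2)) \<in> borel_measurable borel"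
      using B(2) by (intro borel_measurable_continuous_on_indicator B(1) continuous_intros continuous_on_subset[OF contF] continuous_on_subset[OF contG])
    then have "(\<lambda>x. ennreal (indicator B x *\<^sub>R ((F x)\<^sup>2 + (norm (egrad F x))\<^sup>2))) \<in> borel_measurable borel"
      by (rule measurable_compose[OF _ measurable_ennreal])
    moreover have "h = (\<lambda>x. ennreal (indicator B x *\<^sub>R ((F x)\<^sup>2 + (norm (egrad F x))\<^sup>2)))"
      by (auto simp: fun_eq_iff h_def indicator_def)
    ultimately show ?thesis by simp
  qed
  define H where "H n p = (\<integral>\<^sup>+ x. h x * indicator (Q n p) x \<partial>lborel)" for n p
  have pw: "ennreal ((F p)\<^sup>2) \<le> ennreal (2 / L\<^sup>2) * H 0 p + (\<Sum>n. ennreal (8 * (real (Suc n))\<^sup>2) * H n p)"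
    if p: "cbox p (p + L *\<^sub>R 1) \<subseteq> B" for p
  proof -
    define a where "a n = cube_average F p (s n)" for n
    have QB: "Q n p \<subseteq> B" for n
    proof -
      have "Q n p \<subseteq> cbox p (p + L *\<^sub>R 1)"
        unfolding Q_def using s(2)[of n] by (auto simp only: in_cube_iff) (meson add_left_mono order_trans)
      then show ?thesis using p by blast
    qed
    have QU: "cbox p (p + s n *\<^sub>R 1) \<subseteq> U" for n using QB[of n] B(2) unfolding Q_def by blast
    have d: "ennreal ((a n - a (Suc n))\<^sup>2) \<le> ennreal 2 * H n p" for n
      unfolding a_def s(3) H_def Q_def
    proof (rule cube_average_halving[OF m F s(1) QU hm])
      fix x assume "x \<in> cbox p (p + s n *\<^sub>R 1)"
      then have "x \<in> B" using QB unfolding Q_def by blast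
      then show "ennreal ((norm (egrad F x))\<^sup>2) \<le> h x" by (simp add: h_def ennreal_leI)
    qed
    have tw: "p + L *\<^sub>R z \<in> cbox p (p + L *\<^sub>R 1)" if "z \<in> ?C" for z
      using that L by (intro cube_scale) auto
    have a0: "ennreal ((a 0)\<^sup>2) \<le> ennreal (1 / L\<^sup>2) * H 0 p"
    proof -
      have c: "continuous_on ?C (\<lambda>z. F (p + L *\<^sub>R z))"
        by (rule continuous_on_compose2[OF contF]) (use tw p B(2) in \<open>auto intro!: continuous_intros\<close>)
      have "(a 0)\<^sup>2 \<le> integral ?C (\<lambda>z. (F (p + L *\<^sub>R z))\<^sup>2)"
        unfolding a_def s_def cube_average_def using unit_cube_square_integral[OF c] by simp
      then have "ennreal ((a 0)\<^sup>2) \<le> ennreal (integral ?C (\<lambda>z. (F (p + L *\<^sub>R z))\<^sup>2))" by (rule ennreal_leI)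
      also have "\<dots> = (\<integral>\<^sup>+ z. ennreal ((F (p + L *\<^sub>R z))\<^sup>2) * indicator ?C z \<partial>lborel)"
        by (rule nn_integral_eq_integral_cbox[symmetric]) (intro continuous_intros c, simp)
      also have "\<dots> \<le> (\<integral>\<^sup>+ z. h (p + L *\<^sub>R z) * indicator ?C z \<partial>lborel)"
      proof (rule nn_integral_mono)
        fix z
        show "ennreal ((F (p + L *\<^sub>R z))\<^sup>2) * indicator ?C z \<le> h (p + L *\<^sub>R z) * indicator ?C z"
        proof (cases "z \<in> ?C")
          case True
          then have "p + L *\<^sub>R z \<in> B" using tw p by blast
          then show ?thesis by (simp add: h_def ennreal_leI mult_right_mono)
        qed simp
      qed
      also have "\<dots> = ennreal (1 / L\<^sup>2) * (ennreal (L\<^sup>2) * (\<integral>\<^sup>+ z. h (p + L *\<^sub>R z) * indicator ?C z \<partial>lborel))"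
        using L by (simp add: mult.assoc[symmetric] ennreal_mult'[symmetric])
      also have "\<dots> = ennreal (1 / L\<^sup>2) * H 0 p"
        using nn_integral_cube_scale[OF hm L, of p] by (simp add: m H_def Q_def s_def)
      finally show ?thesis .
    qed
    have le: "ennreal ((a M)\<^sup>2) \<le> ennreal (2 / L\<^sup>2) * H 0 p + (\<Sum>n. ennreal (8 * (real (Suc n))\<^sup>2) * H n p)" for M
    proof -
      have "ennreal ((a M)\<^sup>2) \<le> ennreal (2 * (a 0)\<^sup>2 + 4 * (\<Sum>n<M. (real (Suc n))\<^sup>2 * (a n - a (Suc n))\<^sup>2))"
        by (intro ennreal_leI telescoping_square)
      also have "\<dots> = ennreal 2 * ennreal ((a 0)\<^sup>2) + (\<Sum>n<M. ennreal (4 * (real (Suc n))\<^sup>2) * ennreal ((a n - a (Suc n))\<^sup>2))"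
      proof -
        have "ennreal 2 * ennreal ((a 0)\<^sup>2) = ennreal (2 * (a 0)\<^sup>2)" by (rule ennreal_mult'[symmetric]) simp
        moreover have "ennreal (4 * (real (Suc n))\<^sup>2) * ennreal ((a n - a (Suc n))\<^sup>2) =
            ennreal (4 * ((real (Suc n))\<^sup>2 * (a n - a (Suc n))\<^sup>2))" for n
          by (subst ennreal_mult'[symmetric]) (simp_all only: mult.assoc, simp)
        moreover have "ennreal (2 * (a 0)\<^sup>2 + 4 * (\<Sum>n<M. (real (Suc n))\<^sup>2 * (a n - a (Suc n))\<^sup>2)) =
            ennreal (2 * (a 0)\<^sup>2) + ennreal (\<Sum>n<M. 4 * ((real (Suc n))\<^sup>2 * (a n - a (Suc n))\<^sup>2))"
          unfolding sum_distrib_left by (intro ennreal_plus sum_nonneg) auto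
        moreover have "ennreal (\<Sum>n<M. 4 * ((real (Suc n))\<^sup>2 * (a n - a (Suc n))\<^sup>2)) =
            (\<Sum>n<M. ennreal (4 * ((real (Suc n))\<^sup>2 * (a n - a (Suc n))\<^sup>2)))"
          by (rule sum_ennreal[symmetric]) simp
        ultimately show ?thesis by (simp only:)
      qed
      also have "\<dots> \<le> ennreal 2 * (ennreal (1 / L\<^sup>2) * H 0 p) + (\<Sum>n<M. ennreal (4 * (real (Suc n))\<^sup>2) * (ennreal 2 * H n p))"
        by (intro add_mono mult_left_mono sum_mono a0 d) simp_all
      also have "\<dots> = ennreal (2 / L\<^sup>2) * H 0 p + (\<Sum>n<M. ennreal (8 * (real (Suc n))\<^sup>2) * H n p)"
      proof -
        have "ennreal 2 * (ennreal (1 / L\<^sup>2) * H 0 p) = ennreal (2 / L\<^sup>2) * H 0 p"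
          by (subst mult.assoc[symmetric], subst ennreal_mult'[symmetric]) simp_all
        moreover have "ennreal (4 * (real (Suc n))\<^sup>2) * (ennreal 2 * H n p) = ennreal (8 * (real (Suc n))\<^sup>2) * H n p" for n
          by (subst mult.assoc[symmetric], subst ennreal_mult''[symmetric]) (simp_all add: mult.commute)
        ultimately show ?thesis by (simp only:)
      qed
      also have "(\<Sum>n<M. ennreal (8 * (real (Suc n))\<^sup>2) * H n p) \<le> (\<Sum>n. ennreal (8 * (real (Suc n))\<^sup>2) * H n p)"
        by (rule sum_le_suminf) (auto intro: summableI)
      finally show ?thesis by (simp add: add_left_mono)
    qed
    have "a \<longlonglongrightarrow> F p"
    proof -
      have c0: "continuous_on {0..L} (cube_average F p)"
        by (rule DERIV_continuous_on[OF cube_average_has_derivative[OF F order_trans[OF p B(2)]]])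
      have "s \<longlonglongrightarrow> 0"
        unfolding s_def by (rule LIMSEQ_divide_realpow_zero) simp
      then have "(\<lambda>n. cube_average F p (s n)) \<longlonglongrightarrow> cube_average F p 0"
        using s L by (intro continuous_on_tendsto_compose[OF c0]) (auto simp: less_imp_le)
      moreover have "cube_average F p 0 = F p"
        unfolding cube_average_def using content_unit_cube[where 'm = 'm] by simp
      ultimately show ?thesis by (simp add: a_def[abs_def])
    qed
    then have "(\<lambda>M. ennreal ((a M)\<^sup>2)) \<longlonglongrightarrow> ennreal ((F p)\<^sup>2)" by (intro tendsto_ennrealI tendsto_intros)
    then show ?thesis by (rule LIMSEQ_le_const2) (use le in blast)
  qed
  interpret sf: pair_sigma_finite \<nu> lborel
    using \<nu>(2) by (simp add: pair_sigma_finite_def finite_measure_def lborel.sigma_finite_measure_axioms)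
  have Hm: "H n \<in> borel_measurable \<nu>" and HI: "(\<integral>\<^sup>+ p. H n p \<partial>\<nu>) \<le> ennreal (b n) * ?T" for n
  proof -
    let ?S = "{y :: (real ^ 'm) \<times> (real ^ 'm). snd y \<in> Q n (fst y)}"
    have "closed ?S"
      unfolding Q_def in_cube_iff
      by (intro closed_Collect_all closed_Collect_conj closed_Collect_le continuous_intros continuous_on_component)
    then have "?S \<in> sets (borel \<Otimes>\<^sub>M borel)" unfolding borel_prod by (rule borel_closed)
    also have "sets (borel \<Otimes>\<^sub>M borel) = sets (\<nu> \<Otimes>\<^sub>M lborel)"
      by (rule sets_pair_measure_cong) (use \<nu> in simp_all)
    finally have S: "?S \<in> sets (\<nu> \<Otimes>\<^sub>M lborel)" .
    let ?f = "\<lambda>y. h (snd y) * indicator ?S y"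
    have f: "?f \<in> borel_measurable (\<nu> \<Otimes>\<^sub>M lborel)"
      by (intro borel_measurable_times_ennreal borel_measurable_indicator S measurable_compose[OF measurable_snd]) (use hm in simp)
    have fH: "(\<integral>\<^sup>+ x. ?f (p, x) \<partial>lborel) = H n p" for p
      unfolding H_def by (intro nn_integral_cong) (simp add: indicator_def)
    show "H n \<in> borel_measurable \<nu>"
      using lborel.borel_measurable_nn_integral_fst[OF f] unfolding fH .
    have "(\<integral>\<^sup>+ p. H n p \<partial>\<nu>) = (\<integral>\<^sup>+ p. (\<integral>\<^sup>+ x. ?f (p, x) \<partial>lborel) \<partial>\<nu>)" unfolding fH ..
    also have "\<dots> = (\<integral>\<^sup>+ x. (\<integral>\<^sup>+ p. ?f (p, x) \<partial>\<nu>) \<partial>lborel)" by (rule sf.Fubini[OF f, symmetric])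
    also have "\<dots> \<le> (\<integral>\<^sup>+ x. h x * ennreal (b n) \<partial>lborel)"
    proof (rule nn_integral_mono)
      fix x :: "real ^ 'm"
      have "closed {p. x \<in> cbox p (p + (L / 2 ^ n) *\<^sub>R 1)}"
        unfolding in_cube_iff by (intro closed_Collect_all closed_Collect_conj closed_Collect_le continuous_intros continuous_on_component)
      then have xs: "{p. x \<in> cbox p (p + (L / 2 ^ n) *\<^sub>R 1)} \<in> sets \<nu>"
        unfolding \<nu>(1) by (rule borel_closed)
      have "(\<integral>\<^sup>+ p. ?f (p, x) \<partial>\<nu>) = (\<integral>\<^sup>+ p. h x * indicator {p. x \<in> cbox p (p + (L / 2 ^ n) *\<^sub>R 1)} p \<partial>\<nu>)"
        by (intro nn_integral_cong) (simp add: indicator_def Q_def s_def)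
      also have "\<dots> = h x * emeasure \<nu> {p. x \<in> cbox p (p + (L / 2 ^ n) *\<^sub>R 1)}" by (rule nn_integral_cmult_indicator[OF xs])
      also have "\<dots> \<le> h x * ennreal (b n)" by (intro mult_left_mono growth) simp
      finally show "(\<integral>\<^sup>+ p. ?f (p, x) \<partial>\<nu>) \<le> h x * ennreal (b n)" .
    qed
    also have "\<dots> = ennreal (b n) * ?T" using hm by (simp add: nn_integral_multc mult.commute)
    finally show "(\<integral>\<^sup>+ p. H n p \<partial>\<nu>) \<le> ennreal (b n) * ?T" .
  qed
  have "(\<integral>\<^sup>+ p. ennreal ((F p)\<^sup>2) \<partial>\<nu>) \<le> (\<integral>\<^sup>+ p. ennreal (2 / L\<^sup>2) * H 0 p + (\<Sum>n. ennreal (8 * (real (Suc n))\<^sup>2) * H n p) \<partial>\<nu>)"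
    by (rule nn_integral_mono_AE, rule eventually_mono[OF cube], rule pw)
  also have "\<dots> = ennreal (2 / L\<^sup>2) * (\<integral>\<^sup>+ p. H 0 p \<partial>\<nu>) + (\<Sum>n. ennreal (8 * (real (Suc n))\<^sup>2) * (\<integral>\<^sup>+ p. H n p \<partial>\<nu>))"
  proof -
    have "(\<integral>\<^sup>+ p. ennreal (2 / L\<^sup>2) * H 0 p + (\<Sum>n. ennreal (8 * (real (Suc n))\<^sup>2) * H n p) \<partial>\<nu>) =
        (\<integral>\<^sup>+ p. ennreal (2 / L\<^sup>2) * H 0 p \<partial>\<nu>) + (\<integral>\<^sup>+ p. (\<Sum>n. ennreal (8 * (real (Suc n))\<^sup>2) * H n p) \<partial>\<nu>)"
      by (rule nn_integral_add) (use Hm in measurable)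
    also have "(\<integral>\<^sup>+ p. ennreal (2 / L\<^sup>2) * H 0 p \<partial>\<nu>) = ennreal (2 / L\<^sup>2) * (\<integral>\<^sup>+ p. H 0 p \<partial>\<nu>)" by (rule nn_integral_cmult[OF Hm])
    also have "(\<integral>\<^sup>+ p. (\<Sum>n. ennreal (8 * (real (Suc n))\<^sup>2) * H n p) \<partial>\<nu>) = (\<Sum>n. \<integral>\<^sup>+ p. ennreal (8 * (real (Suc n))\<^sup>2) * H n p \<partial>\<nu>)"
      by (rule nn_integral_suminf) (use Hm in measurable)
    also have "\<dots> = (\<Sum>n. ennreal (8 * (real (Suc n))\<^sup>2) * (\<integral>\<^sup>+ p. H n p \<partial>\<nu>))"
      by (intro suminf_cong nn_integral_cmult[OF Hm])
    finally show ?thesis .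
  qed
  also have "\<dots> \<le> ennreal (2 / L\<^sup>2) * (ennreal (b 0) * ?T) + (\<Sum>n. ennreal (8 * (real (Suc n))\<^sup>2) * (ennreal (b n) * ?T))"
    by (intro add_mono mult_left_mono suminf_le summableI HI) simp_all
  also have "\<dots> = ennreal (2 / L\<^sup>2 * b 0) * ?T + (\<Sum>n. ennreal (8 * ((real (Suc n))\<^sup>2 * b n)) * ?T)"
  proof -
    have "ennreal (2 / L\<^sup>2) * (ennreal (b 0) * ?T) = ennreal (2 / L\<^sup>2 * b 0) * ?T"
      by (subst mult.assoc[symmetric], subst ennreal_mult''[symmetric]) (simp_all add: b(1))
    moreover have "ennreal (8 * (real (Suc n))\<^sup>2) * (ennreal (b n) * ?T) = ennreal (8 * ((real (Suc n))\<^sup>2 * b n)) * ?T" for n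
      by (subst mult.assoc[symmetric], subst ennreal_mult''[symmetric]) (simp_all only: b(1) mult.assoc)
    ultimately show ?thesis by (simp only:)
  qed
  also have "\<dots> = ennreal (2 / L\<^sup>2 * b 0) * ?T + (\<Sum>n. ennreal (8 * ((real (Suc n))\<^sup>2 * b n))) * ?T"
    by (simp add: ennreal_suminf_multc)
  also have "(\<Sum>n. ennreal (8 * ((real (Suc n))\<^sup>2 * b n))) = ennreal (8 * (\<Sum>n. (real (Suc n))\<^sup>2 * b n))"
    using b by (subst suminf_ennreal2) (auto simp: suminf_mult simp del: of_nat_Suc intro: summable_mult)
  also have "ennreal (2 / L\<^sup>2 * b 0) * ?T + ennreal (8 * (\<Sum>n. (real (Suc n))\<^sup>2 * b n)) * ?T =
      ennreal (2 / L\<^sup>2 * b 0 + 8 * (\<Sum>n. (real (Suc n))\<^sup>2 * b n)) * ?T"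
    using b L by (simp add: distrib_right[symmetric] ennreal_plus[symmetric] suminf_nonneg del: of_nat_Suc ennreal_plus)
  finally show ?thesis unfolding h_def .
qed


section \<open>A measure of dimension zero with a trace inequality\<close>

text \<open>The \<open>k\<close>-th jump size \<open>2\<^sup>-\<^sup>k\<^sup>(\<^sup>k\<^sup>+\<^sup>1\<^sup>)\<close> is attached to the binary level \<open>k\<close>. It is summable against the \<open>2\<^sup>k\<close>
  jumps of that level and larger than the total of all later levels.\<close>

definition sparse_term :: "nat \<Rightarrow> real \<Rightarrow> real" where
  "sparse_term k \<omega> = (1 / 2) ^ (k * (k + 1)) * of_int \<lfloor>2 ^ k * \<omega>\<rfloor>"

definition sparse_map :: "real \<Rightarrow> real" where
  "sparse_map \<omega> = (\<Sum>k. sparse_term k \<omega>)"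

lemma sparse_term_bounds:
  assumes "0 \<le> \<omega>" "\<omega> < 1"
  shows "0 \<le> sparse_term k \<omega>" "sparse_term k \<omega> \<le> (1 / 2) ^ (k * k)" "sparse_term k \<omega> \<le> (1 / 2) ^ k"
proof -
  show "0 \<le> sparse_term k \<omega>" using assms by (simp add: sparse_term_def)
  have "of_int \<lfloor>2 ^ k * \<omega>\<rfloor> \<le> 2 ^ k * \<omega>" by (rule of_int_floor_le)
  also have "\<dots> \<le> 2 ^ k" using assms by simp
  finally have "sparse_term k \<omega> \<le> (1 / 2) ^ (k * (k + 1)) * 2 ^ k"
    unfolding sparse_term_def by (intro mult_left_mono) simp_all
  also have "\<dots> = (1 / 2) ^ (k * k) * ((1 / 2) ^ k * 2 ^ k)" by (simp add: power_add distrib_left)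
  also have "\<dots> = (1 / 2) ^ (k * k)" by (simp flip: power_mult_distrib)
  finally show 1: "sparse_term k \<omega> \<le> (1 / 2) ^ (k * k)" .
  have "k \<le> k * k" by (cases k) auto
  then have "(1 / 2 :: real) ^ (k * k) \<le> (1 / 2) ^ k" by (intro power_decreasing) simp_all
  then show "sparse_term k \<omega> \<le> (1 / 2) ^ k" using 1 by linarith
qed

lemma summable_sparse: "0 \<le> \<omega> \<Longrightarrow> \<omega> < 1 \<Longrightarrow> summable (\<lambda>k. sparse_term k \<omega>)"
  by (rule summable_comparison_test'[of "\<lambda>k. (1 / 2) ^ k" 0]) (auto simp: sparse_term_bounds)

lemma sparse_map_bounds:
  assumes "0 \<le> \<omega>" "\<omega> < 1"
  shows "0 \<le> sparse_map \<omega>" "sparse_map \<omega> \<le> 2"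
proof -
  show "0 \<le> sparse_map \<omega>"
    unfolding sparse_map_def by (intro suminf_nonneg summable_sparse sparse_term_bounds assms)
  have "sparse_map \<omega> \<le> (\<Sum>k. (1 / 2) ^ k)"
    unfolding sparse_map_def by (intro suminf_le summable_sparse sparse_term_bounds assms) simp
  also have "\<dots> = 2" by (simp add: suminf_geometric)
  finally show "sparse_map \<omega> \<le> 2" .
qed

lemma sparse_term_mono: "\<omega> \<le> \<omega>' \<Longrightarrow> sparse_term k \<omega> \<le> sparse_term k \<omega>'"
  unfolding sparse_term_def by (intro mult_left_mono) (auto intro!: floor_mono)

lemma sparse_map_mono: "0 \<le> \<omega> \<Longrightarrow> \<omega> \<le> \<omega>' \<Longrightarrow> \<omega>' < 1 \<Longrightarrow> sparse_map \<omega> \<le> sparse_map \<omega>'"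
  unfolding sparse_map_def by (intro suminf_le summable_sparse sparse_term_mono) auto

text \<open>Between the two points the floor at level \<open>k\<close> increases at least once, and no other level
  decreases.\<close>

lemma sparse_map_separates:
  assumes "0 \<le> \<omega>" "\<omega> + (1 / 2) ^ k \<le> \<omega>'" "\<omega>' < 1"
  shows "sparse_map \<omega> + (1 / 2) ^ (k * (k + 1)) \<le> sparse_map \<omega>'"
proof -
  have pos: "0 < (1 / 2 :: real) ^ k" by simp
  then have le: "\<omega> \<le> \<omega>'" using assms(2) by linarith
  have s: "summable (\<lambda>k. sparse_term k \<omega>)" "summable (\<lambda>k. sparse_term k \<omega>')"
    using assms le by (auto intro!: summable_sparse)
  have "2 ^ k * (\<omega> + (1 / 2) ^ k) \<le> 2 ^ k * \<omega>'" using assms(2) by (intro mult_left_mono) simp_all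
  then have "2 ^ k * \<omega> + 1 \<le> 2 ^ k * \<omega>'" by (simp add: distrib_left flip: power_mult_distrib)
  then have "\<lfloor>2 ^ k * \<omega>\<rfloor> + 1 \<le> \<lfloor>2 ^ k * \<omega>'\<rfloor>" using floor_mono[of "2 ^ k * \<omega> + 1" "2 ^ k * \<omega>'"] by simp
  then have "of_int (\<lfloor>2 ^ k * \<omega>\<rfloor> + 1) \<le> (of_int \<lfloor>2 ^ k * \<omega>'\<rfloor> :: real)" unfolding of_int_le_iff .
  then have "(1 / 2) ^ (k * (k + 1)) * (of_int \<lfloor>2 ^ k * \<omega>\<rfloor> + 1) \<le> sparse_term k \<omega>'"
    unfolding sparse_term_def by (intro mult_left_mono) simp_all
  then have "(1 / 2) ^ (k * (k + 1)) \<le> sparse_term k \<omega>' - sparse_term k \<omega>"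
    unfolding sparse_term_def by (simp add: distrib_left)
  also have "\<dots> = (\<Sum>j\<in>{k}. sparse_term j \<omega>' - sparse_term j \<omega>)" by simp
  also have "\<dots> \<le> (\<Sum>j. sparse_term j \<omega>' - sparse_term j \<omega>)"
    using sparse_term_mono[OF le] by (intro sum_le_suminf summable_diff s) auto
  also have "\<dots> = sparse_map \<omega>' - sparse_map \<omega>" unfolding sparse_map_def by (rule suminf_diff[OF s(2,1), symmetric])
  finally show ?thesis by linarith
qed

lemma sparse_map_measurable [measurable]: "sparse_map \<in> borel_measurable borel"
  unfolding sparse_map_def sparse_term_def by measurable

lemma emeasure_sparse_preimage:
  assumes s: "s < (1 / 2) ^ (k * (k + 1))"
  shows "emeasure lborel {\<omega> \<in> {0..<1}. t - s \<le> sparse_map \<omega> \<and> sparse_map \<omega> \<le> t} \<le> ennreal (2 * (1 / 2) ^ k)"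
proof (cases "{\<omega> \<in> {0..<1}. t - s \<le> sparse_map \<omega> \<and> sparse_map \<omega> \<le> t} = {}")
  case False
  let ?A = "{\<omega> \<in> {0..<1}. t - s \<le> sparse_map \<omega> \<and> sparse_map \<omega> \<le> t}"
  let ?r = "(1 / 2 :: real) ^ k"
  obtain \<omega>0 where \<omega>0: "\<omega>0 \<in> ?A" using False by blast
  have "?A \<subseteq> {\<omega>0 - ?r..\<omega>0 + ?r}"
  proof
    fix \<omega> assume \<omega>: "\<omega> \<in> ?A"
    have "\<not> \<omega>0 + ?r \<le> \<omega>"
    proof
      assume "\<omega>0 + ?r \<le> \<omega>"
      then have "sparse_map \<omega>0 + (1 / 2) ^ (k * (k + 1)) \<le> sparse_map \<omega>"
        using \<omega> \<omega>0 by (intro sparse_map_separates) auto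
      then show False using \<omega> \<omega>0 s by auto
    qed
    moreover have "\<not> \<omega> + ?r \<le> \<omega>0"
    proof
      assume "\<omega> + ?r \<le> \<omega>0"
      then have "sparse_map \<omega> + (1 / 2) ^ (k * (k + 1)) \<le> sparse_map \<omega>0"
        using \<omega> \<omega>0 by (intro sparse_map_separates) auto
      then show False using \<omega> \<omega>0 s by auto
    qed
    ultimately show "\<omega> \<in> {\<omega>0 - ?r..\<omega>0 + ?r}" by auto
  qed
  then have "emeasure lborel ?A \<le> emeasure lborel {\<omega>0 - ?r..\<omega>0 + ?r}" by (intro emeasure_mono) simp_all
  also have "\<dots> = ennreal (2 * ?r)" by simp
  finally show ?thesis .
next
  case True
  show ?thesis unfolding True by simp
qed

text \<open>Bernoulli's inequality for the eighth root of two bounds \<open>k + 2\<close> by a multiple of \<open>2\<^sup>k\<^sup>/\<^sup>8\<close>.\<close>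

lemma power_times_halving_bounded:
  obtains C :: real where "1 \<le> C" "\<And>k. 2 * (1 / 2) ^ k * (real k + 2) ^ 8 \<le> C"
proof -
  define q where "q = root 8 2"
  define a where "a = 2 + 1 / (q - 1)"
  have q8: "q ^ 8 = 2" unfolding q_def by (rule real_root_pow_pos2) simp_all
  have q1: "1 < q" unfolding q_def by simp
  have a2: "2 \<le> a" using q1 by (simp add: a_def)
  have "2 * (1 / 2) ^ k * (real k + 2) ^ 8 \<le> 2 * a ^ 8" for k
  proof -
    have "1 + real k * (q - 1) \<le> (1 + (q - 1)) ^ k" by (rule Bernoulli_inequality) (use q1 in simp)
    then have "real k * (q - 1) \<le> q ^ k" by simp
    then have "real k \<le> q ^ k * (1 / (q - 1))" using q1 by (simp add: field_simps)
    moreover have "2 \<le> q ^ k * 2" using one_le_power[of q k] q1 by simp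
    ultimately have "real k + 2 \<le> q ^ k * a" unfolding a_def by (simp add: distrib_left)
    then have "(real k + 2) ^ 8 \<le> (q ^ k * a) ^ 8" by (intro power_mono) simp_all
    also have "\<dots> = (q ^ 8) ^ k * a ^ 8" by (simp add: power_mult_distrib mult.commute flip: power_mult)
    finally have "(real k + 2) ^ 8 \<le> 2 ^ k * a ^ 8" unfolding q8 .
    then have "2 * (1 / 2) ^ k * (real k + 2) ^ 8 \<le> 2 * (1 / 2) ^ k * (2 ^ k * a ^ 8)" by (intro mult_left_mono) simp_all
    also have "\<dots> = 2 * ((1 / 2) ^ k * 2 ^ k) * a ^ 8" by (simp only: mult.assoc)
    also have "\<dots> = 2 * a ^ 8" by (simp flip: power_mult_distrib)
    finally show ?thesis .
  qed
  moreover have "1 \<le> 2 * a ^ 8" using one_le_power[of a 8] a2 by linarith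
  ultimately show ?thesis using that by blast
qed

lemma between_pronic:
  assumes "0 < n"
  obtains k :: nat where "k * (k + 1) < n" "n \<le> (k + 1) * (k + 2)"
proof -
  have "\<exists>k. k * (k + 1) < n \<and> n \<le> (k + 1) * (k + 2)" using assms
  proof (induction n rule: nat_induct_non_zero)
    case 1
    show ?case by (intro exI[of _ 0]) simp
  next
    case (Suc n)
    then obtain k where k: "k * (k + 1) < n" "n \<le> (k + 1) * (k + 2)" by blast
    show ?case
    proof (cases "Suc n \<le> (k + 1) * (k + 2)")
      case True
      then show ?thesis using k by (intro exI[of _ k]) simp
    next
      case False
      have "(k + 1) * (k + 2) + 1 \<le> (k + 2) * (k + 3)" by (simp add: algebra_simps)
      then show ?thesis using k False by (intro exI[of _ "k + 1"]) (simp add: algebra_simps)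
    qed
  qed
  then show ?thesis using that by blast
qed

text \<open>An interval of length \<open>2\<^sup>-\<^sup>n\<close> with \<open>k (k + 1) < n \<le> (k + 1) (k + 2)\<close> has mass at most \<open>2 * 2\<^sup>-\<^sup>k\<close>, and
  \<open>n + 1 \<le> (k + 2)\<^sup>2\<close>. The fourth power leaves a summable series after multiplication by \<open>(n + 1)\<^sup>2\<close>.\<close>

lemma sparse_preimage_growth:
  obtains C :: real where "1 \<le> C"
    "\<And>n t. emeasure lborel {\<omega> \<in> {0..<1}. t - (1 / 2) ^ n \<le> sparse_map \<omega> \<and> sparse_map \<omega> \<le> t} \<le> ennreal (C / (real (Suc n)) ^ 4)"
proof -
  obtain C :: real where C: "1 \<le> C" "\<And>k. 2 * (1 / 2) ^ k * (real k + 2) ^ 8 \<le> C"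
    using power_times_halving_bounded by blast
  have "emeasure lborel {\<omega> \<in> {0..<1}. t - (1 / 2) ^ n \<le> sparse_map \<omega> \<and> sparse_map \<omega> \<le> t} \<le> ennreal (C / (real (Suc n)) ^ 4)"
    (is "emeasure lborel ?A \<le> _") for n t
  proof (cases "n = 0")
    case True
    have "emeasure lborel ?A \<le> emeasure lborel {0..<1::real}" by (intro emeasure_mono) auto
    also have "\<dots> \<le> ennreal (C / (real (Suc n)) ^ 4)" using True C(1) by simp
    finally show ?thesis .
  next
    case False
    then obtain k where k: "k * (k + 1) < n" "n \<le> (k + 1) * (k + 2)" using between_pronic[of n] by blast
    have "(1 / 2 :: real) ^ n < (1 / 2) ^ (k * (k + 1))" using k(1) by (intro power_strict_decreasing) simp_all
    then have "emeasure lborel ?A \<le> ennreal (2 * (1 / 2) ^ k)" by (rule emeasure_sparse_preimage)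
    also have "2 * (1 / 2) ^ k \<le> C / (real k + 2) ^ 8"
      using C(2)[of k] by (simp add: pos_le_divide_eq)
    also have "\<dots> \<le> C / (real (Suc n)) ^ 4"
    proof (rule divide_left_mono)
      have "Suc n \<le> (k + 1) * (k + 2) + 1" using k(2) by simp
      also have "\<dots> \<le> (k + 2) ^ 2" by (simp add: power2_eq_square algebra_simps)
      finally have "real (Suc n) \<le> real ((k + 2) ^ 2)" unfolding of_nat_le_iff .
      then have "real (Suc n) ^ 4 \<le> ((real k + 2)\<^sup>2) ^ 4" by (intro power_mono) (simp_all add: add.commute)
      then show "real (Suc n) ^ 4 \<le> (real k + 2) ^ 8" by (simp flip: power_mult)
    qed (use C(1) in simp_all)
    finally show ?thesis by (simp add: ennreal_leI)
  qed
  then show ?thesis using that C(1) by blast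
qed

text \<open>A compact set that contains the image of the monotone map: at every level \<open>k\<close> the image of a dyadic
  interval lies within \<open>2\<^sup>-\<^sup>k\<^sup>*\<^sup>k\<close> above the value at its left end.\<close>

definition sparse_set :: "real set" where
  "sparse_set = (\<Inter>k. \<Union>q<2 ^ k. {sparse_map (real q / 2 ^ k)..sparse_map (real q / 2 ^ k) + (1 / 2) ^ (k * k)})"

lemma floor_dyadic:
  fixes \<omega> :: real
  assumes "j \<le> k"
  shows "\<lfloor>2 ^ j * (of_int \<lfloor>2 ^ k * \<omega>\<rfloor> / 2 ^ k :: real)\<rfloor> = \<lfloor>2 ^ j * \<omega>\<rfloor>"
proof -
  let ?b = "2 ^ (k - j) :: int"
  have k: "(2 :: real) ^ k = 2 ^ j * of_int ?b" using assms by (simp flip: power_add)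
  have "2 ^ j * (x / 2 ^ k) = x / of_int ?b" for x :: real unfolding k by simp
  moreover have "2 ^ j * \<omega> = (2 ^ k * \<omega>) / of_int ?b" unfolding k by simp
  ultimately have "\<lfloor>2 ^ j * (of_int \<lfloor>2 ^ k * \<omega>\<rfloor> / 2 ^ k :: real)\<rfloor> = \<lfloor>of_int \<lfloor>2 ^ k * \<omega>\<rfloor> / (of_int ?b :: real)\<rfloor>"
    "\<lfloor>2 ^ j * \<omega>\<rfloor> = \<lfloor>(2 ^ k * \<omega>) / of_int ?b\<rfloor>" by (simp_all only:)
  moreover have "\<lfloor>of_int \<lfloor>2 ^ k * \<omega>\<rfloor> / (of_int ?b :: real)\<rfloor> = \<lfloor>2 ^ k * \<omega>\<rfloor> div ?b" by (rule floor_divide_of_int_eq)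
  moreover have "\<lfloor>(2 ^ k * \<omega>) / of_int ?b\<rfloor> = \<lfloor>2 ^ k * \<omega>\<rfloor> div ?b" by (rule floor_divide_real_eq_div) simp
  ultimately show ?thesis by simp
qed

text \<open>The levels up to \<open>k\<close> do not see the difference between a point and the left end of its dyadic
  interval of length \<open>2\<^sup>-\<^sup>k\<close>, and the later levels add up to at most \<open>2\<^sup>-\<^sup>k\<^sup>*\<^sup>k\<close>.\<close>

lemma sparse_map_in_sparse_set:
  assumes \<omega>: "0 \<le> \<omega>" "\<omega> < 1"
  shows "sparse_map \<omega> \<in> sparse_set"
  unfolding sparse_set_def
proof (intro INT_I UN_I)
  fix k :: nat
  define q where "q = nat \<lfloor>2 ^ k * \<omega>\<rfloor>"
  define \<omega>' where "\<omega>' = real q / 2 ^ k"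
  have q: "real q = of_int \<lfloor>2 ^ k * \<omega>\<rfloor>" using \<omega> by (simp add: q_def)
  have ql: "real q \<le> 2 ^ k * \<omega>" unfolding q by (rule of_int_floor_le)
  also have "\<dots> < 2 ^ k" using \<omega> by simp
  finally have "real q < real (2 ^ k)" by simp
  then show "q \<in> {..<2 ^ k}" unfolding of_nat_less_iff by simp
  have \<omega>'01: "0 \<le> \<omega>'" "\<omega>' \<le> \<omega>" using ql by (simp_all add: \<omega>'_def pos_divide_le_eq mult.commute)
  then have \<omega>': "0 \<le> \<omega>'" "\<omega>' \<le> \<omega>" "\<omega>' < 1" using \<omega> by linarith+
  have eq: "sparse_term j \<omega>' = sparse_term j \<omega>" if "j < Suc k" for j
    using floor_dyadic[of j k \<omega>] that unfolding sparse_term_def \<omega>'_def q by simp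
  have s: "summable (\<lambda>k. sparse_term k \<omega>)" "summable (\<lambda>k. sparse_term k \<omega>')"
    using \<omega> \<omega>' by (auto intro!: summable_sparse)
  have tail: "sparse_term (i + Suc k) \<omega> - sparse_term (i + Suc k) \<omega>' \<le> (1 / 2) ^ (k * k) * ((1 / 2) * (1 / 2) ^ i)" for i
  proof -
    have "sparse_term (i + Suc k) \<omega> - sparse_term (i + Suc k) \<omega>' \<le> (1 / 2) ^ ((i + Suc k) * (i + Suc k))"
      using sparse_term_bounds(2)[OF \<omega>, of "i + Suc k"] sparse_term_bounds(1)[OF \<omega>'(1,3), of "i + Suc k"] by linarith
    also have "\<dots> \<le> (1 / 2) ^ (k * k + Suc i)"
      by (intro power_decreasing) (simp_all add: algebra_simps)
    finally show ?thesis by (simp add: power_add)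
  qed
  have sg: "summable (\<lambda>i. (1 / 2 :: real) ^ (k * k) * ((1 / 2) * (1 / 2) ^ i))"
    by (intro summable_mult) simp
  have sd: "summable (\<lambda>j. sparse_term j \<omega> - sparse_term j \<omega>')" by (intro summable_diff s)
  have "sparse_map \<omega> - sparse_map \<omega>' = (\<Sum>j. sparse_term j \<omega> - sparse_term j \<omega>')"
    unfolding sparse_map_def by (rule suminf_diff[OF s])
  also have "\<dots> = (\<Sum>i. sparse_term (i + Suc k) \<omega> - sparse_term (i + Suc k) \<omega>')"
    unfolding suminf_split_initial_segment[OF sd, of "Suc k"] using eq by simp
  also have "\<dots> \<le> (\<Sum>i. (1 / 2) ^ (k * k) * ((1 / 2) * (1 / 2) ^ i))"
    by (intro suminf_le tail sg) (rule summable_ignore_initial_segment[OF sd])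
  also have "\<dots> = (1 / 2) ^ (k * k)"
    using sums_unique[OF sums_mult[OF power_half_series, of "(1 / 2) ^ (k * k)"]] by simp
  finally have "sparse_map \<omega> \<le> sparse_map \<omega>' + (1 / 2) ^ (k * k)" by linarith
  moreover have "sparse_map \<omega>' \<le> sparse_map \<omega>" using \<omega> \<omega>' by (intro sparse_map_mono)
  ultimately show "sparse_map \<omega> \<in> {sparse_map (real q / 2 ^ k)..sparse_map (real q / 2 ^ k) + (1 / 2) ^ (k * k)}"
    unfolding \<omega>'_def by simp
qed

lemma compact_sparse_set: "compact sparse_set" and sparse_set_bounds: "t \<in> sparse_set \<Longrightarrow> 0 \<le> t \<and> t \<le> 3"
proof -
  have b: "0 \<le> t \<and> t \<le> 3" if "t \<in> sparse_set" for t
  proof -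
    have "t \<in> (\<Union>q<2 ^ 0. {sparse_map (real q / 2 ^ 0)..sparse_map (real q / 2 ^ 0) + (1 / 2) ^ (0 * 0)})"
      using that unfolding sparse_set_def by (rule INT_D) simp
    then have "sparse_map 0 \<le> t" "t \<le> sparse_map 0 + 1" by (auto simp: lessThan_Suc)
    then show ?thesis using sparse_map_bounds[of 0] by auto
  qed
  then show "t \<in> sparse_set \<Longrightarrow> 0 \<le> t \<and> t \<le> 3" .
  have "sparse_set \<subseteq> {0..3}" using b by auto
  then have "bounded sparse_set" by (rule bounded_subset[OF bounded_closed_interval])
  moreover have "closed sparse_set"
    unfolding sparse_set_def by (intro closed_INT ballI closed_UN closed_atLeastAtMost) auto
  ultimately show "compact sparse_set" by (simp add: compact_eq_bounded_closed)
qed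

text \<open>At level \<open>k\<close> there are \<open>2\<^sup>k\<close> pieces, and the \<open>s\<close>-th power of their size is at most \<open>a\<^sup>s 2\<^sup>-\<^sup>k\<^sup>*\<^sup>k\<^sup>*\<^sup>s\<close>,
  which is below \<open>a\<^sup>s 4\<^sup>-\<^sup>k\<close> as soon as \<open>k s \<ge> 2\<close>.\<close>

lemma hausdorff_dim_zero:
  fixes E :: "nat \<Rightarrow> nat \<Rightarrow> 'a set"
  assumes a: "0 \<le> a" and cover: "\<And>k. S \<subseteq> (\<Union>q<2 ^ k. E k q)"
    and small: "\<And>k q. q < 2 ^ k \<Longrightarrow> diam d (E k q) \<le> ennreal (a * (1 / 2) ^ (k * k))"
  shows "hausdorff_dim d S = 0"
proof -
  have pre: "hausdorff_premeasure d s \<delta> S = 0" if s: "0 < s" and \<delta>: "0 < \<delta>" for s \<delta> :: real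
  proof -
    have lim: "(\<lambda>k. c * (1 / 2 :: real) ^ k) \<longlonglongrightarrow> 0" for c :: real
      by (intro tendsto_mult_right_zero LIMSEQ_realpow_zero) simp_all
    have ev1: "\<forall>\<^sub>F k in sequentially. a * (1 / 2) ^ k < \<delta>" using lim[of a] \<delta> by (rule order_tendstoD(2))
    have ev: "\<forall>\<^sub>F k in sequentially. hausdorff_premeasure d s \<delta> S \<le> ennreal (a powr s * (1 / 2) ^ k)"
      using ev1 eventually_ge_at_top[of "nat \<lceil>2 / s\<rceil>"]
    proof eventually_elim
      case (elim k)
      \<comment> \<open>The cover of level \<open>k\<close>, filled up with empty sets, whose diameter is \<open>0\<close>.\<close>
      define G where "G n = (if n < 2 ^ k then E k n else {})" for n :: nat
      let ?\<epsilon> = "a * (1 / 2) ^ (k * k)"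
      have dG: "diam d (G n) \<le> ennreal ?\<epsilon>" for n
        using small[of n k] a by (simp add: G_def diam_def bot_ennreal)
      have "k \<le> k * k" by (cases k) auto
      then have "?\<epsilon> \<le> a * (1 / 2) ^ k" using a by (intro mult_left_mono power_decreasing) simp_all
      then have "?\<epsilon> \<le> \<delta>" using elim(1) by linarith
      then have "G \<in> {E. S \<subseteq> (\<Union>n. E n) \<and> (\<forall>n. diam d (E n) \<le> ennreal \<delta>)}"
      proof (intro CollectI conjI allI)
        have "(\<Union>q<2 ^ k. E k q) = (\<Union>q<2 ^ k. G q)" by (rule SUP_cong) (simp_all add: G_def)
        then have "S \<subseteq> (\<Union>q<2 ^ k. G q)" using cover[of k] by (simp only:)
        also have "\<dots> \<subseteq> (\<Union>n. G n)" by (rule UN_mono) simp_all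
        finally show "S \<subseteq> (\<Union>n. G n)" .
        show "diam d (G n) \<le> ennreal \<delta>" for n
          by (rule order_trans[OF dG ennreal_leI]) fact
      qed
      then have "hausdorff_premeasure d s \<delta> S \<le> (\<Sum>n. ennreal (enn2real (diam d (G n)) powr s))"
        unfolding hausdorff_premeasure_def by (rule INF_lower)
      also have "\<dots> = (\<Sum>n<2 ^ k. ennreal (enn2real (diam d (G n)) powr s))"
        by (rule suminf_finite) (auto simp: G_def diam_def bot_ennreal)
      also have "\<dots> \<le> (\<Sum>n<(2 ^ k :: nat). ennreal (?\<epsilon> powr s))"
      proof (intro sum_mono ennreal_leI powr_mono2)
        fix n
        show "enn2real (diam d (G n)) \<le> ?\<epsilon>"
          using enn2real_mono[OF dG[of n]] a by (simp add: zero_le_mult_iff)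
      qed (use s in simp_all)
      also have "\<dots> = ennreal (2 ^ k * ?\<epsilon> powr s)" by (simp add: ennreal_mult' flip: ennreal_power ennreal_numeral)
      also have "2 ^ k * ?\<epsilon> powr s \<le> a powr s * (1 / 2) ^ k"
      proof -
        have "2 / s \<le> real k" using elim(2) by linarith
        then have "2 * real k \<le> s * real k * real k" using s by (intro mult_right_mono) (simp_all add: field_simps)
        then have le: "real k * 2 \<le> real (k * k) * s" by (simp add: mult_ac)
        have "((1 / 2 :: real) ^ (k * k)) powr s = (1 / 2) powr (real (k * k) * s)"
          by (simp add: powr_powr flip: powr_realpow)
        also have "\<dots> \<le> (1 / 2) powr (real k * 2)" using le by (intro powr_mono') simp_all
        also have "\<dots> = (1 / 2) ^ (k * 2)" using powr_realpow[of "1 / 2 :: real" "k * 2"] by simp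
        also have "\<dots> = (1 / 2) ^ k * (1 / 2) ^ k" by (simp add: mult_2_right power_add)
        finally have "2 ^ k * ?\<epsilon> powr s \<le> 2 ^ k * (a powr s * ((1 / 2) ^ k * (1 / 2) ^ k))"
          using a unfolding powr_mult by (intro mult_left_mono) simp_all
        also have "\<dots> = a powr s * (1 / 2) ^ k * (2 ^ k * (1 / 2) ^ k)" by (simp only: mult_ac)
        also have "\<dots> = a powr s * (1 / 2) ^ k" by (simp flip: power_mult_distrib)
        finally show ?thesis .
      qed
      finally show ?case by (simp add: ennreal_leI)
    qed
    have "(\<lambda>k. ennreal (a powr s * (1 / 2) ^ k)) \<longlonglongrightarrow> ennreal 0" by (intro tendsto_ennrealI lim)
    then have "hausdorff_premeasure d s \<delta> S \<le> ennreal 0"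
      by (rule tendsto_lowerbound) (use ev in simp_all)
    then show ?thesis by simp
  qed
  have H: "hausdorff_measure d s S = 0" if "0 < s" for s
    unfolding hausdorff_measure_def using pre[OF that] by (auto intro!: antisym SUP_least)
  show ?thesis unfolding hausdorff_dim_def
  proof (rule antisym)
    show "(INF s\<in>{s. 0 < s \<and> hausdorff_measure d s S = 0}. ereal s) \<le> 0"
    proof (rule ereal_le_epsilon2)
      fix e :: real assume "0 < e"
      then show "(INF s\<in>{s. 0 < s \<and> hausdorff_measure d s S = 0}. ereal s) \<le> 0 + ereal e"
        using H by (intro INF_lower2[of e]) auto
    qed
  qed (auto intro!: INF_greatest)
qed

context closed_riemannian
begin

text \<open>Place the sparse measure on a coordinate segment inside a good ball. Squares of side \<open>L / 2\<^sup>n\<close> meet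
  the segment in an interval of relative length at most \<open>2\<^sup>-\<^sup>n\<close>.\<close>

lemma exists_zero_dimensional_trace:
  assumes m: "CARD('m) = 2"
  shows "\<exists>\<mu> N. smooth_trace \<mu> N \<and> emeasure \<mu> UNIV \<noteq> 0 \<and>
    (\<exists>S\<in>sets borel. carries S \<mu> \<and> hausdorff_dim (riem_dist A g) S = 0)"
proof -
  obtain K c y R where gd: "good K c y R"
    using good_exists[OF chart_at] by blast
  have c: "c \<in> A" and R: "0 < R" and K: "1 \<le> K" and sub: "cball y (3 * R) \<subseteq> im c"
    using gd by (auto simp: good_def)
  obtain i1 :: 'm where "i1 \<in> UNIV" by blast
  define e where "e = axis i1 (1 :: real)"
  have e1: "norm e = 1" "e $ i1 = 1" by (simp_all add: e_def)
  define L where "L = R / 2"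
  have L: "0 < L" "2 * L = R" using R by (auto simp: L_def)
  define l where "l t = y + (L * t) *\<^sub>R e" for t
  have lin: "l t \<in> cball y (3 * R)" if "0 \<le> t" "t \<le> 3" for t
  proof -
    have "L * t \<le> L * 3" using that L by (intro mult_left_mono) auto
    moreover have "0 \<le> L * t" using that L by simp
    ultimately have "\<bar>L * t\<bar> \<le> 3 * R" using L by linarith
    then show ?thesis using e1 unfolding l_def by (simp add: dist_norm)
  qed
  have lcont: "continuous_on UNIV l" unfolding l_def by (intro continuous_intros)
  have lm: "l \<in> borel_measurable borel" using lcont by (rule borel_measurable_continuous_onI)
  define P where "P = density lborel (indicator {0..<1::real})"
  have Psets: "sets P = sets borel" and Pspace: "space P = UNIV" by (simp_all add: P_def)
  have PE: "emeasure P D = emeasure lborel ({0..<1} \<inter> D)" if "D \<in> sets borel" for D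
    using that unfolding P_def by (subst emeasure_density) (simp_all add: nn_integral_indicator flip: indicator_inter_arith)
  have PAE: "AE \<omega> in P. 0 \<le> \<omega> \<and> \<omega> < 1"
    unfolding P_def by (subst AE_density) (auto simp: indicator_def)
  have pm: "(\<lambda>\<omega>. l (sparse_map \<omega>)) \<in> measurable P borel"
    using measurable_compose[OF sparse_map_measurable lm] Psets measurable_cong_sets by blast
  define \<nu> where "\<nu> = distr P borel (\<lambda>\<omega>. l (sparse_map \<omega>))"
  have \<nu>s: "sets \<nu> = sets borel" by (simp add: \<nu>_def)
  have P1: "emeasure P UNIV = 1" using PE[of UNIV] by simp
  have finP: "finite_measure P" by (rule finite_measureI) (simp add: Pspace P1)
  have fin\<nu>: "finite_measure \<nu>" unfolding \<nu>_def by (rule finite_measure.finite_measure_distr[OF finP pm])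
  have qm: "param_ext c \<in> measurable \<nu> borel"
    using param_ext_measurable[OF c] \<nu>s measurable_cong_sets by blast
  define \<mu> where "\<mu> = distr \<nu> borel (param_ext c)"
  have \<mu>s: "sets \<mu> = sets borel" "space \<mu> = UNIV" by (simp_all add: \<mu>_def)
  have fin\<mu>: "finite_measure \<mu>" unfolding \<mu>_def by (rule finite_measure.finite_measure_distr[OF fin\<nu> qm])
  have \<mu>E: "emeasure \<mu> D = emeasure P {\<omega>. param_ext c (l (sparse_map \<omega>)) \<in> D}" if "D \<in> sets borel" for D
  proof -
    have "emeasure \<mu> D = emeasure \<nu> (param_ext c -` D \<inter> space \<nu>)" unfolding \<mu>_def by (rule emeasure_distr[OF qm that])
    also have "\<dots> = emeasure P ((\<lambda>\<omega>. l (sparse_map \<omega>)) -` (param_ext c -` D \<inter> space \<nu>) \<inter> space P)"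
      unfolding \<nu>_def using measurable_sets[OF qm that] \<nu>s by (intro emeasure_distr[OF pm]) (simp add: \<nu>_def)
    also have "\<dots> = emeasure P {\<omega>. param_ext c (l (sparse_map \<omega>)) \<in> D}"
      unfolding Pspace by (rule arg_cong[where f = "emeasure P"]) (auto simp: \<nu>_def)
    finally show ?thesis .
  qed
  obtain Cb where Cb: "1 \<le> Cb" "\<And>n t. emeasure lborel {\<omega> \<in> {0..<1}. t - (1 / 2) ^ n \<le> sparse_map \<omega> \<and> sparse_map \<omega> \<le> t} \<le> ennreal (Cb / (real (Suc n)) ^ 4)"
    using sparse_preimage_growth by blast
  \<comment> \<open>The exponent \<open>4\<close> is what makes the series of \<open>planar_trace\<close> converge.\<close>
  define b where "b n = Cb / (real (Suc n)) ^ 4" for n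
  have b: "\<And>n. 0 \<le> b n" using Cb(1) by (simp add: b_def)
  have bs: "summable (\<lambda>n. (real (Suc n))\<^sup>2 * b n)"
  proof -
    have "(real (Suc n))\<^sup>2 * b n = Cb * (1 / (real (Suc n))\<^sup>2)" for n
      unfolding b_def by (simp add: divide_simps del: of_nat_Suc flip: power_add)
    moreover have "summable (\<lambda>n. Cb * (1 / (real (Suc n))\<^sup>2))"
    proof (intro summable_mult)
      have "summable (\<lambda>n. inverse ((real n)\<^sup>2))" by (rule inverse_power_summable) simp
      then show "summable (\<lambda>n. 1 / (real (Suc n))\<^sup>2)"
        using summable_Suc_iff[of "\<lambda>n. inverse ((real n)\<^sup>2)"] by (simp add: inverse_eq_divide)
    qed
    ultimately show ?thesis by simp
  qed
  have cube: "AE p in \<nu>. cbox p (p + L *\<^sub>R 1) \<subseteq> cball y (3 * R)"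
  proof -
    have one: "cbox p (p + L *\<^sub>R 1) \<subseteq> cball y (3 * R)" if p: "norm (p - y) \<le> R" for p
    proof
      fix x assume x: "x \<in> cbox p (p + L *\<^sub>R 1)"
      have "norm (x - p) \<le> (\<Sum>i\<in>UNIV. \<bar>(x - p) $ i\<bar>)" by (rule norm_le_l1_cart)
      also have "\<dots> \<le> (\<Sum>i\<in>(UNIV :: 'm set). L)"
        using x unfolding in_cube_iff by (intro sum_mono) (auto simp: abs_le_iff algebra_simps)
      also have "\<dots> = R" using m L by simp
      finally have "norm (x - p) \<le> R" .
      then have "norm (x - y) \<le> 3 * R" using p R norm_triangle_ineq[of "x - p" "p - y"] by simp
      then show "x \<in> cball y (3 * R)" by (simp add: dist_norm norm_minus_commute)
    qed
    have "AE \<omega> in P. norm (l (sparse_map \<omega>) - y) \<le> R"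
      using PAE
    proof eventually_elim
      case (elim \<omega>)
      then have "0 \<le> sparse_map \<omega>" "sparse_map \<omega> \<le> 2" by (auto intro: sparse_map_bounds)
      then have "L * sparse_map \<omega> \<le> L * 2" "0 \<le> L * sparse_map \<omega>" using L by (simp_all add: mult_left_mono)
      then have "\<bar>L * sparse_map \<omega>\<bar> \<le> R" using L by linarith
      then show ?case using e1 by (simp add: l_def)
    qed
    moreover have "{p. norm (p - y) \<le> R} \<in> sets borel"
      by (intro borel_closed closed_Collect_le continuous_intros)
    ultimately have "AE p in \<nu>. norm (p - y) \<le> R"
      unfolding \<nu>_def by (subst AE_distr_iff[OF pm]) simp_all
    then show ?thesis by (rule eventually_mono) (rule one)
  qed
  have growth: "emeasure \<nu> {p. x \<in> cbox p (p + (L / 2 ^ n) *\<^sub>R 1)} \<le> ennreal (b n)" for n x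
  proof -
    let ?D = "{p. x \<in> cbox p (p + (L / 2 ^ n) *\<^sub>R 1)}"
    let ?t = "(x - y) $ i1 / L"
    let ?W = "{\<omega>. ?t - (1 / 2) ^ n \<le> sparse_map \<omega> \<and> sparse_map \<omega> \<le> ?t}"
    have "closed ?D"
      unfolding in_cube_iff by (intro closed_Collect_all closed_Collect_conj closed_Collect_le continuous_intros continuous_on_component)
    then have D: "?D \<in> sets borel" by (rule borel_closed)
    have W: "?W \<in> sets borel" by measurable
    have "emeasure \<nu> ?D = emeasure P ((\<lambda>\<omega>. l (sparse_map \<omega>)) -` ?D \<inter> space P)"
      unfolding \<nu>_def by (rule emeasure_distr[OF pm D])
    also have "\<dots> \<le> emeasure P ?W"
    proof (rule emeasure_mono)
      show "(\<lambda>\<omega>. l (sparse_map \<omega>)) -` ?D \<inter> space P \<subseteq> ?W"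
      proof
        fix \<omega> assume "\<omega> \<in> (\<lambda>\<omega>. l (sparse_map \<omega>)) -` ?D \<inter> space P"
        then have "x \<in> cbox (l (sparse_map \<omega>)) (l (sparse_map \<omega>) + (L / 2 ^ n) *\<^sub>R 1)" by simp
        then have "l (sparse_map \<omega>) $ i1 \<le> x $ i1" "x $ i1 \<le> l (sparse_map \<omega>) $ i1 + L / 2 ^ n"
          unfolding in_cube_iff by blast+
        then have 1: "L * sparse_map \<omega> \<le> (x - y) $ i1" "(x - y) $ i1 \<le> L * sparse_map \<omega> + L / 2 ^ n"
          using e1 by (simp_all add: l_def)
        have "sparse_map \<omega> \<le> ?t" using 1(1) L by (simp add: pos_le_divide_eq mult.commute)
        moreover have "?t \<le> sparse_map \<omega> + (1 / 2) ^ n"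
        proof -
          have "?t \<le> (L * sparse_map \<omega> + L / 2 ^ n) / L" using 1(2) L by (intro divide_right_mono) simp_all
          also have "\<dots> = sparse_map \<omega> + 1 / 2 ^ n" using L by (simp add: add_divide_distrib)
          finally show ?thesis by (simp add: power_one_over)
        qed
        ultimately show "\<omega> \<in> ?W" by simp
      qed
    qed (use W Psets in simp)
    also have "\<dots> = emeasure lborel {\<omega> \<in> {0..<1}. ?t - (1 / 2) ^ n \<le> sparse_map \<omega> \<and> sparse_map \<omega> \<le> ?t}"
      unfolding PE[OF W] by (rule arg_cong[where f = "emeasure lborel"]) auto
    also have "\<dots> \<le> ennreal (b n)" unfolding b_def by (rule Cb(2))
    finally show ?thesis .
  qed
  define C where "C = 2 / L\<^sup>2 * b 0 + 8 * (\<Sum>n. (real (Suc n))\<^sup>2 * b n)"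
  have C0: "0 \<le> C" unfolding C_def using b L by (intro add_nonneg_nonneg mult_nonneg_nonneg suminf_nonneg bs) auto
  have "smooth_trace \<mu> (C * K\<^sup>2)"
    unfolding smooth_trace_def finite_borel_measure_def
  proof (intro conjI allI impI \<mu>s(1) fin\<mu>)
    show "0 \<le> C * K\<^sup>2" using C0 by simp
  next
    fix f assume f: "smooth_fun A f"
    let ?F = "f \<circ> param c"
    have fm: "(\<lambda>p. ennreal ((f p)\<^sup>2)) \<in> borel_measurable borel"
      using continuous_imp_borel[OF continuous_smooth_fun[OF f]] by measurable
    have "(\<integral>\<^sup>+ p. ennreal ((f p)\<^sup>2) \<partial>\<mu>) = (\<integral>\<^sup>+ p. ennreal ((f (param_ext c p))\<^sup>2) \<partial>\<nu>)"
      unfolding \<mu>_def by (rule nn_integral_distr[OF qm]) (use fm in simp)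
    also have "\<dots> = (\<integral>\<^sup>+ p. ennreal ((?F p)\<^sup>2) \<partial>\<nu>)"
    proof (rule nn_integral_cong_AE, use cube in eventually_elim)
      fix p assume "cbox p (p + L *\<^sub>R 1) \<subseteq> cball y (3 * R)"
      moreover have "p \<in> cbox p (p + L *\<^sub>R 1)" unfolding in_cube_iff using L by simp
      ultimately have "p \<in> im c" using sub by blast
      then show "ennreal ((f (param_ext c p))\<^sup>2) = ennreal ((?F p)\<^sup>2)" by (simp add: param_ext_def)
    qed
    also have "\<dots> \<le> ennreal C * (\<integral>\<^sup>+ x. ennreal ((?F x)\<^sup>2 + (norm (egrad ?F x))\<^sup>2) * indicator (cball y (3 * R)) x \<partial>lborel)"
      unfolding C_def
      by (rule planar_trace[OF m smooth_funD[OF f c] borel_closed[OF closed_cball] sub L(1) \<nu>s fin\<nu> cube growth b bs])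
    also have "\<dots> \<le> ennreal C * ennreal (K\<^sup>2 * (h1n f)\<^sup>2)"
      using good_energy(2)[OF gd f borel_closed[OF closed_cball] subset_refl] unfolding comp_def
      by (intro mult_left_mono) simp_all
    also have "\<dots> = ennreal (C * K\<^sup>2 * (h1n f)\<^sup>2)" using C0 by (simp add: ennreal_mult' mult.assoc)
    finally show "(\<integral>\<^sup>+ p. ennreal ((f p)\<^sup>2) \<partial>\<mu>) \<le> ennreal (C * K\<^sup>2 * (h1n f)\<^sup>2)" .
  qed
  moreover have "emeasure \<mu> UNIV \<noteq> 0" using \<mu>E[of UNIV] P1 by simp
  moreover have "\<exists>S\<in>sets borel. carries S \<mu> \<and> hausdorff_dim (riem_dist A g) S = 0"
  proof -
    let ?S = "param c ` (l ` sparse_set)"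
    have lS: "l ` sparse_set \<subseteq> cball y (3 * R)" using lin sparse_set_bounds by blast
    have "compact (l ` sparse_set)" by (intro compact_continuous_image continuous_on_subset[OF lcont] compact_sparse_set) simp
    then have "compact ?S" using lS sub by (intro compact_param_image[OF c]) auto
    then have S: "?S \<in> sets borel" by (intro borel_closed compact_imp_closed)
    have "emeasure \<mu> (space \<mu> - ?S) = emeasure P {\<omega>. param_ext c (l (sparse_map \<omega>)) \<in> - ?S}"
      using \<mu>E[of "- ?S"] S \<mu>s by (simp add: Compl_eq_Diff_UNIV)
    also have "\<dots> = 0"
    proof -
      have "AE \<omega> in P. \<not> param_ext c (l (sparse_map \<omega>)) \<in> - ?S"
        using PAE
      proof eventually_elim
        case (elim \<omega>)
        then have "sparse_map \<omega> \<in> sparse_set" by (auto intro: sparse_map_in_sparse_set)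
        then have "l (sparse_map \<omega>) \<in> l ` sparse_set" by (rule imageI)
        then have "param c (l (sparse_map \<omega>)) \<in> ?S" "l (sparse_map \<omega>) \<in> im c" using lS sub by auto
        then show ?case by (simp add: param_ext_def)
      qed
      moreover have "{\<omega>. param_ext c (l (sparse_map \<omega>)) \<in> - ?S} \<in> sets P"
        using measurable_sets[OF measurable_compose[OF pm param_ext_measurable[OF c]], of "- ?S"] S
        by (simp add: Pspace vimage_def Compl_eq_Diff_UNIV)
      ultimately have "{\<omega>. param_ext c (l (sparse_map \<omega>)) \<in> - ?S} \<in> null_sets P"
        by (subst AE_iff_null_sets) simp_all
      then show ?thesis by (rule null_setsD1)
    qed
    finally have "carries ?S \<mu>" unfolding carries_def .
    moreover have "hausdorff_dim (riem_dist A g) ?S = 0"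
    proof (rule hausdorff_dim_zero)
      let ?J = "\<lambda>k q. {sparse_map (real q / 2 ^ k)..sparse_map (real q / 2 ^ k) + (1 / 2) ^ (k * k)}"
      show "?S \<subseteq> (\<Union>q<2 ^ k. param c ` (l ` (sparse_set \<inter> ?J k q)))" for k
      proof -
        have "sparse_set \<subseteq> (\<Union>q<2 ^ k. ?J k q)" unfolding sparse_set_def by blast
        then show ?thesis by blast
      qed
      show "0 \<le> sqrt K * L" using K L by simp
      show "diam (riem_dist A g) (param c ` (l ` (sparse_set \<inter> ?J k q))) \<le> ennreal (sqrt K * L * (1 / 2) ^ (k * k))" for k q
        unfolding diam_def
      proof (intro SUP_least)
        fix a b assume "a \<in> param c ` (l ` (sparse_set \<inter> ?J k q))" "b \<in> param c ` (l ` (sparse_set \<inter> ?J k q))"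
        then obtain t u where t: "a = param c (l t)" "t \<in> sparse_set" "t \<in> ?J k q"
          and u: "b = param c (l u)" "u \<in> sparse_set" "u \<in> ?J k q" by blast
        have "riem_dist A g a b \<le> ennreal (sqrt K * norm (l u - l t))"
          unfolding t(1) u(1) using t(2) u(2) lS by (intro riem_dist_param_le[OF gd]) auto
        also have "norm (l u - l t) = L * \<bar>u - t\<bar>"
          using L e1 by (simp add: l_def flip: scaleR_left_diff_distrib right_diff_distrib) (simp add: abs_mult)
        also have "sqrt K * (L * \<bar>u - t\<bar>) \<le> sqrt K * (L * (1 / 2) ^ (k * k))"
          using t(3) u(3) K L by (intro mult_left_mono) auto
        finally show "riem_dist A g a b \<le> ennreal (sqrt K * L * (1 / 2) ^ (k * k))"
          by (simp add: ennreal_leI mult.assoc)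
      qed
    qed
    ultimately show ?thesis using S by blast
  qed
  ultimately show ?thesis by blast
qed

end


section \<open>Trace measures on closed manifolds\<close>

theorem proposition4p23:
  fixes A :: "('a::{t2_space,second_countable_topology}, 'm::finite) chart set"
    and g :: "('a, 'm) metric_coeffs"
  assumes X: "closed_riemannian_manifold A g"
    and m: "CARD('m) \<ge> 2"
  shows
    "(\<exists>C r0 :: real. 0 < C \<and> 0 < r0 \<and>
       (\<forall>\<mu> N. finite_borel_measure \<mu> \<and> emeasure \<mu> UNIV \<noteq> 0 \<and> trace_bound A g \<mu> N \<longrightarrow>
         (\<forall>x \<rho>. 0 < \<rho> \<and> \<rho> \<le> r0 / 4 \<longrightarrow>
            measure \<mu> (riem_ball A g x \<rho>) \<le>
              C * N * (if CARD('m) \<ge> 3 then \<rho> ^ (CARD('m) - 2)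
                       else inverse (1 + ln (r0 / \<rho>)))))) \<and>
     (\<forall>\<mu> N. finite_borel_measure \<mu> \<and> emeasure \<mu> UNIV \<noteq> 0 \<and> trace_bound A g \<mu> N \<longrightarrow>
        (\<forall>S\<in>sets borel. carries S \<mu> \<longrightarrow>
           \<not> polar A g S \<and>
           (CARD('m) \<ge> 3 \<longrightarrow>
              hausdorff_dim (riem_dist A g) S \<ge> ereal (real CARD('m) - 2))) \<and>
        (CARD('m) = 2 \<longrightarrow>
           (\<forall>x. emeasure \<mu> {x} = 0) \<and>
           (\<forall>S\<in>sets borel. carries S \<mu> \<longrightarrow> hausdorff_dim (riem_dist A g) S \<ge> 0))) \<and>
     (CARD('m) = 2 \<longrightarrow>
        (\<exists>\<mu>' N'. finite_borel_measure \<mu>' \<and> emeasure \<mu>' UNIV \<noteq> 0 \<and> trace_bound A g \<mu>' N' \<and>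
           (\<exists>S\<in>sets borel. carries S \<mu>' \<and> hausdorff_dim (riem_dist A g) S = 0)))"
proof -
  interpret closed_riemannian A g by unfold_locales (rule X)
  have nonneg: "0 \<le> hausdorff_dim (riem_dist A g) S" for S
    unfolding hausdorff_dim_def by (auto intro!: INF_greatest)
  have nonpolar: "\<not> polar A g S"
    if \<mu>: "smooth_trace \<mu> N" and nz: "emeasure \<mu> UNIV \<noteq> 0" and S: "S \<in> sets borel" "carries S \<mu>" for \<mu> N S
  proof
    assume "polar A g S"
    then have "emeasure \<mu> S = 0" by (rule polar_null[OF \<mu>])
    moreover have "emeasure \<mu> (UNIV - S) = 0" using S(2) smooth_trace_measure(3)[OF \<mu>] by (simp add: carries_def)
    moreover have "emeasure \<mu> UNIV = emeasure \<mu> S + emeasure \<mu> (UNIV - S)"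
      using S(1) smooth_trace_measure(2)[OF \<mu>] by (subst plus_emeasure) auto
    ultimately show False using nz by simp
  qed
  have growth: "\<exists>C r0 :: real. 0 < C \<and> 0 < r0 \<and>
       (\<forall>\<mu> N. finite_borel_measure \<mu> \<and> emeasure \<mu> UNIV \<noteq> 0 \<and> trace_bound A g \<mu> N \<longrightarrow>
         (\<forall>x \<rho>. 0 < \<rho> \<and> \<rho> \<le> r0 / 4 \<longrightarrow>
            measure \<mu> (riem_ball A g x \<rho>) \<le>
              C * N * (if CARD('m) \<ge> 3 then \<rho> ^ (CARD('m) - 2) else inverse (1 + ln (r0 / \<rho>)))))"
  proof -
    obtain C r0 where C: "0 < C" "0 < r0" "\<And>\<mu> N x \<rho>. smooth_trace \<mu> N \<Longrightarrow> 0 < \<rho> \<Longrightarrow> \<rho> \<le> r0 / 4 \<Longrightarrow>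
        measure \<mu> (riem_ball A g x \<rho>) \<le> C * N * growth_gauge r0 \<rho>"
      using measure_riem_ball_le[OF m] by blast
    show ?thesis
    proof (rule exI[of _ C], rule exI[of _ r0], intro conjI C(1,2) allI impI)
      fix \<mu> N x \<rho>
      assume "finite_borel_measure \<mu> \<and> emeasure \<mu> UNIV \<noteq> 0 \<and> trace_bound A g \<mu> N" and \<rho>: "0 < \<rho> \<and> \<rho> \<le> r0 / 4"
      then have "smooth_trace \<mu> N" by (intro trace_bound_imp_smooth_trace) auto
      then show "measure \<mu> (riem_ball A g x \<rho>) \<le>
          C * N * (if CARD('m) \<ge> 3 then \<rho> ^ (CARD('m) - 2) else inverse (1 + ln (r0 / \<rho>)))"
        using C(3)[of \<mu> N \<rho> x] \<rho> unfolding growth_gauge_def by blast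
    qed
  qed
  moreover have "\<not> polar A g S \<and>
      (CARD('m) \<ge> 3 \<longrightarrow> hausdorff_dim (riem_dist A g) S \<ge> ereal (real CARD('m) - 2))"
    if "finite_borel_measure \<mu> \<and> emeasure \<mu> UNIV \<noteq> 0 \<and> trace_bound A g \<mu> N" "S \<in> sets borel" "carries S \<mu>" for \<mu> N S
  proof -
    have \<mu>: "smooth_trace \<mu> N" using that(1) by (intro trace_bound_imp_smooth_trace) auto
    show ?thesis using that nonpolar[OF \<mu>] hausdorff_dim_ge[OF _ \<mu>] by blast
  qed
  moreover have "emeasure \<mu> {x} = 0"
    if "finite_borel_measure \<mu> \<and> emeasure \<mu> UNIV \<noteq> 0 \<and> trace_bound A g \<mu> N" "CARD('m) = 2" for \<mu> N x
    using that by (intro smooth_trace_no_atoms trace_bound_imp_smooth_trace) auto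
  moreover have "\<exists>\<mu>' N'. finite_borel_measure \<mu>' \<and> emeasure \<mu>' UNIV \<noteq> 0 \<and> trace_bound A g \<mu>' N' \<and>
      (\<exists>S\<in>sets borel. carries S \<mu>' \<and> hausdorff_dim (riem_dist A g) S = 0)" if m2: "CARD('m) = 2"
  proof -
    obtain \<mu> N where \<mu>: "smooth_trace \<mu> N" "emeasure \<mu> UNIV \<noteq> 0"
      "\<exists>S\<in>sets borel. carries S \<mu> \<and> hausdorff_dim (riem_dist A g) S = 0"
      using exists_zero_dimensional_trace[OF m2] by blast
    have "finite_borel_measure \<mu>" using \<mu>(1) by (simp add: smooth_trace_def)
    then show ?thesis using \<mu>(2,3) smooth_trace_imp_trace_bound[OF \<mu>(1)] by blast
  qed
  ultimately show ?thesis using nonneg by (intro conjI allI impI ballI) (assumption | blast)+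
qed

end
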